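(* Let $(s,p,r)$ satisfy either $$1<s<1+\frac1p,\quad (p,r)\in[2,\infty)\times[1,\infty],\qquad\text{or}\qquad s=1,\quad (p,r)\in[2,\infty)\times[1,2].$$ Then for any $\delta>0$ there exists initial data $u_0$ satisfying $$\|u_0\|_{B^s_{p,r}(\mathbb{R})}\le \delta$$ such that, for some $0<T_0<\delta$, a solution $u\in \mathcal{C}([0,T_0];B^s_{p,r}(\mathbb{R}))$ of the Cauchy problem $$\partial_t u+\frac32 u u_x=\partial_x(1-\partial_x^2)^{-1}u,\qquad u(0,x)=u_0(x),\quad x\in\mathbb{R},$$ satisfies $$\|u(T_0)\|_{B^s_{p,r}(\mathbb{R})}\ge \frac1\delta.$$
   Context: The functions are real-valued on $\mathbb{R}$. The operator $(1-\partial_x^2)^{-1}$ is $(1-\partial_x^2)^{-1}f=G*f$ with $G(x)=\frac12 e^{-|x|}$. The Cauchy problem is the non-local form of the Fornberg-Whitham equation; solutions are understood in the sense of distributions, with $uu_x=\frac12\partial_x(u^2)$. For $s\in\mathbb{R}$ and $(p,r)\in[1,\infty]^2$, the nonhomogeneous Besov space $B^s_{p,r}(\mathbb{R})$ is the set of tempered distributions $f$ on $\mathbb{R}$ with $$\|f\|_{B^s_{p,r}}:=\big\|\,2^{js}\|\Delta_j f\|_{L^p}\,\big\|_{\ell^r(j\ge -1)}<\infty,$$ where $(\Delta_j)_{j\ge -1}$ are the standard nonhomogeneous Littlewood-Paley blocks: $\Delta_{-1}f=\mathcal{F}^{-1}(\chi\,\mathcal{F}f)$ and $\Delta_j f=\mathcal{F}^{-1}(\varphi(2^{-j}\cdot)\mathcal{F}f)$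 for $j\ge0$, with $\chi$ smooth, even, supported in a ball centred at $0$, $\varphi$ smooth, even, supported in an annulus centred at $0$, and $\chi(\xi)+\sum_{j\ge0}\varphi(2^{-j}\xi)=1$ for all $\xi$. $\mathcal{C}(I;X)$ denotes the continuous functions on $I$ with values in the Banach space $X$. *)

theory Defs
  imports "HOL-Analysis.Analysis" "HOL-Probability.Essential_Supremum"
begin

section \<open>Smooth functions\<close>

definition dderiv ::
    "'a::real_normed_vector \<Rightarrow> ('a \<Rightarrow> 'b::real_normed_vector) \<Rightarrow> 'a \<Rightarrow> 'b" where
  "dderiv v f = (\<lambda>x. frechet_derivative f (at x) v)"

text \<open>On a finite-dimensional space this is \<open>C\<^sup>\<infinity>\<close>: every iterated directional derivative (along
  any list of directions, the empty list included) is differentiable everywhere.  On the real line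
  \<open>dderiv 1\<close> is the ordinary derivative.\<close>

definition smooth :: "('a::euclidean_space \<Rightarrow> 'b::real_normed_vector) \<Rightarrow> bool" where
  "smooth f \<longleftrightarrow> (\<forall>vs x. foldr dderiv vs f differentiable (at x))"


section \<open>Schwartz functions and tempered distributions on the real line\<close>

definition schwartz_weight :: "nat \<Rightarrow> nat \<Rightarrow> (real \<Rightarrow> complex) \<Rightarrow> real \<Rightarrow> real" where
  "schwartz_weight k n \<psi> x = \<bar>x\<bar> ^ k * cmod ((dderiv 1 ^^ n) \<psi> x)"

definition schwartz :: "(real \<Rightarrow> complex) set" where
  "schwartz = {\<psi>. smooth \<psi> \<and> (\<forall>k n. bdd_above (range (schwartz_weight k n \<psi>)))}"

definition schwartz_seminorm :: "nat \<Rightarrow> nat \<Rightarrow> (real \<Rightarrow> complex) \<Rightarrow> real" where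
  "schwartz_seminorm k n \<psi> = (SUP x. schwartz_weight k n \<psi> x)"

type_synonym functional = "(real \<Rightarrow> complex) \<Rightarrow> complex"

text \<open>Functionals are normalised to vanish outside the Schwartz space, so that equality of
  functionals is equality of distributions.\<close>

definition tempered :: "functional set" where
  "tempered = {T.
     (\<forall>\<psi>. \<psi> \<notin> schwartz \<longrightarrow> T \<psi> = 0) \<and>
     (\<forall>\<psi>\<in>schwartz. \<forall>\<eta>\<in>schwartz. T (\<lambda>x. \<psi> x + \<eta> x) = T \<psi> + T \<eta>) \<and>
     (\<forall>\<psi>\<in>schwartz. \<forall>c. T (\<lambda>x. c * \<psi> x) = c * T \<psi>) \<and>
     (\<exists>C N. \<forall>\<psi>\<in>schwartz. cmod (T \<psi>) \<le> C * (\<Sum>k\<le>N. \<Sum>n\<le>N. schwartz_seminorm k n \<psi>))}"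

text \<open>The tempered distribution \<open>T\<close> is (the regular distribution given by) the function \<open>g\<close>.\<close>

definition represents :: "(real \<Rightarrow> complex) \<Rightarrow> functional \<Rightarrow> bool" where
  "represents g T \<longleftrightarrow> g \<in> borel_measurable borel \<and>
     (\<forall>\<psi>\<in>schwartz. integrable lborel (\<lambda>x. g x * \<psi> x) \<and> T \<psi> = (LINT x|lborel. g x * \<psi> x))"

definition fourier :: "(real \<Rightarrow> complex) \<Rightarrow> real \<Rightarrow> complex" where
  "fourier \<psi> \<xi> = (LINT x|lborel. cis (- (x * \<xi>)) * \<psi> x)"

definition inv_fourier :: "(real \<Rightarrow> complex) \<Rightarrow> real \<Rightarrow> complex" where
  "inv_fourier \<psi> x = (LINT \<xi>|lborel. cis (x * \<xi>) * \<psi> \<xi>) / (2 * pi)"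

definition fourier_td :: "functional \<Rightarrow> functional" where
  "fourier_td T = (\<lambda>\<psi>. if \<psi> \<in> schwartz then T (fourier \<psi>) else 0)"

definition inv_fourier_td :: "functional \<Rightarrow> functional" where
  "inv_fourier_td T = (\<lambda>\<psi>. if \<psi> \<in> schwartz then T (inv_fourier \<psi>) else 0)"

definition mult_td :: "(real \<Rightarrow> real) \<Rightarrow> functional \<Rightarrow> functional" where
  "mult_td m T = (\<lambda>\<psi>. if \<psi> \<in> schwartz then T (\<lambda>\<xi>. complex_of_real (m \<xi>) * \<psi> \<xi>) else 0)"


section \<open>Lebesgue norms\<close>

text \<open>Power of an extended nonnegative real with a positive real exponent.\<close>

definition epow :: "ennreal \<Rightarrow> real \<Rightarrow> ennreal" where
  "epow x a = (if x = \<infinity> then \<infinity> else ennreal (enn2real x powr a))"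

text \<open>The exponent ranges over \<open>[1,\<infinity>]\<close>; with a counting measure this is the \<open>\<ell>\<^sup>q\<close> norm.\<close>

definition Lnorm :: "'a measure \<Rightarrow> ennreal \<Rightarrow> ('a \<Rightarrow> ennreal) \<Rightarrow> ennreal" where
  "Lnorm M q f = (if q = \<infinity> then esssup M f
     else epow (\<integral>\<^sup>+ x. epow (f x) (enn2real q) \<partial>M) (1 / enn2real q))"

text \<open>The \<open>L\<^sup>q\<close> norm of a distribution; it is infinite if the distribution is not a function (the
  infimum is then over the empty set).  Two representing functions agree almost everywhere.\<close>

definition Lnorm_td :: "ennreal \<Rightarrow> functional \<Rightarrow> ennreal" where
  "Lnorm_td q T = (INF g\<in>{g. represents g T}. Lnorm lborel q (\<lambda>x. ennreal (cmod (g x))))"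


section \<open>Nonhomogeneous Besov spaces\<close>

definition littlewood_paley_pair :: "(real \<Rightarrow> real) \<Rightarrow> (real \<Rightarrow> real) \<Rightarrow> bool" where
  "littlewood_paley_pair chi phi \<longleftrightarrow>
     smooth chi \<and> (\<forall>\<xi>. chi (- \<xi>) = chi \<xi>) \<and> (\<exists>R>0. \<forall>\<xi>. chi \<xi> \<noteq> 0 \<longrightarrow> \<bar>\<xi>\<bar> \<le> R) \<and>
     smooth phi \<and> (\<forall>\<xi>. phi (- \<xi>) = phi \<xi>) \<and>
     (\<exists>a b. 0 < a \<and> a < b \<and> (\<forall>\<xi>. phi \<xi> \<noteq> 0 \<longrightarrow> a \<le> \<bar>\<xi>\<bar> \<and> \<bar>\<xi>\<bar> \<le> b)) \<and>
     (\<forall>\<xi>. (\<lambda>j::nat. phi (\<xi> / 2 ^ j)) sums (1 - chi \<xi>))"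

text \<open>The Littlewood-Paley block \<open>\<Delta>\<^sub>j\<close>, used for \<open>j \<ge> -1\<close>.\<close>

definition lp_block ::
    "(real \<Rightarrow> real) \<Rightarrow> (real \<Rightarrow> real) \<Rightarrow> int \<Rightarrow> functional \<Rightarrow> functional" where
  "lp_block chi phi j T =
     inv_fourier_td (mult_td (if j = -1 then chi else (\<lambda>\<xi>. phi (2 powi (- j) * \<xi>))) (fourier_td T))"

definition besov_norm ::
    "(real \<Rightarrow> real) \<Rightarrow> (real \<Rightarrow> real) \<Rightarrow> real \<Rightarrow> ennreal \<Rightarrow> ennreal \<Rightarrow> functional \<Rightarrow> ennreal" where
  "besov_norm chi phi s p r T =
     Lnorm (count_space {-1::int..}) r
       (\<lambda>j. ennreal (2 powr (of_int j * s)) * Lnorm_td p (lp_block chi phi j T))"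

definition besov ::
    "(real \<Rightarrow> real) \<Rightarrow> (real \<Rightarrow> real) \<Rightarrow> real \<Rightarrow> ennreal \<Rightarrow> ennreal \<Rightarrow> functional set" where
  "besov chi phi s p r = {T \<in> tempered. besov_norm chi phi s p r T < \<infinity>}"

text \<open>\<open>C(I; B\<^sup>s\<^sub>p\<^sub>,\<^sub>r)\<close>; values outside \<open>I\<close> are irrelevant.\<close>

definition besov_continuous ::
    "(real \<Rightarrow> real) \<Rightarrow> (real \<Rightarrow> real) \<Rightarrow> real \<Rightarrow> ennreal \<Rightarrow> ennreal \<Rightarrow> real set
      \<Rightarrow> (real \<Rightarrow> functional) set" where
  "besov_continuous chi phi s p r I = {u.
     (\<forall>t\<in>I. u t \<in> besov chi phi s p r) \<and>
     (\<forall>t\<in>I. ((\<lambda>\<tau>. besov_norm chi phi s p r (u \<tau> - u t)) \<longlongrightarrow> 0) (at t within I))}"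


section \<open>The Fornberg-Whitham equation\<close>

definition green :: "real \<Rightarrow> real" where
  "green x = exp (- \<bar>x\<bar>) / 2"

text \<open>\<open>(1 - \<partial>\<^sub>x\<^sup>2)\<^sup>-\<^sup>1 f = G * f\<close>\<close>

definition helmholtz_inv :: "(real \<Rightarrow> real) \<Rightarrow> real \<Rightarrow> real" where
  "helmholtz_inv f x = (LINT y|lborel. green (x - y) * f y)"

text \<open>Points of \<open>(0,T) \<times> \<real>\<close> are pairs \<open>(t, x)\<close>, so \<open>\<partial>\<^sub>t\<close> and \<open>\<partial>\<^sub>x\<close> are the derivatives along
  \<open>(1,0)\<close> and \<open>(0,1)\<close>.\<close>

definition strip_tests :: "real \<Rightarrow> (real \<times> real \<Rightarrow> real) set" where
  "strip_tests T = {\<psi>. smooth \<psi> \<and> compact (closure {z. \<psi> z \<noteq> 0}) \<and>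
     closure {z. \<psi> z \<noteq> 0} \<subseteq> {0<..<T} \<times> UNIV}"

definition strip_loc_integrable :: "real \<Rightarrow> (real \<times> real \<Rightarrow> real) \<Rightarrow> bool" where
  "strip_loc_integrable T f \<longleftrightarrow>
     (\<forall>K. compact K \<and> K \<subseteq> {0<..<T} \<times> UNIV \<longrightarrow> set_integrable lborel K f)"

definition regular_distr :: "(real \<times> real \<Rightarrow> real) \<Rightarrow> (real \<times> real \<Rightarrow> real) \<Rightarrow> real" where
  "regular_distr f = (\<lambda>\<psi>. LINT z|lborel. f z * \<psi> z)"

definition distr_deriv ::
    "real \<times> real \<Rightarrow> ((real \<times> real \<Rightarrow> real) \<Rightarrow> real) \<Rightarrow> (real \<times> real \<Rightarrow> real) \<Rightarrow> real" where
  "distr_deriv v \<Lambda> = (\<lambda>\<psi>. - \<Lambda> (dderiv v \<psi>))"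

text \<open>\<open>u\<close> is a real-valued solution on \<open>[0,T]\<close> with initial value \<open>u\<^sub>0\<close>.  For the product \<open>u\<^sup>2\<close> to
  make sense the distributions \<open>u t\<close> have to be functions; \<open>U\<close> is a representative of \<open>u\<close> that is
  jointly measurable in \<open>(t,x)\<close>.  The integrability conditions make sure that all terms of the
  equation, with \<open>u u\<^sub>x\<close> read as \<open>\<partial>\<^sub>x (u\<^sup>2) / 2\<close>, are genuine distributions on \<open>(0,T) \<times> \<real>\<close>.\<close>

definition FW_solution :: "real \<Rightarrow> functional \<Rightarrow> (real \<Rightarrow> functional) \<Rightarrow> bool" where
  "FW_solution T u\<^sub>0 u \<longleftrightarrow> u 0 = u\<^sub>0 \<and>
     (\<exists>U \<in> borel_measurable borel.
        (\<forall>t\<in>{0..T}. represents (\<lambda>x. complex_of_real (U (t, x))) (u t)) \<and>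
        (\<forall>t\<in>{0..T}. \<forall>x. integrable lborel (\<lambda>y. green (x - y) * U (t, y))) \<and>
        strip_loc_integrable T U \<and>
        strip_loc_integrable T (\<lambda>z. (U z)\<^sup>2) \<and>
        strip_loc_integrable T (\<lambda>(t, x). helmholtz_inv (\<lambda>y. U (t, y)) x) \<and>
        (\<forall>\<psi>\<in>strip_tests T.
           distr_deriv (1, 0) (regular_distr U) \<psi>
             + 3 / 2 * (1 / 2 * distr_deriv (0, 1) (regular_distr (\<lambda>z. (U z)\<^sup>2)) \<psi>)
           = distr_deriv (0, 1)
               (regular_distr (\<lambda>(t, x). helmholtz_inv (\<lambda>y. U (t, y)) x)) \<psi>))"

end

theory Submission
  imports Defs "HOL-Probability.Levy" "HOL-Real_Asymp.Real_Asymp"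
begin

text \<open>Write \<open>u(t,x) = - v(T - t,x)\<close>.  Then \<open>v\<close> has to solve the same equation with the sign of the nonlocal
  term reversed, and it suffices to find \<open>v\<close> that is large at time \<open>0\<close> and small at time \<open>T\<close>.  Start
  from a hat of height \<open>h\<close> with a steep rising edge of width \<open>\<epsilon>\<close>.  A rising edge rarefies: the
  characteristics spread, and at time \<open>T\<close> the total variation of the slope is at most \<open>28/T\<close>, whatever
  \<open>h\<close> and \<open>\<epsilon>\<close> are.  With the edge stretched to unit length, the equation in Lagrangian coordinates
  has bounded Lipschitz coefficients, so that \<open>v\<close> comes from a contraction on a time interval that
  does not depend on \<open>\<epsilon>\<close>.

  The \<open>L\<^sup>p\<close> norm of \<open>v(T)\<close> is of order \<open>h\<close>.  Interpolating it with the bound on the variation of the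
  slope, which gives regularity \<open>1 + 1/p > s\<close>, makes the Besov norm of \<open>v(T)\<close> small once \<open>h\<close> is small.
  At frequency \<open>2\<^sup>j\<close> the edge of width \<open>\<epsilon> = 1 / 4 ^ j\<close> is indistinguishable from a jump of height \<open>h\<close>,
  so the Besov norm of \<open>v(0)\<close> is at least of order \<open>h * 2 powr (j * (s - 1/p))\<close>, which is arbitrarily large for fixed \<open>h\<close>.\<close>

section \<open>Integration on the line\<close>

text \<open>Obstacle: the lifetime must be fixed before the data. The order of choice is T below
  \<delta>, then h so small that the interpolated norm of v(T) is below \<delta>, and only then j,
  hence \<epsilon>, so large that the norm of the hat exceeds 1/\<delta>. An estimate through the
  initial slope h/\<epsilon> would shrink T with \<epsilon>. The Lagrangian system never divides by
  the Jacobian, which is tiny on the edge; as the edge has unit label length, exp(-|X(\<xi>) -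
  X(\<eta>)|) still decays in the labels up to a factor. The range of s lies between a jump and a
  kink: s < 1 + 1/p admits slopes of bounded variation, and s > 1/p, which follows from p >= 2 and s
  >= 1, makes the norm of an ever steeper edge diverge. The labels 0, 1, 2 carry kinks, so calculus
  is done off finite sets and regularity is measured by variation. The nonlocal term spreads over
  the whole line, hence an exponential weight; its bounded primitive is the modulus of continuity
  that keeps the variation finite. The slope at time T is at most 2/T since the Jacobian has grown
  to at least h T, while the label derivative of the velocity is at most 2 h.\<close>

lemma set_integral_FTC_finite_exceptions:
  fixes F :: "real \<Rightarrow> 'a::euclidean_space"
  assumes "finite S" "a \<le> b" "\<And>x. x \<in> {a<..<b} - S \<Longrightarrow> (F has_vector_derivative f x) (at x)"
    and "continuous_on {a..b} F" and "set_integrable lborel {a..b} f"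
  shows "(LINT x:{a..b}|lborel. f x) = F b - F a"
proof -
  have "(f has_integral (F b - F a)) {a..b}"
    using assms by (intro fundamental_theorem_of_calculus_interior_strong[of S]) auto
  then show ?thesis
    using set_borel_integral_eq_integral[OF assms(5)] by (simp add: integral_unique)
qed

lemma integral_FTC_UNIV_finite_exceptions:
  fixes F :: "real \<Rightarrow> 'a::euclidean_space"
  assumes S: "finite S" and D: "\<And>x. x \<notin> S \<Longrightarrow> (F has_vector_derivative f x) (at x)"
    and F: "continuous_on UNIV F" and f: "integrable lborel f"
    and lim: "(F \<longlongrightarrow> A) at_bot" "(F \<longlongrightarrow> B) at_top"
  shows "(LINT x|lborel. f x) = B - A"
proof -
  have fin: "(LINT x:{- real n..real n}|lborel. f x) = F (real n) - F (- real n)" for n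
    by (rule set_integral_FTC_finite_exceptions[OF S])
      (auto intro: D continuous_on_subset[OF F] integrable_mult_indicator f simp: set_integrable_def)
  have "(\<lambda>n. LINT x:{- real n..real n}|lborel. f x) \<longlonglongrightarrow> (LINT x|lborel. f x)"
    unfolding set_lebesgue_integral_def
  proof (rule integral_dominated_convergence[where w="\<lambda>x. norm (f x)"])
    show "AE x in lborel. (\<lambda>n. indicat_real {- real n..real n} x *\<^sub>R f x) \<longlonglongrightarrow> f x"
    proof (rule AE_I2)
      fix x :: real
      have "eventually (\<lambda>n. indicat_real {- real n..real n} x *\<^sub>R f x = f x) sequentially"
        using eventually_ge_at_top[of "nat \<lceil>\<bar>x\<bar>\<rceil>"]
        by eventually_elim (auto simp: indicator_def; linarith)
      then show "(\<lambda>n. indicat_real {- real n..real n} x *\<^sub>R f x) \<longlonglongrightarrow> f x"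
        by (rule tendsto_eventually)
    qed
  qed (use f in \<open>auto intro!: AE_I2 simp: indicator_def borel_measurable_integrable\<close>)
  moreover have "(\<lambda>n. F (real n) - F (- real n)) \<longlonglongrightarrow> B - A"
    by (intro tendsto_diff filterlim_compose[OF lim(1)] filterlim_compose[OF lim(2)]
        filterlim_real_sequentially filterlim_compose[OF filterlim_uminus_at_bot_at_top])
  ultimately show ?thesis by (simp add: fin LIMSEQ_unique)
qed

lemma integrable_bounded_by:
  fixes f :: "'a \<Rightarrow> 'b::{banach,second_countable_topology}"
  assumes "integrable M g" "f \<in> borel_measurable M" "\<And>x. norm (f x) \<le> g x"
  shows "integrable M f"
  by (rule Bochner_Integration.integrable_bound[OF assms(1,2)])
    (use assms(3) in \<open>auto intro!: AE_I2 order_trans[OF assms(3)]\<close>)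

lemma integral_norm_le:
  fixes f :: "'a \<Rightarrow> 'b::{banach,second_countable_topology}"
  assumes "integrable M g" "\<And>x. norm (f x) \<le> g x"
  shows "norm (integral\<^sup>L M f) \<le> integral\<^sup>L M g"
proof (cases "integrable M f")
  case True
  have "norm (integral\<^sup>L M f) \<le> (LINT x|M. norm (f x))" by (rule integral_norm_bound)
  also have "\<dots> \<le> integral\<^sup>L M g" by (rule integral_mono) (use True assms in auto)
  finally show ?thesis .
next
  case False
  have "0 \<le> g x" for x using norm_ge_zero assms(2) order_trans by blast
  then have "0 \<le> integral\<^sup>L M g" by simp
  then show ?thesis using False by (simp add: not_integrable_integral_eq)
qed

section \<open>Smooth functions on the line\<close>

lemma dderiv_1_eq:
  assumes "\<And>x. (f has_vector_derivative f' x) (at x)"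
  shows "dderiv (1::real) f = f'"
proof
  fix x
  have "frechet_derivative f (at x) = (\<lambda>h. h *\<^sub>R f' x)"
    using assms[of x] unfolding has_vector_derivative_def by (rule frechet_derivative_at[symmetric])
  then show "dderiv 1 f x = f' x" by (simp add: dderiv_def)
qed

lemma has_vector_derivative_dderiv:
  fixes f :: "real \<Rightarrow> 'b::real_normed_vector"
  assumes "f differentiable (at x)"
  shows "(f has_vector_derivative dderiv 1 f x) (at x)"
proof -
  have D: "(f has_derivative frechet_derivative f (at x)) (at x)"
    using assms by (simp add: frechet_derivative_works)
  have "frechet_derivative f (at x) h = h *\<^sub>R frechet_derivative f (at x) 1" for h
    using linear_scale[OF has_derivative_linear[OF D], of h 1] by simp
  then have "frechet_derivative f (at x) = (\<lambda>h. h *\<^sub>R frechet_derivative f (at x) 1)"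
    by (rule ext)
  with D show ?thesis unfolding has_vector_derivative_def dderiv_def by metis
qed

lemma dderiv_real_scale:
  fixes f :: "real \<Rightarrow> 'b::real_normed_vector"
  assumes "\<And>x. f differentiable (at x)"
  shows "dderiv v (\<lambda>x. c *\<^sub>R f x) = (\<lambda>x. (v * c) *\<^sub>R dderiv 1 f x)"
proof
  fix x
  have "((\<lambda>x. c *\<^sub>R f x) has_derivative (\<lambda>h. c *\<^sub>R (h *\<^sub>R dderiv 1 f x))) (at x)"
    using has_vector_derivative_dderiv[OF assms[of x]]
    unfolding has_vector_derivative_def by (intro has_derivative_scaleR_right)
  from frechet_derivative_at[OF this, symmetric]
  show "dderiv v (\<lambda>x. c *\<^sub>R f x) x = (v * c) *\<^sub>R dderiv 1 f x"
    by (simp add: dderiv_def mult.commute)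
qed

text \<open>A directional derivative along v is v times the ordinary one, so a list of directions
  contributes only its product and its length.\<close>

lemma smooth_real_iff:
  fixes f :: "real \<Rightarrow> 'b::real_normed_vector"
  shows "smooth f \<longleftrightarrow> (\<forall>n x. (dderiv 1 ^^ n) f differentiable (at x))"
proof
  assume "smooth f"
  moreover have "foldr dderiv (replicate n 1) f = (dderiv 1 ^^ n) f" for n
    by (induction n) auto
  ultimately show "\<forall>n x. (dderiv 1 ^^ n) f differentiable (at x)"
    unfolding smooth_def by metis
next
  assume D: "\<forall>n x. (dderiv 1 ^^ n) f differentiable (at x)"
  have "foldr dderiv vs f = (\<lambda>x. prod_list vs *\<^sub>R (dderiv 1 ^^ length vs) f x)" for vs
    by (induction vs) (use D in \<open>simp_all add: dderiv_real_scale\<close>)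
  then show "smooth f"
    unfolding smooth_def using D by (auto intro!: derivative_intros)
qed

text \<open>Smoothness is the largest class closed under differentiation. The closure properties
  below exhibit a class of functions that contains its own derivatives, instead of computing
  derivatives of order n.\<close>

lemma smooth_coinduct [consumes 1, case_names deriv]:
  fixes f :: "real \<Rightarrow> 'b::real_normed_vector"
  assumes "P f"
    and "\<And>f. P f \<Longrightarrow> \<exists>f'. (\<forall>x. (f has_vector_derivative f' x) (at x)) \<and> P f'"
  shows "smooth f"
proof -
  have "P ((dderiv 1 ^^ n) f)" for n
  proof (induction n)
    case (Suc n)
    from assms(2)[OF Suc] obtain f' where "\<And>x. ((dderiv 1 ^^ n) f has_vector_derivative f' x) (at x)" "P f'"
      by blast
    then show ?case using dderiv_1_eq[of "(dderiv 1 ^^ n) f" f'] by simp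
  qed (use assms in simp)
  then show ?thesis
    unfolding smooth_real_iff
    by (meson assms(2) has_vector_derivative_def differentiableI)
qed

lemma smooth_deriv:
  fixes f :: "real \<Rightarrow> 'b::real_normed_vector"
  assumes "smooth f" shows "(f has_vector_derivative dderiv 1 f x) (at x)"
  using assms smooth_real_iff[of f] has_vector_derivative_dderiv[of f x]
  by (metis funpow_0)

lemma smooth_dderiv:
  fixes f :: "real \<Rightarrow> 'b::real_normed_vector"
  assumes "smooth f" shows "smooth (dderiv 1 f)"
  using assms unfolding smooth_real_iff by (metis funpow_Suc_right comp_apply)

lemma smooth_continuous:
  fixes f :: "real \<Rightarrow> 'b::real_normed_vector"
  assumes "smooth f" shows "continuous_on A f"
  using smooth_deriv[OF assms]
  by (auto intro!: continuous_at_imp_continuous_on has_vector_derivative_continuous)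

lemma smooth_measurable:
  fixes f :: "real \<Rightarrow> 'b::real_normed_vector"
  assumes "smooth f" shows "f \<in> borel_measurable borel"
  using smooth_continuous[OF assms] by (rule borel_measurable_continuous_onI)

text \<open>The Leibniz rule leaves the set of products but stays among finite sums of products,
  which is therefore the invariant for \<open>smooth_coinduct\<close>.\<close>

inductive mult_span :: "(real \<Rightarrow> 'b::real_normed_algebra) \<Rightarrow> bool" where
  mult_span_mult: "smooth f \<Longrightarrow> smooth g \<Longrightarrow> mult_span (\<lambda>x. f x * g x)"
| mult_span_add: "mult_span f \<Longrightarrow> mult_span g \<Longrightarrow> mult_span (\<lambda>x. f x + g x)"

lemma mult_span_deriv:
  "mult_span f \<Longrightarrow> \<exists>f'. (\<forall>x. (f has_vector_derivative f' x) (at x)) \<and> mult_span f'"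
proof (induction rule: mult_span.induct)
  case (mult_span_mult f g)
  then have "mult_span (\<lambda>x. f x * dderiv 1 g x + dderiv 1 f x * g x)"
    by (intro mult_span.intros smooth_dderiv)
  moreover have "((\<lambda>x. f x * g x) has_vector_derivative f x * dderiv 1 g x + dderiv 1 f x * g x) (at x)" for x
    by (intro has_vector_derivative_mult smooth_deriv mult_span_mult)
  ultimately show ?case
    by (intro exI[of _ "\<lambda>x. f x * dderiv 1 g x + dderiv 1 f x * g x"]) auto
next
  case (mult_span_add f g)
  then obtain f' g' where "\<forall>x. (f has_vector_derivative f' x) (at x)" "mult_span f'"
    "\<forall>x. (g has_vector_derivative g' x) (at x)" "mult_span g'" by blast
  then show ?case
    by (intro exI[of _ "\<lambda>x. f' x + g' x"]) (auto intro: has_vector_derivative_add mult_span.intros)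
qed

lemma smooth_mult:
  fixes f g :: "real \<Rightarrow> 'b::real_normed_algebra"
  assumes "smooth f" "smooth g" shows "smooth (\<lambda>x. f x * g x)"
  by (rule smooth_coinduct[of mult_span]) (use assms mult_span.intros mult_span_deriv in blast)+

lemma smooth_add:
  fixes f g :: "real \<Rightarrow> 'b::real_normed_vector"
  assumes "smooth f" "smooth g" shows "smooth (\<lambda>x. f x + g x)"
proof (rule smooth_coinduct[of "\<lambda>h. \<exists>f g. smooth f \<and> smooth g \<and> h = (\<lambda>x. f x + g x)"])
  fix h :: "real \<Rightarrow> 'b" assume "\<exists>f g. smooth f \<and> smooth g \<and> h = (\<lambda>x. f x + g x)"
  then obtain f g where "smooth f" "smooth g" "h = (\<lambda>x. f x + g x)" by blast
  then show "\<exists>f'. (\<forall>x. (h has_vector_derivative f' x) (at x)) \<and> (\<exists>f g. smooth f \<and> smooth g \<and> f' = (\<lambda>x. f x + g x))"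
    by (intro exI[of _ "\<lambda>x. dderiv 1 f x + dderiv 1 g x"] conjI exI[of _ "dderiv 1 f"] exI[of _ "dderiv 1 g"])
      (auto intro!: has_vector_derivative_add smooth_deriv smooth_dderiv)
qed (use assms in blast)

lemma smooth_const: "smooth (\<lambda>x::real. c)"
  by (rule smooth_coinduct[of "\<lambda>h. \<exists>c. h = (\<lambda>x. c)"]) (auto intro!: exI derivative_eq_intros)

lemma smooth_of_real: "smooth (\<lambda>x. of_real x :: 'b::real_normed_field)"
proof (rule smooth_coinduct[of "\<lambda>h. h = (\<lambda>x. of_real x :: 'b) \<or> smooth h"])
  fix h :: "real \<Rightarrow> 'b" assume "h = (\<lambda>x. of_real x) \<or> smooth h"
  then show "\<exists>h'. (\<forall>x. (h has_vector_derivative h' x) (at x)) \<and> (h' = (\<lambda>x. of_real x) \<or> smooth h')"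
  proof
    assume h: "h = (\<lambda>x. of_real x)"
    have "(h has_vector_derivative 1) (at x)" for x
      unfolding h has_vector_derivative_def by (auto intro!: derivative_eq_intros simp: scaleR_conv_of_real)
    then show ?thesis by (intro exI[of _ "\<lambda>_. 1"]) (auto simp: smooth_const)
  next
    assume "smooth h"
    then show ?thesis by (intro exI[of _ "dderiv 1 h"]) (auto intro: smooth_deriv smooth_dderiv)
  qed
qed simp

lemma smooth_bounded_linear:
  fixes f :: "real \<Rightarrow> 'b::real_normed_vector" and L :: "'b \<Rightarrow> 'c::real_normed_vector"
  assumes L: "bounded_linear L" and f: "smooth f" shows "smooth (\<lambda>x. L (f x))"
proof (rule smooth_coinduct[of "\<lambda>h. \<exists>f. smooth f \<and> h = (\<lambda>x. L (f x))"])
  fix h :: "real \<Rightarrow> 'c" assume "\<exists>f. smooth f \<and> h = (\<lambda>x. L (f x))"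
  then obtain f where "smooth f" "h = (\<lambda>x. L (f x))" by blast
  then show "\<exists>f'. (\<forall>x. (h has_vector_derivative f' x) (at x)) \<and> (\<exists>f. smooth f \<and> f' = (\<lambda>x. L (f x)))"
    by (intro exI[of _ "\<lambda>x. L (dderiv 1 f x)"] conjI exI[of _ "dderiv 1 f"])
      (auto intro!: bounded_linear.has_vector_derivative[OF L] smooth_deriv smooth_dderiv)
qed (use f in blast)

lemma smooth_compose_scale:
  fixes f :: "real \<Rightarrow> 'b::real_normed_vector"
  assumes f: "smooth f" shows "smooth (\<lambda>x. f (a * x))"
proof (rule smooth_coinduct[of "\<lambda>h. \<exists>f. smooth f \<and> h = (\<lambda>x. f (a * x))"])
  fix h :: "real \<Rightarrow> 'b" assume "\<exists>f. smooth f \<and> h = (\<lambda>x. f (a * x))"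
  then obtain f :: "real \<Rightarrow> 'b" where f: "smooth f" "h = (\<lambda>x. f (a * x))" by blast
  have "(h has_vector_derivative a *\<^sub>R dderiv 1 f (a * x)) (at x)" for x
  proof -
    have "((\<lambda>x. a * x) has_vector_derivative a) (at x)" by (auto intro!: derivative_eq_intros)
    from vector_diff_chain_at[OF this smooth_deriv[OF f(1)]]
    show ?thesis by (simp add: f(2) o_def)
  qed
  moreover have "smooth (\<lambda>x. a *\<^sub>R dderiv 1 f x)"
    by (intro smooth_bounded_linear[OF bounded_linear_scaleR_right] smooth_dderiv f)
  ultimately show "\<exists>f'. (\<forall>x. (h has_vector_derivative f' x) (at x)) \<and> (\<exists>f. smooth f \<and> f' = (\<lambda>x. f (a * x)))"
    by (intro exI[of _ "\<lambda>x. a *\<^sub>R dderiv 1 f (a * x)"]) auto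
qed (use f in blast)

section \<open>Schwartz functions\<close>

lemma schwartz_smooth: "\<psi> \<in> schwartz \<Longrightarrow> smooth \<psi>"
  by (simp add: schwartz_def)

text \<open>Since every derivative stays in the class, decay has to be checked for the members
  themselves only; the bounds for all orders follow.\<close>

lemma schwartz_coinduct:
  assumes "P f"
    and D: "\<And>f. P f \<Longrightarrow> \<exists>f'. (\<forall>x. (f has_vector_derivative f' x) (at x)) \<and> P f'"
    and B: "\<And>f k. P f \<Longrightarrow> \<exists>C. \<forall>x. \<bar>x\<bar> ^ k * cmod (f x) \<le> C"
  shows "f \<in> schwartz"
proof -
  have "smooth f" by (rule smooth_coinduct[of P]) (use assms in auto)
  have P: "P ((dderiv 1 ^^ n) f)" for n
  proof (induction n)
    case (Suc n)
    from D[OF Suc] obtain f' where "\<And>x. ((dderiv 1 ^^ n) f has_vector_derivative f' x) (at x)" "P f'"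
      by blast
    then show ?case using dderiv_1_eq[of "(dderiv 1 ^^ n) f" f'] by simp
  qed (use assms in simp)
  then have "bdd_above (range (schwartz_weight k n f))" for k n
    using B[OF P, of k n] by (auto simp: schwartz_weight_def bdd_above_def)
  with \<open>smooth f\<close> show ?thesis by (simp add: schwartz_def)
qed

lemma schwartz_dderiv:
  assumes "\<psi> \<in> schwartz" shows "dderiv 1 \<psi> \<in> schwartz"
proof -
  have "schwartz_weight k n (dderiv 1 \<psi>) = schwartz_weight k (Suc n) \<psi>" for k n
    by (simp add: schwartz_weight_def fun_eq_iff funpow_Suc_right del: funpow.simps)
  then show ?thesis using assms by (auto simp: schwartz_def smooth_dderiv)
qed

lemma schwartz_funpow: "\<psi> \<in> schwartz \<Longrightarrow> (dderiv 1 ^^ n) \<psi> \<in> schwartz"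
  by (induction n) (auto simp: schwartz_dderiv)

lemma schwartz_bound:
  assumes "\<psi> \<in> schwartz" shows "\<exists>C. \<forall>x. \<bar>x\<bar> ^ k * cmod (\<psi> x) \<le> C"
proof -
  have "bdd_above (range (schwartz_weight k 0 \<psi>))" using assms by (auto simp: schwartz_def)
  then show ?thesis by (auto simp: schwartz_weight_def bdd_above_def)
qed

lemma schwartz_add:
  assumes "f \<in> schwartz" "g \<in> schwartz" shows "(\<lambda>x. f x + g x) \<in> schwartz"
proof (rule schwartz_coinduct[of "\<lambda>h. \<exists>f g. f \<in> schwartz \<and> g \<in> schwartz \<and> h = (\<lambda>x. f x + g x)"])
  fix h :: "real \<Rightarrow> complex" assume "\<exists>f g. f \<in> schwartz \<and> g \<in> schwartz \<and> h = (\<lambda>x. f x + g x)"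
  then obtain f g where *: "f \<in> schwartz" "g \<in> schwartz" "h = (\<lambda>x. f x + g x)" by blast
  then show "\<exists>f'. (\<forall>x. (h has_vector_derivative f' x) (at x)) \<and> (\<exists>f g. f \<in> schwartz \<and> g \<in> schwartz \<and> f' = (\<lambda>x. f x + g x))"
    by (intro exI[of _ "\<lambda>x. dderiv 1 f x + dderiv 1 g x"] conjI exI[of _ "dderiv 1 f"] exI[of _ "dderiv 1 g"])
      (auto intro!: has_vector_derivative_add smooth_deriv schwartz_dderiv schwartz_smooth)
  fix k
  obtain C D where "\<And>x. \<bar>x\<bar> ^ k * cmod (f x) \<le> C" "\<And>x. \<bar>x\<bar> ^ k * cmod (g x) \<le> D"
    using schwartz_bound[OF *(1)] schwartz_bound[OF *(2)] by metis
  then have "\<bar>x\<bar> ^ k * cmod (h x) \<le> C + D" for x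
    unfolding *(3)
    by (smt (verit) distrib_left mult_left_mono norm_triangle_ineq zero_le_power abs_ge_zero)
  then show "\<exists>C. \<forall>x. \<bar>x\<bar> ^ k * cmod (h x) \<le> C" by blast
qed (use assms in blast)

lemma schwartz_cmult:
  assumes "f \<in> schwartz" shows "(\<lambda>x. c * f x) \<in> schwartz"
proof (rule schwartz_coinduct[of "\<lambda>h. \<exists>f. f \<in> schwartz \<and> h = (\<lambda>x. c * f x)"])
  fix h :: "real \<Rightarrow> complex" assume "\<exists>f. f \<in> schwartz \<and> h = (\<lambda>x. c * f x)"
  then obtain f where *: "f \<in> schwartz" "h = (\<lambda>x. c * f x)" by blast
  then show "\<exists>f'. (\<forall>x. (h has_vector_derivative f' x) (at x)) \<and> (\<exists>f. f \<in> schwartz \<and> f' = (\<lambda>x. c * f x))"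
    by (intro exI[of _ "\<lambda>x. c * dderiv 1 f x"] conjI exI[of _ "dderiv 1 f"])
      (auto intro!: has_vector_derivative_mult_right smooth_deriv schwartz_dderiv schwartz_smooth)
  fix k
  obtain C where "\<And>x. \<bar>x\<bar> ^ k * cmod (f x) \<le> C"
    using schwartz_bound[OF *(1)] by metis
  then have "\<bar>x\<bar> ^ k * cmod (h x) \<le> cmod c * C" for x
    unfolding *(2) by (metis norm_mult mult.left_commute mult_left_mono norm_ge_zero)
  then show "\<exists>C. \<forall>x. \<bar>x\<bar> ^ k * cmod (h x) \<le> C" by blast
qed (use assms in blast)

text \<open>The invariant is the set of all x f + g with Schwartz f and g: its derivative x f' + (f
  + g') has the same form. The weight of order k on x f is the weight of order k + 1 on f.\<close>

lemma schwartz_mult_x: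
  assumes "f \<in> schwartz" shows "(\<lambda>x. of_real x * f x) \<in> schwartz"
proof -
  have zero: "(\<lambda>x. 0) \<in> schwartz" using schwartz_cmult[OF assms, of 0] by simp
  show ?thesis
  proof (rule schwartz_coinduct[of "\<lambda>h. \<exists>f g. f \<in> schwartz \<and> g \<in> schwartz \<and> h = (\<lambda>x. of_real x * f x + g x)"])
    show "\<exists>fa g. fa \<in> schwartz \<and> g \<in> schwartz \<and> (\<lambda>x. of_real x * f x) = (\<lambda>x. of_real x * fa x + g x)"
      by (rule exI[of _ f], rule exI[of _ "\<lambda>x. 0"]) (use assms zero in auto)
    fix h :: "real \<Rightarrow> complex" assume "\<exists>f g. f \<in> schwartz \<and> g \<in> schwartz \<and> h = (\<lambda>x. of_real x * f x + g x)"
    then obtain f g where *: "f \<in> schwartz" "g \<in> schwartz" "h = (\<lambda>x. of_real x * f x + g x)" by blast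
    have "(h has_vector_derivative of_real x * dderiv 1 f x + (f x + dderiv 1 g x)) (at x)" for x
    proof -
      have o: "((\<lambda>x. of_real x :: complex) has_vector_derivative 1) (at x)"
        using has_vector_derivative_of_real[of "\<lambda>x. x" 1 "at x"] by simp
      show ?thesis unfolding *(3)
        using has_vector_derivative_add[OF has_vector_derivative_mult[OF o smooth_deriv[OF schwartz_smooth[OF *(1)]]]
            smooth_deriv[OF schwartz_smooth[OF *(2)]]]
        by (simp add: add_ac)
    qed
    moreover have "\<exists>F g'. F \<in> schwartz \<and> g' \<in> schwartz \<and> (\<lambda>x. of_real x * dderiv 1 f x + (f x + dderiv 1 g x)) = (\<lambda>x. of_real x * F x + g' x)"
      by (rule exI[of _ "dderiv 1 f"], rule exI[of _ "\<lambda>x. f x + dderiv 1 g x"])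
        (use * in \<open>auto intro: schwartz_dderiv schwartz_add\<close>)
    ultimately show "\<exists>f'. (\<forall>x. (h has_vector_derivative f' x) (at x)) \<and> (\<exists>f g. f \<in> schwartz \<and> g \<in> schwartz \<and> f' = (\<lambda>x. of_real x * f x + g x))"
      by (intro exI[of _ "\<lambda>x. of_real x * dderiv 1 f x + (f x + dderiv 1 g x)"]) auto
    fix k
    obtain C D where CD: "\<And>x. \<bar>x\<bar> ^ Suc k * cmod (f x) \<le> C" "\<And>x. \<bar>x\<bar> ^ k * cmod (g x) \<le> D"
      using schwartz_bound[OF *(1)] schwartz_bound[OF *(2)] by metis
    have "\<bar>x\<bar> ^ k * cmod (h x) \<le> C + D" for x
    proof -
      have "cmod (h x) \<le> \<bar>x\<bar> * cmod (f x) + cmod (g x)"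
        unfolding *(3) by (rule order_trans[OF norm_triangle_ineq]) (simp add: norm_mult)
      then have "\<bar>x\<bar> ^ k * cmod (h x) \<le> \<bar>x\<bar> ^ k * (\<bar>x\<bar> * cmod (f x) + cmod (g x))"
        by (rule mult_left_mono) simp
      also have "\<dots> = \<bar>x\<bar> ^ Suc k * cmod (f x) + \<bar>x\<bar> ^ k * cmod (g x)" by (simp add: algebra_simps)
      finally show ?thesis using CD[of x] by linarith
    qed
    then show "\<exists>C. \<forall>x. \<bar>x\<bar> ^ k * cmod (h x) \<le> C" by blast
  qed
qed

lemma schwartz_power_x: "f \<in> schwartz \<Longrightarrow> (\<lambda>x. of_real x ^ n * f x) \<in> schwartz"
proof (induction n)
  case (Suc n)
  from schwartz_mult_x[OF Suc.IH[OF Suc.prems]] show ?case by (simp add: mult.assoc)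
qed simp

lemma schwartz_scale:
  assumes "f \<in> schwartz" "a \<noteq> 0" shows "(\<lambda>x. f (a * x)) \<in> schwartz"
proof (rule schwartz_coinduct[of "\<lambda>h. \<exists>f. f \<in> schwartz \<and> h = (\<lambda>x. f (a * x))"])
  fix h :: "real \<Rightarrow> complex" assume "\<exists>f. f \<in> schwartz \<and> h = (\<lambda>x. f (a * x))"
  then obtain f where f: "f \<in> schwartz" "h = (\<lambda>x. f (a * x))" by blast
  have "(h has_vector_derivative of_real a * dderiv 1 f (a * x)) (at x)" for x
  proof -
    have "((\<lambda>x. a * x) has_vector_derivative a) (at x)" by (auto intro!: derivative_eq_intros)
    from vector_diff_chain_at[OF this smooth_deriv[OF schwartz_smooth[OF f(1)]]]
    show ?thesis by (simp add: f(2) o_def scaleR_conv_of_real)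
  qed
  then show "\<exists>f'. (\<forall>x. (h has_vector_derivative f' x) (at x)) \<and> (\<exists>f. f \<in> schwartz \<and> f' = (\<lambda>x. f (a * x)))"
    by (intro exI[of _ "\<lambda>x. of_real a * dderiv 1 f (a * x)"] conjI allI exI[of _ "\<lambda>x. of_real a * dderiv 1 f x"])
      (auto intro: schwartz_cmult schwartz_dderiv f)
  fix k
  obtain C where C: "\<And>x. \<bar>x\<bar> ^ k * cmod (f x) \<le> C" using schwartz_bound[OF f(1)] by metis
  have "\<bar>x\<bar> ^ k * cmod (h x) \<le> C / \<bar>a\<bar> ^ k" for x
    using C[of "a * x"] assms(2) by (simp add: f(2) field_simps abs_mult power_mult_distrib)
  then show "\<exists>C. \<forall>x. \<bar>x\<bar> ^ k * cmod (h x) \<le> C" by blast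
qed (use assms in blast)

lemma dderiv_zero_outside:
  fixes f :: "real \<Rightarrow> 'b::real_normed_vector"
  assumes "smooth f" "\<And>x. \<bar>x\<bar> > R \<Longrightarrow> f x = 0" "\<bar>x\<bar> > R"
  shows "dderiv 1 f x = 0"
proof -
  have "((\<lambda>x. 0) has_vector_derivative dderiv 1 f x) (at x)"
  proof (rule has_vector_derivative_transform_within_open[OF smooth_deriv[OF assms(1)]])
    show "open {y. \<bar>y\<bar> > R}" by (intro open_Collect_less continuous_intros)
  qed (use assms in auto)
  then show ?thesis using vector_derivative_unique_at[OF _ has_vector_derivative_const] by metis
qed

lemma smooth_compact_schwartz:
  fixes f :: "real \<Rightarrow> complex"
  assumes "smooth f" "\<And>x. \<bar>x\<bar> > R \<Longrightarrow> f x = 0"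
  shows "f \<in> schwartz"
proof (rule schwartz_coinduct[of "\<lambda>f. smooth f \<and> (\<forall>x. \<bar>x\<bar> > R \<longrightarrow> f x = 0)"])
  fix f :: "real \<Rightarrow> complex" assume f: "smooth f \<and> (\<forall>x. \<bar>x\<bar> > R \<longrightarrow> f x = 0)"
  then show "\<exists>f'. (\<forall>x. (f has_vector_derivative f' x) (at x)) \<and> smooth f' \<and> (\<forall>x. \<bar>x\<bar> > R \<longrightarrow> f' x = 0)"
    by (intro exI[of _ "dderiv 1 f"]) (auto intro: smooth_deriv smooth_dderiv dderiv_zero_outside)
  fix k
  have "compact ((\<lambda>x. \<bar>x\<bar> ^ k * cmod (f x)) ` {-R..R})"
    by (intro compact_continuous_image continuous_intros smooth_continuous) (use f in auto)
  then have "bdd_above ((\<lambda>x. \<bar>x\<bar> ^ k * cmod (f x)) ` {-R..R})"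
    by (intro bounded_imp_bdd_above compact_imp_bounded)
  then obtain C where C: "\<And>x. x \<in> {-R..R} \<Longrightarrow> \<bar>x\<bar> ^ k * cmod (f x) \<le> C"
    unfolding bdd_above_def by blast
  have "\<bar>x\<bar> ^ k * cmod (f x) \<le> max C 0" for x
    using C[of x] f by (cases "\<bar>x\<bar> \<le> R") (auto simp: abs_le_iff)
  then show "\<exists>C. \<forall>x. \<bar>x\<bar> ^ k * cmod (f x) \<le> C" by blast
qed (use assms in auto)

lemma schwartz_mult_compact:
  assumes "smooth m" "\<And>x. \<bar>x\<bar> > R \<Longrightarrow> m x = 0" "\<psi> \<in> schwartz"
  shows "(\<lambda>x. complex_of_real (m x) * \<psi> x) \<in> schwartz"
proof (rule smooth_compact_schwartz[of _ R])
  show "smooth (\<lambda>x. complex_of_real (m x) * \<psi> x)"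
    by (intro smooth_mult smooth_bounded_linear[OF bounded_linear_of_real] assms schwartz_smooth)
qed (use assms in auto)

text \<open>Adding the weights of order k and k + 2 produces the factor 1 + x^2, whose inverse is
  integrable.\<close>

lemma schwartz_decay:
  assumes "\<psi> \<in> schwartz"
  obtains C where "C \<ge> 0" "\<And>x. \<bar>x\<bar> ^ k * cmod (\<psi> x) \<le> C / (1 + x\<^sup>2)"
proof -
  obtain C D where CD: "\<And>x. \<bar>x\<bar> ^ k * cmod (\<psi> x) \<le> C" "\<And>x. \<bar>x\<bar> ^ (k + 2) * cmod (\<psi> x) \<le> D"
    using schwartz_bound[OF assms] by metis
  have "\<bar>x\<bar> ^ k * cmod (\<psi> x) * (1 + x\<^sup>2) \<le> C + D" for x
  proof -
    have "\<bar>x\<bar> ^ k * cmod (\<psi> x) * (1 + x\<^sup>2) = \<bar>x\<bar> ^ k * cmod (\<psi> x) + \<bar>x\<bar> ^ (k + 2) * cmod (\<psi> x)"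
      by (simp add: power_add algebra_simps power2_eq_square)
    then show ?thesis using CD[of x] by linarith
  qed
  moreover from this[of 0] have "0 \<le> C + D"
    by (smt (verit) mult_nonneg_nonneg norm_ge_zero zero_le_power abs_ge_zero zero_le_power2)
  ultimately show thesis
    by (intro that[of "C + D"]) (auto simp: pos_le_divide_eq add_pos_nonneg)
qed

lemma integrable_inverse_quadratic: "integrable lborel (\<lambda>x::real. C / (1 + x\<^sup>2))"
  using integrable_inverse_1_plus_square
  by (simp add: set_integrable_def divide_inverse einterval_eq)

lemma schwartz_measurable: "\<psi> \<in> schwartz \<Longrightarrow> \<psi> \<in> borel_measurable borel"
  by (intro smooth_measurable schwartz_smooth)

lemma schwartz_integrable:
  assumes "\<psi> \<in> schwartz" shows "integrable lborel \<psi>"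
proof -
  obtain C where "\<And>x. cmod (\<psi> x) \<le> C / (1 + x\<^sup>2)" using schwartz_decay[OF assms, of 0] by auto
  then show ?thesis
    by (intro integrable_bounded_by[OF integrable_inverse_quadratic]) (auto simp: schwartz_measurable assms)
qed

lemma schwartz_tendsto_0:
  assumes "\<psi> \<in> schwartz" shows "(\<psi> \<longlongrightarrow> 0) at_top" "(\<psi> \<longlongrightarrow> 0) at_bot"
proof -
  obtain C where C: "\<And>x. cmod (\<psi> x) \<le> C / (1 + x\<^sup>2)" using schwartz_decay[OF assms, of 0] by auto
  have "((\<lambda>x::real. C / (1 + x\<^sup>2)) \<longlongrightarrow> 0) at_top" "((\<lambda>x::real. C / (1 + x\<^sup>2)) \<longlongrightarrow> 0) at_bot"
    by real_asymp+
  from Lim_null_comparison[OF always_eventually this(1)] Lim_null_comparison[OF always_eventually this(2)]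
  show "(\<psi> \<longlongrightarrow> 0) at_top" "(\<psi> \<longlongrightarrow> 0) at_bot" using C by auto
qed

section \<open>The Fourier transform of Schwartz functions\<close>

lemma integral_continuous_pos:
  fixes f :: "real \<Rightarrow> real"
  assumes f: "integrable lborel f" "\<And>x. 0 \<le> f x" and "continuous_on UNIV f" "f a \<noteq> 0"
  shows "0 < (LINT x|lborel. f x)"
proof -
  have pos: "0 < f a" using assms(2)[of a] assms(4) by simp
  have "isCont f a" using assms(3) by (simp add: continuous_on_eq_continuous_at)
  then obtain d where d: "d > 0" "\<And>x. \<bar>x - a\<bar> < d \<Longrightarrow> \<bar>f x - f a\<bar> < f a / 2"
    using pos unfolding continuous_at_eps_delta by (metis dist_real_def half_gt_zero)
  have "0 < d * f a / 2" using d pos by simp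
  also have "d * f a / 2 = (LINT x|lborel. indicator {a..a + d / 2} x * (f a)) "
    using d by (simp add: field_simps)
  also have "(LINT x|lborel. indicator {a..a + d / 2} x * (f a)) = 2 * (LINT x|lborel. indicator {a..a + d / 2} x * (f a / 2))"
    using d by (simp add: field_simps)
  also have "(LINT x|lborel. indicator {a..a + d / 2} x * (f a / 2)) \<le> (LINT x|lborel. f x)"
  proof (rule integral_mono[OF _ f(1)])
    show "integrable lborel (\<lambda>x. indicator {a..a + d / 2} x * (f a / 2))"
      by (intro integrable_mult_left integrable_real_indicator) (simp_all add: emeasure_lborel_Icc_eq)
    show "indicator {a..a + d / 2} x * (f a / 2) \<le> f x" for x
    proof (cases "x \<in> {a..a + d / 2}")
      case True
      then have "\<bar>x - a\<bar> < d" using d(1) by auto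
      from d(2)[OF this] have "f a / 2 \<le> f x" by linarith
      then show ?thesis using True by simp
    qed (use f(2)[of x] in auto)
  qed
  finally show ?thesis by simp
qed

text \<open>Second-order Taylor bounds are what the estimate for \<open>cis\<close> gives, and they
  integrate directly; differentiation under the integral sign of \<open>fourier\<close> thereby
  becomes a plain norm estimate.\<close>

lemma has_vector_derivative_quadratic:
  assumes B: "\<And>h. norm (f (x + h) - f x - h *\<^sub>R D) \<le> B * h\<^sup>2"
  shows "(f has_vector_derivative D) (at x)"
  unfolding has_vector_derivative_def has_derivative_at
proof (intro conjI bounded_linear_scaleR_left)
  have "((\<lambda>h. B * \<bar>h\<bar>) \<longlongrightarrow> B * \<bar>0\<bar>) (at 0)" by (intro tendsto_intros)
  then have lim: "((\<lambda>h. B * \<bar>h\<bar>) \<longlongrightarrow> 0) (at 0)" by simp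
  show "((\<lambda>h. norm (f (x + h) - f x - h *\<^sub>R D) / norm h) \<longlongrightarrow> 0) (at 0)"
  proof (rule Lim_null_comparison[OF _ lim])
    show "\<forall>\<^sub>F h in at 0. norm (norm (f (x + h) - f x - h *\<^sub>R D) / norm h) \<le> B * \<bar>h\<bar>"
      unfolding eventually_at_filter
      using B by (intro always_eventually) (auto simp: pos_divide_le_eq power2_eq_square mult.assoc)
  qed
qed

lemma cmod_cis_taylor: "cmod (cis y - 1 - \<i> * y) \<le> y\<^sup>2 / 2"
  using iexp_approx1[of y 1] by (simp add: cis_conv_exp atMost_Suc algebra_simps power2_eq_square)

lemma integrable_cis_mult:
  fixes f :: "real \<Rightarrow> complex"
  assumes "integrable lborel f" "g \<in> borel_measurable borel"
  shows "integrable lborel (\<lambda>x. cis (g x) * f x)"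
proof (rule integrable_bounded_by[OF integrable_norm[OF assms(1)]])
  have [measurable]: "cis \<in> borel_measurable borel"
    by (intro borel_measurable_continuous_onI continuous_intros)
  show "(\<lambda>x. cis (g x) * f x) \<in> borel_measurable lborel"
    using assms by measurable
qed (simp add: norm_mult)

lemma fourier_norm_le:
  "cmod (fourier \<psi> \<xi>) \<le> (LINT x|lborel. cmod (\<psi> x))" if "integrable lborel \<psi>"
  unfolding fourier_def by (rule integral_norm_le) (use that in \<open>auto simp: norm_mult\<close>)

lemma fourier_cmult: "fourier (\<lambda>x. c * \<psi> x) \<xi> = c * fourier \<psi> \<xi>"
  unfolding fourier_def by (subst integral_mult_right_zero[symmetric]) (simp add: ac_simps)

text \<open>The Taylor remainder of the exponential is at most (x h)^2 / 2, so the error is h^2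
  times half the second absolute moment of \<psi>, finite by Schwartz decay.\<close>

lemma fourier_has_vector_derivative:
  assumes "\<psi> \<in> schwartz"
  shows "(fourier \<psi> has_vector_derivative fourier (\<lambda>x. - \<i> * (of_real x * \<psi> x)) \<xi>) (at \<xi>)"
proof (rule has_vector_derivative_quadratic)
  let ?F = "\<lambda>x. - \<i> * (of_real x * \<psi> x)"
  have S: "?F \<in> schwartz" "(\<lambda>x. of_real x ^ 2 * \<psi> x) \<in> schwartz"
    using schwartz_cmult[OF schwartz_mult_x[OF assms], of "-\<i>"] schwartz_power_x[OF assms] by auto
  have i2: "integrable lborel (\<lambda>x. x\<^sup>2 * cmod (\<psi> x))"
    using integrable_norm[OF schwartz_integrable[OF S(2)]] by (simp add: norm_mult norm_power)
  fix h
  have "fourier \<psi> (\<xi> + h) - fourier \<psi> \<xi> - h *\<^sub>R fourier ?F \<xi> =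
     (LINT x|lborel. cis (- (x * (\<xi> + h))) * \<psi> x - cis (- (x * \<xi>)) * \<psi> x - h *\<^sub>R (cis (- (x * \<xi>)) * ?F x))"
  proof -
    have "integrable lborel (\<lambda>x. cis (- (x * (\<xi> + h))) * \<psi> x)" "integrable lborel (\<lambda>x. cis (- (x * \<xi>)) * \<psi> x)"
      "integrable lborel (\<lambda>x. h *\<^sub>R (cis (- (x * \<xi>)) * ?F x))"
      by (intro integrable_scaleR_right integrable_cis_mult schwartz_integrable assms S; measurable)+
    then show ?thesis unfolding fourier_def
      by (simp only: Bochner_Integration.integral_diff Bochner_Integration.integrable_diff integral_scaleR_right)
  qed
  also have "norm \<dots> \<le> (LINT x|lborel. h\<^sup>2 / 2 * (x\<^sup>2 * cmod (\<psi> x)))"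
  proof (rule integral_norm_le)
    fix x
    have "cis (- (x * (\<xi> + h))) * \<psi> x - cis (- (x * \<xi>)) * \<psi> x - h *\<^sub>R (cis (- (x * \<xi>)) * ?F x)
      = cis (- (x * \<xi>)) * \<psi> x * (cis (- (x * h)) - 1 - \<i> * of_real (- (x * h)))"
    proof -
      have "cis (- (x * (\<xi> + h))) = cis (- (x * \<xi>)) * cis (- (x * h))"
        by (simp add: cis_mult algebra_simps)
      then show ?thesis by (simp add: algebra_simps scaleR_conv_of_real)
    qed
    also have "cmod \<dots> = cmod (\<psi> x) * cmod (cis (- (x * h)) - 1 - \<i> * of_real (- (x * h)))"
      by (simp add: norm_mult)
    also have "\<dots> \<le> cmod (\<psi> x) * ((- (x * h))\<^sup>2 / 2)"
      by (intro mult_left_mono cmod_cis_taylor norm_ge_zero)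
    also have "\<dots> = h\<^sup>2 / 2 * (x\<^sup>2 * cmod (\<psi> x))" by (simp add: power_mult_distrib)
    finally show "norm (cis (- (x * (\<xi> + h))) * \<psi> x - cis (- (x * \<xi>)) * \<psi> x - h *\<^sub>R (cis (- (x * \<xi>)) * ?F x)) \<le> h\<^sup>2 / 2 * (x\<^sup>2 * cmod (\<psi> x))" .
  qed (use i2 in simp)
  also have "\<dots> = (LINT x|lborel. x\<^sup>2 * cmod (\<psi> x)) / 2 * h\<^sup>2" by simp
  finally show "norm (fourier \<psi> (\<xi> + h) - fourier \<psi> \<xi> - h *\<^sub>R fourier ?F \<xi>)
     \<le> (LINT x|lborel. x\<^sup>2 * cmod (\<psi> x)) / 2 * h\<^sup>2" .
qed

lemma has_vector_derivative_cis:
  "((\<lambda>x. cis (- (x * \<xi>))) has_vector_derivative - \<i> * \<xi> * cis (- (x * \<xi>))) (at x)"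
proof -
  have "(cis has_vector_derivative \<i> * cis (- (x * \<xi>))) (at (- (x * \<xi>)))"
  proof (rule has_vector_derivative_quadratic)
    fix h
    have "cis (- (x * \<xi>) + h) - cis (- (x * \<xi>)) - h *\<^sub>R (\<i> * cis (- (x * \<xi>)))
       = cis (- (x * \<xi>)) * (cis h - 1 - \<i> * h)"
      unfolding cis_mult[symmetric] by (simp add: scaleR_conv_of_real algebra_simps)
    then have "norm (cis (- (x * \<xi>) + h) - cis (- (x * \<xi>)) - h *\<^sub>R (\<i> * cis (- (x * \<xi>)))) = cmod (cis h - 1 - \<i> * h)"
      by (simp add: norm_mult)
    then show "norm (cis (- (x * \<xi>) + h) - cis (- (x * \<xi>)) - h *\<^sub>R (\<i> * cis (- (x * \<xi>)))) \<le> 1 / 2 * h\<^sup>2"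
      using cmod_cis_taylor[of h] by simp
  qed
  moreover have "((\<lambda>x. - (x * \<xi>)) has_vector_derivative - \<xi>) (at x)"
    by (auto intro!: derivative_eq_intros)
  ultimately have "((cis \<circ> (\<lambda>x. - (x * \<xi>))) has_vector_derivative (- \<xi>) *\<^sub>R (\<i> * cis (- (x * \<xi>)))) (at x)"
    by (intro vector_diff_chain_at)
  moreover have "(- \<xi>) *\<^sub>R (\<i> * cis (- (x * \<xi>))) = - \<i> * \<xi> * cis (- (x * \<xi>))"
    by (simp add: scaleR_conv_of_real)
  ultimately show ?thesis by (simp add: o_def)
qed

lemma fourier_dderiv:
  assumes "\<psi> \<in> schwartz"
  shows "fourier (dderiv 1 \<psi>) \<xi> = \<i> * \<xi> * fourier \<psi> \<xi>"
proof -
  have int: "integrable lborel (\<lambda>x. cis (- (x * \<xi>)) * \<psi> x)" "integrable lborel (\<lambda>x. cis (- (x * \<xi>)) * dderiv 1 \<psi> x)"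
    by (intro integrable_cis_mult schwartz_integrable schwartz_dderiv assms; measurable)+
  have nrm: "cmod (cis (- (x * \<xi>)) * \<psi> x) = cmod (\<psi> x)" for x by (simp add: norm_mult)
  have "(LINT x|lborel. cis (- (x * \<xi>)) * dderiv 1 \<psi> x + (- \<i> * \<xi>) * (cis (- (x * \<xi>)) * \<psi> x)) = 0 - 0"
  proof (rule integral_FTC_UNIV_finite_exceptions[of "{}"])
    have D: "((\<lambda>x. cis (- (x * \<xi>)) * \<psi> x) has_vector_derivative
       cis (- (x * \<xi>)) * dderiv 1 \<psi> x + (- \<i> * \<xi>) * (cis (- (x * \<xi>)) * \<psi> x)) (at x)" for x
      using has_vector_derivative_mult[OF has_vector_derivative_cis[of \<xi> x] smooth_deriv[OF schwartz_smooth[OF assms], of x]]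
      by (simp add: mult_ac)
    then show "((\<lambda>x. cis (- (x * \<xi>)) * \<psi> x) has_vector_derivative
       cis (- (x * \<xi>)) * dderiv 1 \<psi> x + (- \<i> * \<xi>) * (cis (- (x * \<xi>)) * \<psi> x)) (at x)" for x .
    show "continuous_on UNIV (\<lambda>x. cis (- (x * \<xi>)) * \<psi> x)"
      using D by (auto intro!: continuous_at_imp_continuous_on has_vector_derivative_continuous)
    show "((\<lambda>x. cis (- (x * \<xi>)) * \<psi> x) \<longlongrightarrow> 0) at_bot" "((\<lambda>x. cis (- (x * \<xi>)) * \<psi> x) \<longlongrightarrow> 0) at_top"
      using schwartz_tendsto_0[OF assms]
      by (auto intro!: tendsto_norm_zero_cancel[of "\<lambda>x. cis (- (x * \<xi>)) * \<psi> x"] simp: nrm simp del: norm_mult dest: tendsto_norm_zero)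
  qed (use int in auto)
  moreover have "(LINT x|lborel. cis (- (x * \<xi>)) * dderiv 1 \<psi> x + (- \<i> * \<xi>) * (cis (- (x * \<xi>)) * \<psi> x))
     = fourier (dderiv 1 \<psi>) \<xi> + (- \<i> * \<xi>) * fourier \<psi> \<xi>"
    unfolding fourier_def by (subst Bochner_Integration.integral_add) (use int in auto)
  ultimately show ?thesis by (simp add: add_eq_0_iff)
qed

text \<open>The class of all transforms of Schwartz functions is closed under differentiation,
  because a factor -i x goes inside; and x^k times a transform is, up to a factor of modulus one,
  the transform of a k-th derivative, hence bounded.\<close>

lemma fourier_schwartz:
  assumes "\<psi> \<in> schwartz" shows "fourier \<psi> \<in> schwartz"
proof (rule schwartz_coinduct[of "\<lambda>f. \<exists>\<psi>\<in>schwartz. f = fourier \<psi>"])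
  fix f assume "\<exists>\<psi>\<in>schwartz. f = fourier \<psi>"
  then obtain \<psi> where \<psi>: "\<psi> \<in> schwartz" "f = fourier \<psi>" by blast
  show "\<exists>f'. (\<forall>x. (f has_vector_derivative f' x) (at x)) \<and> (\<exists>\<psi>\<in>schwartz. f' = fourier \<psi>)"
    unfolding \<psi>(2)
    by (intro exI[of _ "fourier (\<lambda>x. - \<i> * (of_real x * \<psi> x))"] conjI allI fourier_has_vector_derivative[OF \<psi>(1)]
        bexI[of _ "\<lambda>x. - \<i> * (of_real x * \<psi> x)"] refl schwartz_cmult schwartz_mult_x \<psi>(1))
  fix k
  have "fourier ((dderiv 1 ^^ k) \<psi>) x = (\<i> * x) ^ k * fourier \<psi> x" for x
    by (induction k) (simp_all add: fourier_dderiv schwartz_funpow \<psi>(1))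
  then have "\<bar>x\<bar> ^ k * cmod (f x) = cmod (fourier ((dderiv 1 ^^ k) \<psi>) x)" for x
    by (simp add: \<psi>(2) norm_mult norm_power)
  then show "\<exists>C. \<forall>x. \<bar>x\<bar> ^ k * cmod (f x) \<le> C"
    using fourier_norm_le[OF schwartz_integrable[OF schwartz_funpow[OF \<psi>(1)]]] by auto
qed (use assms in blast)

lemma inv_fourier_eq: "inv_fourier \<psi> = (\<lambda>x. (1 / (2 * pi)) * fourier \<psi> ((-1) * x))"
  by (simp add: fun_eq_iff inv_fourier_def fourier_def mult.commute)

lemma inv_fourier_schwartz: "\<psi> \<in> schwartz \<Longrightarrow> inv_fourier \<psi> \<in> schwartz"
  unfolding inv_fourier_eq
  by (intro schwartz_cmult schwartz_scale[of "fourier \<psi>" "-1"] fourier_schwartz) auto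

lemma inv_fourier_dderiv:
  "\<psi> \<in> schwartz \<Longrightarrow> inv_fourier (dderiv 1 \<psi>) \<xi> = - \<i> * \<xi> * inv_fourier \<psi> \<xi>"
  by (simp add: inv_fourier_eq fourier_dderiv)

section \<open>Fourier multipliers as convolutions\<close>

lemma integrable_pair_bound:
  fixes F :: "real \<times> real \<Rightarrow> 'b::{banach,second_countable_topology}"
  assumes "integrable lborel f" "integrable lborel g" "F \<in> borel_measurable (borel \<Otimes>\<^sub>M borel)"
    and "\<And>x y. norm (F (x, y)) \<le> f x * g y"
  shows "integrable (lborel \<Otimes>\<^sub>M lborel) F"
proof -
  have b: "integrable (lborel \<Otimes>\<^sub>M lborel) (\<lambda>z. f (fst z) * g (snd z))"
  proof (rule lborel_pair.Fubini_integrable)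
    show "(\<lambda>z. f (fst z) * g (snd z)) \<in> borel_measurable (lborel \<Otimes>\<^sub>M lborel)"
      using assms(1,2) by measurable
    have "integrable lborel (\<lambda>x. norm (f x) * (LINT y|lborel. norm (g y)))"
      using assms(1,2) by auto
    then show "integrable lborel (\<lambda>x. LINT y|lborel. norm (f (fst (x, y)) * g (snd (x, y))))"
      by (simp add: abs_mult)
  qed (use assms(2) in auto)
  show ?thesis
    by (rule Bochner_Integration.integrable_bound[OF b])
      (use assms(3,4) in \<open>auto intro!: AE_I2 order_trans[OF assms(4)]\<close>)
qed

lemma lborel_Fubini:
  fixes F :: "real \<Rightarrow> real \<Rightarrow> 'b::{banach,second_countable_topology}"
  assumes "integrable lborel f" "integrable lborel g" "case_prod F \<in> borel_measurable (borel \<Otimes>\<^sub>M borel)"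
    and "\<And>x y. norm (F x y) \<le> f x * g y"
  shows "(LINT x|lborel. LINT y|lborel. F x y) = (LINT y|lborel. LINT x|lborel. F x y)"
  by (rule lborel_pair.Fubini_integral[symmetric], rule integrable_pair_bound[OF assms(1-3)])
    (use assms(4) in auto)

section \<open>Convolution kernels of smooth, compactly supported multipliers\<close>

definition multiplier_kernel :: "(real \<Rightarrow> real) \<Rightarrow> real \<Rightarrow> complex" where
  "multiplier_kernel m z = 1 / (2 * pi) * fourier (\<lambda>\<xi>. of_real (m \<xi>)) z"

definition multiplier :: "(real \<Rightarrow> real) \<Rightarrow> bool" where
  "multiplier m \<longleftrightarrow> smooth m \<and> (\<exists>R. \<forall>x. \<bar>x\<bar> > R \<longrightarrow> m x = 0)"

lemma multiplier_smooth: "multiplier m \<Longrightarrow> smooth m" by (simp add: multiplier_def)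

lemma multiplier_mult_schwartz:
  "multiplier m \<Longrightarrow> \<psi> \<in> schwartz \<Longrightarrow> (\<lambda>x. complex_of_real (m x) * \<psi> x) \<in> schwartz"
  unfolding multiplier_def using schwartz_mult_compact by blast

lemma multiplier_schwartz: "multiplier m \<Longrightarrow> (\<lambda>x. complex_of_real (m x)) \<in> schwartz"
  unfolding multiplier_def
  using smooth_compact_schwartz[OF smooth_bounded_linear[OF bounded_linear_of_real, of m]] by fastforce

lemma multiplier_kernel_schwartz: "multiplier m \<Longrightarrow> multiplier_kernel m \<in> schwartz"
  unfolding multiplier_kernel_def[abs_def] by (intro schwartz_cmult fourier_schwartz multiplier_schwartz)

lemma borel_measurable_cis[measurable]: "cis \<in> borel_measurable borel"
  by (intro borel_measurable_continuous_onI continuous_intros)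

text \<open>The compact support of m makes the double integral absolutely convergent, so Fubini
  yields the convolution at once; Fourier inversion does not enter.\<close>

lemma fourier_multiplier_convolution:
  assumes m: "multiplier m" and \<psi>: "\<psi> \<in> schwartz"
  shows "fourier (\<lambda>\<xi>. of_real (m \<xi>) * inv_fourier \<psi> \<xi>) x = (LINT y|lborel. multiplier_kernel m (x - y) * \<psi> y)"
proof -
  have [measurable]: "m \<in> borel_measurable borel" "\<psi> \<in> borel_measurable borel"
    by (auto intro: smooth_measurable multiplier_smooth schwartz_measurable m \<psi>)
  have "fourier (\<lambda>\<xi>. of_real (m \<xi>) * inv_fourier \<psi> \<xi>) x =
     (LINT \<xi>|lborel. LINT y|lborel. 1 / (2 * pi) * (cis (- (x * \<xi>)) * of_real (m \<xi>) * (cis (\<xi> * y) * \<psi> y)))"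
    unfolding fourier_def inv_fourier_def
    by (simp only: integral_mult_right_zero) (simp add: mult_ac)
  also have "\<dots> = (LINT y|lborel. LINT \<xi>|lborel. 1 / (2 * pi) * (cis (- (x * \<xi>)) * of_real (m \<xi>) * (cis (\<xi> * y) * \<psi> y)))"
  proof (rule lborel_Fubini)
    show "integrable lborel (\<lambda>\<xi>. 1 / (2 * pi) * cmod (of_real (m \<xi>)))" "integrable lborel (\<lambda>y. cmod (\<psi> y))"
      by (intro integrable_mult_right integrable_norm schwartz_integrable multiplier_schwartz m \<psi>)+
    show "(\<lambda>(\<xi>, y). 1 / (2 * pi) * (cis (- (x * \<xi>)) * of_real (m \<xi>) * (cis (\<xi> * y) * \<psi> y))) \<in> borel_measurable (borel \<Otimes>\<^sub>M borel)"
      by measurable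
  qed (simp add: norm_mult norm_divide)
  also have "\<dots> = (LINT y|lborel. multiplier_kernel m (x - y) * \<psi> y)"
  proof (rule Bochner_Integration.integral_cong[OF refl])
    fix y
    have "1 / (2 * pi) * (cis (- (x * \<xi>)) * of_real (m \<xi>) * (cis (\<xi> * y) * \<psi> y)) =
      1 / (2 * pi) * \<psi> y * (cis (- (\<xi> * (x - y))) * of_real (m \<xi>))" for \<xi>
    proof -
      have "cis (- (\<xi> * (x - y))) = cis (- (x * \<xi>)) * cis (\<xi> * y)"
        by (simp add: cis_mult algebra_simps)
      then show ?thesis by simp
    qed
    then show "(LINT \<xi>|lborel. 1 / (2 * pi) * (cis (- (x * \<xi>)) * of_real (m \<xi>) * (cis (\<xi> * y) * \<psi> y))) = multiplier_kernel m (x - y) * \<psi> y"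
      by (simp only: multiplier_kernel_def fourier_def integral_mult_right_zero) simp
  qed
  finally show ?thesis .
qed

lemma multiplier_kernel_minus:
  assumes "\<And>\<xi>. m (- \<xi>) = m \<xi>"
  shows "multiplier_kernel m (- z) = multiplier_kernel m z"
proof -
  have "(LINT \<xi>|lborel. cis (- (\<xi> * - z)) * of_real (m \<xi>)) = (LINT \<xi>|lborel. cis (- (\<xi> * z)) * complex_of_real (m \<xi>))"
    by (subst lborel_integral_real_affine[of "-1" _ 0]) (simp_all add: assms)
  then show ?thesis by (simp add: multiplier_kernel_def fourier_def)
qed

text \<open>Holds because m is real. It makes the convolution square of the kernel at the origin
  equal to the integral of |k|^2, the source of positivity in the lower bound for the hat.\<close>

lemma multiplier_kernel_cnj: "multiplier_kernel m (- z) = cnj (multiplier_kernel m z)"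
proof -
  have "cnj (LINT \<xi>|lborel. cis (- (\<xi> * z)) * complex_of_real (m \<xi>)) = (LINT \<xi>|lborel. cnj (cis (- (\<xi> * z)) * complex_of_real (m \<xi>)))"
    by (rule Bochner_Integration.integral_cnj[symmetric])
  also have "\<dots> = (LINT \<xi>|lborel. cis (- (\<xi> * (- z))) * complex_of_real (m \<xi>))"
    by (simp add: cis_cnj)
  finally show ?thesis by (simp add: multiplier_kernel_def fourier_def)
qed

lemma multiplier_kernel_scale:
  assumes "a > 0"
  shows "multiplier_kernel (\<lambda>\<xi>. m (\<xi> / a)) z = a * multiplier_kernel m (a * z)"
  unfolding multiplier_kernel_def fourier_def
  using assms by (subst lborel_integral_real_affine[of a _ 0])
    (auto simp: scaleR_conv_of_real mult_ac)

lemma multiplier_scale: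
  assumes "multiplier m" "a > 0" shows "multiplier (\<lambda>\<xi>. m (a * \<xi>))"
proof -
  obtain R where "\<And>x. \<bar>x\<bar> > R \<Longrightarrow> m x = 0" using assms by (auto simp: multiplier_def)
  then have "\<forall>x. \<bar>x\<bar> > R / a \<longrightarrow> m (a * x) = 0" using assms(2)
    by (auto simp: field_simps abs_mult)
  then show ?thesis using assms smooth_compose_scale[of m a] unfolding multiplier_def by blast
qed

text \<open>The invariant is f / x^n with f smooth and zero near the origin. The quotient rule gives
  (x f' - n f) / x^(n+1), again of this form. Near the origin the numerator vanishes, so the default
  value of division by zero is the correct one.\<close>

lemma smooth_divide_power:
  fixes m :: "real \<Rightarrow> real"
  assumes "smooth m" "a > 0" "\<And>x. \<bar>x\<bar> < a \<Longrightarrow> m x = 0"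
  shows "smooth (\<lambda>x. m x / x)"
proof (rule smooth_coinduct[of "\<lambda>h. \<exists>n f. smooth f \<and> (\<forall>x. \<bar>x\<bar> < a \<longrightarrow> f x = 0) \<and> h = (\<lambda>x. f x / x ^ n)"])
  show "\<exists>n f. smooth f \<and> (\<forall>x. \<bar>x\<bar> < a \<longrightarrow> f x = 0) \<and> (\<lambda>x. m x / x) = (\<lambda>x. f x / x ^ n)"
    by (rule exI[of _ 1], rule exI[of _ m]) (use assms in auto)
  fix h :: "real \<Rightarrow> real" assume "\<exists>n f. smooth f \<and> (\<forall>x. \<bar>x\<bar> < a \<longrightarrow> f x = 0) \<and> h = (\<lambda>x. f x / x ^ n)"
  then obtain n f where f: "smooth f" "\<And>x. \<bar>x\<bar> < a \<Longrightarrow> f x = 0" and h: "h = (\<lambda>x. f x / x ^ n)" by blast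
  define g where "g = (\<lambda>x. x * dderiv 1 f x + (- real n) * f x)"
  have g: "smooth g" unfolding g_def
    by (intro smooth_add smooth_mult smooth_const smooth_dderiv f smooth_of_real[where 'b=real, simplified])
  have near: "open {x::real. \<bar>x\<bar> < a}" by (intro open_Collect_less continuous_intros)
  have df: "dderiv 1 f x = 0" if "\<bar>x\<bar> < a" for x
  proof -
    have "((\<lambda>x. 0) has_vector_derivative dderiv 1 f x) (at x)"
      by (rule has_vector_derivative_transform_within_open[OF smooth_deriv[OF f(1)] near]) (use that f in auto)
    then show ?thesis using vector_derivative_unique_at[OF _ has_vector_derivative_const] by metis
  qed
  have "(h has_vector_derivative g x / x ^ Suc n) (at x)" for x
  proof (cases "\<bar>x\<bar> < a")
    case True
    have "((\<lambda>x. 0) has_vector_derivative 0) (at x)" by simp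
    then have "(h has_vector_derivative 0) (at x)"
      by (rule has_vector_derivative_transform_within_open[OF _ near]) (use True f h in auto)
    then show ?thesis using True df f by (simp add: g_def)
  next
    case False
    then have x: "x \<noteq> 0" using assms(2) by auto
    have [derivative_intros]: "(f has_real_derivative dderiv 1 f x) (at x)"
      using smooth_deriv[OF f(1), of x] by (simp add: has_real_derivative_iff_has_vector_derivative)
    have "(h has_real_derivative (dderiv 1 f x * x ^ n - f x * (real n * x ^ (n - 1))) / (x ^ n * x ^ n)) (at x)"
      unfolding h using x by (auto intro!: derivative_eq_intros)
    also have "(dderiv 1 f x * x ^ n - f x * (real n * x ^ (n - 1))) / (x ^ n * x ^ n) = g x / x ^ Suc n"
      using x by (cases n) (auto simp: g_def field_simps)
    finally show ?thesis by (simp add: has_real_derivative_iff_has_vector_derivative)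
  qed
  moreover have "g x = 0" if "\<bar>x\<bar> < a" for x using that df f by (simp add: g_def)
  ultimately show "\<exists>f'. (\<forall>x. (h has_vector_derivative f' x) (at x)) \<and>
     (\<exists>n f. smooth f \<and> (\<forall>x. \<bar>x\<bar> < a \<longrightarrow> f x = 0) \<and> f' = (\<lambda>x. f x / x ^ n))"
    using g by (intro exI[of _ "\<lambda>x. g x / x ^ Suc n"] conjI exI[of _ "Suc n"] exI[of _ g]) auto
qed

text \<open>A multiplier vanishing near the origin is \<open>\<xi>\<close> times another multiplier, so its kernel is a
  derivative.\<close>

lemma integral_multiplier_kernel_0:
  assumes "multiplier m" "a > 0" "\<And>x. \<bar>x\<bar> < a \<Longrightarrow> m x = 0"
  shows "(LINT z|lborel. multiplier_kernel m z) = 0"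
proof -
  define \<theta> where "\<theta> = (\<lambda>\<xi>. m \<xi> / \<xi>)"
  have \<theta>: "multiplier \<theta>"
    using assms(1) smooth_divide_power[OF multiplier_smooth assms(2,3)]
    unfolding multiplier_def \<theta>_def by fastforce
  define G where "G = fourier (\<lambda>x. complex_of_real (\<theta> x))"
  have G: "G \<in> schwartz" unfolding G_def by (intro fourier_schwartz multiplier_schwartz \<theta>)
  have "dderiv 1 G = fourier (\<lambda>x. - \<i> * (of_real x * of_real (\<theta> x)))"
    unfolding G_def by (rule dderiv_1_eq) (rule fourier_has_vector_derivative[OF multiplier_schwartz[OF \<theta>]])
  also have "(\<lambda>x. - \<i> * (of_real x * of_real (\<theta> x))) = (\<lambda>x. - \<i> * complex_of_real (m x))"
    using assms(2) assms(3)[of 0] by (auto simp: \<theta>_def fun_eq_iff)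
  finally have D: "dderiv 1 G = (\<lambda>z. - \<i> * (2 * pi) * multiplier_kernel m z)"
    by (simp only: fun_eq_iff fourier_cmult multiplier_kernel_def) simp
  have "(LINT z|lborel. dderiv 1 G z) = 0 - 0"
    by (rule integral_FTC_UNIV_finite_exceptions[where S="{}" and F=G])
      (auto intro!: smooth_deriv smooth_continuous schwartz_smooth schwartz_integrable schwartz_dderiv schwartz_tendsto_0 G)
  then show ?thesis by (simp add: D)
qed

text \<open>Positive and negative part of a multiplier with vanishing kernel would be densities with the
  same characteristic function.\<close>

lemma multiplier_kernel_nonzero:
  assumes m: "multiplier m" and "m \<xi>\<^sub>0 \<noteq> 0"
  shows "\<exists>z. multiplier_kernel m z \<noteq> 0"
proof (rule ccontr)
  assume "\<not> ?thesis"
  then have k: "fourier (\<lambda>\<xi>. of_real (m \<xi>)) z = 0" for z by (auto simp: multiplier_kernel_def)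
  have meas[measurable]: "m \<in> borel_measurable borel" by (intro smooth_measurable multiplier_smooth m)
  have cont: "continuous_on UNIV m" by (intro smooth_continuous multiplier_smooth m)
  have int: "integrable lborel m"
    using schwartz_integrable[OF multiplier_schwartz[OF m]] by (simp add: complex_of_real_integrable_eq)
  define P N where "P = (\<lambda>x. max (m x) 0)" and "N = (\<lambda>x. max (- m x) 0)"
  have [measurable]: "P \<in> borel_measurable borel" "N \<in> borel_measurable borel"
    unfolding P_def N_def by measurable
  have PN: "0 \<le> P x" "0 \<le> N x" "m x = P x - N x" "P x \<le> \<bar>m x\<bar>" "N x \<le> \<bar>m x\<bar>" for x by (auto simp: P_def N_def)
  have intPN: "integrable lborel P" "integrable lborel N"
    by (rule integrable_bounded_by[OF integrable_norm[OF int]]; use PN in auto)+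
  have fPN: "(LINT x|lborel. cis (t * x) * of_real (P x)) = (LINT x|lborel. cis (t * x) * of_real (N x))" for t
  proof -
    have i: "integrable lborel (\<lambda>x. cis (t * x) * complex_of_real (P x))" "integrable lborel (\<lambda>x. cis (t * x) * complex_of_real (N x))"
      by (auto intro!: integrable_cis_mult intPN)
    have "0 = (LINT x|lborel. cis (t * x) * of_real (P x) - cis (t * x) * of_real (N x))"
      using k[of "- t"] by (simp add: fourier_def PN(3) mult.commute algebra_simps)
    then show ?thesis using i by simp
  qed
  from fPN[of 0] have "complex_of_real (LINT x|lborel. P x) = of_real (LINT x|lborel. N x)"
    by (simp del: of_real_eq_iff)
  then have same: "(LINT x|lborel. P x) = (LINT x|lborel. N x)" by (simp only: of_real_eq_iff)
  define c where "c = (LINT x|lborel. P x)"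
  have "0 < (LINT x|lborel. \<bar>m x\<bar>)"
    by (rule integral_continuous_pos[of _ \<xi>\<^sub>0]) (use int cont assms in \<open>auto intro!: continuous_intros\<close>)
  also have "(LINT x|lborel. \<bar>m x\<bar>) = (LINT x|lborel. P x + N x)"
    by (rule Bochner_Integration.integral_cong) (auto simp: P_def N_def)
  also have "\<dots> = 2 * c" using intPN same by (simp add: c_def)
  finally have c: "c > 0" by simp
  define M where "M = (\<lambda>f::real \<Rightarrow> real. density lborel (\<lambda>x. ennreal (f x / c)))"
  have rd: "real_distribution (M f)" if [measurable]: "f \<in> borel_measurable borel" and f: "\<And>x. 0 \<le> f x" "integrable lborel f" "(LINT x|lborel. f x) = c" for f :: "real \<Rightarrow> real"
  proof -
    have "emeasure (M f) (space (M f)) = ennreal (LINT x|lborel. f x / c)"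
      unfolding M_def using f c by (simp add: emeasure_density nn_integral_eq_integral)
    then have "prob_space (M f)" using f c by (intro prob_spaceI) simp
    then show ?thesis by (auto simp: real_distribution_def real_distribution_axioms_def M_def)
  qed
  have "char (M P) = char (M N)"
  proof
    fix t
    have "char (M f) t = (1 / c) * (LINT x|lborel. iexp (t * x) * of_real (f x))" if [measurable]: "f \<in> borel_measurable borel" and f: "\<And>x. 0 \<le> f x" for f
      unfolding char_def M_def using f c
      by (subst integral_density) (auto simp: scaleR_conv_of_real mult_ac)
    from this[of P] this[of N] show "char (M P) t = char (M N) t"
      using PN fPN[of t] by (simp add: cis_conv_exp)
  qed
  then have "M P = M N"
    by (intro Levy_uniqueness rd) (use PN intPN same c_def in auto)
  \<comment> \<open>Where m is positive, the first law has all its mass and the second has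
    none.\<close>
  then have "emeasure (M P) {x. m x > 0} = emeasure (M N) {x. m x > 0}" by simp
  moreover have "emeasure (M P) {x. m x > 0} = (\<integral>\<^sup>+x. ennreal (P x / c) \<partial>lborel)"
    unfolding M_def by (subst emeasure_density) (auto intro!: nn_integral_cong simp: P_def indicator_def)
  moreover have "(\<integral>\<^sup>+x. ennreal (P x / c) \<partial>lborel) = ennreal (LINT x|lborel. P x / c)"
    using intPN PN c by (intro nn_integral_eq_integral) auto
  moreover have "emeasure (M N) {x. m x > 0} = (\<integral>\<^sup>+x. 0 \<partial>(lborel::real measure))"
  proof -
    have "ennreal (N x / c) * indicator {x. m x > 0} x = 0" for x
      by (cases "m x > 0") (simp_all add: N_def)
    moreover have "emeasure (M N) {x. m x > 0} = (\<integral>\<^sup>+x. ennreal (N x / c) * indicator {x. m x > 0} x \<partial>lborel)"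
      unfolding M_def by (rule emeasure_density) auto
    ultimately show ?thesis by (simp only:)
  qed
  ultimately show False using c by (simp add: c_def[symmetric])
qed

section \<open>Lebesgue norms\<close>

text \<open>Young's inequality for the functions divided by their norms. A vanishing norm is treated
  apart: then the product vanishes almost everywhere.\<close>

lemma Holder_integral:
  fixes f g :: "'a \<Rightarrow> real"
  assumes pq: "p > 1" "q > 1" "1 / p + 1 / q = 1"
    and [measurable]: "f \<in> borel_measurable M" "g \<in> borel_measurable M"
    and pos: "\<And>x. 0 \<le> f x" "\<And>x. 0 \<le> g x"
    and f: "integrable M (\<lambda>x. f x powr p)" and g: "integrable M (\<lambda>x. g x powr q)"
  shows "integrable M (\<lambda>x. f x * g x)"
    and "(LINT x|M. f x * g x) \<le> (LINT x|M. f x powr p) powr (1 / p) * (LINT x|M. g x powr q) powr (1 / q)"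
proof -
  let ?F = "LINT x|M. f x powr p" and ?G = "LINT x|M. g x powr q"
  show int: "integrable M (\<lambda>x. f x * g x)"
  proof (rule integrable_bounded_by)
    show "integrable M (\<lambda>x. f x powr p / p + g x powr q / q)" using f g by auto
    show "norm (f x * g x) \<le> f x powr p / p + g x powr q / q" for x
      using Youngs_inequality[OF pq pos(1)[of x] pos(2)[of x]] pos[of x] by simp
  qed measurable
  have nn: "0 \<le> ?F" "0 \<le> ?G" by (auto intro!: integral_nonneg)
  consider "?F = 0" | "?G = 0" | "?F > 0" "?G > 0" using nn by linarith
  then show "(LINT x|M. f x * g x) \<le> ?F powr (1 / p) * ?G powr (1 / q)"
  proof cases
    case 1
    then have "AE x in M. f x powr p = 0" using f by (subst (asm) integral_nonneg_eq_0_iff_AE) auto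
    then have "AE x in M. f x * g x = 0" by eventually_elim auto
    then have "(LINT x|M. f x * g x) = 0" by (rule integral_eq_zero_AE)
    then show ?thesis by simp
  next
    case 2
    then have "AE x in M. g x powr q = 0" using g by (subst (asm) integral_nonneg_eq_0_iff_AE) auto
    then have "AE x in M. f x * g x = 0" by eventually_elim auto
    then have "(LINT x|M. f x * g x) = 0" by (rule integral_eq_zero_AE)
    then show ?thesis by simp
  next
    case 3
    let ?a = "?F powr (1 / p)" and ?b = "?G powr (1 / q)"
    have ab: "?a > 0" "?b > 0" "?a powr p = ?F" "?b powr q = ?G"
      using 3 pq by (auto simp: powr_powr)
    have "(LINT x|M. f x * g x) / (?a * ?b) = (LINT x|M. f x / ?a * (g x / ?b))"
      by (simp add: field_simps)
    also have "\<dots> \<le> (LINT x|M. f x powr p / ?F / p + g x powr q / ?G / q)"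
    proof (rule integral_mono)
      show "integrable M (\<lambda>x. f x / ?a * (g x / ?b))" using int by (auto simp: field_simps)
      show "f x / ?a * (g x / ?b) \<le> f x powr p / ?F / p + g x powr q / ?G / q" for x
        using Youngs_inequality[OF pq, of "f x / ?a" "g x / ?b"] pos[of x] ab
        by (simp add: powr_divide)
    qed (use f g in auto)
    also have "\<dots> = ?F / ?F / p + ?G / ?G / q" using f g by simp
    also have "\<dots> = 1" using 3 pq by simp
    finally show ?thesis using ab by (simp add: pos_divide_le_eq)
  qed
qed

lemma epow_ennreal: "0 \<le> a \<Longrightarrow> epow (ennreal a) q = ennreal (a powr q)"
  by (simp add: epow_def)

lemma epow_mono: "x \<le> y \<Longrightarrow> 0 \<le> q \<Longrightarrow> epow x q \<le> epow y q"
  by (cases x; cases y) (auto simp: epow_def top_unique intro!: powr_mono2 ennreal_leI)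

lemma epow_epow_inverse: "q > 0 \<Longrightarrow> epow (epow x q) (1 / q) = x"
  by (cases x) (auto simp: epow_def powr_powr)

lemma Lnorm_finite_exponent:
  "q \<ge> 0 \<Longrightarrow> Lnorm M (ennreal q) f = epow (\<integral>\<^sup>+ x. epow (f x) q \<partial>M) (1 / q)"
  by (simp add: Lnorm_def)

lemma Lnorm_leI:
  assumes "q > 0" "B \<ge> 0" "(\<integral>\<^sup>+ x. epow (f x) q \<partial>M) \<le> ennreal (B powr q)"
  shows "Lnorm M (ennreal q) f \<le> ennreal B"
proof -
  have "Lnorm M (ennreal q) f \<le> epow (ennreal (B powr q)) (1 / q)"
    using assms by (simp add: Lnorm_finite_exponent epow_mono)
  also have "\<dots> = ennreal B"
    using epow_epow_inverse[OF assms(1), of "ennreal B"] assms(2) by (simp add: epow_ennreal)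
  finally show ?thesis .
qed

lemma Lnorm_count_space_ge:
  assumes "r \<ge> 1" "j \<in> A"
  shows "f j \<le> Lnorm (count_space A) r f"
proof (cases "r = \<infinity>")
  case True
  have "AE x in count_space A. f x \<le> esssup (count_space A) f" by (rule esssup_AE)
  then show ?thesis using True assms(2) by (simp add: Lnorm_def AE_count_space)
next
  case False
  define q where "q = enn2real r"
  have q: "r = ennreal q" "q \<ge> 1"
    using False assms(1) by (cases r; auto simp: q_def)+
  have "epow (f j) q = (\<integral>\<^sup>+ x. epow (f j) q * indicator {j} x \<partial>count_space A)"
    using assms(2) by (subst nn_integral_cmult_indicator) (auto simp: emeasure_count_space)
  also have "\<dots> \<le> (\<integral>\<^sup>+ x. epow (f x) q \<partial>count_space A)"
    by (intro nn_integral_mono) (auto simp: indicator_def)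
  finally have "epow (epow (f j) q) (1 / q) \<le> epow (\<integral>\<^sup>+ x. epow (f x) q \<partial>count_space A) (1 / q)"
    using q by (intro epow_mono) auto
  then show ?thesis using q epow_epow_inverse[of q "f j"] by (simp add: Lnorm_finite_exponent)
qed

text \<open>Room \<kappa> in the exponent makes the sequence summable to any power, so a single
  dyadic decay estimate serves every r; the constant contains a factor for the starting index
  -1.\<close>

lemma Lnorm_geometric:
  assumes r: "r \<ge> 1" and \<kappa>: "\<kappa> > 0"
  shows "\<exists>C>0. \<forall>f B. B \<ge> 0 \<longrightarrow> (\<forall>j\<ge>-1. f j \<le> ennreal (B * 2 powr (- \<kappa> * of_int j))) \<longrightarrow>
    Lnorm (count_space {-1::int..}) r f \<le> ennreal (C * B)"
proof (cases "r = \<infinity>")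
  case True
  show ?thesis
  proof (intro exI[of _ "2 powr \<kappa>"] conjI allI impI)
    fix f :: "int \<Rightarrow> ennreal" and B :: real assume B: "0 \<le> B" and f: "\<forall>j\<ge>-1. f j \<le> ennreal (B * 2 powr (- \<kappa> * of_int j))"
    have "f j \<le> ennreal (2 powr \<kappa> * B)" if "j \<ge> -1" for j
    proof -
      have "real_of_int (-1) \<le> of_int j" using that by (simp only: of_int_le_iff)
      then have "- \<kappa> * of_int j \<le> \<kappa>" using \<kappa> mult_left_mono[of "-1" "of_int j" \<kappa>] by simp
      then have "B * 2 powr (- \<kappa> * of_int j) \<le> 2 powr \<kappa> * B"
        using B by (subst mult.commute) (intro mult_right_mono; simp)
      then show ?thesis using f that ennreal_leI order_trans by blast
    qed
    then show "Lnorm (count_space {-1..}) r f \<le> ennreal (2 powr \<kappa> * B)"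
      unfolding True Lnorm_def by (auto intro!: esssup_I simp: AE_count_space)
  qed simp
next
  case False
  define q where "q = enn2real r"
  have q: "r = ennreal q" "q \<ge> 1"
    using False assms(1) by (cases r; auto simp: q_def)+
  define \<rho> where "\<rho> = 2 powr (- \<kappa> * q)"
  have \<rho>: "0 < \<rho>" "\<rho> < 1" using q \<kappa> by (auto simp: \<rho>_def intro!: powr_less_one)
  define S where "S = 2 powr (\<kappa> * q) / (1 - \<rho>)"
  have S: "S > 0" using \<rho> by (simp add: S_def)
  show ?thesis
  proof (intro exI[of _ "S powr (1 / q)"] conjI allI impI)
    fix f :: "int \<Rightarrow> ennreal" and B :: real assume B: "0 \<le> B" and f: "\<forall>j\<ge>-1. f j \<le> ennreal (B * 2 powr (- \<kappa> * of_int j))"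
    have bij: "bij_betw (\<lambda>n. int n - 1) UNIV {-1::int..}"
      by (rule bij_betwI[where g = "\<lambda>j. nat (j + 1)"]) auto
    have "(\<integral>\<^sup>+ j. epow (f j) q \<partial>count_space {-1::int..}) = (\<integral>\<^sup>+ n. epow (f (int n - 1)) q \<partial>count_space UNIV)"
      by (rule nn_integral_bij_count_space[OF bij, symmetric])
    also have "\<dots> \<le> (\<integral>\<^sup>+ n. ennreal (B powr q * 2 powr (\<kappa> * q) * \<rho> ^ n) \<partial>count_space UNIV)"
    proof (rule nn_integral_mono)
      fix n :: nat
      have "epow (f (int n - 1)) q \<le> epow (ennreal (B * 2 powr (- \<kappa> * of_int (int n - 1)))) q"
        using f[rule_format, of "int n - 1"] q by (intro epow_mono) auto
      also have "\<dots> = ennreal ((B * 2 powr (- \<kappa> * of_int (int n - 1))) powr q)" using B by (simp add: epow_ennreal)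
      also have "(B * 2 powr (- \<kappa> * of_int (int n - 1))) powr q = B powr q * 2 powr (\<kappa> * q) * \<rho> ^ n"
        using B by (simp add: powr_mult powr_powr \<rho>_def powr_realpow[symmetric] powr_add[symmetric] algebra_simps)
      finally show "epow (f (int n - 1)) q \<le> ennreal (B powr q * 2 powr (\<kappa> * q) * \<rho> ^ n)" .
    qed
    also have "\<dots> = (\<Sum>n. ennreal (B powr q * 2 powr (\<kappa> * q) * \<rho> ^ n))" by (rule nn_integral_count_space_nat)
    also have "\<dots> = ennreal (B powr q * 2 powr (\<kappa> * q) * (1 / (1 - \<rho>)))"
      using \<rho> B by (intro suminf_ennreal_eq sums_mult geometric_sums) auto
    also have "\<dots> = ennreal ((S powr (1 / q) * B) powr q)"
      using q S B by (simp add: powr_mult powr_powr) (simp add: S_def mult_ac)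
    finally show "Lnorm (count_space {-1..}) r f \<le> ennreal (S powr (1 / q) * B)"
      unfolding q(1) using q(2) B S by (intro Lnorm_leI) auto
  qed (use S in simp)
qed

text \<open>Young's convolution inequality in a form where the L^p norm in y may depend on the shift
  z. Splitting |k| = |k|^(1/p) |k|^(1/q) in the Hoelder inequality keeps |w|^p under the measure |k|
  dz and leaves the total mass to the power p - 1; Fubini then exposes the norm in y.\<close>

lemma convolution_Lp_bound:
  fixes k :: "real \<Rightarrow> complex" and w :: "real \<Rightarrow> real \<Rightarrow> real"
  assumes p: "p > 1" and k: "integrable lborel k"
    and [measurable]: "case_prod w \<in> borel_measurable (borel \<Otimes>\<^sub>M borel)"
    and B: "\<And>y z. \<bar>w y z\<bar> \<le> B"
    and c: "\<And>z. (\<integral>\<^sup>+ y. ennreal (\<bar>w y z\<bar> powr p) \<partial>lborel) \<le> ennreal (c z)"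
    and c0: "\<And>z. 0 \<le> c z" and kc: "integrable lborel (\<lambda>z. cmod (k z) * c z)"
  shows "(\<integral>\<^sup>+ y. ennreal (cmod (LINT z|lborel. k z * of_real (w y z)) powr p) \<partial>lborel)
    \<le> ennreal ((LINT z|lborel. cmod (k z)) powr (p - 1) * (LINT z|lborel. cmod (k z) * c z))"
proof -
  define q where "q = p / (p - 1)"
  have q: "q > 1" "1 / p + 1 / q = 1" using p by (auto simp: q_def field_simps)
  have [measurable]: "k \<in> borel_measurable borel" using k by auto
  let ?K = "LINT z|lborel. cmod (k z)"
  have B0: "0 \<le> B" using B[of 0 0] by linarith
  have ikw: "integrable lborel (\<lambda>z. cmod (k z) * \<bar>w y z\<bar> powr p)" for y
  proof (rule integrable_bounded_by)
    show "integrable lborel (\<lambda>z. cmod (k z) * B powr p)" using k by auto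
    show "norm (cmod (k z) * \<bar>w y z\<bar> powr p) \<le> cmod (k z) * B powr p" for z
      using B p by (auto intro!: mult_left_mono powr_mono2)
  qed measurable
  have pt: "cmod (LINT z|lborel. k z * of_real (w y z)) powr p \<le> ?K powr (p - 1) * (LINT z|lborel. cmod (k z) * \<bar>w y z\<bar> powr p)" for y
  proof -
    let ?W = "LINT z|lborel. cmod (k z) * \<bar>w y z\<bar> powr p"
    let ?f = "\<lambda>z. cmod (k z) powr (1 / p) * \<bar>w y z\<bar>" and ?g = "\<lambda>z. cmod (k z) powr (1 / q)"
    have f: "?f z powr p = cmod (k z) * \<bar>w y z\<bar> powr p" for z using p by (simp add: powr_mult powr_powr)
    have g: "?g z powr q = cmod (k z)" for z using q by (simp add: powr_powr)
    have fg: "?f z * ?g z = cmod (k z * of_real (w y z))" for z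
      using q(2) by (cases "k z = 0") (simp_all add: norm_mult powr_add[symmetric])
    have "?f z * ?g z = cmod (k z) powr (1 / p) * cmod (k z) powr (1 / q) * \<bar>w y z\<bar>" for z by simp
    have "(LINT z|lborel. ?f z * ?g z) \<le> ?W powr (1 / p) * ?K powr (1 / q)"
      using Holder_integral(2)[OF p q, of ?f lborel ?g] ikw k unfolding f g by simp
    then have "(LINT z|lborel. cmod (k z * of_real (w y z))) \<le> ?W powr (1 / p) * ?K powr (1 / q)"
      unfolding fg .
    then have "cmod (LINT z|lborel. k z * of_real (w y z)) \<le> ?W powr (1 / p) * ?K powr (1 / q)"
      using integral_norm_bound[of lborel "\<lambda>z. k z * of_real (w y z)"] by linarith
    then have "cmod (LINT z|lborel. k z * of_real (w y z)) powr p \<le> (?W powr (1 / p) * ?K powr (1 / q)) powr p"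
      using p by (intro powr_mono2) auto
    also have "\<dots> = ?W * ?K powr (p / q)"
    proof -
      have "0 \<le> ?W" "0 \<le> ?K" by (auto intro!: integral_nonneg)
      then show ?thesis using p by (simp add: powr_mult powr_powr)
    qed
    also have "p / q = p - 1" using p by (simp add: q_def)
    finally show ?thesis by (simp add: mult.commute)
  qed
  have "(\<integral>\<^sup>+ y. ennreal (cmod (LINT z|lborel. k z * of_real (w y z)) powr p) \<partial>lborel)
    \<le> (\<integral>\<^sup>+ y. ennreal (?K powr (p - 1)) * (\<integral>\<^sup>+ z. ennreal (cmod (k z) * \<bar>w y z\<bar> powr p) \<partial>lborel) \<partial>lborel)"
  proof (rule nn_integral_mono)
    fix y
    have "(\<integral>\<^sup>+ z. ennreal (cmod (k z) * \<bar>w y z\<bar> powr p) \<partial>lborel) = ennreal (LINT z|lborel. cmod (k z) * \<bar>w y z\<bar> powr p)"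
      by (rule nn_integral_eq_integral[OF ikw]) auto
    then show "ennreal (cmod (LINT z|lborel. k z * of_real (w y z)) powr p)
      \<le> ennreal (?K powr (p - 1)) * (\<integral>\<^sup>+ z. ennreal (cmod (k z) * \<bar>w y z\<bar> powr p) \<partial>lborel)"
      using pt[of y] by (simp add: ennreal_mult[symmetric] ennreal_leI integral_nonneg)
  qed
  also have "\<dots> = ennreal (?K powr (p - 1)) * (\<integral>\<^sup>+ y. \<integral>\<^sup>+ z. ennreal (cmod (k z) * \<bar>w y z\<bar> powr p) \<partial>lborel \<partial>lborel)"
    by (rule nn_integral_cmult) measurable
  also have "(\<integral>\<^sup>+ y. \<integral>\<^sup>+ z. ennreal (cmod (k z) * \<bar>w y z\<bar> powr p) \<partial>lborel \<partial>lborel) =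
      (\<integral>\<^sup>+ z. \<integral>\<^sup>+ y. ennreal (cmod (k z) * \<bar>w y z\<bar> powr p) \<partial>lborel \<partial>lborel)"
    by (rule lborel_pair.Fubini'[symmetric]) measurable
  also have "\<dots> \<le> (\<integral>\<^sup>+ z. ennreal (cmod (k z) * c z) \<partial>lborel)"
  proof (rule nn_integral_mono)
    fix z
    have "(\<integral>\<^sup>+ y. ennreal (cmod (k z) * \<bar>w y z\<bar> powr p) \<partial>lborel) = ennreal (cmod (k z)) * (\<integral>\<^sup>+ y. ennreal (\<bar>w y z\<bar> powr p) \<partial>lborel)"
      by (simp add: ennreal_mult nn_integral_cmult)
    also have "\<dots> \<le> ennreal (cmod (k z)) * ennreal (c z)" by (intro mult_left_mono c) simp
    finally show "(\<integral>\<^sup>+ y. ennreal (cmod (k z) * \<bar>w y z\<bar> powr p) \<partial>lborel) \<le> ennreal (cmod (k z) * c z)"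
      by (simp add: ennreal_mult c0)
  qed
  also have "\<dots> = ennreal (LINT z|lborel. cmod (k z) * c z)"
    by (rule nn_integral_eq_integral[OF kc]) (use c0 in auto)
  finally show ?thesis
    by (simp add: ennreal_mult integral_nonneg c0 mult_left_mono)
qed

text \<open>Over a window [-n, n] the integral is a difference of two integrals of \<Theta> over
  windows shifted by a, hence at most the part of length a that sticks out on the right. Monotone
  convergence removes the window.\<close>

lemma nn_integral_mono_increment:
  fixes \<Theta> :: "real \<Rightarrow> real"
  assumes mono: "mono \<Theta>" and \<Theta>: "\<And>x. 0 \<le> \<Theta> x" "\<And>x. \<Theta> x \<le> M" and a: "0 \<le> a"
  shows "(\<integral>\<^sup>+ x. ennreal (\<Theta> (x + a) - \<Theta> x) \<partial>lborel) \<le> ennreal (a * M)"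
proof -
  have [measurable]: "\<Theta> \<in> borel_measurable borel" by (rule borel_measurable_mono[OF mono])
  have inc: "\<Theta> x \<le> \<Theta> (x + a)" for x using mono a by (auto simp: mono_def)
  have M0: "0 \<le> M" using \<Theta>[of 0] by linarith
  define F where "F = (\<lambda>(n::nat) x. ennreal (\<Theta> (x + a) - \<Theta> x) * indicator {- real n..real n} x)"
  have ind_int: "integrable lborel (\<lambda>x. indicator {l..u} x * \<Theta> x)" for l u
  proof (rule integrable_bounded_by)
    show "integrable lborel (\<lambda>x::real. indicator {l..u} x * M)"
      by (intro integrable_mult_left integrable_real_indicator) (auto simp: emeasure_lborel_Icc_eq)
  qed (use \<Theta> M0 in \<open>auto simp: indicator_def\<close>)
  have ind_int': "integrable lborel (\<lambda>x. indicator {l..u} x * \<Theta> (x + a))" for l u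
    using lborel_integrable_real_affine[OF ind_int[of "l + a" "u + a"], of 1 a]
    by (simp add: add.commute indicator_def)
  have "integral\<^sup>N lborel (F n) \<le> ennreal (a * M)" for n
  proof -
    have "integral\<^sup>N lborel (F n) = (\<integral>\<^sup>+ x. ennreal (indicator {- real n..real n} x * \<Theta> (x + a) - indicator {- real n..real n} x * \<Theta> x) \<partial>lborel)"
      by (intro nn_integral_cong) (auto simp: F_def indicator_def)
    also have "\<dots> = ennreal (LINT x|lborel. indicator {- real n..real n} x * \<Theta> (x + a) - indicator {- real n..real n} x * \<Theta> x)"
      by (intro nn_integral_eq_integral Bochner_Integration.integrable_diff ind_int ind_int')
        (use inc in \<open>auto simp: indicator_def\<close>)
    also have "(LINT x|lborel. indicator {- real n..real n} x * \<Theta> (x + a) - indicator {- real n..real n} x * \<Theta> x)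
      = (LINT x|lborel. indicator {- real n..real n} x * \<Theta> (x + a)) - (LINT x|lborel. indicator {- real n..real n} x * \<Theta> x)"
      by (intro Bochner_Integration.integral_diff ind_int ind_int')
    also have "(LINT x|lborel. indicator {- real n..real n} x * \<Theta> (x + a)) = (LINT x|lborel. indicator {- real n + a..real n + a} x * \<Theta> x)"
      by (subst lborel_integral_real_affine[of 1 "\<lambda>x. indicator {- real n + a..real n + a} x * \<Theta> x" a])
        (auto intro!: Bochner_Integration.integral_cong simp: add.commute indicator_def)
    also have "(LINT x|lborel. indicator {- real n + a..real n + a} x * \<Theta> x) - (LINT x|lborel. indicator {- real n..real n} x * \<Theta> x)
       = (LINT x|lborel. indicator {- real n + a..real n + a} x * \<Theta> x - indicator {- real n..real n} x * \<Theta> x)"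
      by (intro Bochner_Integration.integral_diff[symmetric] ind_int)
    \<comment> \<open>On the overlap the two windows cancel; what remains on the left has a negative
      sign and is dropped.\<close>
    also have "\<dots> \<le> (LINT x|lborel. indicator {real n..real n + a} x * M)"
    proof (rule integral_mono)
      show "integrable lborel (\<lambda>x. indicator {real n..real n + a} x * M)"
        by (intro integrable_mult_left integrable_real_indicator) (auto simp: emeasure_lborel_Icc_eq)
      show "indicator {- real n + a..real n + a} x * \<Theta> x - indicator {- real n..real n} x * \<Theta> x \<le> indicator {real n..real n + a} x * M" for x
        using \<Theta>[of x] M0 a by (auto simp: indicator_def)
    qed (intro Bochner_Integration.integrable_diff ind_int)
    also have "\<dots> = a * M" using a by simp
    finally show ?thesis by (simp add: ennreal_leI)
  qed
  moreover have "(\<integral>\<^sup>+ x. ennreal (\<Theta> (x + a) - \<Theta> x) \<partial>lborel) = (\<integral>\<^sup>+ x. (SUP n. F n x) \<partial>lborel)"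
  proof (rule nn_integral_cong)
    fix x :: real
    show "ennreal (\<Theta> (x + a) - \<Theta> x) = (SUP n. F n x)"
    proof (rule antisym)
      have "x \<in> {- real (nat \<lceil>\<bar>x\<bar>\<rceil>)..real (nat \<lceil>\<bar>x\<bar>\<rceil>)}" by (auto; linarith)
      then have "ennreal (\<Theta> (x + a) - \<Theta> x) = F (nat \<lceil>\<bar>x\<bar>\<rceil>) x" by (simp add: F_def)
      then show "ennreal (\<Theta> (x + a) - \<Theta> x) \<le> (SUP n. F n x)" by (metis SUP_upper UNIV_I)
    qed (auto intro!: SUP_least simp: F_def indicator_def)
  qed
  moreover have "(\<integral>\<^sup>+ x. (SUP n. F n x) \<partial>lborel) = (SUP n. integral\<^sup>N lborel (F n))"
    by (rule nn_integral_monotone_convergence_SUP)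
      (auto simp: F_def incseq_def le_fun_def indicator_def)
  ultimately show ?thesis by (auto intro!: SUP_least)
qed

section \<open>Littlewood-Paley blocks of functions\<close>

definition distr_of :: "(real \<Rightarrow> real) \<Rightarrow> functional" where
  "distr_of u = (\<lambda>\<psi>. if \<psi> \<in> schwartz then LINT x|lborel. complex_of_real (u x) * \<psi> x else 0)"

lemma integrable_bounded_mult:
  fixes f :: "real \<Rightarrow> complex" and g :: "real \<Rightarrow> complex"
  assumes "integrable lborel g" "f \<in> borel_measurable borel" "\<And>x. cmod (f x) \<le> B"
  shows "integrable lborel (\<lambda>x. f x * g x)"
proof (rule integrable_bounded_by)
  show "integrable lborel (\<lambda>x. B * cmod (g x))" using assms(1) by auto
  show "norm (f x * g x) \<le> B * cmod (g x)" for x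
    using assms(3) by (simp add: norm_mult mult_right_mono)
qed (use assms in measurable)

lemma integrable_bounded_schwartz:
  assumes "u \<in> borel_measurable borel" "\<And>x. \<bar>u x\<bar> \<le> B" "\<psi> \<in> schwartz"
  shows "integrable lborel (\<lambda>x. complex_of_real (u x) * \<psi> x)"
  by (rule integrable_bounded_mult[OF schwartz_integrable[OF assms(3)], where B = B]) (use assms in auto)

lemma represents_distr_of:
  assumes "u \<in> borel_measurable borel" "\<And>x. \<bar>u x\<bar> \<le> B"
  shows "represents (\<lambda>x. complex_of_real (u x)) (distr_of u)"
  unfolding represents_def distr_of_def
  using assms integrable_bounded_schwartz[OF assms] by auto

lemma distr_of_diff:
  assumes [measurable]: "u \<in> borel_measurable borel" "v \<in> borel_measurable borel"
    and "\<And>x. \<bar>u x\<bar> \<le> B" "\<And>x. \<bar>v x\<bar> \<le> B"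
  shows "distr_of u - distr_of v = distr_of (\<lambda>x. u x - v x)"
proof
  fix \<psi>
  show "(distr_of u - distr_of v) \<psi> = distr_of (\<lambda>x. u x - v x) \<psi>"
  proof (cases "\<psi> \<in> schwartz")
    case True
    have "integrable lborel (\<lambda>x. complex_of_real (u x) * \<psi> x)" "integrable lborel (\<lambda>x. complex_of_real (v x) * \<psi> x)"
      by (rule integrable_bounded_schwartz[where B = B]; use assms True in simp)+
    then show ?thesis using True by (simp add: distr_of_def left_diff_distrib)
  qed (simp add: distr_of_def)
qed

lemma schwartz_weight_le_seminorm:
  assumes "\<psi> \<in> schwartz" shows "schwartz_weight k n \<psi> x \<le> schwartz_seminorm k n \<psi>"
  using assms unfolding schwartz_seminorm_def schwartz_def by (auto intro!: cSUP_upper)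

lemma tempered_distr_of:
  assumes u: "u \<in> borel_measurable borel" "\<And>x. \<bar>u x\<bar> \<le> B"
  shows "distr_of u \<in> tempered"
proof -
  have int: "integrable lborel (\<lambda>x. complex_of_real (u x) * \<psi> x)" if "\<psi> \<in> schwartz" for \<psi>
    by (rule integrable_bounded_schwartz[OF u that])
  have B0: "0 \<le> B" using u(2)[of 0] by linarith
  define I where "I = (LINT x|lborel. 1 / (1 + x\<^sup>2 :: real))"
  have I0: "I \<ge> 0" unfolding I_def by (rule Bochner_Integration.integral_nonneg) (simp add: add_nonneg_nonneg)
  have "cmod (distr_of u \<psi>) \<le> B * I * (\<Sum>k\<le>2. \<Sum>n\<le>2. schwartz_seminorm k n \<psi>)" if \<psi>: "\<psi> \<in> schwartz" for \<psi>
  proof -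
    have nn: "0 \<le> schwartz_seminorm k n \<psi>" for k n
      using schwartz_weight_le_seminorm[OF \<psi>, of k n 0]
      by (rule order_trans[rotated]) (simp add: schwartz_weight_def)
    let ?S = "schwartz_seminorm 0 0 \<psi> + schwartz_seminorm 2 0 \<psi>"
    have pt: "cmod (\<psi> x) \<le> ?S * (1 / (1 + x\<^sup>2))" for x
    proof -
      have "cmod (\<psi> x) * (1 + x\<^sup>2) \<le> ?S"
        using schwartz_weight_le_seminorm[OF \<psi>, of 0 0 x] schwartz_weight_le_seminorm[OF \<psi>, of 2 0 x]
        by (simp add: schwartz_weight_def algebra_simps)
      then show ?thesis by (simp add: pos_le_divide_eq add_pos_nonneg)
    qed
    have "cmod (distr_of u \<psi>) \<le> (LINT x|lborel. B * ?S * (1 / (1 + x\<^sup>2)))"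
      unfolding distr_of_def using \<psi>
    proof (simp only: if_True, intro integral_norm_le)
      show "integrable lborel (\<lambda>x. B * ?S * (1 / (1 + x\<^sup>2)))"
        by (intro integrable_mult_right integrable_inverse_quadratic)
      show "cmod (complex_of_real (u x) * \<psi> x) \<le> B * ?S * (1 / (1 + x\<^sup>2))" for x
        using mult_mono[OF u(2)[of x] pt[of x] B0] by (simp add: norm_mult)
    qed
    also have "\<dots> = B * I * ?S" unfolding I_def by (subst integral_mult_right_zero) simp
    also have "?S \<le> (\<Sum>k\<le>2. \<Sum>n\<le>2. schwartz_seminorm k n \<psi>)"
      using nn by (simp add: numeral_2_eq_2 add_nonneg_nonneg)
    finally show ?thesis using B0 I0 by (simp add: mult_left_mono)
  qed
  then show ?thesis
    unfolding tempered_def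
    using int schwartz_add schwartz_cmult
    by (auto simp: distr_of_def distrib_left mult.left_commute)
qed

definition block_multiplier :: "(real \<Rightarrow> real) \<Rightarrow> (real \<Rightarrow> real) \<Rightarrow> int \<Rightarrow> real \<Rightarrow> real" where
  "block_multiplier chi phi j = (if j = -1 then chi else (\<lambda>\<xi>. phi (2 powi (- j) * \<xi>)))"

lemma lp_block_distr_of:
  assumes m: "multiplier (block_multiplier chi phi j)" and \<psi>: "\<psi> \<in> schwartz"
  shows "lp_block chi phi j (distr_of u) \<psi> =
    (LINT x|lborel. complex_of_real (u x) * fourier (\<lambda>\<xi>. of_real (block_multiplier chi phi j \<xi>) * inv_fourier \<psi> \<xi>) x)"
proof -
  note S = inv_fourier_schwartz[OF \<psi>]
  show ?thesis
    unfolding lp_block_def block_multiplier_def[symmetric]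
    using \<psi> S multiplier_mult_schwartz[OF m S] fourier_schwartz[OF multiplier_mult_schwartz[OF m S]]
    by (simp add: inv_fourier_td_def mult_td_def fourier_td_def distr_of_def)
qed

text \<open>Duality moves the block onto the test function, where it is a convolution, and Fubini
  moves it back to u. The kernel is evaluated at z against u(y + z) because transposition reflects
  it.\<close>

lemma represents_lp_block:
  assumes m: "multiplier (block_multiplier chi phi j)"
    and u[measurable]: "u \<in> borel_measurable borel" and B: "\<And>x. \<bar>u x\<bar> \<le> B" and iu: "integrable lborel u"
  shows "represents (\<lambda>y. LINT z|lborel. multiplier_kernel (block_multiplier chi phi j) z * of_real (u (y + z)))
     (lp_block chi phi j (distr_of u))"
proof -
  let ?m = "block_multiplier chi phi j"
  let ?k = "multiplier_kernel ?m"
  have k: "?k \<in> schwartz" by (rule multiplier_kernel_schwartz[OF m])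
  note ik = schwartz_integrable[OF k]
  have [measurable]: "?k \<in> borel_measurable borel" by (rule schwartz_measurable[OF k])
  obtain K where K: "\<And>x. cmod (?k x) \<le> K" using schwartz_bound[OF k, of 0] by auto
  have K0: "0 \<le> K" using K[of 0] norm_ge_zero[of "?k 0"] by linarith
  have B0: "0 \<le> B" using B[of 0] by linarith
  have shift: "(LINT z|lborel. ?k z * of_real (u (y + z))) = (LINT x|lborel. ?k (x - y) * of_real (u x))" for y
    by (subst lborel_integral_real_affine[of 1 "\<lambda>x. ?k (x - y) * of_real (u x)" y]) simp_all
  have meas: "(\<lambda>y. LINT z|lborel. ?k z * of_real (u (y + z))) \<in> borel_measurable borel" by measurable
  have bd: "cmod (LINT z|lborel. ?k z * of_real (u (y + z))) \<le> (LINT z|lborel. cmod (?k z) * B)" for y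
    by (rule integral_norm_le) (use ik B in \<open>auto simp: norm_mult intro!: mult_left_mono\<close>)
  show ?thesis unfolding represents_def
  proof (intro conjI ballI meas)
    fix \<psi> assume \<psi>: "\<psi> \<in> schwartz"
    note i\<psi> = schwartz_integrable[OF \<psi>]
    have [measurable]: "\<psi> \<in> borel_measurable borel" by (rule schwartz_measurable[OF \<psi>])
    show "integrable lborel (\<lambda>y. (LINT z|lborel. ?k z * of_real (u (y + z))) * \<psi> y)"
      by (rule integrable_bounded_mult[OF i\<psi> meas bd])
    have "lp_block chi phi j (distr_of u) \<psi> = (LINT x|lborel. complex_of_real (u x) * (LINT y|lborel. ?k (x - y) * \<psi> y))"
      by (simp add: lp_block_distr_of[OF m \<psi>] fourier_multiplier_convolution[OF m \<psi>])
    also have "\<dots> = (LINT x|lborel. LINT y|lborel. complex_of_real (u x) * (?k (x - y) * \<psi> y))"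
      by (simp only: integral_mult_right_zero)
    also have "\<dots> = (LINT y|lborel. LINT x|lborel. complex_of_real (u x) * (?k (x - y) * \<psi> y))"
    proof (rule lborel_Fubini)
      show "integrable lborel (\<lambda>x. \<bar>u x\<bar> * K)" "integrable lborel (\<lambda>y. cmod (\<psi> y))" using iu i\<psi> by auto
      show "(\<lambda>(x, y). complex_of_real (u x) * (?k (x - y) * \<psi> y)) \<in> borel_measurable (borel \<Otimes>\<^sub>M borel)" by measurable
      show "cmod (complex_of_real (u x) * (?k (x - y) * \<psi> y)) \<le> \<bar>u x\<bar> * K * cmod (\<psi> y)" for x y
      proof -
        have "cmod (complex_of_real (u x) * (?k (x - y) * \<psi> y)) = (\<bar>u x\<bar> * cmod (\<psi> y)) * cmod (?k (x - y))"
          by (simp add: norm_mult)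
        also have "\<dots> \<le> (\<bar>u x\<bar> * cmod (\<psi> y)) * K" by (intro mult_left_mono K) simp
        finally show ?thesis by (simp add: mult_ac)
      qed
    qed
    also have "\<dots> = (LINT y|lborel. (LINT x|lborel. ?k (x - y) * of_real (u x)) * \<psi> y)"
    proof (rule Bochner_Integration.integral_cong[OF refl])
      fix y
      have "(LINT x|lborel. complex_of_real (u x) * (?k (x - y) * \<psi> y)) = (LINT x|lborel. ?k (x - y) * of_real (u x) * \<psi> y)"
        by (simp add: mult_ac)
      then show "(LINT x|lborel. complex_of_real (u x) * (?k (x - y) * \<psi> y)) = (LINT x|lborel. ?k (x - y) * of_real (u x)) * \<psi> y"
        by (simp only: integral_mult_left_zero)
    qed
    finally show "lp_block chi phi j (distr_of u) \<psi> = (LINT y|lborel. (LINT z|lborel. ?k z * of_real (u (y + z))) * \<psi> y)"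
      by (simp only: shift)
  qed
qed

lemma Lnorm_td_le:
  assumes "represents g T" "p > 0" "B \<ge> 0" "(\<integral>\<^sup>+ y. ennreal (cmod (g y) powr p) \<partial>lborel) \<le> ennreal (B powr p)"
  shows "Lnorm_td (ennreal p) T \<le> ennreal B"
proof -
  have "Lnorm_td (ennreal p) T \<le> Lnorm lborel (ennreal p) (\<lambda>x. ennreal (cmod (g x)))"
    unfolding Lnorm_td_def by (rule INF_lower) (use assms in simp)
  also have "\<dots> \<le> ennreal B"
    by (rule Lnorm_leI) (use assms in \<open>auto simp: epow_ennreal\<close>)
  finally show ?thesis .
qed

lemma lp_block_Lp_bound:
  assumes m: "multiplier (block_multiplier chi phi j)" and p: "p > 1"
    and u[measurable]: "u \<in> borel_measurable borel" and B: "\<And>x. \<bar>u x\<bar> \<le> B" and iu: "integrable lborel u"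
    and A: "A \<ge> 0" "(\<integral>\<^sup>+ x. ennreal (\<bar>u x\<bar> powr p) \<partial>lborel) \<le> ennreal (A powr p)"
    and K: "(LINT z|lborel. cmod (multiplier_kernel (block_multiplier chi phi j) z)) \<le> K"
  shows "Lnorm_td (ennreal p) (lp_block chi phi j (distr_of u)) \<le> ennreal (K * A)"
proof (rule Lnorm_td_le[OF represents_lp_block[OF m u B iu]])
  let ?k = "multiplier_kernel (block_multiplier chi phi j)"
  have ik: "integrable lborel ?k" by (rule schwartz_integrable[OF multiplier_kernel_schwartz[OF m]])
  have K0: "0 \<le> (LINT z|lborel. cmod (?k z))" by simp
  then have K1: "0 \<le> K" using K by linarith
  have "(\<integral>\<^sup>+ y. ennreal (cmod (LINT z|lborel. ?k z * of_real (u (y + z))) powr p) \<partial>lborel)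
    \<le> ennreal ((LINT z|lborel. cmod (?k z)) powr (p - 1) * (LINT z|lborel. cmod (?k z) * A powr p))"
  proof (rule convolution_Lp_bound[OF p ik])
    show "(\<integral>\<^sup>+ y. ennreal (\<bar>u (y + z)\<bar> powr p) \<partial>lborel) \<le> ennreal (A powr p)" for z
    proof -
      have "(\<integral>\<^sup>+ y. ennreal (\<bar>u (y + z)\<bar> powr p) \<partial>lborel) = (\<integral>\<^sup>+ x. ennreal (\<bar>u x\<bar> powr p) \<partial>lborel)"
        by (subst nn_integral_real_affine[of "\<lambda>x. ennreal (\<bar>u x\<bar> powr p)" 1 z]) (simp_all add: add.commute)
      then show ?thesis using A by simp
    qed
  qed (use B ik in auto)
  also have "(LINT z|lborel. cmod (?k z)) powr (p - 1) * (LINT z|lborel. cmod (?k z) * A powr p)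
     = (LINT z|lborel. cmod (?k z)) powr p * A powr p"
    using K0 powr_add[of "LINT z|lborel. cmod (?k z)" "p - 1" 1] by simp
  also have "\<dots> \<le> K powr p * A powr p"
    using K K0 p by (intro mult_right_mono powr_mono2) auto
  also have "\<dots> = (K * A) powr p" using A K1 by (simp add: powr_mult)
  finally show "(\<integral>\<^sup>+ y. ennreal (cmod (LINT z|lborel. ?k z * of_real (u (y + z))) powr p) \<partial>lborel) \<le> ennreal ((K * A) powr p)"
    by (simp add: ennreal_leI)
  show "0 \<le> K * A" using K1 A by simp
qed (use p in simp)

text \<open>Since the kernel of a block is even with vanishing integral, the block only sees symmetric
  second differences.\<close>

lemma lp_block_second_difference_bound:
  assumes m: "multiplier (block_multiplier chi phi j)" and p: "p > 1"
    and even: "\<And>z. multiplier_kernel (block_multiplier chi phi j) (- z) = multiplier_kernel (block_multiplier chi phi j) z"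
    and zero: "(LINT z|lborel. multiplier_kernel (block_multiplier chi phi j) z) = 0"
    and u[measurable]: "u \<in> borel_measurable borel" and B: "\<And>x. \<bar>u x\<bar> \<le> B" and iu: "integrable lborel u"
    and \<Theta>: "mono \<Theta>" "\<And>x. 0 \<le> \<Theta> x" "\<And>x. \<Theta> x \<le> M"
    and D: "\<And>x \<tau>. \<tau> > 0 \<Longrightarrow> \<bar>u (x + \<tau>) + u (x - \<tau>) - 2 * u x\<bar> \<le> \<tau> * (\<Theta> (x + \<tau>) - \<Theta> (x - \<tau>))"
    and K: "(LINT z|lborel. cmod (multiplier_kernel (block_multiplier chi phi j) z)) powr (p - 1) *
        (LINT z|lborel. cmod (multiplier_kernel (block_multiplier chi phi j) z) * \<bar>z\<bar> powr (p + 1)) \<le> K powr p"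
    and K0: "0 \<le> K"
    and int: "integrable lborel (\<lambda>z. cmod (multiplier_kernel (block_multiplier chi phi j) z) * \<bar>z\<bar> powr (p + 1))"
  shows "Lnorm_td (ennreal p) (lp_block chi phi j (distr_of u)) \<le> ennreal (K * M)"
proof (rule Lnorm_td_le[OF represents_lp_block[OF m u B iu]])
  let ?k = "multiplier_kernel (block_multiplier chi phi j)"
  define w where "w = (\<lambda>y z. (u (y + z) + u (y - z) - 2 * u y) / 2)"
  have ks: "?k \<in> schwartz" by (rule multiplier_kernel_schwartz[OF m])
  have ik: "integrable lborel ?k" by (rule schwartz_integrable[OF ks])
  have [measurable]: "?k \<in> borel_measurable borel" by (rule schwartz_measurable[OF ks])
  have M0: "0 \<le> M" using \<Theta>(2,3)[of 0] by linarith
  have bu: "cmod (complex_of_real (u x)) \<le> B" for x using B by simp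
  have [measurable]: "case_prod w \<in> borel_measurable (borel \<Otimes>\<^sub>M borel)" unfolding w_def by measurable
  have wB: "\<bar>w y z\<bar> \<le> 2 * B" for y z
    unfolding w_def using B[of "y + z"] B[of "y - z"] B[of y] by (auto simp: abs_le_iff)
  have conv: "(LINT z|lborel. ?k z * of_real (u (y + z))) = (LINT z|lborel. ?k z * of_real (w y z))" for y
  proof -
    have i: "integrable lborel (\<lambda>z. complex_of_real (u (y + z)) * ?k z)" "integrable lborel (\<lambda>z. complex_of_real (u (y - z)) * ?k z)"
      by (auto intro!: integrable_bounded_mult[OF ik _ bu])
    have r: "(LINT z|lborel. complex_of_real (u (y - z)) * ?k z) = (LINT z|lborel. complex_of_real (u (y + z)) * ?k z)"
      by (subst lborel_integral_real_affine[of "-1" _ 0]) (simp_all add: even)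
    have "(LINT z|lborel. ?k z * of_real (w y z)) =
      (LINT z|lborel. (1 / 2) * (complex_of_real (u (y + z)) * ?k z) + (1 / 2) * (complex_of_real (u (y - z)) * ?k z) - of_real (u y) * ?k z)"
      by (rule Bochner_Integration.integral_cong) (auto simp: w_def field_simps)
    also have "\<dots> = (1 / 2) * (LINT z|lborel. complex_of_real (u (y + z)) * ?k z) + (1 / 2) * (LINT z|lborel. complex_of_real (u (y - z)) * ?k z)
        - of_real (u y) * (LINT z|lborel. ?k z)"
      using i ik by simp
    also have "\<dots> = (LINT z|lborel. complex_of_real (u (y + z)) * ?k z)" by (simp add: r zero)
    finally show ?thesis by (simp add: mult.commute)
  qed
  have "(\<integral>\<^sup>+ y. ennreal (cmod (LINT z|lborel. ?k z * of_real (w y z)) powr p) \<partial>lborel)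
    \<le> ennreal ((LINT z|lborel. cmod (?k z)) powr (p - 1) * (LINT z|lborel. cmod (?k z) * (\<bar>z\<bar> powr (p + 1) * M powr p)))"
  proof (rule convolution_Lp_bound[OF p ik _ wB])
    fix z :: real
    show "(\<integral>\<^sup>+ y. ennreal (\<bar>w y z\<bar> powr p) \<partial>lborel) \<le> ennreal (\<bar>z\<bar> powr (p + 1) * M powr p)"
    proof (cases "z = 0")
      case True
      then show ?thesis using p by (simp add: w_def)
    next
      case False
      define t where "t = \<bar>z\<bar>"
      have t: "t > 0" using False by (simp add: t_def)
      have wt: "\<bar>w y z\<bar> \<le> t / 2 * (\<Theta> (y + t) - \<Theta> (y - t))" for y
        using D[OF t, of y] unfolding w_def t_def by (cases "z \<ge> 0") (auto simp: add.commute)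
      define d where "d = (\<lambda>y. \<Theta> (y + t) - \<Theta> (y - t))"
      have d: "0 \<le> d y" "d y \<le> M" for y
        using \<Theta>(2)[of "y - t"] \<Theta>(3)[of "y + t"] monoD[OF \<Theta>(1), of "y - t" "y + t"] t by (auto simp: d_def)
      have [measurable]: "\<Theta> \<in> borel_measurable borel" by (rule borel_measurable_mono[OF \<Theta>(1)])
      \<comment> \<open>Of the p factors of the increment d only one is kept for the integration in
        y; the others are bounded by M. Integrating d gains one more power of t, and after the p-th
        root this is the step from regularity 1 to 1 + 1/p.\<close>
      have pt: "\<bar>w y z\<bar> powr p \<le> ((t / 2) powr p * M powr (p - 1)) * d y" for y
      proof -
        have "\<bar>w y z\<bar> powr p \<le> (t / 2 * d y) powr p" using wt[of y] p by (intro powr_mono2) (auto simp: d_def)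
        also have "\<dots> = (t / 2) powr p * d y powr p" by (rule powr_mult)
        also have "d y powr p = d y powr (p - 1) * d y"
          using powr_add[of "d y" "p - 1" 1] d[of y] by simp
        also have "\<dots> \<le> M powr (p - 1) * d y" using d[of y] p by (intro mult_right_mono powr_mono2) auto
        finally show ?thesis by (simp add: mult.assoc mult_left_mono)
      qed
      have "(\<integral>\<^sup>+ y. ennreal (\<bar>w y z\<bar> powr p) \<partial>lborel) \<le> (\<integral>\<^sup>+ y. ennreal ((t / 2) powr p * M powr (p - 1)) * ennreal (d y) \<partial>lborel)"
        using pt d by (intro nn_integral_mono) (auto simp: ennreal_mult[symmetric] intro!: ennreal_leI)
      also have "\<dots> = ennreal ((t / 2) powr p * M powr (p - 1)) * (\<integral>\<^sup>+ y. ennreal (d y) \<partial>lborel)"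
        unfolding d_def by (rule nn_integral_cmult) measurable
      also have "(\<integral>\<^sup>+ y. ennreal (d y) \<partial>lborel) = (\<integral>\<^sup>+ y. ennreal (\<Theta> (y + 2 * t) - \<Theta> y) \<partial>lborel)"
        unfolding d_def by (subst nn_integral_real_affine[of _ 1 t]) (simp_all add: algebra_simps)
      also have "\<dots> \<le> ennreal (2 * t * M)"
        by (rule nn_integral_mono_increment) (use \<Theta> t in auto)
      finally have "(\<integral>\<^sup>+ y. ennreal (\<bar>w y z\<bar> powr p) \<partial>lborel) \<le> ennreal ((t / 2) powr p * M powr (p - 1)) * ennreal (2 * t * M)"
        by (simp add: mult_left_mono)
      also have "\<dots> = ennreal ((t / 2) powr p * M powr (p - 1) * (2 * t * M))"
        using t M0 by (simp add: ennreal_mult)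
      also have "(t / 2) powr p * M powr (p - 1) * (2 * t * M) = 2 powr (1 - p) * (t powr (p + 1) * M powr p)"
        using t M0 powr_add[of M "p - 1" 1] by (simp add: powr_divide powr_add powr_diff)
      also have "\<dots> \<le> 1 * (t powr (p + 1) * M powr p)"
      proof (rule mult_right_mono)
        have "(2::real) powr (1 - p) \<le> 2 powr 0" using p by (intro powr_mono) auto
        then show "(2::real) powr (1 - p) \<le> 1" by simp
      qed auto
      finally show ?thesis by (simp add: t_def ennreal_leI)
    qed
    have "integrable lborel (\<lambda>z. cmod (?k z) * \<bar>z\<bar> powr (p + 1) * M powr p)" using int by (rule integrable_mult_left)
    then show "integrable lborel (\<lambda>z. cmod (?k z) * (\<bar>z\<bar> powr (p + 1) * M powr p))" by (simp add: mult.assoc)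
  qed auto
  also have "(LINT z|lborel. cmod (?k z) * (\<bar>z\<bar> powr (p + 1) * M powr p)) = (LINT z|lborel. cmod (?k z) * \<bar>z\<bar> powr (p + 1)) * M powr p"
    by (subst integral_mult_left_zero[symmetric]) (simp add: mult.assoc)
  also have "(LINT z|lborel. cmod (?k z)) powr (p - 1) * ((LINT z|lborel. cmod (?k z) * \<bar>z\<bar> powr (p + 1)) * M powr p) \<le> K powr p * M powr p"
    using mult_right_mono[OF K, of "M powr p"] by (simp add: mult.assoc)
  also have "K powr p * M powr p = (K * M) powr p" using K0 M0 by (simp add: powr_mult)
  finally show "(\<integral>\<^sup>+ y. ennreal (cmod (LINT z|lborel. ?k z * of_real (u (y + z))) powr p) \<partial>lborel) \<le> ennreal ((K * M) powr p)"
    unfolding conv by (simp add: ennreal_leI)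
  show "0 \<le> K * M" using K0 M0 by simp
qed (use p in simp)

lemma schwartz_integrable_powr:
  assumes "\<psi> \<in> schwartz" "q > 0" shows "integrable lborel (\<lambda>z. cmod (\<psi> z) * \<bar>z\<bar> powr q)"
proof -
  define k where "k = nat \<lceil>q\<rceil>"
  have qk: "q \<le> real k" unfolding k_def by linarith
  obtain C D where CD: "\<And>x. \<bar>x\<bar> ^ 0 * cmod (\<psi> x) \<le> C / (1 + x\<^sup>2)" "\<And>x. \<bar>x\<bar> ^ k * cmod (\<psi> x) \<le> D / (1 + x\<^sup>2)"
    using schwartz_decay[OF assms(1)] by metis
  have [measurable]: "\<psi> \<in> borel_measurable borel" by (rule schwartz_measurable[OF assms(1)])
  show ?thesis
  proof (rule integrable_bounded_by[OF integrable_inverse_quadratic[of "C + D"]])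
    fix x :: real
    have "\<bar>x\<bar> powr q \<le> 1 + \<bar>x\<bar> ^ k"
    proof (cases "\<bar>x\<bar> \<le> 1")
      case True
      then have "\<bar>x\<bar> powr q \<le> 1" using assms(2) powr_mono2[of q "\<bar>x\<bar>" 1] by simp
      then show ?thesis by (simp add: add_increasing2)
    next
      case False
      then have "\<bar>x\<bar> powr q \<le> \<bar>x\<bar> powr real k" using qk by (intro powr_mono) auto
      then show ?thesis using False by (simp add: powr_realpow)
    qed
    then have "cmod (\<psi> x) * \<bar>x\<bar> powr q \<le> cmod (\<psi> x) * (1 + \<bar>x\<bar> ^ k)" by (rule mult_left_mono) simp
    also have "\<dots> \<le> C / (1 + x\<^sup>2) + D / (1 + x\<^sup>2)" using CD[of x] by (simp add: algebra_simps)
    finally show "norm (cmod (\<psi> x) * \<bar>x\<bar> powr q) \<le> (C + D) / (1 + x\<^sup>2)" by (simp add: add_divide_distrib)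
  qed measurable
qed

section \<open>Bounds for Besov norms\<close>

lemma littlewood_paley_multipliers:
  assumes "littlewood_paley_pair chi phi"
  shows "multiplier chi" "multiplier phi" "\<And>\<xi>. phi (- \<xi>) = phi \<xi>" "\<exists>a>0. \<forall>\<xi>. \<bar>\<xi>\<bar> < a \<longrightarrow> phi \<xi> = 0" "\<exists>\<xi>. phi \<xi> \<noteq> 0"
proof -
  show "\<And>\<xi>. phi (- \<xi>) = phi \<xi>" using assms by (simp add: littlewood_paley_pair_def)
  obtain R where R: "R > 0" "\<And>\<xi>. chi \<xi> \<noteq> 0 \<Longrightarrow> \<bar>\<xi>\<bar> \<le> R"
    using assms unfolding littlewood_paley_pair_def by blast
  obtain a b where ab: "0 < a" "a < b" "\<And>\<xi>. phi \<xi> \<noteq> 0 \<Longrightarrow> a \<le> \<bar>\<xi>\<bar> \<and> \<bar>\<xi>\<bar> \<le> b"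
    using assms unfolding littlewood_paley_pair_def by blast
  show "multiplier chi" using assms R(2) unfolding multiplier_def littlewood_paley_pair_def
    by (metis not_le)
  show "multiplier phi" using assms ab(3) unfolding multiplier_def littlewood_paley_pair_def
    by (metis not_le)
  show "\<exists>a>0. \<forall>\<xi>. \<bar>\<xi>\<bar> < a \<longrightarrow> phi \<xi> = 0" using ab by (meson not_le)
  show "\<exists>\<xi>. phi \<xi> \<noteq> 0"
  proof (rule ccontr)
    assume "\<not> ?thesis"
    \<comment> \<open>If phi vanished, chi would equal 1 everywhere, in particular beyond its
      support radius R.\<close>
    then have "(\<lambda>j::nat. 0::real) sums (1 - chi (R + 1))"
      using assms unfolding littlewood_paley_pair_def by simp
    then have "chi (R + 1) = 1" using sums_unique2[OF sums_zero] by fastforce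
    then show False using R(1) R(2)[of "R + 1"] by simp
  qed
qed

lemma block_multiplier_eq:
  "block_multiplier chi phi (int j) = (\<lambda>\<xi>. phi (\<xi> / 2 ^ j))"
  by (simp add: block_multiplier_def power_int_minus divide_inverse mult.commute fun_eq_iff)

lemma block_multiplier_multiplier:
  assumes "littlewood_paley_pair chi phi" "j \<ge> -1"
  shows "multiplier (block_multiplier chi phi j)"
proof (cases "j = -1")
  case True
  then show ?thesis using littlewood_paley_multipliers[OF assms(1)] by (simp add: block_multiplier_def)
next
  case False
  then show ?thesis
    using multiplier_scale[OF littlewood_paley_multipliers(2)[OF assms(1)], of "2 powi (- j)"]
    by (simp add: block_multiplier_def)
qed

lemma block_kernel_eq:
  "multiplier_kernel (block_multiplier chi phi (int j)) z = 2 ^ j * multiplier_kernel phi (2 ^ j * z)"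
  using multiplier_kernel_scale[of "2 ^ j" phi z] by (simp add: block_multiplier_eq)

lemma min_le_powr_interpolation:
  fixes x a b :: real
  assumes "0 \<le> x" "x \<le> a" "x \<le> b" "0 < \<theta>" "\<theta> < 1"
  shows "x \<le> a powr \<theta> * b powr (1 - \<theta>)"
proof -
  have "x = x powr \<theta> * x powr (1 - \<theta>)" using assms by (simp add: powr_add[symmetric])
  also have "\<dots> \<le> a powr \<theta> * b powr (1 - \<theta>)" using assms by (intro mult_mono powr_mono2) auto
  finally show ?thesis .
qed

text \<open>The monotone majorant \<open>\<Theta>\<close> plays the role of the variation function of \<open>u'\<close>, so \<open>M\<close> bounds the total
  variation of \<open>u'\<close> and gives \<open>u\<close> the regularity \<open>1 + 1/p\<close> in \<open>L\<^sup>p\<close>.\<close>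

definition interpolates :: "(functional \<Rightarrow> ennreal) \<Rightarrow> real \<Rightarrow> real \<Rightarrow> real \<Rightarrow> bool" where
  "interpolates N p C \<theta> \<longleftrightarrow> (\<forall>u A B M \<Theta>.
    u \<in> borel_measurable borel \<longrightarrow> (\<forall>x. \<bar>u x\<bar> \<le> B) \<longrightarrow> integrable lborel u \<longrightarrow> 0 < A \<longrightarrow> A \<le> M \<longrightarrow>
    (\<integral>\<^sup>+ x. ennreal (\<bar>u x\<bar> powr p) \<partial>lborel) \<le> ennreal (A powr p) \<longrightarrow>
    mono \<Theta> \<longrightarrow> (\<forall>x. 0 \<le> \<Theta> x \<and> \<Theta> x \<le> M) \<longrightarrow>
    (\<forall>x \<tau>. \<tau> > 0 \<longrightarrow> \<bar>u (x + \<tau>) + u (x - \<tau>) - 2 * u x\<bar> \<le> \<tau> * (\<Theta> (x + \<tau>) - \<Theta> (x - \<tau>))) \<longrightarrow>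
    N (distr_of u) \<le> ennreal (C * (A powr \<theta> * M powr (1 - \<theta>))))"

text \<open>For j >= 0 block j is bounded both by a multiple of A and by a multiple of 2^(-j
  \<sigma>) M with \<sigma> = 1 + 1/p. Their geometric mean decays like 2^(-j (1 - \<theta>)
  \<sigma>), which beats the factor 2^(j s) with room \<kappa> as soon as \<theta> is small.\<close>

theorem besov_norm_interpolation:
  assumes lp: "littlewood_paley_pair chi phi" and p: "p > 1" and s: "s < 1 + 1 / p" and r: "r \<ge> 1"
  shows "\<exists>C>0. \<exists>\<theta>. 0 < \<theta> \<and> \<theta> < 1 \<and> interpolates (besov_norm chi phi s (ennreal p) r) p C \<theta>"
proof -
  define \<sigma> where "\<sigma> = 1 + 1 / p"
  have \<sigma>: "\<sigma> > 1" "s < \<sigma>" using p s by (auto simp: \<sigma>_def)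
  \<comment> \<open>The second entry gives \<kappa> >= (\<sigma> - s) / 2; the cap 1/2 keeps
    \<theta> below 1 when s is very negative.\<close>
  define \<theta> where "\<theta> = min (1 / 2) ((\<sigma> - s) / (2 * \<sigma>))"
  have \<theta>: "0 < \<theta>" "\<theta> < 1" using \<sigma> by (auto simp: \<theta>_def)
  define \<kappa> where "\<kappa> = (1 - \<theta>) * \<sigma> - s"
  have \<kappa>: "\<kappa> > 0"
  proof -
    have "\<theta> * \<sigma> \<le> (\<sigma> - s) / (2 * \<sigma>) * \<sigma>" using \<sigma> by (intro mult_right_mono) (auto simp: \<theta>_def)
    also have "\<dots> = (\<sigma> - s) / 2" using \<sigma> by simp
    finally show ?thesis using \<sigma> by (simp add: \<kappa>_def algebra_simps)
  qed
  let ?k = "multiplier_kernel phi"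
  note mult = littlewood_paley_multipliers[OF lp]
  have ks: "?k \<in> schwartz" by (rule multiplier_kernel_schwartz[OF mult(2)])
  obtain a where a: "a > 0" "\<And>\<xi>. \<bar>\<xi>\<bar> < a \<Longrightarrow> phi \<xi> = 0" using mult(4) by blast
  define \<kappa>0 where "\<kappa>0 = (LINT z|lborel. cmod (?k z))"
  define \<kappa>1 where "\<kappa>1 = (LINT z|lborel. cmod (?k z) * \<bar>z\<bar> powr (p + 1))"
  define \<kappa>c where "\<kappa>c = (LINT z|lborel. cmod (multiplier_kernel chi z))"
  have nn: "0 \<le> \<kappa>0" "0 \<le> \<kappa>1" "0 \<le> \<kappa>c" by (auto simp: \<kappa>0_def \<kappa>1_def \<kappa>c_def)
  define \<kappa>2 where "\<kappa>2 = (\<kappa>0 powr (p - 1) * \<kappa>1) powr (1 / p)"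
  define c where "c = \<kappa>0 + \<kappa>2 + \<kappa>c + 1"
  have "\<kappa>2 \<ge> 0" by (simp add: \<kappa>2_def)
  then have c: "c > 0" "\<kappa>0 \<le> c" "\<kappa>2 \<le> c" "\<kappa>c \<le> c" using nn by (auto simp: c_def)
  obtain C where C: "C > 0" "\<And>f B. B \<ge> 0 \<Longrightarrow> (\<forall>j\<ge>-1. f j \<le> ennreal (B * 2 powr (- \<kappa> * of_int j))) \<Longrightarrow>
    Lnorm (count_space {-1::int..}) r f \<le> ennreal (C * B)"
    using Lnorm_geometric[OF r \<kappa>] by blast
  have kj0: "(LINT z|lborel. cmod (multiplier_kernel (block_multiplier chi phi (int j)) z)) = \<kappa>0" for j
    unfolding \<kappa>0_def block_kernel_eq
    by (subst (2) lborel_integral_real_affine[of "2 ^ j" _ 0]) (simp_all add: norm_mult norm_power)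
  have kj1: "(LINT z|lborel. cmod (multiplier_kernel (block_multiplier chi phi (int j)) z) * \<bar>z\<bar> powr (p + 1)) = (2 ^ j) powr (- (p + 1)) * \<kappa>1" for j
  proof -
    have "\<kappa>1 = 2 ^ j * (LINT z|lborel. cmod (?k (2 ^ j * z)) * ((2 ^ j) powr (p + 1) * \<bar>z\<bar> powr (p + 1)))"
      unfolding \<kappa>1_def by (subst lborel_integral_real_affine[of "2 ^ j" _ 0]) (simp_all add: abs_mult powr_mult)
    also have "\<dots> = (LINT z|lborel. (2 ^ j) powr (p + 1) * (2 ^ j * cmod (?k (2 ^ j * z)) * \<bar>z\<bar> powr (p + 1)))"
      by (subst integral_mult_right_zero[symmetric]) (simp add: mult_ac)
    also have "\<dots> = (2 ^ j) powr (p + 1) * (LINT z|lborel. 2 ^ j * cmod (?k (2 ^ j * z)) * \<bar>z\<bar> powr (p + 1))"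
      by (rule integral_mult_right_zero)
    finally have eq: "\<kappa>1 = (2 ^ j) powr (p + 1) * (LINT z|lborel. cmod (multiplier_kernel (block_multiplier chi phi (int j)) z) * \<bar>z\<bar> powr (p + 1))"
      by (simp add: block_kernel_eq norm_mult norm_power)
    have "((2::real) ^ j) powr (- (p + 1)) * (2 ^ j) powr (p + 1) = 1"
      unfolding powr_add[symmetric] by simp
    then show ?thesis unfolding eq by (simp only: mult.assoc[symmetric] mult_1)
  qed
  show ?thesis unfolding interpolates_def
  proof (rule exI[of _ "C * c"], intro conjI exI[of _ \<theta>] allI impI \<theta>)
    show "0 < C * c" using C c by simp
    fix u A B M \<Theta>
    assume u: "u \<in> borel_measurable borel" "\<forall>x. \<bar>u x\<bar> \<le> B" "integrable lborel u"
      and A: "0 < A" "A \<le> M" "(\<integral>\<^sup>+ x. ennreal (\<bar>u x\<bar> powr p) \<partial>lborel) \<le> ennreal (A powr p)"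
      and \<Theta>: "mono \<Theta>" "\<forall>x. 0 \<le> \<Theta> x \<and> \<Theta> x \<le> M"
      and D: "\<forall>x \<tau>. \<tau> > 0 \<longrightarrow> \<bar>u (x + \<tau>) + u (x - \<tau>) - 2 * u x\<bar> \<le> \<tau> * (\<Theta> (x + \<tau>) - \<Theta> (x - \<tau>))"
    have M: "M > 0" using A by linarith
    let ?B = "c * (A powr \<theta> * M powr (1 - \<theta>))"
    have "ennreal (2 powr (of_int j * s)) * Lnorm_td (ennreal p) (lp_block chi phi j (distr_of u))
       \<le> ennreal (?B * 2 powr (- \<kappa> * of_int j))" if j: "j \<ge> -1" for j
    proof -
      note m = block_multiplier_multiplier[OF lp j]
      have "\<exists>x. 0 \<le> x \<and> Lnorm_td (ennreal p) (lp_block chi phi j (distr_of u)) \<le> ennreal x \<and> 2 powr (of_int j * s) * x \<le> ?B * 2 powr (- \<kappa> * of_int j)"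
      proof (cases "j = -1")
        case True
        have "Lnorm_td (ennreal p) (lp_block chi phi j (distr_of u)) \<le> ennreal (c * A)"
          by (rule lp_block_Lp_bound[OF m p u(1) _ u(3)])
            (use u A c True in \<open>auto simp: block_multiplier_def \<kappa>c_def\<close>)
        moreover have "2 powr (of_int j * s) * (c * A) \<le> ?B * 2 powr (- \<kappa> * of_int j)"
        proof -
          \<comment> \<open>The lowest block is estimated by A alone, without cancellation; A <= M
            brings this bound into the interpolated form.\<close>
          have "A \<le> A powr \<theta> * M powr (1 - \<theta>)" using A \<theta> by (intro min_le_powr_interpolation) auto
          moreover have "2 powr (- s) \<le> 2 powr \<kappa>" using \<theta> \<sigma> by (intro powr_mono) (auto simp: \<kappa>_def)
          ultimately have "2 powr (- s) * (c * A) \<le> 2 powr \<kappa> * ?B" using c A by (intro mult_mono) auto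
          then show ?thesis using True by (simp add: mult.commute)
        qed
        ultimately show ?thesis using c A by (intro exI[of _ "c * A"]) auto
      next
        case False
        define n where "n = nat j"
        have n: "j = int n" using False j by (simp add: n_def)
        define N where "N = (2::real) ^ n"
        have N: "N > 0" "N powr x = 2 powr (of_int j * x)" for x by (auto simp: N_def n powr_powr[symmetric] powr_realpow[symmetric])
        have b1: "Lnorm_td (ennreal p) (lp_block chi phi j (distr_of u)) \<le> ennreal (c * A)"
          by (rule lp_block_Lp_bound[OF m p u(1) _ u(3)]) (use u A c in \<open>auto simp: n kj0\<close>)
        have b2: "Lnorm_td (ennreal p) (lp_block chi phi j (distr_of u)) \<le> ennreal (c * N powr (- \<sigma>) * M)"
        proof (rule lp_block_second_difference_bound[OF m p _ _ u(1) _ u(3) \<Theta>(1)])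
          show "multiplier_kernel (block_multiplier chi phi j) (- z) = multiplier_kernel (block_multiplier chi phi j) z" for z
            by (rule multiplier_kernel_minus) (use mult(3) in \<open>simp add: n block_multiplier_eq minus_divide_left[symmetric]\<close>)
          show "(LINT z|lborel. multiplier_kernel (block_multiplier chi phi j) z) = 0"
          proof (rule integral_multiplier_kernel_0[OF m])
            show "0 < a" by (rule a)
            fix x assume x: "\<bar>x\<bar> < a"
            have "\<bar>x / 2 ^ n\<bar> \<le> \<bar>x\<bar>" by (simp add: divide_le_eq mult_left_mono[of 1 "2 ^ n" "\<bar>x\<bar>", simplified])
            then show "block_multiplier chi phi j x = 0" using a(2)[of "x / 2 ^ n"] x by (simp add: n block_multiplier_eq)
          qed
          \<comment> \<open>Rescaling the kernel multiplies its moment of order p + 1 by N^(-(p+1))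
            and keeps its mass; the p-th root of this factor is N^(-\<sigma>).\<close>
          have "\<kappa>0 powr (p - 1) * (N powr (- (p + 1)) * \<kappa>1) = (\<kappa>2 * N powr (- \<sigma>)) powr p"
          proof -
            have "\<kappa>2 powr p = \<kappa>0 powr (p - 1) * \<kappa>1" using p nn by (simp add: \<kappa>2_def powr_powr)
            moreover have "- \<sigma> * p = - (p + 1)" using p by (simp add: \<sigma>_def field_simps)
            then have "(N powr (- \<sigma>)) powr p = N powr (- (p + 1))" by (simp only: powr_powr)
            ultimately show ?thesis using N p by (simp add: powr_mult \<kappa>2_def)
          qed
          also have "\<dots> \<le> (c * N powr (- \<sigma>)) powr p" using c p by (intro powr_mono2 mult_right_mono) (auto simp: \<kappa>2_def)
          finally show "(LINT z|lborel. cmod (multiplier_kernel (block_multiplier chi phi j) z)) powr (p - 1) *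
            (LINT z|lborel. cmod (multiplier_kernel (block_multiplier chi phi j) z) * \<bar>z\<bar> powr (p + 1)) \<le> (c * N powr (- \<sigma>)) powr p"
            by (simp add: n kj0 kj1 N_def)
          show "integrable lborel (\<lambda>z. cmod (multiplier_kernel (block_multiplier chi phi j) z) * \<bar>z\<bar> powr (p + 1))"
            using p by (intro schwartz_integrable_powr multiplier_kernel_schwartz m) auto
        qed (use u \<Theta> D c in auto)
        let ?x = "(c * A) powr \<theta> * (c * N powr (- \<sigma>) * M) powr (1 - \<theta>)"
        have "Lnorm_td (ennreal p) (lp_block chi phi j (distr_of u)) \<le> ennreal (min (c * A) (c * N powr (- \<sigma>) * M))"
          using b1 b2 by (simp add: min_def)
        also have "\<dots> \<le> ennreal ?x"
          using c A M \<theta> by (intro ennreal_leI min_le_powr_interpolation) auto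
        finally have "Lnorm_td (ennreal p) (lp_block chi phi j (distr_of u)) \<le> ennreal ?x" .
        moreover have "?x = ?B * N powr (- \<sigma> * (1 - \<theta>))"
          using c A M by (simp add: powr_mult powr_powr powr_add[symmetric] mult_ac)
        moreover have "N powr s * N powr (- \<sigma> * (1 - \<theta>)) = N powr (- \<kappa>)"
          by (simp add: powr_add[symmetric] \<kappa>_def algebra_simps)
        ultimately have "2 powr (of_int j * s) * ?x = ?B * 2 powr (- \<kappa> * of_int j)"
          using N(2)[of s] N(2)[of "- \<kappa>"] by (simp add: mult_ac)
        then show ?thesis using \<open>Lnorm_td (ennreal p) (lp_block chi phi j (distr_of u)) \<le> ennreal ?x\<close>
          by (intro exI[of _ ?x]) auto
      qed
      then obtain x where x: "0 \<le> x" "Lnorm_td (ennreal p) (lp_block chi phi j (distr_of u)) \<le> ennreal x"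
        "2 powr (of_int j * s) * x \<le> ?B * 2 powr (- \<kappa> * of_int j)" by blast
      have "ennreal (2 powr (of_int j * s)) * Lnorm_td (ennreal p) (lp_block chi phi j (distr_of u)) \<le> ennreal (2 powr (of_int j * s)) * ennreal x"
        by (intro mult_left_mono x) simp
      also have "\<dots> = ennreal (2 powr (of_int j * s) * x)" using x by (simp add: ennreal_mult)
      also have "\<dots> \<le> ennreal (?B * 2 powr (- \<kappa> * of_int j))" by (intro ennreal_leI x)
      finally show ?thesis .
    qed
    then have "besov_norm chi phi s (ennreal p) r (distr_of u) \<le> ennreal (C * ?B)"
      unfolding besov_norm_def using c by (intro C(2)) auto
    then show "besov_norm chi phi s (ennreal p) r (distr_of u) \<le> ennreal (C * c * (A powr \<theta> * M powr (1 - \<theta>)))"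
      by (simp add: mult.assoc)
  qed
qed

section \<open>The hat with one steep edge and the lower bound for its Besov norm\<close>

definition steep_hat :: "real \<Rightarrow> real \<Rightarrow> real \<Rightarrow> real" where
  "steep_hat h \<epsilon> x = (if x \<le> 0 then 0 else if x \<le> \<epsilon> then h * x / \<epsilon> else if x \<le> 1 + \<epsilon> then h * (1 + \<epsilon> - x) else 0)"

lemma steep_hat_continuous:
  assumes "\<epsilon> > 0" shows "continuous_on UNIV (steep_hat h \<epsilon>)"
proof -
  have "steep_hat h \<epsilon> = (\<lambda>x. h * max 0 (min (x / \<epsilon>) (1 + \<epsilon> - x)))"
  proof
    fix x
    consider "x \<le> 0" | "0 < x" "x \<le> \<epsilon>" | "\<epsilon> < x" "x \<le> 1 + \<epsilon>" | "1 + \<epsilon> < x" by linarith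
    then show "steep_hat h \<epsilon> x = h * max 0 (min (x / \<epsilon>) (1 + \<epsilon> - x))"
    proof cases
      case 1
      then have "x / \<epsilon> \<le> 0" using assms by (simp add: divide_le_0_iff)
      then show ?thesis using 1 by (simp add: steep_hat_def)
    next
      case 2
      then have "x / \<epsilon> \<le> 1" "0 \<le> x / \<epsilon>" using assms by auto
      then have "min (x / \<epsilon>) (1 + \<epsilon> - x) = x / \<epsilon>" using 2 by linarith
      then show ?thesis using 2 assms by (simp add: steep_hat_def)
    next
      case 3
      then have "x / \<epsilon> > 1" using assms by (simp add: less_divide_eq)
      then have "min (x / \<epsilon>) (1 + \<epsilon> - x) = 1 + \<epsilon> - x" using 3 by linarith
      then show ?thesis using 3 assms by (simp add: steep_hat_def)
    next
      case 4
      then show ?thesis using assms by (simp add: steep_hat_def)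
    qed
  qed
  then show ?thesis using assms by (auto intro!: continuous_intros)
qed

lemma steep_hat_bound: "\<epsilon> > 0 \<Longrightarrow> 0 \<le> h \<Longrightarrow> \<bar>steep_hat h \<epsilon> x\<bar> \<le> h"
  by (auto simp: steep_hat_def abs_mult divide_le_eq intro!: mult_left_le mult_left_mono)

lemma steep_hat_deriv:
  assumes "\<epsilon> > 0" "x \<notin> {0, \<epsilon>, 1 + \<epsilon>}"
  shows "(steep_hat h \<epsilon> has_real_derivative
    (if 0 < x \<and> x < \<epsilon> then h / \<epsilon> else if \<epsilon> < x \<and> x < 1 + \<epsilon> then - h else 0)) (at x)"
proof -
  consider "x < 0" | "0 < x" "x < \<epsilon>" | "\<epsilon> < x" "x < 1 + \<epsilon>" | "1 + \<epsilon> < x" using assms by fastforce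
  then show ?thesis
  proof cases
    case 1
    show ?thesis
      by (rule has_field_derivative_transform_within_open[of "\<lambda>_. 0" _ _ "{..<0}"]) (use 1 assms in \<open>auto simp: steep_hat_def\<close>)
  next
    case 2
    show ?thesis
      by (rule has_field_derivative_transform_within_open[of "\<lambda>x. h * x / \<epsilon>" _ _ "{0<..<\<epsilon>}"])
        (use 2 in \<open>auto simp: steep_hat_def intro!: derivative_eq_intros\<close>)
  next
    case 3
    show ?thesis
      by (rule has_field_derivative_transform_within_open[of "\<lambda>x. h * (1 + \<epsilon> - x)" _ _ "{\<epsilon><..<1 + \<epsilon>}"])
        (use 3 assms in \<open>auto simp: steep_hat_def intro!: derivative_eq_intros\<close>)
  next
    case 4
    show ?thesis
      by (rule has_field_derivative_transform_within_open[of "\<lambda>_. 0" _ _ "{1 + \<epsilon><..}"]) (use 4 assms in \<open>auto simp: steep_hat_def\<close>)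
  qed
qed

lemma integral_steep_hat_deriv:
  assumes "\<epsilon> > 0" "G \<in> schwartz" "0 \<le> h"
  shows "(LINT x|lborel. complex_of_real (steep_hat h \<epsilon> x) * dderiv 1 G x) =
    h * (LINT x:{\<epsilon>..1 + \<epsilon>}|lborel. G x) - h / \<epsilon> * (LINT x:{0..\<epsilon>}|lborel. G x)"
proof -
  let ?f = "steep_hat h \<epsilon>"
  let ?d = "\<lambda>x. h / \<epsilon> * indicator {0..\<epsilon>} x - h * indicator {\<epsilon>..1 + \<epsilon>} x :: real"
  note G = schwartz_integrable[OF assms(2)] schwartz_integrable[OF schwartz_dderiv[OF assms(2)]]
  have [measurable]: "?f \<in> borel_measurable borel" by (rule borel_measurable_continuous_onI[OF steep_hat_continuous[OF assms(1)]])
  have iG: "integrable lborel (\<lambda>x. indicator {a..b} x *\<^sub>R G x)" for a b by (intro integrable_mult_indicator G) auto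
  have i1: "integrable lborel (\<lambda>x. complex_of_real (?f x) * dderiv 1 G x)"
    by (rule integrable_bounded_schwartz[OF _ steep_hat_bound[OF assms(1,3)]]) (auto intro: schwartz_dderiv assms)
  have dG: "complex_of_real (?d x) * G x = (h / \<epsilon>) *\<^sub>R (indicator {0..\<epsilon>} x *\<^sub>R G x) - h *\<^sub>R (indicator {\<epsilon>..1 + \<epsilon>} x *\<^sub>R G x)" for x
    by (simp add: scaleR_conv_of_real algebra_simps indicator_def)
  have i2: "integrable lborel (\<lambda>x. complex_of_real (?d x) * G x)"
    unfolding dG by (intro Bochner_Integration.integrable_diff integrable_scaleR_right iG)
  have "(LINT x|lborel. complex_of_real (?d x) * G x + complex_of_real (?f x) * dderiv 1 G x) = 0 - 0"
  proof (rule integral_FTC_UNIV_finite_exceptions[where S = "{0, \<epsilon>, 1 + \<epsilon>}" and F = "\<lambda>x. complex_of_real (?f x) * G x"])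
    fix x assume x: "x \<notin> {0, \<epsilon>, 1 + \<epsilon>}"
    have "(if 0 < x \<and> x < \<epsilon> then h / \<epsilon> else if \<epsilon> < x \<and> x < 1 + \<epsilon> then - h else 0) = ?d x"
    proof -
      consider "x < 0" | "0 < x" "x < \<epsilon>" | "\<epsilon> < x" "x < 1 + \<epsilon>" | "1 + \<epsilon> < x" using x by fastforce
      then show ?thesis by cases (use assms(1) in simp_all)
    qed
    then have "(?f has_real_derivative ?d x) (at x)"
      using steep_hat_deriv[OF assms(1) x, of h] by simp
    then have "((\<lambda>x. complex_of_real (?f x)) has_vector_derivative complex_of_real (?d x)) (at x)"
      by (rule has_vector_derivative_of_real)
    from has_vector_derivative_mult[OF this smooth_deriv[OF schwartz_smooth[OF assms(2)]]]
    show "((\<lambda>x. complex_of_real (?f x) * G x) has_vector_derivative complex_of_real (?d x) * G x + complex_of_real (?f x) * dderiv 1 G x) (at x)"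
      by (simp add: add.commute)
  next
    show "continuous_on UNIV (\<lambda>x. complex_of_real (?f x) * G x)"
      by (intro continuous_intros steep_hat_continuous smooth_continuous schwartz_smooth assms)
    show "integrable lborel (\<lambda>x. complex_of_real (?d x) * G x + complex_of_real (?f x) * dderiv 1 G x)"
      by (intro Bochner_Integration.integrable_add i1 i2)
    have "eventually (\<lambda>x. complex_of_real (?f x) * G x = 0) at_bot"
      using eventually_le_at_bot[of 0] by eventually_elim (simp add: steep_hat_def)
    then show "((\<lambda>x. complex_of_real (?f x) * G x) \<longlongrightarrow> 0) at_bot" by (rule tendsto_eventually)
    have "eventually (\<lambda>x. complex_of_real (?f x) * G x = 0) at_top"
      using eventually_gt_at_top[of "1 + \<epsilon>"] by eventually_elim (use assms in \<open>simp add: steep_hat_def\<close>)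
    then show "((\<lambda>x. complex_of_real (?f x) * G x) \<longlongrightarrow> 0) at_top" by (rule tendsto_eventually)
  qed simp
  then have "(LINT x|lborel. complex_of_real (?f x) * dderiv 1 G x) = - (LINT x|lborel. complex_of_real (?d x) * G x)"
    using i1 i2 by (simp add: add_eq_0_iff)
  also have "(LINT x|lborel. complex_of_real (?d x) * G x) = (h / \<epsilon>) *\<^sub>R (LINT x:{0..\<epsilon>}|lborel. G x) - h *\<^sub>R (LINT x:{\<epsilon>..1 + \<epsilon>}|lborel. G x)"
    unfolding dG set_lebesgue_integral_def
    by (simp only: Bochner_Integration.integral_diff[OF integrable_scaleR_right[OF iG] integrable_scaleR_right[OF iG]] integral_scaleR_right)
  finally show ?thesis by (simp add: scaleR_conv_of_real)
qed

text \<open>Integration by parts turns the edge into h times the mean of the test function over an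
  interval of length \<epsilon> = 4^(-j). On that interval a function at scale 2^(-j) is nearly
  constant, so the mean is close to G(0). The descent has slope -h and sees only the integral of the
  rescaled G, of order 2^(-j). The hat therefore acts like a jump of height h.\<close>

lemma steep_hat_test_bound:
  assumes G: "G \<in> schwartz" and "G 0 \<noteq> 0"
  shows "\<exists>N. \<forall>j\<ge>N. \<forall>h>0. h * cmod (G 0) / 2 \<le>
    cmod (LINT x|lborel. complex_of_real (steep_hat h (1 / 4 ^ j) x) * dderiv 1 (\<lambda>x. G (2 ^ j * x)) x)"
proof -
  define g where "g = cmod (G 0)"
  have g: "g > 0" using assms by (simp add: g_def)
  have "isCont G 0" using smooth_continuous[OF schwartz_smooth[OF G], of UNIV] by (simp add: continuous_on_eq_continuous_at)
  then obtain d where d: "d > 0" "\<And>x. \<bar>x\<bar> < d \<Longrightarrow> cmod (G x - G 0) < g / 4"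
    using g unfolding continuous_at_eps_delta by (metis dist_norm diff_zero divide_pos_pos real_norm_def zero_less_numeral)
  define I where "I = (LINT x|lborel. cmod (G x))"
  have I0: "0 \<le> I" by (simp add: I_def)
  \<comment> \<open>The first entry puts the rescaled edge, of length 2^(-j), inside the radius d of
    near-constancy; the second makes the descent contribute at most g/4. What is left is 3/4 - 1/4 =
    1/2 of |G(0)|.\<close>
  have "\<exists>N. max (1 / d) (4 * I / g) < 2 ^ N" by (rule real_arch_pow) simp
  then obtain N where N: "max (1 / d) (4 * I / g) < 2 ^ N" ..
  show ?thesis
  proof (intro exI[of _ N] allI impI)
    fix j and h :: real assume j: "N \<le> j" and h: "h > 0"
    define a where "a = (2::real) ^ j"
    define \<epsilon> where "\<epsilon> = 1 / (4::real) ^ j"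
    have "(2::real) ^ N \<le> a" using j by (simp add: a_def)
    moreover have "a > 0" by (simp add: a_def)
    ultimately have a: "a > 0" "1 / d < a" "4 * I / g < a" using N by auto
    have \<epsilon>: "\<epsilon> > 0" "a * \<epsilon> = 1 / a" by (auto simp: \<epsilon>_def a_def field_simps power_mult_distrib[symmetric])
    let ?H = "\<lambda>x. G (a * x)"
    have H: "?H \<in> schwartz" using schwartz_scale[OF G, of a] a by simp
    note iH = schwartz_integrable[OF H]
    have sH: "set_integrable lborel {l..u} ?H" for l u unfolding set_integrable_def by (intro integrable_mult_indicator iH) auto
    have tail: "cmod (LINT x:{\<epsilon>..1 + \<epsilon>}|lborel. ?H x) \<le> g / 4"
    proof -
      have "cmod (LINT x:{\<epsilon>..1 + \<epsilon>}|lborel. ?H x) \<le> (LINT x|lborel. cmod (?H x))"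
        unfolding set_lebesgue_integral_def by (rule integral_norm_le) (use iH in \<open>auto simp: indicator_def\<close>)
      also have "\<dots> = I / a" unfolding I_def using a by (subst lborel_integral_real_affine[of a "\<lambda>x. cmod (G x)" 0]) auto
      also have "\<dots> \<le> g / 4" using a g by (simp add: field_simps)
      finally show ?thesis .
    qed
    have head: "cmod ((1 / \<epsilon>) * (LINT x:{0..\<epsilon>}|lborel. ?H x)) \<ge> 3 * g / 4"
    proof -
      have "(LINT x:{0..\<epsilon>}|lborel. ?H x) = (LINT x:{0..\<epsilon>}|lborel. ?H x - G 0) + (LINT x:{0..\<epsilon>}|lborel. G 0)"
        by (subst set_integral_diff) (use sH in \<open>auto simp: set_integrable_def emeasure_lborel_Icc_eq\<close>)
      also have "(LINT x:{0..\<epsilon>}|lborel. G 0) = \<epsilon> * G 0"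
        using \<epsilon> by (simp add: set_lebesgue_integral_def scaleR_conv_of_real)
      finally have eq: "(1 / \<epsilon>) * (LINT x:{0..\<epsilon>}|lborel. ?H x) = (1 / \<epsilon>) * (LINT x:{0..\<epsilon>}|lborel. ?H x - G 0) + G 0"
        using \<epsilon> by (simp add: field_simps)
      have "cmod (LINT x:{0..\<epsilon>}|lborel. ?H x - G 0) \<le> (LINT x|lborel. indicator {0..\<epsilon>} x * (g / 4))"
        unfolding set_lebesgue_integral_def
      proof (rule integral_norm_le)
        show "integrable lborel (\<lambda>x. indicator {0..\<epsilon>} x * (g / 4))"
          by (intro integrable_mult_left integrable_real_indicator) (auto simp: emeasure_lborel_Icc_eq)
        fix x
        show "cmod (indicator {0..\<epsilon>} x *\<^sub>R (?H x - G 0)) \<le> indicator {0..\<epsilon>} x * (g / 4)"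
        proof (cases "x \<in> {0..\<epsilon>}")
          case True
          then have "\<bar>a * x\<bar> \<le> a * \<epsilon>" using a by (auto simp: abs_mult)
          also have "\<dots> < d" unfolding \<epsilon>(2) using a d by (simp add: field_simps)
          finally show ?thesis using d(2)[of "a * x"] True by simp
        qed simp
      qed
      also have "\<dots> = \<epsilon> * g / 4" using \<epsilon> by simp
      finally have "cmod ((1 / \<epsilon>) * (LINT x:{0..\<epsilon>}|lborel. ?H x - G 0)) \<le> g / 4"
        using \<epsilon> by (simp add: norm_mult norm_divide divide_le_eq mult_ac)
      moreover have "cmod (G 0) \<le> cmod ((1 / \<epsilon>) * (LINT x:{0..\<epsilon>}|lborel. ?H x)) + cmod ((1 / \<epsilon>) * (LINT x:{0..\<epsilon>}|lborel. ?H x - G 0))"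
        using norm_triangle_ineq4[of "(1 / \<epsilon>) * (LINT x:{0..\<epsilon>}|lborel. ?H x)" "(1 / \<epsilon>) * (LINT x:{0..\<epsilon>}|lborel. ?H x - G 0)"]
        unfolding eq by simp
      ultimately show ?thesis by (simp add: g_def)
    qed
    have "h * g / 2 = h * (3 * g / 4 - g / 4)" by (simp add: field_simps)
    also have "\<dots> \<le> h * (cmod ((1 / \<epsilon>) * (LINT x:{0..\<epsilon>}|lborel. ?H x)) - cmod (LINT x:{\<epsilon>..1 + \<epsilon>}|lborel. ?H x))"
      using h head tail by (intro mult_left_mono) auto
    also have "\<dots> \<le> h * cmod ((LINT x:{\<epsilon>..1 + \<epsilon>}|lborel. ?H x) - (1 / \<epsilon>) * (LINT x:{0..\<epsilon>}|lborel. ?H x))"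
      using h norm_triangle_ineq3[of "LINT x:{\<epsilon>..1 + \<epsilon>}|lborel. ?H x" "(1 / \<epsilon>) * (LINT x:{0..\<epsilon>}|lborel. ?H x)"]
      by (intro mult_left_mono) auto
    also have "\<dots> = cmod (h * ((LINT x:{\<epsilon>..1 + \<epsilon>}|lborel. ?H x) - (1 / \<epsilon>) * (LINT x:{0..\<epsilon>}|lborel. ?H x)))"
      using h by (simp add: norm_mult)
    also have "h * ((LINT x:{\<epsilon>..1 + \<epsilon>}|lborel. ?H x) - (1 / \<epsilon>) * (LINT x:{0..\<epsilon>}|lborel. ?H x)) =
       (LINT x|lborel. complex_of_real (steep_hat h \<epsilon> x) * dderiv 1 ?H x)"
      unfolding integral_steep_hat_deriv[OF \<epsilon>(1) H less_imp_le[OF h]]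
      by (simp add: right_diff_distrib)
    finally show "h * cmod (G 0) / 2 \<le> cmod (LINT x|lborel. complex_of_real (steep_hat h (1 / 4 ^ j) x) * dderiv 1 (\<lambda>x. G (2 ^ j * x)) x)"
      by (simp add: g_def \<epsilon>_def a_def)
  qed
qed

text \<open>Hoelder's inequality bounds the norm of every representing function from below. If none
  exists, the infimum in \<open>Lnorm_td\<close> is infinite and the bound holds too.\<close>

lemma Lnorm_td_ge:
  assumes pq: "p > 1" "q > 1" "1 / p + 1 / q = 1" and \<psi>: "\<psi> \<in> schwartz"
    and Q: "integrable lborel (\<lambda>x. cmod (\<psi> x) powr q)" "(LINT x|lborel. cmod (\<psi> x) powr q) powr (1 / q) \<le> Q" "Q > 0"
    and b: "b \<le> cmod (T \<psi>)"
  shows "ennreal (b / Q) \<le> Lnorm_td (ennreal p) T"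
  unfolding Lnorm_td_def
proof (rule INF_greatest)
  fix g assume "g \<in> {g. represents g T}"
  then have g[measurable]: "g \<in> borel_measurable borel" and T: "T \<psi> = (LINT x|lborel. g x * \<psi> x)"
    using \<psi> by (auto simp: represents_def)
  have [measurable]: "\<psi> \<in> borel_measurable borel" by (rule schwartz_measurable[OF \<psi>])
  have L: "Lnorm lborel (ennreal p) (\<lambda>x. ennreal (cmod (g x))) = epow (\<integral>\<^sup>+ x. ennreal (cmod (g x) powr p) \<partial>lborel) (1 / p)"
    using pq by (simp add: Lnorm_finite_exponent epow_ennreal)
  show "ennreal (b / Q) \<le> Lnorm lborel (ennreal p) (\<lambda>x. ennreal (cmod (g x)))"
  proof (cases "(\<integral>\<^sup>+ x. ennreal (cmod (g x) powr p) \<partial>lborel) = \<infinity>")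
    case True
    then show ?thesis unfolding L by (simp add: epow_def)
  next
    case False
    have ig: "integrable lborel (\<lambda>x. cmod (g x) powr p)"
      using False by (intro integrableI_bounded) (auto simp: top.not_eq_extremum)
    let ?G = "LINT x|lborel. cmod (g x) powr p"
    have G0: "0 \<le> ?G" by simp
    have L': "Lnorm lborel (ennreal p) (\<lambda>x. ennreal (cmod (g x))) = ennreal (?G powr (1 / p))"
      unfolding L using ig by (subst nn_integral_eq_integral) (auto simp: epow_ennreal)
    have "b \<le> (LINT x|lborel. cmod (g x) * cmod (\<psi> x))"
      using b integral_norm_bound[of lborel "\<lambda>x. g x * \<psi> x"] unfolding T by (simp add: norm_mult)
    also have "\<dots> \<le> ?G powr (1 / p) * (LINT x|lborel. cmod (\<psi> x) powr q) powr (1 / q)"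
      by (rule Holder_integral(2)[OF pq]) (use ig Q in auto)
    also have "\<dots> \<le> ?G powr (1 / p) * Q" using Q by (intro mult_left_mono) auto
    finally have "b / Q \<le> ?G powr (1 / p)" using Q by (simp add: pos_divide_le_eq)
    then show ?thesis unfolding L' by (rule ennreal_leI)
  qed
qed

text \<open>A single block suffices. It is tested with the derivative of k(2^j x), k being the
  kernel of phi; the block maps this to the derivative of G(2^j x), to which
  \<open>steep_hat_test_bound\<close> applies. The L^q norm of the test function grows like 2^(j/p),
  so the L^p norm of the block is at least of order h 2^(-j/p).\<close>

theorem besov_norm_steep_hat:
  assumes lp: "littlewood_paley_pair chi phi" and p: "p > 1" and r: "r \<ge> 1"
  shows "\<exists>c>0. \<exists>N. \<forall>j\<ge>N. \<forall>h>0.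
    ennreal (c * h * 2 powr (real j * (s - 1 / p))) \<le> besov_norm chi phi s (ennreal p) r (distr_of (\<lambda>x. - steep_hat h (1 / 4 ^ j) x))"
proof -
  note mult = littlewood_paley_multipliers[OF lp]
  let ?k = "multiplier_kernel phi"
  define q where "q = p / (p - 1)"
  have q: "q > 1" "1 / p + 1 / q = 1" using p by (auto simp: q_def field_simps)
  have k: "?k \<in> schwartz" by (rule multiplier_kernel_schwartz[OF mult(2)])
  obtain \<xi> where "phi \<xi> \<noteq> 0" using mult(5) by blast
  then obtain z\<^sub>0 where z0: "?k z\<^sub>0 \<noteq> 0" using multiplier_kernel_nonzero[OF mult(2)] by blast
  \<comment> \<open>G is the convolution of the kernel with itself, whose value at the origin is the
    integral of |k|^2 and hence positive.\<close>
  define G where "G = fourier (\<lambda>\<xi>. of_real (phi \<xi>) * inv_fourier ?k \<xi>)"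
  have G: "G \<in> schwartz" unfolding G_def by (intro fourier_schwartz multiplier_mult_schwartz inv_fourier_schwartz mult k)
  have Gx: "G x = (LINT y|lborel. ?k (x - y) * ?k y)" for x
    unfolding G_def by (rule fourier_multiplier_convolution[OF mult(2) k])
  have "G 0 = (LINT y|lborel. complex_of_real ((cmod (?k y))\<^sup>2))"
    unfolding Gx by (rule Bochner_Integration.integral_cong)
      (simp_all add: multiplier_kernel_cnj complex_norm_square mult.commute del: of_real_power)
  then have G0: "G 0 = complex_of_real (LINT y|lborel. (cmod (?k y))\<^sup>2)" by (simp only: integral_complex_of_real)
  have "0 < (LINT y|lborel. (cmod (?k y))\<^sup>2)"
  proof (rule integral_continuous_pos[of _ z\<^sub>0])
    obtain C where "\<And>x. cmod (?k x) \<le> C" using schwartz_bound[OF k, of 0] by auto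
    then have "integrable lborel (\<lambda>x. cnj (?k x) * ?k x)"
      by (intro integrable_bounded_mult[OF schwartz_integrable[OF k], where B = C]) (use schwartz_measurable[OF k] in \<open>auto simp: multiplier_kernel_cnj[symmetric]\<close>)
    then have "integrable lborel (\<lambda>x. complex_of_real ((cmod (?k x))\<^sup>2))"
      by (simp add: complex_norm_square mult.commute del: of_real_power)
    then show "integrable lborel (\<lambda>x. (cmod (?k x))\<^sup>2)" by (simp only: complex_of_real_integrable_eq)
    show "continuous_on UNIV (\<lambda>x. (cmod (?k x))\<^sup>2)"
      by (intro continuous_intros smooth_continuous schwartz_smooth k)
  qed (use z0 in auto)
  then have G0n: "G 0 \<noteq> 0" using G0 by simp
  obtain N where N: "\<And>j h. N \<le> j \<Longrightarrow> h > 0 \<Longrightarrow> h * cmod (G 0) / 2 \<le>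
    cmod (LINT x|lborel. complex_of_real (steep_hat h (1 / 4 ^ j) x) * dderiv 1 (\<lambda>x. G (2 ^ j * x)) x)"
    using steep_hat_test_bound[OF G G0n] by blast
  let ?dk = "dderiv 1 ?k"
  have dk: "?dk \<in> schwartz" by (rule schwartz_dderiv[OF k])
  have [measurable]: "?dk \<in> borel_measurable borel" by (rule schwartz_measurable[OF dk])
  have idk: "integrable lborel (\<lambda>x. cmod (?dk x) powr q)"
  proof -
    obtain C where C: "\<And>x. cmod (?dk x) \<le> C" using schwartz_bound[OF dk, of 0] by auto
    show ?thesis
    proof (rule integrable_bounded_by)
      show "integrable lborel (\<lambda>x. C powr (q - 1) * cmod (?dk x))" using schwartz_integrable[OF dk] by auto
      show "norm (cmod (?dk x) powr q) \<le> C powr (q - 1) * cmod (?dk x)" for x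
      proof -
        have "cmod (?dk x) powr q = cmod (?dk x) powr (q - 1) * cmod (?dk x)"
          using powr_add[of "cmod (?dk x)" "q - 1" 1] by simp
        also have "\<dots> \<le> C powr (q - 1) * cmod (?dk x)" using C q by (intro mult_right_mono powr_mono2) auto
        finally show ?thesis by simp
      qed
    qed measurable
  qed
  define \<kappa> where "\<kappa> = (LINT x|lborel. cmod (?dk x) powr q) powr (1 / q) + 1"
  have \<kappa>: "\<kappa> > 0" unfolding \<kappa>_def by (smt (verit) powr_ge_zero)
  define c where "c = cmod (G 0) / (2 * \<kappa>)"
  show ?thesis
  proof (rule exI[of _ c], intro conjI exI[of _ N] allI impI)
    show "c > 0" using G0n \<kappa> by (simp add: c_def)
    fix j and h :: real assume j: "N \<le> j" and h: "h > 0"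
    define a where "a = (2::real) ^ j"
    have a: "a > 0" by (simp add: a_def)
    let ?u = "\<lambda>x. - steep_hat h (1 / 4 ^ j) x"
    let ?m = "block_multiplier chi phi (int j)"
    have m: "multiplier ?m" by (rule block_multiplier_multiplier[OF lp]) simp
    define \<eta> where "\<eta> = (\<lambda>x. ?k (a * x))"
    have \<eta>: "\<eta> \<in> schwartz" unfolding \<eta>_def using a by (intro schwartz_scale k) auto
    have d\<eta>: "dderiv 1 \<eta> = (\<lambda>x. a *\<^sub>R ?dk (a * x))"
    proof (rule dderiv_1_eq)
      fix x
      have "((\<lambda>x. a * x) has_vector_derivative a) (at x)" by (auto intro!: derivative_eq_intros)
      from vector_diff_chain_at[OF this smooth_deriv[OF schwartz_smooth[OF k]]]
      show "(\<eta> has_vector_derivative a *\<^sub>R ?dk (a * x)) (at x)" by (simp add: \<eta>_def o_def)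
    qed
    have Ga: "fourier (\<lambda>\<xi>. of_real (?m \<xi>) * inv_fourier \<eta> \<xi>) = (\<lambda>x. G (a * x))"
    proof
      fix x
      have "fourier (\<lambda>\<xi>. of_real (?m \<xi>) * inv_fourier \<eta> \<xi>) x = (LINT y|lborel. a * (?k (a * x - a * y) * ?k (a * y)))"
        by (subst fourier_multiplier_convolution[OF m \<eta>]) (simp add: block_kernel_eq \<eta>_def a_def right_diff_distrib mult.assoc)
      also have "\<dots> = a *\<^sub>R (LINT y|lborel. ?k (a * x - (0 + a * y)) * ?k (0 + a * y))"
        by (subst integral_mult_right_zero) (simp add: scaleR_conv_of_real)
      also have "\<dots> = G (a * x)"
        using lborel_integral_real_affine[of a "\<lambda>y. ?k (a * x - y) * ?k y" 0] a unfolding Gx by simp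
      finally show "fourier (\<lambda>\<xi>. of_real (?m \<xi>) * inv_fourier \<eta> \<xi>) x = G (a * x)" .
    qed
    have mS: "(\<lambda>\<xi>. of_real (?m \<xi>) * inv_fourier \<eta> \<xi>) \<in> schwartz"
      by (intro multiplier_mult_schwartz m inv_fourier_schwartz \<eta>)
    have "fourier (\<lambda>\<xi>. of_real (?m \<xi>) * inv_fourier (dderiv 1 \<eta>) \<xi>) = fourier (\<lambda>\<xi>. - \<i> * (of_real \<xi> * (of_real (?m \<xi>) * inv_fourier \<eta> \<xi>)))"
      by (simp add: inv_fourier_dderiv[OF \<eta>] mult_ac)
    also have "\<dots> = dderiv 1 (\<lambda>x. G (a * x))"
      unfolding Ga[symmetric] by (rule dderiv_1_eq[symmetric], rule fourier_has_vector_derivative[OF mS])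
    finally have "lp_block chi phi (int j) (distr_of ?u) (dderiv 1 \<eta>) =
      - (LINT x|lborel. complex_of_real (steep_hat h (1 / 4 ^ j) x) * dderiv 1 (\<lambda>x. G (a * x)) x)"
      by (subst lp_block_distr_of[OF m schwartz_dderiv[OF \<eta>]]) simp
    then have b: "h * cmod (G 0) / 2 \<le> cmod (lp_block chi phi (int j) (distr_of ?u) (dderiv 1 \<eta>))"
      using N[OF j h] by (simp add: a_def)
    have pw: "cmod (dderiv 1 \<eta> x) powr q = a powr q * cmod (?dk (0 + a * x)) powr q" for x
      using a by (simp add: d\<eta> powr_mult)
    have i\<eta>: "integrable lborel (\<lambda>x. cmod (dderiv 1 \<eta> x) powr q)"
      unfolding pw using a by (intro integrable_mult_right lborel_integrable_real_affine[OF idk]) auto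
    have "(LINT x|lborel. cmod (dderiv 1 \<eta> x) powr q) = a powr q / a * (LINT x|lborel. cmod (?dk x) powr q)"
      unfolding pw using a by (subst (2) lborel_integral_real_affine[of a _ 0]) auto
    also have "a powr q / a = a powr (q - 1)" using a by (simp add: powr_diff)
    finally have "(LINT x|lborel. cmod (dderiv 1 \<eta> x) powr q) powr (1 / q) = a powr ((q - 1) / q) * (LINT x|lborel. cmod (?dk x) powr q) powr (1 / q)"
      using a by (simp add: powr_mult powr_powr)
    also have "(q - 1) / q = 1 / p" using q by (simp add: field_simps)
    also have "a powr (1 / p) * (LINT x|lborel. cmod (?dk x) powr q) powr (1 / q) \<le> a powr (1 / p) * \<kappa>"
      by (intro mult_left_mono) (auto simp: \<kappa>_def)
    finally have Q: "(LINT x|lborel. cmod (dderiv 1 \<eta> x) powr q) powr (1 / q) \<le> a powr (1 / p) * \<kappa>" .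
    have L: "ennreal (h * cmod (G 0) / 2 / (a powr (1 / p) * \<kappa>)) \<le> Lnorm_td (ennreal p) (lp_block chi phi (int j) (distr_of ?u))"
      by (rule Lnorm_td_ge[where \<psi> = "dderiv 1 \<eta>", OF p q schwartz_dderiv[OF \<eta>] i\<eta> Q])
        (use a \<kappa> b in auto)
    have ap: "a powr x = 2 powr (real j * x)" for x by (simp add: a_def powr_powr[symmetric] powr_realpow[symmetric])
    have "c * h * 2 powr (real j * (s - 1 / p)) = a powr s * (h * cmod (G 0) / 2 / (a powr (1 / p) * \<kappa>))"
      unfolding ap[symmetric] by (simp add: c_def powr_diff mult_ac)
    then have "ennreal (c * h * 2 powr (real j * (s - 1 / p))) = ennreal (a powr s) * ennreal (h * cmod (G 0) / 2 / (a powr (1 / p) * \<kappa>))"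
      using h \<kappa> by (simp add: ennreal_mult[symmetric])
    also have "\<dots> \<le> ennreal (2 powr (of_int (int j) * s)) * Lnorm_td (ennreal p) (lp_block chi phi (int j) (distr_of ?u))"
      unfolding ap of_int_of_nat_eq by (intro mult_left_mono L[unfolded ap]) simp
    also have "\<dots> \<le> besov_norm chi phi s (ennreal p) r (distr_of ?u)"
      unfolding besov_norm_def by (rule Lnorm_count_space_ge[OF r, where f = "\<lambda>j. ennreal (2 powr (of_int j * s)) * Lnorm_td (ennreal p) (lp_block chi phi j (distr_of ?u))"]) simp
    finally show "ennreal (c * h * 2 powr (real j * (s - 1 / p))) \<le> besov_norm chi phi s (ennreal p) r (distr_of ?u)" .
  qed
qed

section \<open>The exponential weight\<close>

text \<open>The rate 1/2 is smaller than the rate 3/4 at which the Green kernel is shown to decay in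
  the labels, so that integration against the kernel preserves the weight.\<close>

definition wt :: "real \<Rightarrow> real" where "wt x = exp (- \<bar>x\<bar> / 2)"

text \<open>The primitive of \<open>wt\<close> that vanishes at minus infinity, with total mass 4. A
  function whose increments are bounded by those of \<open>wt_prim\<close> is Lipschitz and has
  finite variation on the whole line, and such bounds survive pointwise limits.\<close>

definition wt_prim :: "real \<Rightarrow> real" where
  "wt_prim x = (if x \<le> 0 then 2 * exp (x / 2) else 4 - 2 * exp (- x / 2))"

lemma integral_exp_abs:
  assumes c: "c > 0"
  shows "integrable lborel (\<lambda>x::real. exp (- c * \<bar>x - a\<bar>))" "(LINT x|lborel. exp (- c * \<bar>x - a\<bar>)) = 2 / c"
proof -
  let ?f = "\<lambda>x::real. exp (- \<bar>x\<bar>)"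
  have half: "(\<integral>\<^sup>+ x. ennreal (exp (- x)) * indicator {0..} x \<partial>lborel) = 1"
    using nn_intergal_power_times_exp_Ici[of 0] by simp
  have "(\<integral>\<^sup>+ x. ennreal (?f x) \<partial>lborel) = (\<integral>\<^sup>+ x. ennreal (exp (- x)) * indicator {0..} x + ennreal (exp x) * indicator {..<0} x \<partial>lborel)"
    by (intro nn_integral_cong) (auto simp: indicator_def)
  also have "\<dots> = 1 + (\<integral>\<^sup>+ x. ennreal (exp x) * indicator {..<0} x \<partial>lborel)"
    by (subst nn_integral_add) (auto simp: half)
  also have "(\<integral>\<^sup>+ x. ennreal (exp x) * indicator {..<0} x \<partial>lborel) = (\<integral>\<^sup>+ x. ennreal (exp (- x)) * indicator {0<..} x \<partial>lborel)"
    by (subst nn_integral_real_affine[of _ "-1" 0]) (auto intro!: nn_integral_cong simp: indicator_def)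
  also have "\<dots> = (\<integral>\<^sup>+ x. ennreal (exp (- x)) * indicator {0..} x \<partial>lborel)"
  proof (rule nn_integral_cong_AE)
    show "AE x in lborel. ennreal (exp (- x)) * indicator {0<..} x = ennreal (exp (- x)) * indicator {0..} x"
      using AE_lborel_singleton[of "0::real"] by eventually_elim (auto simp: indicator_def)
  qed
  finally have nn: "(\<integral>\<^sup>+ x. ennreal (?f x) \<partial>lborel) = ennreal 2" by (simp add: half one_add_one)
  have hb: "has_bochner_integral lborel ?f 2"
    by (rule has_bochner_integral_nn_integral[OF _ _ _ nn]) auto
  have eq: "exp (- c * \<bar>x - a\<bar>) = ?f (- c * a + c * x)" for x
  proof -
    have "c * \<bar>x - a\<bar> = \<bar>c * (x - a)\<bar>" using c by (simp add: abs_mult)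
    also have "c * (x - a) = - c * a + c * x" by (simp add: algebra_simps)
    finally show ?thesis by simp
  qed
  show "integrable lborel (\<lambda>x::real. exp (- c * \<bar>x - a\<bar>))"
    unfolding eq using lborel_integrable_real_affine[of ?f c] hb c by (simp only: has_bochner_integral_iff)
  show "(LINT x|lborel. exp (- c * \<bar>x - a\<bar>)) = 2 / c"
    unfolding eq using lborel_integral_real_affine[of c ?f "- c * a"] hb c by (simp add: has_bochner_integral_iff field_simps)
qed

lemma wt_pos: "0 < wt x" and wt_le_1: "wt x \<le> 1" by (auto simp: wt_def)

lemma wt_integral: "integrable lborel wt" "(LINT x|lborel. wt x) = 4"
  using integral_exp_abs[of "1/2" 0] by (auto simp: wt_def[abs_def])

lemma wt_shift: "wt \<eta> \<le> wt \<xi> * exp (\<bar>\<xi> - \<eta>\<bar> / 2)"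
proof -
  have "- \<bar>\<eta>\<bar> / 2 \<le> - \<bar>\<xi>\<bar> / 2 + \<bar>\<xi> - \<eta>\<bar> / 2" using abs_triangle_ineq[of \<eta> "\<xi> - \<eta>"] by simp
  then show ?thesis unfolding wt_def exp_add[symmetric] by simp
qed

lemma wt_prim_bounds: "0 \<le> wt_prim x" "wt_prim x \<le> 4"
proof -
  have "0 \<le> wt_prim x \<and> wt_prim x \<le> 4"
  proof (cases "x \<le> 0")
    case True
    then have "exp (x / 2) \<le> 1" by simp
    moreover have "0 \<le> exp (x / 2)" by simp
    ultimately show ?thesis unfolding wt_prim_def if_P[OF True] by linarith
  next
    case False
    then have "exp (- x / 2) \<le> 1" by simp
    moreover have "0 \<le> exp (- x / 2)" by simp
    ultimately show ?thesis using False unfolding wt_prim_def if_not_P[OF False] by linarith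
  qed
  then show "0 \<le> wt_prim x" "wt_prim x \<le> 4" by auto
qed

lemma wt_prim_continuous: "continuous_on A wt_prim"
proof -
  have "continuous_on UNIV (\<lambda>x::real. if x \<le> 0 then 2 * exp (x / 2) else 4 - 2 * exp (- x / 2))"
    by (rule continuous_on_cases_le[where h = "\<lambda>x. x" and a = 0]; auto intro!: continuous_intros)
  then show ?thesis unfolding wt_prim_def[abs_def] by (rule continuous_on_subset) simp
qed

lemma wt_prim_deriv:
  assumes "x \<noteq> 0" shows "(wt_prim has_real_derivative wt x) (at x)"
proof (cases "x < 0")
  case True
  show ?thesis
    by (rule has_field_derivative_transform_within_open[of "\<lambda>x. 2 * exp (x / 2)" _ _ "{..<0}"])
      (use True in \<open>auto simp: wt_prim_def wt_def intro!: derivative_eq_intros\<close>)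
next
  case False
  show ?thesis
    by (rule has_field_derivative_transform_within_open[of "\<lambda>x. 4 - 2 * exp (- x / 2)" _ _ "{0<..}"])
      (use False assms in \<open>auto simp: wt_prim_def wt_def intro!: derivative_eq_intros\<close>)
qed

lemma nondecreasing_finite_exceptions:
  fixes G :: "real \<Rightarrow> real"
  assumes "finite S" "a \<le> b" "continuous_on {a..b} G"
    and D: "\<And>x. x \<in> {a<..<b} - S \<Longrightarrow> (G has_real_derivative G' x) (at x)" "\<And>x. x \<in> {a<..<b} - S \<Longrightarrow> 0 \<le> G' x"
  shows "G a \<le> G b"
proof -
  let ?g = "\<lambda>x. if x \<in> {a<..<b} - S then G' x else 0"
  have "(?g has_integral (G b - G a)) {a..b}"
    using assms by (intro fundamental_theorem_of_calculus_interior_strong[of S])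
      (auto simp: has_real_derivative_iff_has_vector_derivative[symmetric])
  then have "0 \<le> G b - G a" by (rule has_integral_nonneg) (use D in auto)
  then show ?thesis by simp
qed

lemma wt_prim_tendsto: "(wt_prim \<longlongrightarrow> 0) at_bot" "(wt_prim \<longlongrightarrow> 4) at_top"
proof -
  have "((\<lambda>x. 2 * exp (x / 2 :: real)) \<longlongrightarrow> 0) at_bot" by real_asymp
  moreover have "eventually (\<lambda>x. 2 * exp (x / 2) = wt_prim x) at_bot"
    using eventually_le_at_bot[of 0] by eventually_elim (simp add: wt_prim_def)
  ultimately show "(wt_prim \<longlongrightarrow> 0) at_bot" by (rule Lim_transform_eventually)
  have "((\<lambda>x. 4 - 2 * exp (- x / 2 :: real)) \<longlongrightarrow> 4) at_top" by real_asymp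
  moreover have "eventually (\<lambda>x. 4 - 2 * exp (- x / 2) = wt_prim x) at_top"
    using eventually_gt_at_top[of 0] by eventually_elim (simp add: wt_prim_def)
  ultimately show "(wt_prim \<longlongrightarrow> 4) at_top" by (rule Lim_transform_eventually)
qed

lemma wt_prim_mono: "mono wt_prim"
proof
  fix x y :: real assume "x \<le> y"
  then show "wt_prim x \<le> wt_prim y"
    by (intro nondecreasing_finite_exceptions[where S = "{0}" and G = wt_prim and G' = wt])
      (auto intro: wt_prim_continuous wt_prim_deriv less_imp_le wt_pos)
qed

lemma wt_prim_Lipschitz: "\<bar>wt_prim x - wt_prim y\<bar> \<le> \<bar>x - y\<bar>"
proof -
  have *: "wt_prim y - wt_prim x \<le> y - x" if "x \<le> y" for x y
  proof -
    have "x - wt_prim x \<le> y - wt_prim y"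
      by (rule nondecreasing_finite_exceptions[where S = "{0}" and G = "\<lambda>x. x - wt_prim x" and G' = "\<lambda>x. 1 - wt x"])
        (auto intro!: continuous_intros wt_prim_continuous derivative_intros wt_prim_deriv simp: wt_le_1 that)
    then show ?thesis by simp
  qed
  show ?thesis using *[of x y] *[of y x] monoD[OF wt_prim_mono, of x y] monoD[OF wt_prim_mono, of y x]
    by (cases "x \<le> y") auto
qed

text \<open>Both c times \<open>wt_prim\<close> minus F and c times \<open>wt_prim\<close> plus F
  have a nonnegative derivative off a finite set.\<close>

lemma wt_prim_dominates:
  fixes F :: "real \<Rightarrow> real"
  assumes S: "finite S" and F: "continuous_on UNIV F"
    and D: "\<And>x. x \<notin> S \<Longrightarrow> (F has_real_derivative F' x) (at x)" "\<And>x. x \<notin> S \<Longrightarrow> \<bar>F' x\<bar> \<le> c * wt x"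
  shows "\<bar>F x - F y\<bar> \<le> c * \<bar>wt_prim x - wt_prim y\<bar>"
proof -
  have *: "\<bar>F y - F x\<bar> \<le> c * (wt_prim y - wt_prim x)" if "x \<le> y" for x y
  proof -
    have c: "continuous_on {x..y} F" using F by (rule continuous_on_subset) simp
    have "c * wt_prim x - F x \<le> c * wt_prim y - F y"
    proof (rule nondecreasing_finite_exceptions[where S = "insert 0 S" and G = "\<lambda>x. c * wt_prim x - F x" and G' = "\<lambda>x. c * wt x - F' x"])
      show "((\<lambda>x. c * wt_prim x - F x) has_real_derivative c * wt z - F' z) (at z)" if "z \<in> {x<..<y} - insert 0 S" for z
        using that D(1)[of z] wt_prim_deriv[of z] by (auto intro!: derivative_eq_intros)
      show "0 \<le> c * wt z - F' z" if "z \<in> {x<..<y} - insert 0 S" for z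
        using that D(2)[of z] by auto
    qed (use S that c in \<open>auto intro!: continuous_intros wt_prim_continuous\<close>)
    moreover have "c * wt_prim x + F x \<le> c * wt_prim y + F y"
    proof (rule nondecreasing_finite_exceptions[where S = "insert 0 S" and G = "\<lambda>x. c * wt_prim x + F x" and G' = "\<lambda>x. c * wt x + F' x"])
      show "((\<lambda>x. c * wt_prim x + F x) has_real_derivative c * wt z + F' z) (at z)" if "z \<in> {x<..<y} - insert 0 S" for z
        using that D(1)[of z] wt_prim_deriv[of z] by (auto intro!: derivative_eq_intros)
      show "0 \<le> c * wt z + F' z" if "z \<in> {x<..<y} - insert 0 S" for z
        using that D(2)[of z] by auto
    qed (use S that c in \<open>auto intro!: continuous_intros wt_prim_continuous\<close>)
    ultimately show ?thesis by (simp add: algebra_simps abs_le_iff)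
  qed
  show ?thesis using *[of x y] *[of y x] monoD[OF wt_prim_mono, of x y] monoD[OF wt_prim_mono, of y x]
    by (cases "x \<le> y") (auto simp: abs_minus_commute)
qed

section \<open>Primitives\<close>

lemma integrable_indicator_Ioc [simp]: "integrable lborel (indicat_real {x<..y::real})"
  by (cases "x \<le> y") (simp_all add: integrable_indicator_iff)

lemma set_integral_atMost_diff:
  fixes f :: "real \<Rightarrow> real"
  assumes "\<And>x. set_integrable lborel {..x} f" "x \<le> y"
  shows "(LINT z:{..y}|lborel. f z) - (LINT z:{..x}|lborel. f z) = (LINT z:{x<..y}|lborel. f z)"
proof -
  have un: "{..y} = {..x} \<union> {x<..y}" using assms(2) by auto
  have i: "set_integrable lborel {x<..y} f" by (rule set_integrable_subset[OF assms(1)[of y]]) auto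
  have "(LINT z:{..y}|lborel. f z) = (LINT z:{..x}|lborel. f z) + (LINT z:{x<..y}|lborel. f z)"
    unfolding un by (rule set_integral_Un[OF _ assms(1) i]) auto
  then show ?thesis by simp
qed

lemma set_integral_bound:
  fixes f :: "real \<Rightarrow> real"
  assumes "x \<le> y" "\<And>z. z \<in> {x<..y} \<Longrightarrow> \<bar>f z\<bar> \<le> C"
  shows "\<bar>LINT z:{x<..y}|lborel. f z\<bar> \<le> C * (y - x)"
proof -
  have "norm (LINT z:{x<..y}|lborel. f z) \<le> (LINT z|lborel. indicator {x<..y} z * C)"
    unfolding set_lebesgue_integral_def
  proof (rule integral_norm_le)
    show "norm (indicator {x<..y} z *\<^sub>R f z) \<le> indicator {x<..y} z * C" for z
      using assms(2)[of z] by (cases "z \<in> {x<..y}") auto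
  qed (intro integrable_mult_left integrable_indicator_Ioc)
  then show ?thesis using assms(1) by (simp add: mult.commute)
qed

lemma set_integral_atMost_deriv:
  fixes f :: "real \<Rightarrow> real"
  assumes f: "\<And>x. set_integrable lborel {..x} f" and "isCont f x"
  shows "((\<lambda>x. LINT z:{..x}|lborel. f z) has_real_derivative f x) (at x)"
  unfolding has_field_derivative_def has_derivative_at_alt
proof (intro conjI allI impI bounded_linear_mult_right)
  fix e :: real assume "e > 0"
  then obtain d where d: "d > 0" "\<And>y. \<bar>y - x\<bar> < d \<Longrightarrow> \<bar>f y - f x\<bar> < e"
    using assms(2) unfolding continuous_at_eps_delta by (metis dist_real_def)
  let ?F = "\<lambda>x. LINT z:{..x}|lborel. f z"
  have sub: "(LINT z:{a<..b}|lborel. f z - f x) = ?F b - ?F a - f x * (b - a)" if "a \<le> b" for a b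
  proof -
    have "set_integrable lborel {a<..b} f" by (rule set_integrable_subset[OF f[of b]]) auto
    moreover have "set_integrable lborel {a<..b} (\<lambda>z. f x)" by (simp add: set_integrable_def)
    ultimately have "(LINT z:{a<..b}|lborel. f z - f x) = (LINT z:{a<..b}|lborel. f z) - (LINT z:{a<..b}|lborel. f x)"
      by (rule set_integral_diff)
    moreover have "(LINT z:{a<..b}|lborel. f x) = f x * (b - a)"
      using that by (simp add: set_lebesgue_integral_def)
    ultimately show ?thesis using set_integral_atMost_diff[OF f that] by simp
  qed
  show "\<exists>d>0. \<forall>y. norm (y - x) < d \<longrightarrow> norm (?F y - ?F x - f x * (y - x)) \<le> e * norm (y - x)"
  proof (intro exI[of _ d] conjI allI impI d)
    fix y assume y: "norm (y - x) < d"
    show "norm (?F y - ?F x - f x * (y - x)) \<le> e * norm (y - x)"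
    proof (cases "x \<le> y")
      case True
      have "\<bar>LINT z:{x<..y}|lborel. f z - f x\<bar> \<le> e * (y - x)"
        by (rule set_integral_bound[OF True]) (use d(2) y in \<open>force intro!: less_imp_le\<close>)
      then show ?thesis using True by (simp add: sub)
    next
      case False
      have "\<bar>LINT z:{y<..x}|lborel. f z - f x\<bar> \<le> e * (x - y)"
        by (rule set_integral_bound) (use d(2) y False in \<open>auto intro!: less_imp_le\<close>)
      moreover have "\<bar>?F y - ?F x - f x * (y - x)\<bar> = \<bar>?F x - ?F y - f x * (x - y)\<bar>"
        by (simp add: algebra_simps abs_minus_commute)
      ultimately show ?thesis using False sub[of y x] by (simp add: abs_minus_commute)
    qed
  qed
qed

lemma locally_Lipschitz_continuous:
  fixes F C :: "real \<Rightarrow> real"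
  assumes "\<And>(R::real) x y. x \<in> {- R..R} \<Longrightarrow> y \<in> {- R..R} \<Longrightarrow> \<bar>F x - F y\<bar> \<le> C R * \<bar>x - y\<bar>"
  shows "continuous_on A F"
proof (rule continuous_at_imp_continuous_on, rule ballI)
  fix x :: real
  define R where "R = \<bar>x\<bar> + 1"
  have "C R \<ge> 0" using assms[of "R" R "- R"] by (smt (verit) R_def atLeastAtMost_iff zero_le_mult_iff)
  have "((\<lambda>y. C R * \<bar>y - x\<bar>) \<longlongrightarrow> C R * \<bar>x - x\<bar>) (at x)" by (intro tendsto_intros)
  then have z: "((\<lambda>y. C R * \<bar>y - x\<bar>) \<longlongrightarrow> 0) (at x)" by simp
  have "eventually (\<lambda>y. y \<in> ball x 1) (at x)" by (rule eventually_at_in_open') auto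
  then have "eventually (\<lambda>y. norm (F y - F x) \<le> C R * \<bar>y - x\<bar>) (at x)"
  proof eventually_elim
    case (elim y)
    then have "\<bar>y - x\<bar> < 1" by (simp add: dist_real_def abs_minus_commute)
    then have "y \<in> {- R..R}" "x \<in> {- R..R}" unfolding R_def atLeastAtMost_iff by linarith+
    then show ?case using assms[of y R x] by simp
  qed
  from Lim_null_comparison[OF this z] show "isCont F x"
    unfolding isCont_def by (simp add: LIM_zero_iff)
qed

lemma set_integral_atMost_continuous:
  fixes f C :: "real \<Rightarrow> real"
  assumes f: "\<And>x. set_integrable lborel {..x} f" and C: "\<And>(R::real) z. z \<in> {- R..R} \<Longrightarrow> \<bar>f z\<bar> \<le> C R"
  shows "continuous_on A (\<lambda>x. LINT z:{..x}|lborel. f z)"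
proof (rule locally_Lipschitz_continuous)
  fix R x y :: real assume xy: "x \<in> {- R..R}" "y \<in> {- R..R}"
  let ?F = "\<lambda>x. LINT z:{..x}|lborel. f z"
  have *: "\<bar>?F y - ?F x\<bar> \<le> C R * (y - x)" if "x \<le> y" "x \<in> {- R..R}" "y \<in> {- R..R}" for x y
    unfolding set_integral_atMost_diff[OF f that(1)]
    by (rule set_integral_bound) (use that in \<open>auto intro!: C\<close>)
  show "\<bar>?F x - ?F y\<bar> \<le> C R * \<bar>x - y\<bar>"
    using *[of x y] *[of y x] xy by (cases "x \<le> y") (auto simp: abs_minus_commute)
qed

section \<open>Nonlocal terms in Lagrangian coordinates\<close>

text \<open>At a fixed time \<open>j\<close> stands for \<open>X\<^sub>\<xi>\<close> and \<open>w\<close> for the label derivative of the velocity;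
  \<open>slice_pos j\<close> is the position \<open>X\<close>.\<close>

definition slice_pos :: "(real \<Rightarrow> real) \<Rightarrow> real \<Rightarrow> real" where
  "slice_pos j \<xi> = \<xi> + (LINT z:{..\<xi>}|lborel. j z - 1)"

text \<open>For w = f(X) X\<xi>, with X\<xi> the label derivative of X, and an increasing X, this is
  the convolution of f with the Green function G if \<sigma> = 1, and with -G' if \<sigma> is
  \<open>side\<close>, evaluated at the position X. The Jacobian is absorbed into w and never
  inverted.\<close>

definition nonlocal :: "(real \<Rightarrow> real \<Rightarrow> real) \<Rightarrow> (real \<Rightarrow> real) \<Rightarrow> (real \<Rightarrow> real) \<Rightarrow> real \<Rightarrow> real" where
  "nonlocal \<sigma> j w \<xi> = (LINT \<eta>|lborel. \<sigma> \<xi> \<eta> * exp (- \<bar>slice_pos j \<xi> - slice_pos j \<eta>\<bar>) * w \<eta>) / 2"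

definition side :: "real \<Rightarrow> real \<Rightarrow> real" where "side \<xi> \<eta> = (if \<eta> \<le> \<xi> then 1 else - 1)"

abbreviation nl_sum where "nl_sum \<equiv> nonlocal (\<lambda>_ _. 1)"
abbreviation nl_diff where "nl_diff \<equiv> nonlocal side"

text \<open>On the labels (0,1), the stretched edge, the Jacobian j is only assumed nonnegative; the
  lower bound 3/4 is asked elsewhere. All constants derived here are therefore uniform in
  \<epsilon>.\<close>

locale slice =
  fixes h :: real and j w :: "real \<Rightarrow> real"
  assumes h: "0 < h" "h \<le> 1"
    and jm[measurable]: "j \<in> borel_measurable borel" and wm[measurable]: "w \<in> borel_measurable borel"
    and j0: "\<And>\<xi>. 0 \<le> j \<xi>" and j1: "\<And>\<xi>. j \<xi> \<le> 5 / 4"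
    and j2: "\<And>\<xi>. \<xi> \<notin> {0<..<1} \<Longrightarrow> 3 / 4 \<le> j \<xi>"
    and j3: "\<And>\<xi>. \<bar>j \<xi> - 1\<bar> \<le> 3 * wt \<xi>"
    and w: "\<And>\<xi>. \<bar>w \<xi>\<bar> \<le> 4 * h * wt \<xi>"
begin

lemma j_int: "integrable lborel (\<lambda>z. j z - 1)"
  by (rule integrable_bounded_by[OF integrable_mult_right[OF wt_integral(1), of 3]]) (use j3 in auto)

lemma j_sint: "set_integrable lborel A (\<lambda>z. j z - 1)" if "A \<in> sets borel"
  unfolding set_integrable_def by (intro integrable_mult_indicator j_int) (use that in simp)

lemma w_int: "integrable lborel w"
  by (rule integrable_bounded_by[OF integrable_mult_right[OF wt_integral(1), of "4 * h"]]) (use w in auto)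

lemma j_ivl_int: "set_integrable lborel {x<..y} j"
proof -
  have "set_integrable lborel {x<..y} (\<lambda>z. (j z - 1) + 1)"
    by (rule set_integral_add(1)[OF j_sint]) (auto simp: set_integrable_def)
  then show ?thesis by simp
qed

lemma pos_diff: "x \<le> y \<Longrightarrow> slice_pos j y - slice_pos j x = (LINT z:{x<..y}|lborel. j z)"
proof -
  assume xy: "x \<le> y"
  have "(LINT z:{x<..y}|lborel. j z) = (LINT z:{x<..y}|lborel. j z - 1) + (LINT z:{x<..y}|lborel. 1)"
    using set_integral_add(2)[OF j_sint, of "{x<..y}" "\<lambda>_. 1"] by (auto simp: set_integrable_def)
  also have "(LINT z:{x<..y}|lborel. 1) = y - x" using xy by (simp add: set_lebesgue_integral_def)
  also have "(LINT z:{x<..y}|lborel. j z - 1) = (LINT z:{..y}|lborel. j z - 1) - (LINT z:{..x}|lborel. j z - 1)"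
    by (rule set_integral_atMost_diff[symmetric, OF _ xy]) (simp add: j_sint)
  finally show ?thesis by (simp add: slice_pos_def)
qed

lemma pos_lower:
  assumes "x \<le> y" "\<And>z. z \<in> {x<..y} \<Longrightarrow> m \<le> j z"
  shows "m * (y - x) \<le> slice_pos j y - slice_pos j x"
proof -
  have "m * (y - x) = (LINT z:{x<..y}|lborel. m)" using assms(1) by (simp add: set_lebesgue_integral_def)
  also have "\<dots> \<le> (LINT z:{x<..y}|lborel. j z)"
  proof (rule set_integral_mono[OF _ j_ivl_int])
    show "set_integrable lborel {x<..y} (\<lambda>z. m)"
      unfolding set_integrable_def by (intro integrable_scaleR_left integrable_indicator_Ioc)
  qed (use assms(2) in simp)
  finally show ?thesis using pos_diff[OF assms(1)] by simp
qed

lemma pos_mono: "x \<le> y \<Longrightarrow> slice_pos j x \<le> slice_pos j y"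
  using pos_lower[of x y 0] j0 by simp

lemma pos_upper: "x \<le> y \<Longrightarrow> slice_pos j y - slice_pos j x \<le> 5 / 4 * (y - x)"
proof -
  assume xy: "x \<le> y"
  have "(LINT z:{x<..y}|lborel. j z) \<le> (LINT z:{x<..y}|lborel. 5 / 4)"
  proof (rule set_integral_mono[OF j_ivl_int])
    show "set_integrable lborel {x<..y} (\<lambda>z. 5 / 4 :: real)"
      unfolding set_integrable_def by (intro integrable_scaleR_left integrable_indicator_Ioc)
  qed (use j1 in simp)
  also have "\<dots> = 5 / 4 * (y - x)" using xy by (simp add: set_lebesgue_integral_def)
  finally show ?thesis using pos_diff[OF xy] by simp
qed

lemma pos_Lipschitz: "\<bar>slice_pos j x - slice_pos j y\<bar> \<le> 5 / 4 * \<bar>x - y\<bar>"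
  using pos_upper[of x y] pos_upper[of y x] pos_mono[of x y] pos_mono[of y x] by (cases "x \<le> y") auto

lemma pos_continuous: "continuous_on A (slice_pos j)"
  by (rule locally_Lipschitz_continuous[where C = "\<lambda>_. 5 / 4"]) (rule pos_Lipschitz)

lemma pos_measurable[measurable]: "slice_pos j \<in> borel_measurable borel"
  by (rule borel_measurable_continuous_onI[OF pos_continuous])

text \<open>Labels at which j may degenerate have total length one, so they cost at most 3/4 of
  distance in all. In the exponential this is a factor below 3.\<close>

lemma pos_far: "3 / 4 * \<bar>x - y\<bar> - 3 / 4 \<le> \<bar>slice_pos j x - slice_pos j y\<bar>"
proof -
  have *: "3 / 4 * (y - x) - 3 / 4 \<le> slice_pos j y - slice_pos j x" if xy: "x \<le> y" for x y
  proof -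
    have i01: "integrable lborel (\<lambda>z::real. 3 / 4 * indicator {0<..<1} z :: real)"
      by (intro integrable_mult_right) (simp add: integrable_indicator_iff)
    have i: "set_integrable lborel {x<..y} (\<lambda>z. 3 / 4 * indicator {0<..<1} z :: real)"
      "set_integrable lborel {x<..y} (\<lambda>z. 3 / 4 :: real)"
      unfolding set_integrable_def
      by (intro integrable_mult_indicator i01 integrable_scaleR_left integrable_indicator_Ioc; simp)+
    have "(LINT z:{x<..y}|lborel. (3 / 4 :: real) - 3 / 4 * indicator {0<..<1} z) \<le> (LINT z:{x<..y}|lborel. j z)"
      by (rule set_integral_mono) (use j_ivl_int j2 j0 i in \<open>auto simp: indicator_def intro!: set_integral_diff\<close>)
    also have "(LINT z:{x<..y}|lborel. (3 / 4 :: real) - 3 / 4 * indicator {0<..<1} z) = (LINT z:{x<..y}|lborel. 3 / 4) - (LINT z:{x<..y}|lborel. 3 / 4 * indicator {0<..<1} z)"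
      using i by (intro set_integral_diff)
    also have "(LINT z:{x<..y}|lborel. 3 / 4) = 3 / 4 * (y - x)" using xy by (simp add: set_lebesgue_integral_def)
    finally have a: "3 / 4 * (y - x) - (LINT z:{x<..y}|lborel. 3 / 4 * indicator {0<..<1} z) \<le> slice_pos j y - slice_pos j x"
      by (simp add: pos_diff[OF xy])
    have "(LINT z:{x<..y}|lborel. (3 / 4 :: real) * indicator {0<..<1} z) \<le> (LINT z|lborel. (3 / 4 :: real) * indicator {0<..<1::real} z)"
      unfolding set_lebesgue_integral_def
    proof (rule integral_mono)
      show "integrable lborel (\<lambda>z. indicator {x<..y} z *\<^sub>R ((3 / 4 :: real) * indicator {0<..<1} z))"
        using i(1) by (simp add: set_integrable_def)
      show "integrable lborel (\<lambda>z. (3 / 4 :: real) * indicator {0<..<1::real} z)" by (rule i01)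
    qed (auto simp: indicator_def)
    also have "\<dots> = 3 / 4" by simp
    finally show ?thesis using a by linarith
  qed
  show ?thesis using *[of x y] *[of y x] by (cases "x \<le> y") (auto simp: abs_if split: if_splits)
qed

lemma kernel_bound: "exp (- \<bar>slice_pos j \<xi> - slice_pos j \<eta>\<bar>) \<le> 3 * exp (- (3 / 4) * \<bar>\<xi> - \<eta>\<bar>)"
proof -
  have "exp (- \<bar>slice_pos j \<xi> - slice_pos j \<eta>\<bar>) \<le> exp (3 / 4 + - (3 / 4) * \<bar>\<xi> - \<eta>\<bar>)"
    using pos_far[of \<xi> \<eta>] by simp
  also have "\<dots> = exp (3 / 4) * exp (- (3 / 4) * \<bar>\<xi> - \<eta>\<bar>)" by (rule exp_add)
  also have "\<dots> \<le> 3 * exp (- (3 / 4) * \<bar>\<xi> - \<eta>\<bar>)"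
  proof (rule mult_right_mono)
    have "exp (3 / 4) \<le> exp (1::real)" by simp
    then show "exp (3 / 4) \<le> (3::real)" using exp_le by linarith
  qed simp
  finally show ?thesis .
qed

text \<open>The bound is 3 times the mass 4 of the weight. It makes weights and supports in labels
  and in positions comparable.\<close>

lemma pos_near: "\<bar>slice_pos j \<xi> - \<xi>\<bar> \<le> 12"
proof -
  have "norm (LINT z:{..\<xi>}|lborel. j z - 1) \<le> (LINT z|lborel. 3 * wt z)"
    unfolding set_lebesgue_integral_def
    by (rule integral_norm_le) (use j3 wt_integral wt_pos in \<open>auto simp: indicator_def less_imp_le\<close>)
  then show ?thesis by (simp add: slice_pos_def wt_integral)
qed

lemma nonlocal_integrable:
  assumes [measurable]: "\<sigma> \<xi> \<in> borel_measurable borel" and \<sigma>: "\<And>\<eta>. \<bar>\<sigma> \<xi> \<eta>\<bar> \<le> 1"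
  shows "integrable lborel (\<lambda>\<eta>. \<sigma> \<xi> \<eta> * exp (- \<bar>slice_pos j \<xi> - slice_pos j \<eta>\<bar>) * w \<eta>)"
proof (rule integrable_bounded_by[OF integrable_abs[OF w_int]])
  fix \<eta>
  have "\<bar>\<sigma> \<xi> \<eta>\<bar> * exp (- \<bar>slice_pos j \<xi> - slice_pos j \<eta>\<bar>) * \<bar>w \<eta>\<bar> \<le> 1 * 1 * \<bar>w \<eta>\<bar>"
    by (intro mult_mono \<sigma>) auto
  then show "norm (\<sigma> \<xi> \<eta> * exp (- \<bar>slice_pos j \<xi> - slice_pos j \<eta>\<bar>) * w \<eta>) \<le> \<bar>w \<eta>\<bar>" by (simp add: abs_mult)
qed measurable

text \<open>Moving the weight from \<eta> to \<xi> costs the rate 1/2 out of 3/4; the remaining 1/4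
  is still integrable.\<close>

lemma wt_kernel: "exp (- (3 / 4) * \<bar>\<xi> - \<eta>\<bar>) * wt \<eta> \<le> wt \<xi> * exp (- (1 / 4) * \<bar>\<eta> - \<xi>\<bar>)"
proof -
  have "exp (- (3 / 4) * \<bar>\<xi> - \<eta>\<bar>) * wt \<eta> \<le> exp (- (3 / 4) * \<bar>\<xi> - \<eta>\<bar>) * (wt \<xi> * exp (\<bar>\<xi> - \<eta>\<bar> / 2))"
    by (intro mult_left_mono wt_shift) simp
  also have "\<dots> = wt \<xi> * exp (- (3 / 4) * \<bar>\<xi> - \<eta>\<bar> + \<bar>\<xi> - \<eta>\<bar> / 2)" by (simp only: exp_add mult_ac)
  also have "- (3 / 4) * \<bar>\<xi> - \<eta>\<bar> + \<bar>\<xi> - \<eta>\<bar> / 2 = - (1 / 4) * \<bar>\<eta> - \<xi>\<bar>" by (simp add: abs_minus_commute)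
  finally show ?thesis .
qed

text \<open>48 = 3 * 4 * 8 / 2: the kernel factor, the bound for w, the mass of exp(-|.|/4), and the
  factor 1/2 of the Green function.\<close>

lemma nonlocal_bound:
  assumes \<sigma>: "\<And>\<eta>. \<bar>\<sigma> \<xi> \<eta>\<bar> \<le> 1"
  shows "\<bar>nonlocal \<sigma> j w \<xi>\<bar> \<le> 48 * h * wt \<xi>"
proof -
  have "norm (LINT \<eta>|lborel. \<sigma> \<xi> \<eta> * exp (- \<bar>slice_pos j \<xi> - slice_pos j \<eta>\<bar>) * w \<eta>)
     \<le> (LINT \<eta>|lborel. 12 * h * wt \<xi> * exp (- (1 / 4) * \<bar>\<eta> - \<xi>\<bar>))"
  proof (rule integral_norm_le)
    show "integrable lborel (\<lambda>\<eta>. 12 * h * wt \<xi> * exp (- (1 / 4) * \<bar>\<eta> - \<xi>\<bar>))"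
      by (intro integrable_mult_right integral_exp_abs) simp
    fix \<eta>
    have "\<bar>\<sigma> \<xi> \<eta>\<bar> * exp (- \<bar>slice_pos j \<xi> - slice_pos j \<eta>\<bar>) * \<bar>w \<eta>\<bar> \<le> 1 * (3 * exp (- (3 / 4) * \<bar>\<xi> - \<eta>\<bar>)) * (4 * h * wt \<eta>)"
      by (intro mult_mono \<sigma> kernel_bound w) auto
    also have "\<dots> = 12 * h * (exp (- (3 / 4) * \<bar>\<xi> - \<eta>\<bar>) * wt \<eta>)" by simp
    also have "\<dots> \<le> 12 * h * (wt \<xi> * exp (- (1 / 4) * \<bar>\<eta> - \<xi>\<bar>))" using h by (intro mult_left_mono wt_kernel) simp
    finally show "norm (\<sigma> \<xi> \<eta> * exp (- \<bar>slice_pos j \<xi> - slice_pos j \<eta>\<bar>) * w \<eta>) \<le> 12 * h * wt \<xi> * exp (- (1 / 4) * \<bar>\<eta> - \<xi>\<bar>)"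
      by (simp add: abs_mult)
  qed
  also have "\<dots> = 12 * h * wt \<xi> * 8" using integral_exp_abs(2)[of "1/4" \<xi>] by simp
  finally show ?thesis by (simp add: nonlocal_def)
qed

lemma exp_pos_integrable: "set_integrable lborel {..x} (\<lambda>z. exp (slice_pos j z) * w z)"
  unfolding set_integrable_def
proof (rule integrable_bounded_by[OF integrable_mult_right[OF integrable_abs[OF w_int], of "exp (slice_pos j x)"]])
  show "norm (indicator {..x} z *\<^sub>R (exp (slice_pos j z) * w z)) \<le> exp (slice_pos j x) * \<bar>w z\<bar>" for z
    using pos_mono[of z x] by (auto simp: indicator_def abs_mult intro!: mult_right_mono)
qed measurable

lemma exp_neg_pos_integrable: "set_integrable lborel {..x} (\<lambda>z. exp (- slice_pos j (- z)) * w (- z))"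
  unfolding set_integrable_def
proof (rule integrable_bounded_by)
  show "integrable lborel (\<lambda>z. exp (- slice_pos j (- x)) * \<bar>w (- z)\<bar>)"
    using lborel_integrable_real_affine[OF integrable_abs[OF w_int], of "-1" 0] by (intro integrable_mult_right) simp
  show "norm (indicator {..x} z *\<^sub>R (exp (- slice_pos j (- z)) * w (- z))) \<le> exp (- slice_pos j (- x)) * \<bar>w (- z)\<bar>" for z
    using pos_mono[of "- x" "- z"] by (auto simp: indicator_def abs_mult intro!: mult_right_mono)
qed measurable

text \<open>Splitting the integral at \<eta> = \<xi> makes the kernel a product of a function of
  \<xi> and one of \<eta>, so nonlocal terms become primitives that the fundamental theorem
  differentiates. The right half is reflected, to be a primitive from minus infinity as well, and is
  evaluated at -\<xi>.\<close>

definition "left_part \<xi> = (LINT z:{..\<xi>}|lborel. exp (slice_pos j z) * w z)"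
definition "right_part \<xi> = (LINT z:{..\<xi>}|lborel. exp (- slice_pos j (- z)) * w (- z))"

lemma w_le: "\<bar>w z\<bar> \<le> 4 * h"
proof -
  have "4 * h * wt z \<le> 4 * h * 1" using h wt_le_1[of z] by (intro mult_left_mono) auto
  then show ?thesis using w[of z] by simp
qed

lemma parts_continuous: "continuous_on A left_part" "continuous_on A right_part"
proof -
  have l: "\<bar>exp (slice_pos j z) * w z\<bar> \<le> exp (12 + R) * (4 * h)" if "z \<in> {- R..R}" for R z
    using pos_near[of z] that w_le[of z] unfolding abs_mult by (intro mult_mono) auto
  have r: "\<bar>exp (- slice_pos j (- z)) * w (- z)\<bar> \<le> exp (12 + R) * (4 * h)" if "z \<in> {- R..R}" for R z
    using pos_near[of "- z"] that w_le[of "- z"] unfolding abs_mult by (intro mult_mono) auto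
  show "continuous_on A left_part" unfolding left_part_def[abs_def]
    by (rule set_integral_atMost_continuous[OF exp_pos_integrable l])
  show "continuous_on A right_part" unfolding right_part_def[abs_def]
    by (rule set_integral_atMost_continuous[OF exp_neg_pos_integrable r])
qed

lemma nonlocal_split:
  assumes \<sigma>: "\<And>\<eta>. \<sigma> \<xi> \<eta> = (if \<eta> \<le> \<xi> then 1 else c)"
  shows "nonlocal \<sigma> j w \<xi> = (exp (- slice_pos j \<xi>) * left_part \<xi> + c * (exp (slice_pos j \<xi>) * right_part (- \<xi>))) / 2"
proof -
  let ?l = "\<lambda>\<eta>. indicator {..\<xi>} \<eta> *\<^sub>R (exp (slice_pos j \<eta>) * w \<eta>)"
  let ?r = "\<lambda>\<eta>. indicator {..- \<xi>} (- \<eta>) *\<^sub>R (exp (- slice_pos j \<eta>) * w \<eta>)"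
  have l: "integrable lborel ?l" using exp_pos_integrable by (simp add: set_integrable_def)
  have r0: "integrable lborel (\<lambda>z. indicator {..- \<xi>} z *\<^sub>R (exp (- slice_pos j (- z)) * w (- z)))"
    using exp_neg_pos_integrable by (simp add: set_integrable_def)
  have r: "integrable lborel ?r" using lborel_integrable_real_affine[OF r0, of "-1" 0] by simp
  have R: "(LINT \<eta>|lborel. ?r \<eta>) = right_part (- \<xi>)"
    unfolding right_part_def set_lebesgue_integral_def
    by (subst lborel_integral_real_affine[of "-1" _ 0]) simp_all
  have "(LINT \<eta>|lborel. \<sigma> \<xi> \<eta> * exp (- \<bar>slice_pos j \<xi> - slice_pos j \<eta>\<bar>) * w \<eta>)
     = (LINT \<eta>|lborel. exp (- slice_pos j \<xi>) * ?l \<eta> + c * exp (slice_pos j \<xi>) * ?r \<eta>)"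
  proof (rule integral_cong_AE)
    show "AE \<eta> in lborel. \<sigma> \<xi> \<eta> * exp (- \<bar>slice_pos j \<xi> - slice_pos j \<eta>\<bar>) * w \<eta>
       = exp (- slice_pos j \<xi>) * ?l \<eta> + c * exp (slice_pos j \<xi>) * ?r \<eta>"
      using AE_lborel_singleton[of \<xi>]
    proof eventually_elim
      case (elim \<eta>)
      show ?case
      proof (cases "\<eta> < \<xi>")
        case True
        then show ?thesis using pos_mono[of \<eta> \<xi>] by (simp add: \<sigma> exp_diff exp_minus field_simps)
      next
        case False
        then show ?thesis using pos_mono[of \<xi> \<eta>] elim by (simp add: \<sigma> exp_diff exp_minus field_simps)
      qed
    qed
    have "\<sigma> \<xi> = (\<lambda>\<eta>. if \<eta> \<le> \<xi> then 1 else c)" by (rule ext) (rule \<sigma>)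
    then show "(\<lambda>\<eta>. \<sigma> \<xi> \<eta> * exp (- \<bar>slice_pos j \<xi> - slice_pos j \<eta>\<bar>) * w \<eta>) \<in> borel_measurable lborel"
      by simp
    show "(\<lambda>\<eta>. exp (- slice_pos j \<xi>) * ?l \<eta> + c * exp (slice_pos j \<xi>) * ?r \<eta>) \<in> borel_measurable lborel"
      using l r by (intro borel_measurable_add borel_measurable_times) auto
  qed
  also have "\<dots> = exp (- slice_pos j \<xi>) * (LINT \<eta>|lborel. ?l \<eta>) + c * exp (slice_pos j \<xi>) * (LINT \<eta>|lborel. ?r \<eta>)"
    by (subst Bochner_Integration.integral_add[OF integrable_mult_right[OF l] integrable_mult_right[OF r]]) simp
  finally show ?thesis
    unfolding R nonlocal_def left_part_def set_lebesgue_integral_def by (simp add: mult.assoc)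
qed

lemma nl_sum_eq: "nl_sum j w \<xi> = (exp (- slice_pos j \<xi>) * left_part \<xi> + exp (slice_pos j \<xi>) * right_part (- \<xi>)) / 2"
  using nonlocal_split[of "\<lambda>_ _. 1" \<xi> 1] by simp

lemma nl_diff_eq: "nl_diff j w \<xi> = (exp (- slice_pos j \<xi>) * left_part \<xi> - exp (slice_pos j \<xi>) * right_part (- \<xi>)) / 2"
  using nonlocal_split[of side \<xi> "-1"] by (simp add: side_def)

lemma nl_sum_bound: "\<bar>nl_sum j w \<xi>\<bar> \<le> 48 * h * wt \<xi>" by (rule nonlocal_bound) simp
lemma nl_diff_bound: "\<bar>nl_diff j w \<xi>\<bar> \<le> 48 * h * wt \<xi>" by (rule nonlocal_bound) (simp add: side_def)

lemma nl_continuous: "continuous_on A (nl_sum j w)" "continuous_on A (nl_diff j w)"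
  unfolding nl_sum_eq[abs_def] nl_diff_eq[abs_def]
  by (intro continuous_intros pos_continuous parts_continuous
      continuous_on_compose2[OF parts_continuous(2)[of UNIV], of A uminus]; simp)+

lemma pos_deriv:
  assumes "isCont j \<xi>" shows "(slice_pos j has_real_derivative j \<xi>) (at \<xi>)"
  unfolding slice_pos_def[abs_def]
  using set_integral_atMost_deriv[OF j_sint, of \<xi>] assms
  by (auto intro!: derivative_eq_intros continuous_intros)

text \<open>The Lagrangian form of G'' = G minus the unit mass at the origin; the term w comes from
  the change of sign across the diagonal.\<close>

lemma nl_deriv:
  assumes c: "isCont j \<xi>" "isCont w \<xi>"
  shows "(nl_sum j w has_real_derivative - (j \<xi> * nl_diff j w \<xi>)) (at \<xi>)"
    and "(nl_diff j w has_real_derivative w \<xi> - j \<xi> * nl_sum j w \<xi>) (at \<xi>)"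
proof -
  have cp: "isCont (slice_pos j) x" for x
    using pos_continuous[of UNIV] by (simp add: continuous_on_eq_continuous_at)
  have dl: "(left_part has_real_derivative exp (slice_pos j \<xi>) * w \<xi>) (at \<xi>)"
    unfolding left_part_def[abs_def]
    by (rule set_integral_atMost_deriv[OF exp_pos_integrable]) (intro continuous_intros cp c)
  have cneg: "isCont (\<lambda>z. f (- z)) (- \<xi>)" if "isCont f \<xi>" for f :: "real \<Rightarrow> real"
    using isCont_o2[of "- \<xi>" uminus f] that by simp
  have "(right_part has_real_derivative exp (- slice_pos j (- (- \<xi>))) * w (- (- \<xi>))) (at (- \<xi>))"
    unfolding right_part_def[abs_def]
    by (rule set_integral_atMost_deriv[OF exp_neg_pos_integrable]) (intro continuous_intros cneg cp c)
  then have "((\<lambda>x. right_part (- x)) has_real_derivative exp (- slice_pos j (- (- \<xi>))) * w (- (- \<xi>)) * (- 1)) (at \<xi>)"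
    by (rule DERIV_chain2[where g = uminus]) (auto intro!: derivative_eq_intros)
  then have dr: "((\<lambda>x. right_part (- x)) has_real_derivative - (exp (- slice_pos j \<xi>) * w \<xi>)) (at \<xi>)"
    by simp
  note [derivative_intros] = dl dr pos_deriv[OF c(1)]
  have e: "exp (- slice_pos j \<xi>) * (exp (slice_pos j \<xi>) * a) = a" "exp (slice_pos j \<xi>) * (exp (- slice_pos j \<xi>) * a) = a" for a
    by (simp_all add: mult.assoc[symmetric] exp_add[symmetric])
  show "(nl_sum j w has_real_derivative - (j \<xi> * nl_diff j w \<xi>)) (at \<xi>)"
    unfolding nl_sum_eq[abs_def] nl_diff_eq
    by (rule derivative_eq_intros refl | simp add: e exp_minus_inverse algebra_simps add_divide_distrib diff_divide_distrib)+
  show "(nl_diff j w has_real_derivative w \<xi> - j \<xi> * nl_sum j w \<xi>) (at \<xi>)"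
    unfolding nl_diff_eq[abs_def] nl_sum_eq
    by (rule derivative_eq_intros refl | simp add: e exp_minus_inverse algebra_simps add_divide_distrib diff_divide_distrib)+
qed

end

section \<open>Lipschitz dependence of the nonlocal terms on the Jacobian and on the density\<close>

locale slice_pair = A: slice h j w + B: slice h j' w' for h j w j' w' +
  fixes D :: real
  assumes D0: "0 \<le> D"
    and jD: "\<And>\<xi>. \<bar>j \<xi> - j' \<xi>\<bar> \<le> D" and wD: "\<And>\<xi>. \<bar>w \<xi> - w' \<xi>\<bar> \<le> D * wt \<xi>"
begin

lemma pos_diff_diff:
  "\<bar>(slice_pos j x - slice_pos j y) - (slice_pos j' x - slice_pos j' y)\<bar> \<le> D * \<bar>x - y\<bar>"
proof -
  have *: "\<bar>(slice_pos j y - slice_pos j x) - (slice_pos j' y - slice_pos j' x)\<bar> \<le> D * (y - x)" if xy: "x \<le> y" for x y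
  proof -
    have "(slice_pos j y - slice_pos j x) - (slice_pos j' y - slice_pos j' x) = (LINT z:{x<..y}|lborel. j z - j' z)"
      unfolding A.pos_diff[OF xy] B.pos_diff[OF xy] by (rule set_integral_diff(2)[symmetric]; fact A.j_ivl_int B.j_ivl_int)
    then show ?thesis using set_integral_bound[OF xy, of "\<lambda>z. j z - j' z" D] jD by simp
  qed
  show ?thesis using *[of x y] *[of y x] by (cases "x \<le> y") (auto simp: abs_minus_commute algebra_simps)
qed

text \<open>A change of the Jacobian by D moves distances of positions by up to D |\<xi> - \<eta>|.
  This linear growth is absorbed by 8 exp(|\<xi> - \<eta>| / 8), which lowers the rate from 3/4 to
  5/8, still above the rate 1/2 of the weight; 24 = 8 * 3.\<close>

lemma kernel_diff:
  "\<bar>exp (- \<bar>slice_pos j \<xi> - slice_pos j \<eta>\<bar>) - exp (- \<bar>slice_pos j' \<xi> - slice_pos j' \<eta>\<bar>)\<bar>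
    \<le> 24 * D * exp (- (5 / 8) * \<bar>\<xi> - \<eta>\<bar>)"
proof -
  have e: "\<bar>exp (- a) - exp (- b)\<bar> \<le> \<bar>a - b\<bar> * max (exp (- a)) (exp (- b))" for a b :: real
  proof -
    have *: "exp (- a) - exp (- b) \<le> (b - a) * exp (- a)" if "a \<le> b" for a b :: real
    proof -
      have "1 + - (b - a) \<le> exp (- (b - a))" by (rule exp_ge_add_one_self)
      then have "exp (- a) * (1 + - (b - a)) \<le> exp (- a) * exp (- (b - a))" by (rule mult_left_mono) simp
      then show ?thesis by (simp add: exp_add[symmetric] algebra_simps)
    qed
    show ?thesis
    proof (cases "a \<le> b")
      case True
      then show ?thesis using *[OF True] by (simp add: max_def abs_if)
    next
      case False
      then show ?thesis using *[of b a] by (simp add: max_def abs_if)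
    qed
  qed
  have "\<bar>exp (- \<bar>slice_pos j \<xi> - slice_pos j \<eta>\<bar>) - exp (- \<bar>slice_pos j' \<xi> - slice_pos j' \<eta>\<bar>)\<bar>
     \<le> (D * \<bar>\<xi> - \<eta>\<bar>) * (3 * exp (- (3 / 4) * \<bar>\<xi> - \<eta>\<bar>))"
  proof (rule order_trans[OF e mult_mono])
    show "\<bar>\<bar>slice_pos j \<xi> - slice_pos j \<eta>\<bar> - \<bar>slice_pos j' \<xi> - slice_pos j' \<eta>\<bar>\<bar> \<le> D * \<bar>\<xi> - \<eta>\<bar>"
      using pos_diff_diff[of \<xi> \<eta>] abs_triangle_ineq3 order_trans by blast
    show "max (exp (- \<bar>slice_pos j \<xi> - slice_pos j \<eta>\<bar>)) (exp (- \<bar>slice_pos j' \<xi> - slice_pos j' \<eta>\<bar>)) \<le> 3 * exp (- (3 / 4) * \<bar>\<xi> - \<eta>\<bar>)"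
      using A.kernel_bound B.kernel_bound by simp
  qed (use D0 in \<open>auto simp: le_max_iff_disj\<close>)
  also have "\<dots> \<le> (D * (8 * exp (\<bar>\<xi> - \<eta>\<bar> / 8))) * (3 * exp (- (3 / 4) * \<bar>\<xi> - \<eta>\<bar>))"
  proof (intro mult_right_mono mult_left_mono D0)
    have "t \<le> 8 * exp (t / 8)" for t :: real using exp_ge_add_one_self[of "t / 8"] by linarith
    then show "\<bar>\<xi> - \<eta>\<bar> \<le> 8 * exp (\<bar>\<xi> - \<eta>\<bar> / 8)" .
  qed simp
  also have "\<dots> = 24 * D * (exp (\<bar>\<xi> - \<eta>\<bar> / 8) * exp (- (3 / 4) * \<bar>\<xi> - \<eta>\<bar>))" by simp
  also have "exp (\<bar>\<xi> - \<eta>\<bar> / 8) * exp (- (3 / 4) * \<bar>\<xi> - \<eta>\<bar>) = exp (- (5 / 8) * \<bar>\<xi> - \<eta>\<bar>)"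
    unfolding exp_add[symmetric] by simp
  finally show ?thesis .
qed

text \<open>780 = (3 * 8 + 96 * 16) / 2. The first term is the change of w, the second that of the
  kernel, with 96 = 24 * 4; 8 and 16 are the masses of the exponentials with rates 1/4 and 1/8 that
  remain once the weight has been moved.\<close>

lemma nonlocal_diff:
  assumes [measurable]: "\<sigma> \<xi> \<in> borel_measurable borel" and \<sigma>: "\<And>\<eta>. \<bar>\<sigma> \<xi> \<eta>\<bar> \<le> 1"
  shows "\<bar>nonlocal \<sigma> j w \<xi> - nonlocal \<sigma> j' w' \<xi>\<bar> \<le> 780 * D * wt \<xi>"
proof -
  let ?k = "\<lambda>\<eta>. exp (- \<bar>slice_pos j \<xi> - slice_pos j \<eta>\<bar>)" and ?k' = "\<lambda>\<eta>. exp (- \<bar>slice_pos j' \<xi> - slice_pos j' \<eta>\<bar>)"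
  have "norm ((LINT \<eta>|lborel. \<sigma> \<xi> \<eta> * ?k \<eta> * w \<eta>) - (LINT \<eta>|lborel. \<sigma> \<xi> \<eta> * ?k' \<eta> * w' \<eta>))
     = norm (LINT \<eta>|lborel. \<sigma> \<xi> \<eta> * ?k \<eta> * w \<eta> - \<sigma> \<xi> \<eta> * ?k' \<eta> * w' \<eta>)"
    by (subst Bochner_Integration.integral_diff) (auto intro!: A.nonlocal_integrable B.nonlocal_integrable \<sigma>)
  also have "\<dots> \<le> (LINT \<eta>|lborel. 3 * D * wt \<xi> * exp (- (1 / 4) * \<bar>\<eta> - \<xi>\<bar>) + 96 * D * wt \<xi> * exp (- (1 / 8) * \<bar>\<eta> - \<xi>\<bar>))"
  proof (rule integral_norm_le)
    show "integrable lborel (\<lambda>\<eta>. 3 * D * wt \<xi> * exp (- (1 / 4) * \<bar>\<eta> - \<xi>\<bar>) + 96 * D * wt \<xi> * exp (- (1 / 8) * \<bar>\<eta> - \<xi>\<bar>))"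
      by (intro Bochner_Integration.integrable_add integrable_mult_right integral_exp_abs) auto
    fix \<eta>
    have "\<bar>?k \<eta> * (w \<eta> - w' \<eta>)\<bar> \<le> 3 * exp (- (3 / 4) * \<bar>\<xi> - \<eta>\<bar>) * (D * wt \<eta>)"
      unfolding abs_mult abs_exp_cancel using A.kernel_bound[of \<xi> \<eta>] wD[of \<eta>] by (intro mult_mono) auto
    also have "\<dots> = 3 * D * (exp (- (3 / 4) * \<bar>\<xi> - \<eta>\<bar>) * wt \<eta>)" by simp
    also have "\<dots> \<le> 3 * D * (wt \<xi> * exp (- (1 / 4) * \<bar>\<eta> - \<xi>\<bar>))" using D0 by (intro mult_left_mono A.wt_kernel) simp
    finally have 1: "\<bar>?k \<eta> * (w \<eta> - w' \<eta>)\<bar> \<le> 3 * D * wt \<xi> * exp (- (1 / 4) * \<bar>\<eta> - \<xi>\<bar>)" by simp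
    have "\<bar>(?k \<eta> - ?k' \<eta>) * w' \<eta>\<bar> \<le> 24 * D * exp (- (5 / 8) * \<bar>\<xi> - \<eta>\<bar>) * (4 * wt \<eta>)"
    proof -
      have "4 * h * wt \<eta> \<le> 4 * 1 * wt \<eta>" using A.h wt_pos[of \<eta>] by (intro mult_right_mono mult_left_mono) auto
      then have "\<bar>w' \<eta>\<bar> \<le> 4 * wt \<eta>" using B.w[of \<eta>] by simp
      then show ?thesis unfolding abs_mult using kernel_diff[of \<xi> \<eta>] D0 by (intro mult_mono) auto
    qed
    also have "\<dots> = 96 * D * (exp (- (5 / 8) * \<bar>\<xi> - \<eta>\<bar>) * wt \<eta>)" by simp
    also have "\<dots> \<le> 96 * D * (exp (- (5 / 8) * \<bar>\<xi> - \<eta>\<bar>) * (wt \<xi> * exp (\<bar>\<xi> - \<eta>\<bar> / 2)))"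
      using D0 by (intro mult_left_mono wt_shift) auto
    also have "\<dots> = 96 * D * (wt \<xi> * exp (- (5 / 8) * \<bar>\<xi> - \<eta>\<bar> + \<bar>\<xi> - \<eta>\<bar> / 2))" by (simp only: exp_add mult_ac)
    also have "- (5 / 8) * \<bar>\<xi> - \<eta>\<bar> + \<bar>\<xi> - \<eta>\<bar> / 2 = - (1 / 8) * \<bar>\<eta> - \<xi>\<bar>" by (simp add: abs_minus_commute)
    finally have 2: "\<bar>(?k \<eta> - ?k' \<eta>) * w' \<eta>\<bar> \<le> 96 * D * wt \<xi> * exp (- (1 / 8) * \<bar>\<eta> - \<xi>\<bar>)" by simp
    have "\<sigma> \<xi> \<eta> * ?k \<eta> * w \<eta> - \<sigma> \<xi> \<eta> * ?k' \<eta> * w' \<eta> = \<sigma> \<xi> \<eta> * (?k \<eta> * (w \<eta> - w' \<eta>) + (?k \<eta> - ?k' \<eta>) * w' \<eta>)"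
      by (simp add: algebra_simps)
    also have "norm \<dots> \<le> 1 * \<bar>?k \<eta> * (w \<eta> - w' \<eta>) + (?k \<eta> - ?k' \<eta>) * w' \<eta>\<bar>"
      unfolding real_norm_def abs_mult[of "\<sigma> \<xi> \<eta>"] by (intro mult_right_mono \<sigma>) simp
    also have "\<dots> \<le> 3 * D * wt \<xi> * exp (- (1 / 4) * \<bar>\<eta> - \<xi>\<bar>) + 96 * D * wt \<xi> * exp (- (1 / 8) * \<bar>\<eta> - \<xi>\<bar>)"
      using 1 2 abs_triangle_ineq[of "?k \<eta> * (w \<eta> - w' \<eta>)" "(?k \<eta> - ?k' \<eta>) * w' \<eta>"] by linarith
    finally show "norm (\<sigma> \<xi> \<eta> * ?k \<eta> * w \<eta> - \<sigma> \<xi> \<eta> * ?k' \<eta> * w' \<eta>)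
      \<le> 3 * D * wt \<xi> * exp (- (1 / 4) * \<bar>\<eta> - \<xi>\<bar>) + 96 * D * wt \<xi> * exp (- (1 / 8) * \<bar>\<eta> - \<xi>\<bar>)" .
  qed
  also have "\<dots> = 3 * D * wt \<xi> * 8 + 96 * D * wt \<xi> * 16"
    using integral_exp_abs[of "1/4" \<xi>] integral_exp_abs[of "1/8" \<xi>]
    by (subst Bochner_Integration.integral_add) (simp_all add: integrable_mult_right)
  finally show ?thesis unfolding nonlocal_def diff_divide_distrib[symmetric] by simp
qed

lemma nl_sum_diff: "\<bar>nl_sum j w \<xi> - nl_sum j' w' \<xi>\<bar> \<le> 780 * D * wt \<xi>" by (rule nonlocal_diff) auto
lemma nl_diff_diff: "\<bar>nl_diff j w \<xi> - nl_diff j' w' \<xi>\<bar> \<le> 780 * D * wt \<xi>"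
  by (rule nonlocal_diff) (auto simp: side_def[abs_def])

end

section \<open>Steepening data and the fixed point\<close>

text \<open>Banach's fixed point argument with a weighted bound at every point. The property P only
  has to be closed under pointwise limits, so measurability and moduli of continuity can be part of
  it.\<close>

lemma pointwise_contraction:
  fixes F :: "('a \<Rightarrow> real) \<Rightarrow> 'a \<Rightarrow> real" and \<omega> :: "'a \<Rightarrow> real"
  assumes f0: "P f0" and F: "\<And>f. P f \<Longrightarrow> P (F f)"
    and lim: "\<And>f g. (\<And>n. P (f n)) \<Longrightarrow> (\<And>x. (\<lambda>n. f n x) \<longlonglongrightarrow> g x) \<Longrightarrow> P g"
    and contr: "\<And>f g D. P f \<Longrightarrow> P g \<Longrightarrow> 0 \<le> D \<Longrightarrow> (\<And>x. \<bar>f x - g x\<bar> \<le> D * \<omega> x) \<Longrightarrow> (\<And>x. \<bar>F f x - F g x\<bar> \<le> D / 2 * \<omega> x)"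
    and D0: "0 \<le> D0" "\<And>x. \<bar>F f0 x - f0 x\<bar> \<le> D0 * \<omega> x"
  shows "\<exists>f. P f \<and> F f = f"
proof -
  define f where "f n = (F ^^ n) f0" for n
  have P: "P (f n)" for n by (induction n) (auto simp: f_def f0 F)
  have step: "\<bar>f (Suc n) x - f n x\<bar> \<le> D0 / 2 ^ n * \<omega> x" for n x
  proof (induction n arbitrary: x)
    case (Suc n)
    have "\<bar>F (f (Suc n)) x - F (f n) x\<bar> \<le> (D0 / 2 ^ n) / 2 * \<omega> x"
      by (rule contr[OF P P _ Suc.IH]) (use D0 in simp)
    then show ?case by (simp add: f_def mult.commute)
  qed (use D0 in \<open>simp add: f_def\<close>)
  have "convergent (\<lambda>n. f n x)" for x
  proof -
    have "summable (\<lambda>n. f (Suc n) x - f n x)"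
    proof (rule summable_comparison_test')
      have "summable (\<lambda>n. (1 / 2 :: real) ^ n)" by (rule summable_geometric) simp
      then show "summable (\<lambda>n. D0 * \<omega> x * (1 / 2) ^ n)" by (rule summable_mult)
      show "norm (f (Suc n) x - f n x) \<le> D0 * \<omega> x * (1 / 2) ^ n" for n
        using step[of n x] by (simp add: field_simps power_divide)
    qed
    then have "convergent (\<lambda>n. \<Sum>i<n. f (Suc i) x - f i x)" by (simp add: summable_iff_convergent)
    moreover have "(\<Sum>i<n. f (Suc i) x - f i x) = f n x - f 0 x" for n by (rule sum_lessThan_telescope)
    ultimately have "convergent (\<lambda>n. f n x - f 0 x)" by simp
    then show ?thesis using convergent_add[of "\<lambda>n. f n x - f 0 x" "\<lambda>n. f 0 x"] by (simp add: convergent_const)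
  qed
  then have lims: "(\<lambda>n. f n x) \<longlonglongrightarrow> lim (\<lambda>n. f n x)" for x by (simp add: convergent_LIMSEQ_iff)
  define g where "g x = lim (\<lambda>n. f n x)" for x
  have g: "(\<lambda>n. f n x) \<longlonglongrightarrow> g x" for x unfolding g_def by (rule lims)
  have Pg: "P g" by (rule lim[OF P g])
  have dist: "\<bar>f m x - f n x\<bar> \<le> 2 * D0 / 2 ^ n * \<omega> x" if "n \<le> m" for m n x
  proof -
    have w: "0 \<le> D0 * \<omega> x" using D0(2)[of x] by linarith
    \<comment> \<open>The exact partial sum of the geometric series is kept so that the induction on
      m closes.\<close>
    have "\<bar>f m x - f n x\<bar> \<le> (2 * D0 / 2 ^ n - 2 * D0 / 2 ^ m) * \<omega> x" using that
    proof (induction m rule: dec_induct)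
      case (step m)
      have "\<bar>f (Suc m) x - f n x\<bar> \<le> D0 / 2 ^ m * \<omega> x + (2 * D0 / 2 ^ n - 2 * D0 / 2 ^ m) * \<omega> x"
        using \<open>\<bar>f m x - f n x\<bar> \<le> _\<close> \<open>\<And>n x. \<bar>f (Suc n) x - f n x\<bar> \<le> D0 / 2 ^ n * \<omega> x\<close>[of m x] by linarith
      then show ?case by (simp add: algebra_simps)
    qed simp
    also have "\<dots> = 2 * D0 / 2 ^ n * \<omega> x - 2 * (D0 * \<omega> x) / 2 ^ m" by (simp add: algebra_simps)
    also have "\<dots> \<le> 2 * D0 / 2 ^ n * \<omega> x" using w by simp
    finally show ?thesis .
  qed
  have gd: "\<bar>g x - f n x\<bar> \<le> 2 * D0 / 2 ^ n * \<omega> x" for n x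
  proof (rule tendsto_upperbound[of "\<lambda>m. \<bar>f m x - f n x\<bar>" _ sequentially])
    show "(\<lambda>m. \<bar>f m x - f n x\<bar>) \<longlonglongrightarrow> \<bar>g x - f n x\<bar>" by (intro tendsto_intros g)
    show "\<forall>\<^sub>F m in sequentially. \<bar>f m x - f n x\<bar> \<le> 2 * D0 / 2 ^ n * \<omega> x"
      using eventually_ge_at_top[of n] by eventually_elim (rule dist)
  qed simp
  have "F g x = g x" for x
  proof -
    have "\<bar>F g x - f (Suc n) x\<bar> \<le> D0 * \<omega> x * (1 / 2) ^ n" for n
    proof -
      have "\<bar>F g x - F (f n) x\<bar> \<le> (2 * D0 / 2 ^ n) / 2 * \<omega> x"
        by (rule contr[OF Pg P _ gd]) (use D0 in simp)
      then show ?thesis by (simp add: f_def power_divide)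
    qed
    moreover have "(\<lambda>n. D0 * \<omega> x * (1 / 2) ^ n) \<longlonglongrightarrow> D0 * \<omega> x * 0"
      by (intro tendsto_intros LIMSEQ_power_zero) simp
    ultimately have "(\<lambda>n. F g x - f (Suc n) x) \<longlonglongrightarrow> 0"
      by (intro Lim_null_comparison[of "\<lambda>n. F g x - f (Suc n) x" "\<lambda>n. D0 * \<omega> x * (1 / 2) ^ n"]) auto
    moreover have "(\<lambda>n. F g x - f (Suc n) x) \<longlonglongrightarrow> F g x - g x"
      by (intro tendsto_intros LIMSEQ_Suc g)
    ultimately show ?thesis using LIMSEQ_unique by fastforce
  qed
  with Pg show ?thesis by blast
qed

lemma set_integral_Icc_bound:
  fixes f :: "real \<Rightarrow> real"
  assumes "a \<le> b" "\<And>z. \<bar>f z\<bar> \<le> C"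
  shows "\<bar>LINT z:{a..b}|lborel. f z\<bar> \<le> C * (b - a)"
proof -
  have "norm (LINT z:{a..b}|lborel. f z) \<le> (LINT z|lborel. indicator {a..b} z * C)"
    unfolding set_lebesgue_integral_def
  proof (rule integral_norm_le)
    show "integrable lborel (\<lambda>z. indicator {a..b} z * C)"
      by (intro integrable_mult_left) (simp add: integrable_indicator_iff emeasure_lborel_Icc_eq)
    show "norm (indicator {a..b} z *\<^sub>R f z) \<le> indicator {a..b} z * C" for z
      using assms(2)[of z] by (cases "z \<in> {a..b}") auto
  qed
  then show ?thesis using assms(1) by (simp add: mult.commute)
qed

lemma set_integrable_bounded:
  fixes f :: "real \<Rightarrow> real"
  assumes "f \<in> borel_measurable borel" "\<And>z. \<bar>f z\<bar> \<le> C"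
  shows "set_integrable lborel {a..b} f"
  unfolding set_integrable_def
proof (rule integrable_bounded_by)
  show "integrable lborel (\<lambda>z. indicator {a..b} z * C)"
    by (intro integrable_mult_left) (simp add: integrable_indicator_iff emeasure_lborel_Icc_eq)
  show "norm (indicator {a..b} z *\<^sub>R f z) \<le> indicator {a..b} z * C" for z
    using assms(2)[of z] by (cases "z \<in> {a..b}") auto
qed (use assms(1) in measurable)

lemma set_integral_Icc_diff:
  fixes f :: "real \<Rightarrow> real"
  assumes f: "f \<in> borel_measurable borel" "\<And>z. \<bar>f z\<bar> \<le> C" and "0 \<le> a" "0 \<le> b"
  shows "\<bar>(LINT z:{0..a}|lborel. f z) - (LINT z:{0..b}|lborel. f z)\<bar> \<le> C * \<bar>a - b\<bar>"
proof -
  have *: "\<bar>(LINT z:{0..b}|lborel. f z) - (LINT z:{0..a}|lborel. f z)\<bar> \<le> C * (b - a)" if "a \<le> b" "0 \<le> a" for a b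
  proof -
    have un: "{0..b} = {0..a} \<union> {a<..b}" using that by auto
    have i: "set_integrable lborel {a<..b} f"
      by (rule set_integrable_subset[OF set_integrable_bounded[OF f, of 0 b]]) (use that in auto)
    have "(LINT z:{0..b}|lborel. f z) = (LINT z:{0..a}|lborel. f z) + (LINT z:{a<..b}|lborel. f z)"
      unfolding un by (rule set_integral_Un[OF _ set_integrable_bounded[OF f] i]) auto
    then show ?thesis using set_integral_bound[OF that(1), of f C] f(2) by simp
  qed
  show ?thesis using *[of a b] *[of b a] assms(3,4) by (cases "a \<le> b") (auto simp: abs_minus_commute)
qed

lemma measurable_curried:
  fixes F :: "real \<Rightarrow> real \<Rightarrow> real"
  assumes "(\<lambda>(t, \<xi>). F t \<xi>) \<in> borel_measurable (borel \<Otimes>\<^sub>M borel)" "f \<in> borel_measurable M" "g \<in> borel_measurable M"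
  shows "(\<lambda>x. F (f x) (g x)) \<in> borel_measurable M"
  using measurable_compose[OF measurable_Pair[OF assms(2,3)] assms(1)] by simp

text \<open>The four label intervals between the kinks: left of the hat, rising edge, descent, right
  of the hat. Labels with equal value have no kink between them, and since the value increases from
  left to right it also counts the jumps of the slope in \<open>tv_prim\<close>.\<close>

definition piece :: "real \<Rightarrow> nat" where
  "piece \<xi> = (if \<xi> \<le> 0 then 0 else if \<xi> < 1 then 1 else if \<xi> < 2 then 2 else 3)"

abbreviation "kinks \<equiv> {0, 1, 2 :: real}"

lemma piece_1_iff: "piece \<xi> = 1 \<longleftrightarrow> 0 < \<xi> \<and> \<xi> < 1" by (simp add: piece_def)

lemma piece_mono: "mono piece" by (auto simp: mono_def piece_def)

lemma piece_le: "piece \<xi> \<le> 3" by (simp add: piece_def)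

lemma piece_measurable[measurable]: "piece \<in> borel \<rightarrow>\<^sub>M count_space UNIV"
  unfolding piece_def[abs_def] by measurable

lemma piece_locally_constant:
  assumes "\<xi> \<notin> kinks" shows "\<exists>d>0. \<forall>\<eta>. \<bar>\<eta> - \<xi>\<bar> < d \<longrightarrow> piece \<eta> = piece \<xi>"
proof -
  define d where "d = min \<bar>\<xi>\<bar> (min \<bar>\<xi> - 1\<bar> \<bar>\<xi> - 2\<bar>)"
  have "d > 0" using assms by (auto simp: d_def)
  moreover have "piece \<eta> = piece \<xi>" if "\<bar>\<eta> - \<xi>\<bar> < d" for \<eta>
  proof -
    have n: "\<bar>\<eta> - \<xi>\<bar> < \<bar>\<xi>\<bar>" "\<bar>\<eta> - \<xi>\<bar> < \<bar>\<xi> - 1\<bar>" "\<bar>\<eta> - \<xi>\<bar> < \<bar>\<xi> - 2\<bar>"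
      using that by (simp_all add: d_def)
    consider "\<xi> < 0" | "0 < \<xi>" "\<xi> < 1" | "1 < \<xi>" "\<xi> < 2" | "2 < \<xi>" using assms by fastforce
    then show ?thesis
    proof cases
      case 1
      then have "\<eta> < 0" using n(1) by linarith
      then show ?thesis using 1 by (simp add: piece_def)
    next
      case 2
      then have "0 < \<eta>" "\<eta> < 1" using n(1,2) by linarith+
      then show ?thesis using 2 by (simp add: piece_def)
    next
      case 3
      then have "1 < \<eta>" "\<eta> < 2" using n(2,3) by linarith+
      then show ?thesis using 3 by (simp add: piece_def)
    next
      case 4
      then have "2 < \<eta>" using n(3) by linarith
      then show ?thesis using 4 by (simp add: piece_def)
    qed
  qed
  ultimately show ?thesis by blast
qed

lemma piecewise_Lipschitz_isCont:
  fixes f :: "real \<Rightarrow> real"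
  assumes "\<xi> \<notin> kinks" "\<And>\<eta>. piece \<eta> = piece \<xi> \<Longrightarrow> \<bar>f \<eta> - f \<xi>\<bar> \<le> C * \<bar>\<eta> - \<xi>\<bar>"
  shows "isCont f \<xi>"
proof -
  obtain d where d: "d > 0" "\<And>\<eta>. \<bar>\<eta> - \<xi>\<bar> < d \<Longrightarrow> piece \<eta> = piece \<xi>" using piece_locally_constant[OF assms(1)] by blast
  have "((\<lambda>y. C * \<bar>y - \<xi>\<bar>) \<longlongrightarrow> C * \<bar>\<xi> - \<xi>\<bar>) (at \<xi>)" by (intro tendsto_intros)
  then have z: "((\<lambda>y. C * \<bar>y - \<xi>\<bar>) \<longlongrightarrow> 0) (at \<xi>)" by simp
  have "eventually (\<lambda>y. y \<in> ball \<xi> d) (at \<xi>)" by (rule eventually_at_in_open') (use d in auto)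
  then have "eventually (\<lambda>y. norm (f y - f \<xi>) \<le> C * \<bar>y - \<xi>\<bar>) (at \<xi>)"
  proof eventually_elim
    case (elim y)
    then have "\<bar>y - \<xi>\<bar> < d" by (simp add: dist_real_def abs_minus_commute)
    from assms(2)[OF d(2)[OF this]] show ?case by simp
  qed
  from Lim_null_comparison[OF this z] show ?thesis unfolding isCont_def by (simp add: LIM_zero_iff)
qed

text \<open>The bound on T makes \<open>step\<close> a contraction (1100 T <= 1/2) and preserves the
  bounds of \<open>admissible\<close> (60 T <= 1/4 and 81 T <= 1); neither h nor \<epsilon>
  restricts it further.\<close>

locale rarefaction =
  fixes h \<epsilon> T :: real
  assumes h: "0 < h" "h \<le> 1" and \<epsilon>: "0 < \<epsilon>" "\<epsilon> \<le> 1 / 2" and T: "0 < T" "T \<le> 1 / 10000"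
begin

text \<open>The labels stretch the rising edge of the hat, of width \<open>\<epsilon>\<close>, to the unit interval, so that the
  Lagrangian quantities are bounded uniformly in \<open>\<epsilon>\<close>.  The unknown \<open>W\<close> is the label derivative of
  the velocity, \<open>jac W\<close> is \<open>X\<^sub>\<xi>\<close>, and \<open>cl\<close> clamps the time to \<open>[0,T]\<close>.\<close>

definition J0 where "J0 \<xi> = (if piece \<xi> = 1 then \<epsilon> else 1)"
definition W0 where "W0 \<xi> = (if piece \<xi> = 1 then h else if piece \<xi> = 2 then - h else 0)"
definition cl where "cl t = max 0 (min T t)"
definition jac where "jac W t \<xi> = J0 \<xi> + 3 / 2 * (LINT s:{0..cl t}|lborel. W (s, \<xi>))"
text \<open>By \<open>nl_deriv\<close> this is minus the label derivative of \<open>nl_sum\<close>.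
  The latter is the convolution of G with the slope of v, and it is minus the time derivative of the
  velocity along the flow.\<close>

definition rhs where "rhs W s \<xi> = jac W s \<xi> * nl_diff (jac W s) (\<lambda>\<eta>. W (s, \<eta>)) \<xi>"
definition step where "step W = (\<lambda>(t, \<xi>). W0 \<xi> + (LINT s:{0..cl t}|lborel. rhs W s \<xi>))"

text \<open>Closeness to \<open>W0\<close> keeps W above 3 h / 4 on the edge, so that the edge
  rarefies. The bound in time gives continuity of the coefficients, hence classical time
  derivatives. The bound by \<open>wt_prim\<close> controls the variation of W between kinks. All of
  this passes to pointwise limits.\<close>

definition admissible :: "(real \<times> real \<Rightarrow> real) \<Rightarrow> bool" where
  "admissible W \<longleftrightarrow> W \<in> borel_measurable (borel \<Otimes>\<^sub>M borel) \<and>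
    (\<forall>t \<xi>. \<bar>W (t, \<xi>) - W0 \<xi>\<bar> \<le> h / 4 * wt \<xi>) \<and>
    (\<forall>t s \<xi>. \<bar>W (t, \<xi>) - W (s, \<xi>)\<bar> \<le> 60 * h * wt \<xi> * \<bar>t - s\<bar>) \<and>
    (\<forall>t \<xi> \<eta>. piece \<xi> = piece \<eta> \<longrightarrow> \<bar>W (t, \<xi>) - W (t, \<eta>)\<bar> \<le> h * \<bar>wt_prim \<xi> - wt_prim \<eta>\<bar>)"

lemma cl_bounds: "0 \<le> cl t" "cl t \<le> T" and cl_Lipschitz: "\<bar>cl t - cl s\<bar> \<le> \<bar>t - s\<bar>"
  and cl_id: "t \<in> {0..T} \<Longrightarrow> cl t = t"
  using T by (auto simp: cl_def)

lemma J0_measurable[measurable]: "J0 \<in> borel_measurable borel" and W0_measurable[measurable]: "W0 \<in> borel_measurable borel"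
  unfolding J0_def[abs_def] W0_def[abs_def] by measurable

lemma cl_measurable[measurable]: "cl \<in> borel_measurable borel"
  unfolding cl_def[abs_def] by measurable

lemma W0_bound: "\<bar>W0 \<xi>\<bar> \<le> 3 * h * wt \<xi>" and wt_support: "0 < \<xi> \<Longrightarrow> \<xi> < 2 \<Longrightarrow> 1 \<le> 3 * wt \<xi>"
proof -
  \<comment> \<open>On the labels of the hat the weight stays above exp(-1), which is at least
    1/3.\<close>
  have *: "1 \<le> 3 * wt \<xi>" if "0 < \<xi>" "\<xi> < 2" for \<xi>
  proof -
    have "exp (\<xi> / 2) \<le> exp (1::real)" using that by simp
    then have "exp (\<xi> / 2) \<le> 3" using exp_le by linarith
    then have "wt \<xi> * exp (\<xi> / 2) \<le> wt \<xi> * 3" using wt_pos[of \<xi>] by (intro mult_left_mono) auto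
    moreover have "wt \<xi> * exp (\<xi> / 2) = 1" using that by (simp add: wt_def exp_add[symmetric])
    ultimately show ?thesis by simp
  qed
  then show "0 < \<xi> \<Longrightarrow> \<xi> < 2 \<Longrightarrow> 1 \<le> 3 * wt \<xi>" .
  show "\<bar>W0 \<xi>\<bar> \<le> 3 * h * wt \<xi>"
  proof (cases "piece \<xi> = 1 \<or> piece \<xi> = 2")
    case True
    then have "1 \<le> 3 * wt \<xi>" by (intro *) (auto simp: piece_def split: if_splits)
    then have "h * 1 \<le> h * (3 * wt \<xi>)" using h by (intro mult_left_mono) auto
    then show ?thesis using h by (auto simp: W0_def)
  qed (use h wt_pos[of \<xi>] in \<open>auto simp: W0_def\<close>)
qed

lemma step_eq: "step W (t, \<xi>) = W0 \<xi> + (LINT s:{0..cl t}|lborel. rhs W s \<xi>)"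
  by (simp add: step_def)

end

section \<open>Estimates for a single admissible profile and invariance under
  \<open>step\<close>\<close>

locale rarefaction_profile = rarefaction +
  fixes W assumes W: "admissible W"
begin

lemma W_meas[measurable]: "W \<in> borel_measurable (borel \<Otimes>\<^sub>M borel)"
  and W_near: "\<bar>W (t, \<xi>) - W0 \<xi>\<bar> \<le> h / 4 * wt \<xi>"
  and W_time: "\<bar>W (t, \<xi>) - W (s, \<xi>)\<bar> \<le> 60 * h * wt \<xi> * \<bar>t - s\<bar>"
  and W_piece: "piece \<xi> = piece \<eta> \<Longrightarrow> \<bar>W (t, \<xi>) - W (t, \<eta>)\<bar> \<le> h * \<bar>wt_prim \<xi> - wt_prim \<eta>\<bar>"
  using W by (auto simp: admissible_def)

lemma W_bound: "\<bar>W (t, \<xi>)\<bar> \<le> 4 * h * wt \<xi>"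
proof -
  have "0 \<le> h * wt \<xi>" using h wt_pos[of \<xi>] by simp
  then show ?thesis using W_near[of t \<xi>] W0_bound[of \<xi>] by linarith
qed

lemma W_bound': "\<bar>W (t, \<xi>)\<bar> \<le> 4 * h"
proof -
  have "4 * h * wt \<xi> \<le> 4 * h * 1" using h wt_le_1[of \<xi>] by (intro mult_left_mono) auto
  then show ?thesis using W_bound[of t \<xi>] by simp
qed

lemma W_section[measurable]: "(\<lambda>s. W (s, \<xi>)) \<in> borel_measurable borel" "(\<lambda>\<eta>. W (s, \<eta>)) \<in> borel_measurable borel"
  by measurable

lemma jac_meas: "(\<lambda>(t, \<xi>). jac W t \<xi>) \<in> borel_measurable (borel \<Otimes>\<^sub>M borel)"
  unfolding jac_def set_lebesgue_integral_def indicator_def atLeastAtMost_iff atMost_iff by measurable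

lemmas jac_measurable[measurable (raw)] = measurable_curried[OF jac_meas]

lemma jac_section[measurable]: "jac W t \<in> borel_measurable borel" by measurable

lemma jac_near: "\<bar>jac W t \<xi> - J0 \<xi>\<bar> \<le> 6 * h * wt \<xi> * cl t"
  using set_integral_Icc_bound[of 0 "cl t" "\<lambda>s. W (s, \<xi>)" "4 * h * wt \<xi>"] W_bound cl_bounds
  by (simp add: jac_def)

lemma small: "6 * h * wt \<xi> * cl t \<le> wt \<xi> / 100"
proof -
  have "(6 * h * cl t) * wt \<xi> \<le> (6 * 1 * (1 / 10000)) * wt \<xi>"
    using h T cl_bounds(2)[of t] cl_bounds(1)[of t] wt_pos[of \<xi>] by (intro mult_right_mono mult_mono) auto
  then show ?thesis using wt_pos[of \<xi>] by (simp add: mult_ac)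
qed

lemma jac_near': "\<bar>jac W t \<xi> - J0 \<xi>\<bar> \<le> wt \<xi> / 100" "\<bar>jac W t \<xi> - J0 \<xi>\<bar> \<le> 1 / 100"
  using jac_near[of t \<xi>] small[of \<xi> t] wt_le_1[of \<xi>] by linarith+

text \<open>This is the rarefaction. On the edge W stays above 3 h / 4, and 3/2 * 3/4 > 1, so the
  Jacobian grows at a rate of at least h.\<close>

lemma jac_lower_steep:
  assumes "piece \<xi> = 1" shows "\<epsilon> + h * cl t \<le> jac W t \<xi>"
proof -
  have "3 / 4 * h \<le> W (s, \<xi>)" for s
  proof -
    have "h / 4 * wt \<xi> \<le> h / 4 * 1" using h wt_le_1[of \<xi>] by (intro mult_left_mono) auto
    moreover have "W0 \<xi> = h" using assms by (simp add: W0_def)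
    ultimately show ?thesis using W_near[of s \<xi>] by linarith
  qed
  then have "(LINT s:{0..cl t}|lborel. 3 / 4 * h) \<le> (LINT s:{0..cl t}|lborel. W (s, \<xi>))"
    by (intro set_integral_mono set_integrable_bounded[of _ "\<bar>3 / 4 * h\<bar>"] set_integrable_bounded[OF W_section(1) W_bound']) auto
  also have "(LINT s:{0..cl t}|lborel. 3 / 4 * h) = 3 / 4 * (h * cl t)"
    using cl_bounds[of t] by (simp add: set_lebesgue_integral_def)
  finally have a: "3 / 4 * (h * cl t) \<le> (LINT s:{0..cl t}|lborel. W (s, \<xi>))" .
  have "h * cl t \<le> 3 / 2 * (LINT s:{0..cl t}|lborel. W (s, \<xi>))"
  proof -
    have "0 \<le> h * cl t" using h cl_bounds(1)[of t] by simp
    then show ?thesis using a by linarith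
  qed
  then show ?thesis using assms by (simp add: jac_def J0_def)
qed

lemma jac_lower: "min (3 / 4) (\<epsilon> + h * cl t) \<le> jac W t \<xi>"
proof (cases "piece \<xi> = 1")
  case False
  then have "3 / 4 \<le> jac W t \<xi>" using jac_near'(2)[of t \<xi>] unfolding J0_def if_not_P[OF False] by linarith
  then show ?thesis by simp
qed (use jac_lower_steep[of \<xi> t] in auto)

lemma jac_slice: "slice h (jac W t) (\<lambda>\<eta>. W (t, \<eta>))"
proof
  fix \<xi>
  have hc: "0 \<le> h * cl t" using h cl_bounds[of t] by simp
  show j0: "0 \<le> jac W t \<xi>" using jac_lower[of t \<xi>] \<epsilon> hc by linarith
  have "J0 \<xi> \<le> 1" using \<epsilon> by (simp add: J0_def)
  then show "jac W t \<xi> \<le> 5 / 4" using jac_near'(2)[of t \<xi>] by linarith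
  show "3 / 4 \<le> jac W t \<xi>" if "\<xi> \<notin> {0<..<1}"
  proof -
    have "J0 \<xi> = 1" using that piece_1_iff[of \<xi>] by (auto simp: J0_def)
    then show ?thesis using jac_near'(2)[of t \<xi>] by linarith
  qed
  show "\<bar>jac W t \<xi> - 1\<bar> \<le> 3 * wt \<xi>"
  proof (cases "piece \<xi> = 1")
    case True
    then have "0 < \<xi> \<and> \<xi> < 1" by (simp only: piece_1_iff)
    then have "1 \<le> 3 * wt \<xi>" by (intro wt_support) auto
    then show ?thesis using jac_near'(2)[of t \<xi>] \<epsilon> j0 unfolding J0_def if_P[OF True] by linarith
  next
    case False
    then show ?thesis using jac_near'(1)[of t \<xi>] wt_pos[of \<xi>] unfolding J0_def if_not_P[OF False] by linarith
  qed
qed (use h W_bound in auto)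

lemma jac_time: "\<bar>jac W t \<xi> - jac W s \<xi>\<bar> \<le> 6 * h * \<bar>t - s\<bar>"
proof -
  have gen: "\<bar>c + 3 / 2 * a - (c + 3 / 2 * b)\<bar> = 3 / 2 * \<bar>a - b\<bar>" for a b c :: real by (simp add: abs_if)
  have "\<bar>jac W t \<xi> - jac W s \<xi>\<bar> = 3 / 2 * \<bar>(LINT s:{0..cl t}|lborel. W (s, \<xi>)) - (LINT s:{0..cl s}|lborel. W (s, \<xi>))\<bar>"
    unfolding jac_def by (rule gen)
  also have "\<dots> \<le> 3 / 2 * (4 * h * \<bar>cl t - cl s\<bar>)"
    by (intro mult_left_mono set_integral_Icc_diff W_section W_bound' cl_bounds) auto
  also have "\<dots> \<le> 3 / 2 * (4 * h * \<bar>t - s\<bar>)" using h by (intro mult_left_mono cl_Lipschitz) auto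
  finally show ?thesis by simp
qed

lemma jac_piece:
  assumes "piece \<xi> = piece \<eta>"
  shows "\<bar>jac W t \<xi> - jac W t \<eta>\<bar> \<le> 3 / 2 * h * cl t * \<bar>wt_prim \<xi> - wt_prim \<eta>\<bar>"
proof -
  have "J0 \<xi> = J0 \<eta>" using assms by (simp add: J0_def)
  moreover have "(LINT s:{0..cl t}|lborel. W (s, \<xi>) - W (s, \<eta>)) = (LINT s:{0..cl t}|lborel. W (s, \<xi>)) - (LINT s:{0..cl t}|lborel. W (s, \<eta>))"
    by (intro set_integral_diff set_integrable_bounded[OF W_section(1) W_bound'])
  ultimately have eq: "jac W t \<xi> - jac W t \<eta> = 3 / 2 * (LINT s:{0..cl t}|lborel. W (s, \<xi>) - W (s, \<eta>))"
    by (simp add: jac_def)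
  have gen: "x = 3 / 2 * y \<Longrightarrow> \<bar>y\<bar> \<le> h * d * (c - 0) \<Longrightarrow> \<bar>x\<bar> \<le> 3 / 2 * h * c * d" for x y c d :: real
    by (auto simp: abs_mult mult_ac)
  have "\<bar>LINT s:{0..cl t}|lborel. W (s, \<xi>) - W (s, \<eta>)\<bar> \<le> h * \<bar>wt_prim \<xi> - wt_prim \<eta>\<bar> * (cl t - 0)"
    by (rule set_integral_Icc_bound) (use cl_bounds W_piece[OF assms] in auto)
  from gen[OF eq this] show ?thesis .
qed

lemma W_isCont: "\<xi> \<notin> kinks \<Longrightarrow> isCont (\<lambda>\<eta>. W (t, \<eta>)) \<xi>"
proof (rule piecewise_Lipschitz_isCont[where C = h])
  fix \<eta> assume "piece \<eta> = piece \<xi>"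
  then have "\<bar>W (t, \<eta>) - W (t, \<xi>)\<bar> \<le> h * \<bar>wt_prim \<eta> - wt_prim \<xi>\<bar>" by (rule W_piece)
  also have "\<dots> \<le> h * \<bar>\<eta> - \<xi>\<bar>" using h by (intro mult_left_mono wt_prim_Lipschitz) simp
  finally show "\<bar>W (t, \<eta>) - W (t, \<xi>)\<bar> \<le> h * \<bar>\<eta> - \<xi>\<bar>" .
qed

lemma jac_isCont: "\<xi> \<notin> kinks \<Longrightarrow> isCont (jac W t) \<xi>"
proof (rule piecewise_Lipschitz_isCont[where C = "3 / 2 * h * cl t"])
  fix \<eta> assume "piece \<eta> = piece \<xi>"
  then have "\<bar>jac W t \<eta> - jac W t \<xi>\<bar> \<le> 3 / 2 * h * cl t * \<bar>wt_prim \<eta> - wt_prim \<xi>\<bar>" by (rule jac_piece)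
  also have "\<dots> \<le> 3 / 2 * h * cl t * \<bar>\<eta> - \<xi>\<bar>" using h cl_bounds(1)[of t] by (intro mult_left_mono wt_prim_Lipschitz) simp
  finally show "\<bar>jac W t \<eta> - jac W t \<xi>\<bar> \<le> 3 / 2 * h * cl t * \<bar>\<eta> - \<xi>\<bar>" .
qed

lemma pos_meas: "(\<lambda>(t, \<xi>). slice_pos (jac W t) \<xi>) \<in> borel_measurable (borel \<Otimes>\<^sub>M borel)"
  unfolding slice_pos_def set_lebesgue_integral_def indicator_def atLeastAtMost_iff atMost_iff by measurable

lemmas pos_measurable[measurable (raw)] = measurable_curried[OF pos_meas]

lemma nl_meas:
  "(\<lambda>(t, \<xi>). nl_sum (jac W t) (\<lambda>\<eta>. W (t, \<eta>)) \<xi>) \<in> borel_measurable (borel \<Otimes>\<^sub>M borel)"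
  "(\<lambda>(t, \<xi>). nl_diff (jac W t) (\<lambda>\<eta>. W (t, \<eta>)) \<xi>) \<in> borel_measurable (borel \<Otimes>\<^sub>M borel)"
  unfolding nonlocal_def side_def by measurable

lemmas nl_measurable[measurable (raw)] = nl_meas[THEN measurable_curried]

lemma rhs_meas: "(\<lambda>(t, \<xi>). rhs W t \<xi>) \<in> borel_measurable (borel \<Otimes>\<^sub>M borel)"
  unfolding rhs_def by measurable

lemmas rhs_measurable[measurable (raw)] = measurable_curried[OF rhs_meas]

lemma rhs_section: "(\<lambda>t. rhs W t \<xi>) \<in> borel_measurable borel" by measurable

lemma rhs_bound: "\<bar>rhs W t \<xi>\<bar> \<le> 60 * h * wt \<xi>"
proof -
  interpret slice h "jac W t" "\<lambda>\<eta>. W (t, \<eta>)" by (rule jac_slice)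
  have "\<bar>jac W t \<xi>\<bar> * \<bar>nl_diff (jac W t) (\<lambda>\<eta>. W (t, \<eta>)) \<xi>\<bar> \<le> 5 / 4 * (48 * h * wt \<xi>)"
    using j0 j1 by (intro mult_mono nl_diff_bound) auto
  then show ?thesis by (simp add: rhs_def abs_mult)
qed

text \<open>By \<open>nl_deriv\<close> the derivative is W minus the Jacobian times
  \<open>nl_sum\<close>, at most 4 + 5/4 * 48 = 64 times h and the weight. The nonlocal term is
  continuous, so this modulus holds across the kinks as well.\<close>

lemma nl_diff_prim:
  "\<bar>nl_diff (jac W t) (\<lambda>\<eta>. W (t, \<eta>)) \<xi> - nl_diff (jac W t) (\<lambda>\<eta>. W (t, \<eta>)) \<eta>\<bar> \<le> 64 * h * \<bar>wt_prim \<xi> - wt_prim \<eta>\<bar>"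
proof -
  interpret slice h "jac W t" "\<lambda>\<eta>. W (t, \<eta>)" by (rule jac_slice)
  show ?thesis
  proof (rule wt_prim_dominates[of kinks])
    fix x assume "x \<notin> kinks"
    then show "(nl_diff (jac W t) (\<lambda>\<eta>. W (t, \<eta>)) has_real_derivative W (t, x) - jac W t x * nl_sum (jac W t) (\<lambda>\<eta>. W (t, \<eta>)) x) (at x)"
      by (intro nl_deriv W_isCont jac_isCont)
    have "\<bar>jac W t x\<bar> * \<bar>nl_sum (jac W t) (\<lambda>\<eta>. W (t, \<eta>)) x\<bar> \<le> 5 / 4 * (48 * h * wt x)"
      using j0 j1 by (intro mult_mono nl_sum_bound) auto
    then have "\<bar>jac W t x * nl_sum (jac W t) (\<lambda>\<eta>. W (t, \<eta>)) x\<bar> \<le> 60 * h * wt x" by (simp add: abs_mult)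
    then show "\<bar>W (t, x) - jac W t x * nl_sum (jac W t) (\<lambda>\<eta>. W (t, \<eta>)) x\<bar> \<le> 64 * h * wt x"
      using W_bound[of t x] by linarith
  qed (auto intro: nl_continuous)
qed

lemma step_admissible: "admissible (step W)"
  unfolding admissible_def
proof (intro conjI allI impI)
  show "step W \<in> borel_measurable (borel \<Otimes>\<^sub>M borel)"
    unfolding step_def set_lebesgue_integral_def indicator_def atLeastAtMost_iff atMost_iff by measurable
  fix t s \<xi> \<eta>
  have "\<bar>step W (t, \<xi>) - W0 \<xi>\<bar> \<le> 60 * h * wt \<xi> * (cl t - 0)"
    unfolding step_eq using set_integral_Icc_bound[OF cl_bounds(1), of "\<lambda>s. rhs W s \<xi>" "60 * h * wt \<xi>" t] rhs_bound by simp
  also have "\<dots> \<le> 60 * h * wt \<xi> * (1 / 10000)"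
    using h wt_pos[of \<xi>] cl_bounds(2)[of t] T by (intro mult_left_mono) auto
  also have "\<dots> \<le> h / 4 * wt \<xi>" using h wt_pos[of \<xi>] by simp
  finally show "\<bar>step W (t, \<xi>) - W0 \<xi>\<bar> \<le> h / 4 * wt \<xi>" .
  have "\<bar>step W (t, \<xi>) - step W (s, \<xi>)\<bar> \<le> 60 * h * wt \<xi> * \<bar>cl t - cl s\<bar>"
    unfolding step_eq using set_integral_Icc_diff[of "\<lambda>s. rhs W s \<xi>" "60 * h * wt \<xi>" "cl t" "cl s"] rhs_section rhs_bound cl_bounds(1) by simp
  also have "\<dots> \<le> 60 * h * wt \<xi> * \<bar>t - s\<bar>" using h wt_pos[of \<xi>] by (intro mult_left_mono cl_Lipschitz) auto
  finally show "\<bar>step W (t, \<xi>) - step W (s, \<xi>)\<bar> \<le> 60 * h * wt \<xi> * \<bar>t - s\<bar>" .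
  show "\<bar>step W (t, \<xi>) - step W (t, \<eta>)\<bar> \<le> h * \<bar>wt_prim \<xi> - wt_prim \<eta>\<bar>" if pc: "piece \<xi> = piece \<eta>"
  proof -
  let ?d = "\<bar>wt_prim \<xi> - wt_prim \<eta>\<bar>"
  \<comment> \<open>81 = 1 + 5/4 * 64: the variation of the Jacobian contributes at most 72 T < 1,
    that of the nonlocal term the rest.\<close>
  have r: "\<bar>rhs W s \<xi> - rhs W s \<eta>\<bar> \<le> 81 * h * ?d" for s
  proof -
    interpret slice h "jac W s" "\<lambda>\<eta>. W (s, \<eta>)" by (rule jac_slice)
    let ?N = "nl_diff (jac W s) (\<lambda>\<eta>. W (s, \<eta>))"
    have "\<bar>jac W s \<xi> - jac W s \<eta>\<bar> * \<bar>?N \<xi>\<bar> \<le> (3 / 2 * h * cl s * ?d) * 48"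
    proof (rule mult_mono[OF jac_piece[OF pc]])
      show "0 \<le> 3 / 2 * h * cl s * ?d" using h cl_bounds(1)[of s] by (intro mult_nonneg_nonneg) auto
      have "48 * h * wt \<xi> \<le> 48 * 1 * 1" using h wt_le_1[of \<xi>] wt_pos[of \<xi>] by (intro mult_mono) auto
      then show "\<bar>?N \<xi>\<bar> \<le> 48" using nl_diff_bound[of \<xi>] by linarith
    qed simp
    also have "\<dots> = (72 * cl s) * (h * ?d)" by simp
    also have "\<dots> \<le> 1 * (h * ?d)" using cl_bounds(2)[of s] T h by (intro mult_right_mono) auto
    finally have 1: "\<bar>jac W s \<xi> - jac W s \<eta>\<bar> * \<bar>?N \<xi>\<bar> \<le> h * ?d" by simp
    have 2: "\<bar>jac W s \<eta>\<bar> * \<bar>?N \<xi> - ?N \<eta>\<bar> \<le> 5 / 4 * (64 * h * ?d)"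
      using j0 j1 by (intro mult_mono nl_diff_prim) auto
    have "rhs W s \<xi> - rhs W s \<eta> = (jac W s \<xi> - jac W s \<eta>) * ?N \<xi> + jac W s \<eta> * (?N \<xi> - ?N \<eta>)"
      by (simp add: rhs_def algebra_simps)
    then have "\<bar>rhs W s \<xi> - rhs W s \<eta>\<bar> \<le> \<bar>jac W s \<xi> - jac W s \<eta>\<bar> * \<bar>?N \<xi>\<bar> + \<bar>jac W s \<eta>\<bar> * \<bar>?N \<xi> - ?N \<eta>\<bar>"
      by (metis abs_mult abs_triangle_ineq)
    then show ?thesis using 1 2 by linarith
  qed
  have i: "set_integrable lborel {0..cl t} (\<lambda>s. rhs W s \<zeta>)" for \<zeta>
    by (rule set_integrable_bounded[OF rhs_section rhs_bound])
  have "W0 \<xi> = W0 \<eta>" using pc by (simp add: W0_def)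
  then have "step W (t, \<xi>) - step W (t, \<eta>) = (LINT s:{0..cl t}|lborel. rhs W s \<xi> - rhs W s \<eta>)"
    unfolding step_eq using set_integral_diff(2)[OF i i, of \<xi> \<eta>] by simp
  also have "\<bar>\<dots>\<bar> \<le> 81 * h * ?d * (cl t - 0)"
    by (rule set_integral_Icc_bound) (use cl_bounds r in auto)
  also have "\<dots> = (81 * cl t) * (h * ?d)" by simp
  also have "\<dots> \<le> 1 * (h * ?d)" using cl_bounds(2)[of t] T h by (intro mult_right_mono) auto
  finally show ?thesis by simp
  qed
qed

end

section \<open>Contraction and existence of the fixed point\<close>

context rarefaction
begin

lemma profile: "admissible W \<Longrightarrow> rarefaction_profile h \<epsilon> T W"
  by (intro rarefaction_profile.intro rarefaction_profile_axioms.intro rarefaction_axioms)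

lemma admissible_slice_pair:
  assumes "admissible W" "admissible W'" "0 \<le> D"
    and "\<And>\<xi>. \<bar>jac W t \<xi> - jac W' s \<xi>\<bar> \<le> D" "\<And>\<xi>. \<bar>W (t, \<xi>) - W' (s, \<xi>)\<bar> \<le> D * wt \<xi>"
  shows "slice_pair h (jac W t) (\<lambda>\<eta>. W (t, \<eta>)) (jac W' s) (\<lambda>\<eta>. W' (s, \<eta>)) D"
  using assms by (intro slice_pair.intro slice_pair_axioms.intro rarefaction_profile.jac_slice profile)

text \<open>The Jacobians differ by at most 3/2 T D <= D in the unweighted norm, as
  \<open>slice_pair\<close> requires. The right-hand sides then differ by at most 48 + 5/4 * 780 <=
  1100 times D and the weight, and integration over a time of at most T makes the factor smaller
  than 1/2.\<close>

lemma step_contraction: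
  assumes W: "admissible W" and W': "admissible W'" and D: "0 \<le> D" "\<And>x. \<bar>W x - W' x\<bar> \<le> D * wt (snd x)"
  shows "\<bar>step W x - step W' x\<bar> \<le> D / 2 * wt (snd x)"
proof (cases x)
  case (Pair t \<xi>)
  interpret A: rarefaction_profile h \<epsilon> T W by (rule profile[OF W])
  interpret B: rarefaction_profile h \<epsilon> T W' by (rule profile[OF W'])
  have jd: "\<bar>jac W s \<zeta> - jac W' s \<zeta>\<bar> \<le> D" for s \<zeta>
  proof -
    have "jac W s \<zeta> - jac W' s \<zeta> = 3 / 2 * (LINT r:{0..cl s}|lborel. W (r, \<zeta>) - W' (r, \<zeta>))"
    proof -
      have "(LINT r:{0..cl s}|lborel. W (r, \<zeta>) - W' (r, \<zeta>)) = (LINT r:{0..cl s}|lborel. W (r, \<zeta>)) - (LINT r:{0..cl s}|lborel. W' (r, \<zeta>))"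
        by (intro set_integral_diff set_integrable_bounded[OF A.W_section(1) A.W_bound'] set_integrable_bounded[OF B.W_section(1) B.W_bound'])
      then show ?thesis by (simp add: jac_def)
    qed
    also have "\<bar>\<dots>\<bar> \<le> 3 / 2 * (D * (cl s - 0))"
    proof -
      have "\<bar>W (r, \<zeta>) - W' (r, \<zeta>)\<bar> \<le> D" for r
        using D(2)[of "(r, \<zeta>)"] mult_left_mono[OF wt_le_1 D(1), of \<zeta>] by simp
      then show ?thesis unfolding abs_mult
        using set_integral_Icc_bound[of 0 "cl s" "\<lambda>r. W (r, \<zeta>) - W' (r, \<zeta>)" D] cl_bounds(1)[of s] by simp
    qed
    also have "\<dots> = D * (3 / 2 * cl s)" by simp
    also have "\<dots> \<le> D * 1" using cl_bounds(2)[of s] T D by (intro mult_left_mono) auto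
    finally show ?thesis by simp
  qed
  have r: "\<bar>rhs W s \<xi> - rhs W' s \<xi>\<bar> \<le> 1100 * D * wt \<xi>" for s
  proof -
    interpret P: slice_pair h "jac W s" "\<lambda>\<eta>. W (s, \<eta>)" "jac W' s" "\<lambda>\<eta>. W' (s, \<eta>)" D
      by (intro admissible_slice_pair W W' D(1) jd) (use D(2)[of "(s, _)"] in simp)
    let ?N = "nl_diff (jac W s) (\<lambda>\<eta>. W (s, \<eta>))" and ?N' = "nl_diff (jac W' s) (\<lambda>\<eta>. W' (s, \<eta>))"
    have "\<bar>jac W s \<xi> - jac W' s \<xi>\<bar> * \<bar>?N \<xi>\<bar> \<le> D * (48 * 1 * wt \<xi>)"
    proof (rule mult_mono[OF jd _ D(1)])
      have "48 * h * wt \<xi> \<le> 48 * 1 * wt \<xi>" using h wt_pos[of \<xi>] by (intro mult_right_mono mult_left_mono) auto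
      then show "\<bar>?N \<xi>\<bar> \<le> 48 * 1 * wt \<xi>" using P.A.nl_diff_bound[of \<xi>] by linarith
    qed simp
    moreover have "\<bar>jac W' s \<xi>\<bar> * \<bar>?N \<xi> - ?N' \<xi>\<bar> \<le> 5 / 4 * (780 * D * wt \<xi>)"
      using P.B.j0 P.B.j1 by (intro mult_mono P.nl_diff_diff) auto
    moreover have "rhs W s \<xi> - rhs W' s \<xi> = (jac W s \<xi> - jac W' s \<xi>) * ?N \<xi> + jac W' s \<xi> * (?N \<xi> - ?N' \<xi>)"
      by (simp add: rhs_def algebra_simps)
    then have "\<bar>rhs W s \<xi> - rhs W' s \<xi>\<bar> \<le> \<bar>jac W s \<xi> - jac W' s \<xi>\<bar> * \<bar>?N \<xi>\<bar> + \<bar>jac W' s \<xi>\<bar> * \<bar>?N \<xi> - ?N' \<xi>\<bar>"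
      by (metis abs_mult abs_triangle_ineq)
    moreover have "0 \<le> D * wt \<xi>" using D wt_pos[of \<xi>] by simp
    ultimately show ?thesis by linarith
  qed
  have "step W x - step W' x = (LINT s:{0..cl t}|lborel. rhs W s \<xi> - rhs W' s \<xi>)"
  proof -
    have "(LINT s:{0..cl t}|lborel. rhs W s \<xi> - rhs W' s \<xi>) = (LINT s:{0..cl t}|lborel. rhs W s \<xi>) - (LINT s:{0..cl t}|lborel. rhs W' s \<xi>)"
      by (intro set_integral_diff set_integrable_bounded[OF A.rhs_section A.rhs_bound] set_integrable_bounded[OF B.rhs_section B.rhs_bound])
    then show ?thesis by (simp add: Pair step_eq)
  qed
  also have "\<bar>\<dots>\<bar> \<le> 1100 * D * wt \<xi> * (cl t - 0)"
    by (rule set_integral_Icc_bound) (use cl_bounds r in auto)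
  also have "\<dots> = (1100 * cl t) * (D * wt \<xi>)" by simp
  also have "\<dots> \<le> (1 / 2) * (D * wt \<xi>)" using cl_bounds(2)[of t] T D wt_pos[of \<xi>] by (intro mult_right_mono) auto
  finally show ?thesis by (simp add: Pair)
qed

lemma initial_admissible: "admissible (\<lambda>x. W0 (snd x))"
  unfolding admissible_def
proof (intro conjI allI impI)
  show "(\<lambda>x. W0 (snd x)) \<in> borel_measurable (borel \<Otimes>\<^sub>M borel)" by measurable
  fix t s \<xi> \<eta>
  have "0 \<le> h * wt \<xi>" using h wt_pos[of \<xi>] by simp
  then show "\<bar>W0 (snd (t, \<xi>)) - W0 \<xi>\<bar> \<le> h / 4 * wt \<xi>"
    "\<bar>W0 (snd (t, \<xi>)) - W0 (snd (s, \<xi>))\<bar> \<le> 60 * h * wt \<xi> * \<bar>t - s\<bar>" by simp_all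
  show "\<bar>W0 (snd (t, \<xi>)) - W0 (snd (t, \<eta>))\<bar> \<le> h * \<bar>wt_prim \<xi> - wt_prim \<eta>\<bar>" if "piece \<xi> = piece \<eta>"
    using that h by (simp add: W0_def)
qed

lemma admissible_limit:
  assumes adm: "\<And>n. admissible (f n)" and lim: "\<And>x. (\<lambda>n::nat. f n x) \<longlonglongrightarrow> g x"
  shows "admissible g"
  unfolding admissible_def
proof (intro conjI allI impI)
  show "g \<in> borel_measurable (borel \<Otimes>\<^sub>M borel)"
    by (rule borel_measurable_LIMSEQ_real[OF lim rarefaction_profile.W_meas[OF profile[OF adm]]])
  fix t s \<xi> \<eta>
  show "\<bar>g (t, \<xi>) - W0 \<xi>\<bar> \<le> h / 4 * wt \<xi>"
  proof (rule LIMSEQ_le_const2)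
    show "(\<lambda>n. \<bar>f n (t, \<xi>) - W0 \<xi>\<bar>) \<longlonglongrightarrow> \<bar>g (t, \<xi>) - W0 \<xi>\<bar>"
      by (intro tendsto_rabs tendsto_diff lim tendsto_const)
    show "\<exists>N. \<forall>n\<ge>N. \<bar>f n (t, \<xi>) - W0 \<xi>\<bar> \<le> h / 4 * wt \<xi>"
      by (intro exI allI impI rarefaction_profile.W_near[OF profile[OF adm]])
  qed
  show "\<bar>g (t, \<xi>) - g (s, \<xi>)\<bar> \<le> 60 * h * wt \<xi> * \<bar>t - s\<bar>"
  proof (rule LIMSEQ_le_const2)
    show "(\<lambda>n. \<bar>f n (t, \<xi>) - f n (s, \<xi>)\<bar>) \<longlonglongrightarrow> \<bar>g (t, \<xi>) - g (s, \<xi>)\<bar>"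
      by (intro tendsto_rabs tendsto_diff lim)
    show "\<exists>N. \<forall>n\<ge>N. \<bar>f n (t, \<xi>) - f n (s, \<xi>)\<bar> \<le> 60 * h * wt \<xi> * \<bar>t - s\<bar>"
      by (intro exI allI impI rarefaction_profile.W_time[OF profile[OF adm]])
  qed
  show "\<bar>g (t, \<xi>) - g (t, \<eta>)\<bar> \<le> h * \<bar>wt_prim \<xi> - wt_prim \<eta>\<bar>" if "piece \<xi> = piece \<eta>"
  proof (rule LIMSEQ_le_const2)
    show "(\<lambda>n. \<bar>f n (t, \<xi>) - f n (t, \<eta>)\<bar>) \<longlonglongrightarrow> \<bar>g (t, \<xi>) - g (t, \<eta>)\<bar>"
      by (intro tendsto_rabs tendsto_diff lim)
    show "\<exists>N. \<forall>n\<ge>N. \<bar>f n (t, \<xi>) - f n (t, \<eta>)\<bar> \<le> h * \<bar>wt_prim \<xi> - wt_prim \<eta>\<bar>"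
      by (intro exI allI impI rarefaction_profile.W_piece[OF profile[OF adm]] that)
  qed
qed

lemma initial_step: "\<bar>step (\<lambda>x. W0 (snd x)) x - W0 (snd x)\<bar> \<le> h * wt (snd x)"
proof (cases x)
  case (Pair t \<xi>)
  have "\<bar>step (\<lambda>x. W0 (snd x)) (t, \<xi>) - W0 \<xi>\<bar> \<le> h / 4 * wt \<xi>"
    by (rule rarefaction_profile.W_near[OF profile[OF rarefaction_profile.step_admissible[OF profile[OF initial_admissible]]]])
  moreover have "0 \<le> h * wt \<xi>" using h wt_pos[of \<xi>] by simp
  ultimately show ?thesis unfolding Pair snd_conv by linarith
qed

lemma fixed_point_exists: "\<exists>W. admissible W \<and> step W = W"
  by (rule pointwise_contraction[of admissible "\<lambda>x. W0 (snd x)" step "\<lambda>x. wt (snd x)" h,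
        OF initial_admissible rarefaction_profile.step_admissible[OF profile] admissible_limit step_contraction less_imp_le[OF h(1)] initial_step])

end

section \<open>The solution in Eulerian coordinates\<close>

lemma set_integral_atMost_FTC:
  fixes F f :: "real \<Rightarrow> real"
  assumes S: "finite S" and D: "\<And>x. x \<notin> S \<Longrightarrow> (F has_real_derivative f x) (at x)"
    and F: "continuous_on UNIV F" and f: "set_integrable lborel {..a} f" and lim: "(F \<longlongrightarrow> 0) at_bot"
  shows "(LINT x:{..a}|lborel. f x) = F a"
proof -
  have "(LINT x|lborel. indicator {..a} x *\<^sub>R f x) = F a - 0"
  proof (rule integral_FTC_UNIV_finite_exceptions[where S = "insert a S" and F = "\<lambda>x. F (min x a)"])
    fix x assume x: "x \<notin> insert a S"
    show "((\<lambda>x. F (min x a)) has_vector_derivative indicator {..a} x *\<^sub>R f x) (at x)"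
    proof (cases "x < a")
      case True
      have "((\<lambda>x. F (min x a)) has_real_derivative f x) (at x)"
        by (rule has_field_derivative_transform_within_open[OF D, of _ "{..<a}"]) (use True x in auto)
      then show ?thesis using True by (simp add: has_real_derivative_iff_has_vector_derivative)
    next
      case False
      then have "a < x" using x by auto
      have "((\<lambda>x. F (min x a)) has_real_derivative 0) (at x)"
        by (rule has_field_derivative_transform_within_open[of "\<lambda>_. F a" _ _ "{a<..}"]) (use \<open>a < x\<close> in auto)
      then show ?thesis using \<open>a < x\<close> by (simp add: has_real_derivative_iff_has_vector_derivative)
    qed
  next
    show "continuous_on UNIV (\<lambda>x. F (min x a))"
      by (rule continuous_on_compose2[OF F]) (auto intro!: continuous_intros)
    show "integrable lborel (\<lambda>x. indicator {..a} x *\<^sub>R f x)" using f by (simp add: set_integrable_def)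
    have "eventually (\<lambda>x. F x = F (min x a)) at_bot"
      using eventually_le_at_bot[of a] by eventually_elim (simp add: min_def)
    from Lim_transform_eventually[OF lim this] show "((\<lambda>x. F (min x a)) \<longlongrightarrow> 0) at_bot" .
    have "eventually (\<lambda>x. F (min x a) = F a) at_top"
      using eventually_ge_at_top[of a] by eventually_elim (simp add: min_def)
    then show "((\<lambda>x. F (min x a)) \<longlongrightarrow> F a) at_top" by (rule tendsto_eventually)
  qed (use S in simp)
  then show ?thesis by (simp add: set_lebesgue_integral_def)
qed

lemma wt_tendsto: "(wt \<longlongrightarrow> 0) at_bot" "(wt \<longlongrightarrow> 0) at_top"
  unfolding wt_def[abs_def] by real_asymp+

lemma dominated_by_wt_tendsto:
  fixes f :: "real \<Rightarrow> real"
  assumes "\<And>x. \<bar>f x\<bar> \<le> C * wt x" shows "(f \<longlongrightarrow> 0) at_bot" "(f \<longlongrightarrow> 0) at_top"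
proof -
  have "((\<lambda>x. C * wt x) \<longlongrightarrow> C * 0) at_bot" "((\<lambda>x. C * wt x) \<longlongrightarrow> C * 0) at_top"
    by (intro tendsto_intros wt_tendsto)+
  then show "(f \<longlongrightarrow> 0) at_bot" "(f \<longlongrightarrow> 0) at_top"
    using assms by (auto intro!: Lim_null_comparison[OF always_eventually, of f "\<lambda>x. C * wt x"])
qed

lemma (in slice) pos_dominates:
  assumes "x \<le> y" "f \<in> borel_measurable borel" "\<And>z. z \<in> {x<..y} \<Longrightarrow> \<bar>f z\<bar> \<le> K * j z"
  shows "\<bar>LINT z:{x<..y}|lborel. f z\<bar> \<le> K * (slice_pos j y - slice_pos j x)"
proof -
  have "norm (LINT z:{x<..y}|lborel. f z) \<le> (LINT z|lborel. K * (indicator {x<..y} z *\<^sub>R j z))"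
    unfolding set_lebesgue_integral_def
  proof (rule integral_norm_le)
    show "integrable lborel (\<lambda>z. K * (indicator {x<..y} z *\<^sub>R j z))"
      using j_ivl_int by (intro integrable_mult_right) (simp add: set_integrable_def)
    show "norm (indicator {x<..y} z *\<^sub>R f z) \<le> K * (indicator {x<..y} z *\<^sub>R j z)" for z
      using assms(3)[of z] by (cases "z \<in> {x<..y}") auto
  qed
  also have "\<dots> = K * (LINT z:{x<..y}|lborel. j z)" by (simp add: set_lebesgue_integral_def)
  finally show ?thesis by (simp add: pos_diff[OF assms(1)])
qed

lemma measure_lborel_simps:
  "measure lborel ({0<..<1} \<inter> {..\<xi>::real}) = (if \<xi> \<le> 0 then 0 else if \<xi> < 1 then \<xi> else 1)"
  "measure lborel ({1..<2} \<inter> {..\<xi>::real}) = (if \<xi> \<le> 1 then 0 else if \<xi> < 2 then \<xi> - 1 else 1)"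
proof -
  consider "\<xi> \<le> 0" | "0 < \<xi>" "\<xi> < 1" | "1 \<le> \<xi>" by linarith
  then show "measure lborel ({0<..<1} \<inter> {..\<xi>}) = (if \<xi> \<le> 0 then 0 else if \<xi> < 1 then \<xi> else 1)"
  proof cases
    case 1 then have "{0<..<1} \<inter> {..\<xi>} = {}" by auto
    then show ?thesis using 1 by simp
  next
    case 2 then have "{0<..<1} \<inter> {..\<xi>} = {0<..\<xi>}" by auto
    then show ?thesis using 2 by simp
  next
    case 3 then have "{0<..<1} \<inter> {..\<xi>} = {0<..<1}" by auto
    then show ?thesis using 3 by simp
  qed
  consider "\<xi> < 1" | "1 \<le> \<xi>" "\<xi> < 2" | "2 \<le> \<xi>" by linarith
  then show "measure lborel ({1..<2} \<inter> {..\<xi>}) = (if \<xi> \<le> 1 then 0 else if \<xi> < 2 then \<xi> - 1 else 1)"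
  proof cases
    case 1 then have "{1..<2} \<inter> {..\<xi>} = {}" by auto
    then show ?thesis using 1 by simp
  next
    case 2 then have "{1..<2} \<inter> {..\<xi>} = {1..\<xi>}" by auto
    then show ?thesis using 2 by simp
  next
    case 3 then have "{1..<2} \<inter> {..\<xi>} = {1..<2}" by auto
    then show ?thesis using 3 by simp
  qed
qed

locale rarefaction_solution = rarefaction_profile +
  assumes fixed: "step W = W"
begin

text \<open>\<open>Y\<close> is the flow map and \<open>Z\<close> its inverse; \<open>V\<close> is
  the velocity in labels, \<open>v\<close> the velocity in positions and \<open>P\<close> the
  convolution of G with the slope of \<open>v\<close>, taken along the flow.\<close>

definition "Y t \<xi> = slice_pos (jac W t) \<xi>"
definition "P t \<xi> = nl_sum (jac W t) (\<lambda>\<eta>. W (t, \<eta>)) \<xi>"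
definition "V t \<xi> = (LINT z:{..\<xi>}|lborel. W (t, z))"
definition "Z t x = (SOME \<xi>. Y t \<xi> = x)"
definition "v t x = V t (Z t x)"
definition "V0 \<xi> = (LINT z:{..\<xi>}|lborel. W0 z)"

sublocale sl: slice h "jac W t" "\<lambda>\<eta>. W (t, \<eta>)" for t by (rule jac_slice)

lemma W_eq: "W (t, \<xi>) = W0 \<xi> + (LINT s:{0..cl t}|lborel. rhs W s \<xi>)"
  using step_eq[of W t \<xi>] by (simp add: fixed)

lemma W_sint: "set_integrable lborel {..x} (\<lambda>z. W (t, z))"
  unfolding set_integrable_def by (intro integrable_mult_indicator sl.w_int) simp

lemma V_diff: "\<xi> \<le> \<eta> \<Longrightarrow> V t \<eta> - V t \<xi> = (LINT z:{\<xi><..\<eta>}|lborel. W (t, z))"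
  unfolding V_def by (rule set_integral_atMost_diff[OF W_sint])

lemma V_deriv: "\<xi> \<notin> kinks \<Longrightarrow> (V t has_real_derivative W (t, \<xi>)) (at \<xi>)"
  unfolding V_def[abs_def] by (rule set_integral_atMost_deriv[OF W_sint W_isCont])

lemma V_continuous: "continuous_on A (V t)"
  unfolding V_def[abs_def] by (rule set_integral_atMost_continuous[OF W_sint W_bound'])

lemma Y_deriv: "\<xi> \<notin> kinks \<Longrightarrow> (Y t has_real_derivative jac W t \<xi>) (at \<xi>)"
  unfolding Y_def[abs_def] by (rule sl.pos_deriv[OF jac_isCont])

lemma Y_continuous: "continuous_on A (Y t)"
  unfolding Y_def[abs_def] by (rule sl.pos_continuous)

lemma P_deriv: "\<xi> \<notin> kinks \<Longrightarrow> (P t has_real_derivative - rhs W t \<xi>) (at \<xi>)"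
  unfolding P_def[abs_def] rhs_def by (rule sl.nl_deriv[OF jac_isCont W_isCont])

lemma P_continuous: "continuous_on A (P t)"
  unfolding P_def[abs_def] by (rule sl.nl_continuous)

lemma P_bound: "\<bar>P t \<xi>\<bar> \<le> 48 * h * wt \<xi>"
  unfolding P_def by (rule sl.nl_sum_bound)

lemma V_measurable[measurable (raw)]:
  assumes "f \<in> borel_measurable M" "g \<in> borel_measurable M" shows "(\<lambda>x. V (f x) (g x)) \<in> borel_measurable M"
proof (rule measurable_curried[OF _ assms])
  show "(\<lambda>(t, \<xi>). V t \<xi>) \<in> borel_measurable (borel \<Otimes>\<^sub>M borel)"
    unfolding V_def set_lebesgue_integral_def indicator_def atMost_iff by measurable
qed

lemma P_measurable[measurable (raw)]:
  "f \<in> borel_measurable M \<Longrightarrow> g \<in> borel_measurable M \<Longrightarrow> (\<lambda>x. P (f x) (g x)) \<in> borel_measurable M"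
  unfolding P_def by measurable

lemma Y_measurable[measurable (raw)]:
  "f \<in> borel_measurable M \<Longrightarrow> g \<in> borel_measurable M \<Longrightarrow> (\<lambda>x. Y (f x) (g x)) \<in> borel_measurable M"
  unfolding Y_def by measurable

lemma rhs_integral: "(LINT z:{..\<xi>}|lborel. rhs W t z) = - P t \<xi>"
proof -
  have [measurable]: "(\<lambda>z. rhs W t z) \<in> borel_measurable borel" by measurable
  have "integrable lborel (\<lambda>z. rhs W t z)"
    by (rule integrable_bounded_by[OF integrable_mult_right[OF wt_integral(1), of "60 * h"]]) (use rhs_bound in auto)
  then have "set_integrable lborel {..\<xi>} (\<lambda>z. rhs W t z)"
    unfolding set_integrable_def by (intro integrable_mult_indicator) auto
  then show ?thesis
  proof (rule set_integral_atMost_FTC[where S = kinks and F = "\<lambda>x. - P t x", rotated 3])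
    show "((\<lambda>x. - P t x) \<longlongrightarrow> 0) at_bot"
      by (rule dominated_by_wt_tendsto(1)[where C = "48 * h"]) (simp add: P_bound)
    show "((\<lambda>x. - P t x) has_real_derivative rhs W t x) (at x)" if "x \<notin> kinks" for x
      using DERIV_minus[OF P_deriv[OF that, of t]] by simp
    show "continuous_on UNIV (\<lambda>x. - P t x)" by (intro continuous_intros P_continuous)
  qed simp
qed

lemma Fubini_time_label:
  fixes g :: "real \<Rightarrow> real \<Rightarrow> real"
  assumes [measurable]: "(\<lambda>(s, z). g s z) \<in> borel_measurable (borel \<Otimes>\<^sub>M borel)" and g: "\<And>s z. \<bar>g s z\<bar> \<le> C * wt z"
  shows "(LINT z:{..\<xi>}|lborel. LINT s:{0..a}|lborel. g s z) = (LINT s:{0..a}|lborel. LINT z:{..\<xi>}|lborel. g s z)"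
proof -
  note [measurable (raw)] = measurable_curried[OF assms(1)]
  let ?F = "\<lambda>z s. indicator {..\<xi>} z * (indicator {0..a} s * g s z)"
  have "(LINT z|lborel. LINT s|lborel. ?F z s) = (LINT s|lborel. LINT z|lborel. ?F z s)"
  proof (rule lborel_Fubini)
    show "integrable lborel (\<lambda>z. C * wt z)" by (intro integrable_mult_right wt_integral)
    show "integrable lborel (\<lambda>s. indicator {0..a} s :: real)" by (simp add: integrable_indicator_iff emeasure_lborel_Icc_eq)
    show "case_prod ?F \<in> borel_measurable (borel \<Otimes>\<^sub>M borel)" unfolding indicator_def by measurable
    show "norm (?F z s) \<le> C * wt z * indicator {0..a} s" for z s
      using g[of s z] abs_ge_zero[of "g s z"] by (auto simp: indicator_def)
  qed
  moreover have "?F z s = indicator {0..a} s * (indicator {..\<xi>} z * g s z)" for z s by simp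
  ultimately have "(LINT z|lborel. LINT s|lborel. ?F z s) = (LINT s|lborel. LINT z|lborel. indicator {0..a} s * (indicator {..\<xi>} z * g s z))"
    by (simp only:)
  then show ?thesis
    by (simp only: set_lebesgue_integral_def real_scaleR_def integral_mult_right_zero)
qed

lemma W0_int: "integrable lborel W0"
  by (rule integrable_bounded_by[OF integrable_mult_right[OF wt_integral(1), of "3 * h"]]) (use W0_bound in auto)

text \<open>Integrating the fixed point equation over the labels and exchanging integrals recovers
  the equation for the velocity itself: its time derivative is -P.\<close>

lemma V_eq: "V t \<xi> = V0 \<xi> - (LINT s:{0..cl t}|lborel. P s \<xi>)"
proof -
  have [measurable]: "(\<lambda>z. LINT s:{0..cl t}|lborel. rhs W s z) \<in> borel_measurable borel"
    unfolding set_lebesgue_integral_def indicator_def by measurable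
  have i1: "set_integrable lborel {..\<xi>} W0" unfolding set_integrable_def by (intro integrable_mult_indicator W0_int) simp
  have i2: "set_integrable lborel {..\<xi>} (\<lambda>z. LINT s:{0..cl t}|lborel. rhs W s z)"
    using set_integral_diff(1)[OF W_sint[of \<xi> t] i1] by (simp add: W_eq)
  have "V t \<xi> = V0 \<xi> + (LINT z:{..\<xi>}|lborel. LINT s:{0..cl t}|lborel. rhs W s z)"
    unfolding V_def V0_def W_eq using set_integral_add(2)[OF i1 i2] by simp
  also have "(LINT z:{..\<xi>}|lborel. LINT s:{0..cl t}|lborel. rhs W s z) = (LINT s:{0..cl t}|lborel. LINT z:{..\<xi>}|lborel. rhs W s z)"
    by (rule Fubini_time_label[OF rhs_meas rhs_bound])
  also have "\<dots> = - (LINT s:{0..cl t}|lborel. P s \<xi>)"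
    unfolding rhs_integral by (simp add: set_lebesgue_integral_def)
  finally show ?thesis by simp
qed

lemma jac_0: "jac W 0 \<xi> = J0 \<xi>"
  using jac_near[of 0 \<xi>] by (simp add: cl_def)

text \<open>The same integration over the labels, applied to the definition of \<open>jac\<close>,
  shows that labels move with speed 3/2 V: they are characteristics.\<close>

lemma Y_eq: "Y t \<xi> = Y 0 \<xi> + 3 / 2 * (LINT s:{0..cl t}|lborel. V s \<xi>)"
proof -
  have i1: "set_integrable lborel {..\<xi>} (\<lambda>z. jac W 0 z - 1)" and i0: "set_integrable lborel {..\<xi>} (\<lambda>z. jac W t z - 1)"
    by (rule sl.j_sint; simp)+
  have j: "jac W t z - 1 = (jac W 0 z - 1) + 3 / 2 * (LINT s:{0..cl t}|lborel. W (s, z))" for z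
    unfolding jac_0 by (simp add: jac_def)
  have i2: "set_integrable lborel {..\<xi>} (\<lambda>z. 3 / 2 * (LINT s:{0..cl t}|lborel. W (s, z)))"
    using set_integral_diff(1)[OF i0 i1] by (simp add: j)
  have "Y t \<xi> = Y 0 \<xi> + (LINT z:{..\<xi>}|lborel. 3 / 2 * (LINT s:{0..cl t}|lborel. W (s, z)))"
    unfolding Y_def slice_pos_def j[of _] using set_integral_add(2)[OF i1 i2] by simp
  also have "(LINT z:{..\<xi>}|lborel. 3 / 2 * (LINT s:{0..cl t}|lborel. W (s, z))) = 3 / 2 * (LINT z:{..\<xi>}|lborel. LINT s:{0..cl t}|lborel. W (s, z))"
    by simp
  also have "(LINT z:{..\<xi>}|lborel. LINT s:{0..cl t}|lborel. W (s, z)) = (LINT s:{0..cl t}|lborel. V s \<xi>)"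
    unfolding V_def by (rule Fubini_time_label[OF _ W_bound]) measurable
  finally show ?thesis .
qed

lemma W0_indicator: "W0 z = h * indicator {0<..<1} z - h * indicator {1..<2} z"
  by (auto simp: W0_def piece_def indicator_def)

lemma J0_indicator: "J0 z - 1 = (\<epsilon> - 1) * indicator {0<..<1} z"
  by (auto simp: J0_def piece_def indicator_def)

lemma V0_eq: "V0 \<xi> = (if \<xi> \<le> 0 then 0 else if \<xi> < 1 then h * \<xi> else if \<xi> < 2 then h * (2 - \<xi>) else 0)"
proof -
  have i: "integrable lborel (\<lambda>z. h * indicator ({0<..<1} \<inter> {..\<xi>}) z)" "integrable lborel (\<lambda>z. h * indicator ({1..<2} \<inter> {..\<xi>}) z)"
    by (intro integrable_mult_right; simp add: integrable_indicator_iff;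
        rule le_less_trans[OF emeasure_mono[of _ "{0..2}"]]; auto simp: emeasure_lborel_Icc_eq)+
  have "V0 \<xi> = (LINT z|lborel. h * indicator ({0<..<1} \<inter> {..\<xi>}) z - h * indicator ({1..<2} \<inter> {..\<xi>}) z)"
    unfolding V0_def set_lebesgue_integral_def
    by (rule Bochner_Integration.integral_cong) (auto simp: W0_indicator indicator_def)
  also have "\<dots> = h * measure lborel ({0<..<1} \<inter> {..\<xi>}) - h * measure lborel ({1..<2} \<inter> {..\<xi>})"
    using i by simp
  finally show ?thesis unfolding measure_lborel_simps
    by (cases "\<xi> \<le> 0"; cases "\<xi> < 1"; cases "\<xi> = 1"; cases "\<xi> < 2"; simp add: algebra_simps)
qed

lemma Y0_eq: "Y 0 \<xi> = (if \<xi> \<le> 0 then \<xi> else if \<xi> < 1 then \<epsilon> * \<xi> else \<xi> - 1 + \<epsilon>)"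
proof -
  have "Y 0 \<xi> = \<xi> + (LINT z|lborel. (\<epsilon> - 1) * indicator ({0<..<1} \<inter> {..\<xi>}) z)"
    unfolding Y_def slice_pos_def jac_0 J0_indicator set_lebesgue_integral_def
    by (intro arg_cong2[where f = "(+)"] refl Bochner_Integration.integral_cong) (auto simp: indicator_def)
  also have "\<dots> = \<xi> + (\<epsilon> - 1) * measure lborel ({0<..<1} \<inter> {..\<xi>})" by simp
  finally show ?thesis unfolding measure_lborel_simps by (auto simp: algebra_simps)
qed

lemma steep_hat_Y0: "steep_hat h \<epsilon> (Y 0 \<xi>) = V0 \<xi>"
proof -
  consider "\<xi> \<le> 0" | "0 < \<xi>" "\<xi> < 1" | "1 \<le> \<xi>" "\<xi> < 2" | "2 \<le> \<xi>" by linarith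
  then show ?thesis
  proof cases
    case 2
    then have "\<epsilon> * \<xi> \<le> \<epsilon>" using \<epsilon> by (auto simp: mult_left_le)
    then show ?thesis using 2 \<epsilon> by (simp add: V0_eq Y0_eq steep_hat_def mult_le_0_iff)
  next
    case 3
    then have "0 < \<xi> - 1 + \<epsilon>" using \<epsilon> by linarith
    then show ?thesis using 3 \<epsilon> by (cases "\<xi> = 1") (auto simp: V0_eq Y0_eq steep_hat_def algebra_simps)
  next
    case 4
    then show ?thesis using \<epsilon> by (cases "\<xi> = 2") (auto simp: V0_eq Y0_eq steep_hat_def)
  qed (simp add: V0_eq Y0_eq steep_hat_def)
qed

lemma V0_bound: "\<bar>V0 \<xi>\<bar> \<le> 3 * h * wt \<xi>"
proof (cases "0 < \<xi> \<and> \<xi> < 2")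
  case True
  then have "1 \<le> 3 * wt \<xi>" by (intro wt_support) auto
  then have "h * 1 \<le> h * (3 * wt \<xi>)" using h by (intro mult_left_mono) auto
  moreover have "\<bar>V0 \<xi>\<bar> \<le> h * 1"
    using True h by (auto simp: V0_eq abs_mult intro!: mult_left_mono)
  ultimately show ?thesis by simp
next
  case False
  then show ?thesis using h wt_pos[of \<xi>] by (auto simp: V0_eq)
qed

lemma P_bound': "\<bar>P t \<xi>\<bar> \<le> 48 * h"
proof -
  have "48 * h * wt \<xi> \<le> 48 * h * 1" using h wt_le_1[of \<xi>] by (intro mult_left_mono) auto
  then show ?thesis using P_bound[of t \<xi>] by simp
qed

text \<open>16/5 times the bound 5/4 of the Jacobian is 4, so that V times the Jacobian again
  satisfies the hypothesis on w in \<open>slice\<close>.\<close>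

lemma V_bound_sharp: "\<bar>V t \<xi>\<bar> \<le> 16 / 5 * h * wt \<xi>"
proof -
  have "\<bar>LINT s:{0..cl t}|lborel. P s \<xi>\<bar> \<le> 48 * h * wt \<xi> * (cl t - 0)"
    by (rule set_integral_Icc_bound) (use cl_bounds P_bound in auto)
  also have "\<dots> \<le> 48 * h * wt \<xi> * (1 / 10000)"
    using h wt_pos[of \<xi>] cl_bounds(2)[of t] T by (intro mult_left_mono) auto
  finally have 1: "\<bar>LINT s:{0..cl t}|lborel. P s \<xi>\<bar> \<le> 48 * (h * wt \<xi>) * (1 / 10000)" by (simp only: mult.assoc)
  have 2: "\<bar>V0 \<xi>\<bar> \<le> 3 * (h * wt \<xi>)" using V0_bound[of \<xi>] by (simp only: mult.assoc)
  have 3: "0 \<le> h * wt \<xi>" using h wt_pos[of \<xi>] by simp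
  have "\<bar>V t \<xi>\<bar> \<le> \<bar>V0 \<xi>\<bar> + \<bar>LINT s:{0..cl t}|lborel. P s \<xi>\<bar>" unfolding V_eq by (rule abs_triangle_ineq4)
  also have "\<dots> \<le> 16 / 5 * (h * wt \<xi>)" using 1 2 3 by argo
  finally show ?thesis by simp
qed

lemma V_bound: "\<bar>V t \<xi>\<bar> \<le> 4 * h * wt \<xi>"
proof -
  have "0 \<le> h * wt \<xi>" using h wt_pos[of \<xi>] by simp
  then show ?thesis using V_bound_sharp[of t \<xi>] by simp
qed

lemma V_bound': "\<bar>V t \<xi>\<bar> \<le> 4 * h"
proof -
  have "4 * h * wt \<xi> \<le> 4 * h * 1" using h wt_le_1[of \<xi>] by (intro mult_left_mono) auto
  then show ?thesis using V_bound[of t \<xi>] by simp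
qed

lemma V_time: "\<bar>V t \<xi> - V s \<xi>\<bar> \<le> 48 * h * \<bar>t - s\<bar>"
proof -
  have "\<bar>V t \<xi> - V s \<xi>\<bar> = \<bar>(LINT s:{0..cl t}|lborel. P s \<xi>) - (LINT s:{0..cl s}|lborel. P s \<xi>)\<bar>"
    unfolding V_eq by (simp add: abs_minus_commute)
  also have "\<dots> \<le> 48 * h * \<bar>cl t - cl s\<bar>" by (intro set_integral_Icc_diff P_bound' cl_bounds) measurable
  also have "\<dots> \<le> 48 * h * \<bar>t - s\<bar>" using h by (intro mult_left_mono cl_Lipschitz) auto
  finally show ?thesis .
qed

lemma Y_time: "\<bar>Y t \<xi> - Y s \<xi>\<bar> \<le> 6 * h * \<bar>t - s\<bar>"
proof -
  have gen: "\<bar>c + 3 / 2 * a - (c + 3 / 2 * b)\<bar> = 3 / 2 * \<bar>a - b\<bar>" for a b c :: real by (simp add: abs_if)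
  have "\<bar>Y t \<xi> - Y s \<xi>\<bar> = 3 / 2 * \<bar>(LINT s:{0..cl t}|lborel. V s \<xi>) - (LINT s:{0..cl s}|lborel. V s \<xi>)\<bar>"
    using Y_eq[of t \<xi>] Y_eq[of s \<xi>] gen by metis
  also have "\<dots> \<le> 3 / 2 * (4 * h * \<bar>cl t - cl s\<bar>)"
    by (intro mult_left_mono set_integral_Icc_diff V_bound' cl_bounds; measurable)
  also have "\<dots> \<le> 3 / 2 * (4 * h * \<bar>t - s\<bar>)" using h by (intro mult_left_mono cl_Lipschitz) auto
  finally show ?thesis by simp
qed

section \<open>The flow map, its inverse and the velocity in positions\<close>

lemma jac_eps: "\<epsilon> \<le> jac W t \<xi>"
proof -
  have "0 \<le> h * cl t" using h cl_bounds(1)[of t] by simp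
  then show ?thesis using jac_lower[of t \<xi>] \<epsilon> by linarith
qed

lemma Y_strict: "\<xi> < \<eta> \<Longrightarrow> Y t \<xi> < Y t \<eta>"
proof -
  assume le: "\<xi> < \<eta>"
  have "0 < \<epsilon> * (\<eta> - \<xi>)" using le \<epsilon> by (intro mult_pos_pos) auto
  also have "\<dots> \<le> Y t \<eta> - Y t \<xi>" unfolding Y_def by (rule sl.pos_lower) (use le jac_eps in auto)
  finally show ?thesis by simp
qed

lemma Y_mono: "\<xi> \<le> \<eta> \<Longrightarrow> Y t \<xi> \<le> Y t \<eta>"
  using Y_strict[of \<xi> \<eta> t] by (cases "\<xi> = \<eta>") auto

lemma Y_near: "\<bar>Y t \<xi> - \<xi>\<bar> \<le> 12"
  unfolding Y_def by (rule sl.pos_near)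

lemma Y_Z: "Y t (Z t x) = x"
proof -
  have "\<exists>\<xi>\<ge>x - 12. \<xi> \<le> x + 12 \<and> Y t \<xi> = x"
    by (rule IVT') (use Y_near[of t "x - 12"] Y_near[of t "x + 12"] in \<open>auto intro: Y_continuous\<close>)
  then show ?thesis unfolding Z_def by (metis (mono_tags, lifting) someI_ex)
qed

lemma Z_Y: "Z t (Y t \<xi>) = \<xi>"
  using Y_Z[of t "Y t \<xi>"] Y_strict[of "Z t (Y t \<xi>)" \<xi> t] Y_strict[of \<xi> "Z t (Y t \<xi>)" t] by linarith

lemma Z_mono: "x \<le> y \<Longrightarrow> Z t x \<le> Z t y"
  using Y_Z[of t x] Y_Z[of t y] Y_strict[of "Z t y" "Z t x" t] by linarith

lemma Z_near: "\<bar>Z t x - x\<bar> \<le> 12"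
  using Y_near[of t "Z t x"] by (simp add: Y_Z abs_minus_commute)

lemma v_Y: "v t (Y t \<xi>) = V t \<xi>"
  by (simp add: v_def Z_Y)

lemma v_0: "v 0 x = steep_hat h \<epsilon> x"
proof -
  have "V 0 (Z 0 x) = V0 (Z 0 x)"
    using set_integral_Icc_bound[of 0 0 "\<lambda>s. P s (Z 0 x)" "48 * h"] P_bound' by (simp add: V_eq cl_def T(1) less_imp_le)
  then show ?thesis using steep_hat_Y0[of "Z 0 x"] by (simp add: v_def Y_Z)
qed

lemma v_bound: "\<bar>v t x\<bar> \<le> 4 * exp 6 * h * wt x"
proof -
  have "wt (Z t x) \<le> wt x * exp (\<bar>x - Z t x\<bar> / 2)" by (rule wt_shift)
  also have "\<dots> \<le> wt x * exp 6" using Z_near[of t x] wt_pos[of x] by (intro mult_left_mono) auto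
  finally have "4 * h * wt (Z t x) \<le> 4 * h * (wt x * exp 6)" using h by (intro mult_left_mono) auto
  then show ?thesis using V_bound[of t "Z t x"] by (simp add: v_def mult_ac)
qed

lemma v_bound': "\<bar>v t x\<bar> \<le> 4 * h"
  unfolding v_def by (rule V_bound')

lemma W_bound_2h: "\<bar>W (t, \<xi>)\<bar> \<le> 2 * h"
proof -
  have "h / 4 * wt \<xi> \<le> h / 4 * 1" using h wt_le_1[of \<xi>] by (intro mult_left_mono) auto
  moreover have "\<bar>W0 \<xi>\<bar> \<le> h" using h by (simp add: W0_def)
  ultimately show ?thesis using W_near[of t \<xi>] by linarith
qed

lemma V_Lipschitz_Y:
  assumes m: "m > 0" "\<And>\<xi>. m \<le> jac W t \<xi>"
  shows "\<bar>V t \<xi> - V t \<eta>\<bar> \<le> 2 * h / m * \<bar>Y t \<xi> - Y t \<eta>\<bar>"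
proof -
  have *: "\<bar>V t \<eta> - V t \<xi>\<bar> \<le> 2 * h / m * (Y t \<eta> - Y t \<xi>)" if "\<xi> \<le> \<eta>" for \<xi> \<eta>
    unfolding V_diff[OF that] Y_def
  proof (rule sl.pos_dominates[OF that])
    fix z
    have "2 * h / m * m \<le> 2 * h / m * jac W t z" using m h by (intro mult_left_mono) auto
    then show "\<bar>W (t, z)\<bar> \<le> 2 * h / m * jac W t z" using m W_bound_2h[of t z] by simp
  qed measurable
  show ?thesis using *[of \<xi> \<eta>] *[of \<eta> \<xi>] Y_mono[of \<xi> \<eta> t] Y_mono[of \<eta> \<xi> t]
    by (cases "\<xi> \<le> \<eta>") (auto simp: abs_minus_commute)
qed

text \<open>Compares the two times along the label that sits at x at time t, then moves in space
  with slope at most 2 h / \<epsilon>. The constant blows up with \<epsilon>; it serves only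
  continuity and measurability for a fixed \<epsilon>.\<close>

lemma v_Lipschitz: "\<bar>v t x - v s y\<bar> \<le> (48 + 12 / \<epsilon>) * (\<bar>t - s\<bar> + \<bar>x - y\<bar>)"
proof -
  let ?\<xi> = "Z t x"
  have 1: "\<bar>V t ?\<xi> - V s ?\<xi>\<bar> \<le> 48 * \<bar>t - s\<bar>"
  proof -
    have "48 * h * \<bar>t - s\<bar> \<le> 48 * 1 * \<bar>t - s\<bar>" using h by (intro mult_right_mono) auto
    then show ?thesis using V_time[of t ?\<xi> s] by simp
  qed
  have "\<bar>V s ?\<xi> - V s (Z s y)\<bar> \<le> 2 * h / \<epsilon> * \<bar>Y s ?\<xi> - Y s (Z s y)\<bar>"
    by (rule V_Lipschitz_Y) (use \<epsilon> jac_eps in auto)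
  also have "\<dots> \<le> 2 / \<epsilon> * (6 * \<bar>t - s\<bar> + \<bar>x - y\<bar>)"
  proof (rule mult_mono)
    have "6 * h * \<bar>s - t\<bar> \<le> 6 * 1 * \<bar>s - t\<bar>" using h by (intro mult_right_mono) auto
    then have "\<bar>Y s ?\<xi> - x\<bar> \<le> 6 * \<bar>t - s\<bar>" using Y_time[of s ?\<xi> t] by (simp add: Y_Z abs_minus_commute)
    then show "\<bar>Y s ?\<xi> - Y s (Z s y)\<bar> \<le> 6 * \<bar>t - s\<bar> + \<bar>x - y\<bar>" unfolding Y_Z by linarith
    show "2 * h / \<epsilon> \<le> 2 / \<epsilon>" using h \<epsilon> by (intro divide_right_mono) auto
  qed (use \<epsilon> in auto)
  finally have 2: "\<bar>V s ?\<xi> - V s (Z s y)\<bar> \<le> 12 / \<epsilon> * \<bar>t - s\<bar> + 2 / \<epsilon> * \<bar>x - y\<bar>" by (simp add: algebra_simps)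
  have "2 / \<epsilon> * \<bar>x - y\<bar> \<le> (48 + 12 / \<epsilon>) * \<bar>x - y\<bar>"
    using \<epsilon> by (intro mult_right_mono) (auto simp: add_increasing divide_right_mono)
  then show ?thesis using 1 2 unfolding v_def by (simp add: algebra_simps) (smt (verit))
qed

text \<open>A monotone majorant for the variation of the slope W/jac when the Jacobian is at least
  m. Between kinks, h/m comes from the variation of W, and 3 h^2 T / m^2 = 2 h * (3/2) h T / m^2
  from that of the Jacobian. Across a kink the slope changes by at most twice its bound 2 h /
  m.\<close>

definition "tv_prim m \<xi> = (h / m + 3 * h\<^sup>2 * T / m\<^sup>2) * wt_prim \<xi> + 4 * h / m * real (piece \<xi>)"

lemma slope_variation:
  assumes m: "m > 0" "\<And>\<xi>. m \<le> jac W t \<xi>" and le: "\<xi> \<le> \<eta>"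
  shows "\<bar>W (t, \<xi>) / jac W t \<xi> - W (t, \<eta>) / jac W t \<eta>\<bar> \<le> tv_prim m \<eta> - tv_prim m \<xi>"
proof -
  have j: "0 < jac W t \<zeta>" for \<zeta> using m(1) m(2)[of \<zeta>] by linarith
  have d: "0 \<le> wt_prim \<eta> - wt_prim \<xi>" using monoD[OF wt_prim_mono le] by simp
  have c1: "0 \<le> h / m + 3 * h\<^sup>2 * T / m\<^sup>2" using h T m by (intro add_nonneg_nonneg) auto
  show ?thesis
  proof (cases "piece \<xi> = piece \<eta>")
    case True
    have "W (t, \<xi>) / jac W t \<xi> - W (t, \<eta>) / jac W t \<eta> =
      (W (t, \<xi>) - W (t, \<eta>)) / jac W t \<xi> + W (t, \<eta>) * (jac W t \<eta> - jac W t \<xi>) / (jac W t \<xi> * jac W t \<eta>)"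
      using j[of \<xi>] j[of \<eta>] by (simp add: field_simps)
    also have "\<bar>\<dots>\<bar> \<le> \<bar>(W (t, \<xi>) - W (t, \<eta>)) / jac W t \<xi>\<bar> + \<bar>W (t, \<eta>) * (jac W t \<eta> - jac W t \<xi>) / (jac W t \<xi> * jac W t \<eta>)\<bar>"
      by (rule abs_triangle_ineq)
    also have "\<bar>(W (t, \<xi>) - W (t, \<eta>)) / jac W t \<xi>\<bar> \<le> h * (wt_prim \<eta> - wt_prim \<xi>) / m"
      unfolding abs_divide using W_piece[OF True, of t] d m j[of \<xi>] h by (intro frac_le) auto
    also have "\<bar>W (t, \<eta>) * (jac W t \<eta> - jac W t \<xi>) / (jac W t \<xi> * jac W t \<eta>)\<bar> \<le> 2 * h * (3 / 2 * h * T * (wt_prim \<eta> - wt_prim \<xi>)) / (m * m)"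
      unfolding abs_divide abs_mult
    proof (rule frac_le)
      have "\<bar>jac W t \<eta> - jac W t \<xi>\<bar> \<le> 3 / 2 * h * cl t * \<bar>wt_prim \<eta> - wt_prim \<xi>\<bar>" by (rule jac_piece) (simp add: True)
      also have "\<dots> \<le> 3 / 2 * h * T * \<bar>wt_prim \<eta> - wt_prim \<xi>\<bar>"
        using h cl_bounds(2)[of t] by (intro mult_right_mono mult_left_mono) auto
      finally show "\<bar>W (t, \<eta>)\<bar> * \<bar>jac W t \<eta> - jac W t \<xi>\<bar> \<le> 2 * h * (3 / 2 * h * T * (wt_prim \<eta> - wt_prim \<xi>))"
        using d h W_bound_2h by (intro mult_mono) auto
      show "m * m \<le> \<bar>jac W t \<xi>\<bar> * \<bar>jac W t \<eta>\<bar>" using m j[of \<xi>] j[of \<eta>] by (intro mult_mono) auto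
    qed (use m h T d in auto)
    finally have "\<bar>W (t, \<xi>) / jac W t \<xi> - W (t, \<eta>) / jac W t \<eta>\<bar> \<le> h * (wt_prim \<eta> - wt_prim \<xi>) / m
        + 2 * h * (3 / 2 * h * T * (wt_prim \<eta> - wt_prim \<xi>)) / (m * m)" by simp
    also have "\<dots> = (h / m + 3 * h\<^sup>2 * T / m\<^sup>2) * (wt_prim \<eta> - wt_prim \<xi>)"
      using m by (simp add: field_simps power2_eq_square)
    finally show ?thesis using True by (simp add: tv_prim_def right_diff_distrib)
  next
    case False
    have q: "\<bar>W (t, \<zeta>) / jac W t \<zeta>\<bar> \<le> 2 * h / m" for \<zeta>
      unfolding abs_divide using W_bound_2h[of t \<zeta>] m j[of \<zeta>] by (intro frac_le) auto
    have "piece \<xi> < piece \<eta>" using False monoD[OF piece_mono le] by simp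
    then have "1 \<le> real (piece \<eta>) - real (piece \<xi>)" by linarith
    then have "4 * h / m * 1 \<le> 4 * h / m * (real (piece \<eta>) - real (piece \<xi>))" using h m by (intro mult_left_mono) auto
    moreover have "0 \<le> (h / m + 3 * h\<^sup>2 * T / m\<^sup>2) * (wt_prim \<eta> - wt_prim \<xi>)" using c1 d by simp
    moreover have "\<bar>W (t, \<xi>) / jac W t \<xi> - W (t, \<eta>) / jac W t \<eta>\<bar> \<le> 4 * h / m"
      using q[of \<xi>] q[of \<eta>] by linarith
    moreover have gen: "q \<le> A * b + B * d - (A * a + B * c)" if "B * 1 \<le> B * (d - c)" "0 \<le> A * (b - a)" "q \<le> B" for q A B a b c d :: real
      using that by (simp add: algebra_simps)
    ultimately show ?thesis unfolding tv_prim_def by (intro gen)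
  qed
qed

lemma tv_prim_bounds:
  assumes "m > 0" shows "0 \<le> tv_prim m \<xi>" "tv_prim m \<xi> \<le> 4 * (h / m + 3 * h\<^sup>2 * T / m\<^sup>2) + 4 * h / m * 3"
proof -
  have c1: "0 \<le> h / m + 3 * h\<^sup>2 * T / m\<^sup>2" and c2: "0 \<le> 4 * h / m" using h T assms by (auto intro!: add_nonneg_nonneg)
  show "0 \<le> tv_prim m \<xi>" unfolding tv_prim_def
    by (rule add_nonneg_nonneg[OF mult_nonneg_nonneg[OF c1 wt_prim_bounds(1)] mult_nonneg_nonneg[OF c2]]) simp
  have "(h / m + 3 * h\<^sup>2 * T / m\<^sup>2) * wt_prim \<xi> \<le> (h / m + 3 * h\<^sup>2 * T / m\<^sup>2) * 4"
    using c1 wt_prim_bounds(2)[of \<xi>] by (intro mult_left_mono) auto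
  moreover have "4 * h / m * real (piece \<xi>) \<le> 4 * h / m * 3"
    using c2 piece_le[of \<xi>] by (intro mult_left_mono) auto
  ultimately show "tv_prim m \<xi> \<le> 4 * (h / m + 3 * h\<^sup>2 * T / m\<^sup>2) + 4 * h / m * 3"
    unfolding tv_prim_def by (subst mult.commute[of 4]) (rule add_mono)
qed

text \<open>On both sides v is compared with the line through x whose slope is W/jac at the label of
  x. The slope deviates from this value by at most the increment of \<open>tv_prim\<close>, and the
  linear parts cancel in the symmetric difference.\<close>

lemma second_difference:
  assumes m: "m > 0" "\<And>\<xi>. m \<le> jac W t \<xi>" and \<tau>: "\<tau> > 0"
  shows "\<bar>v t (x + \<tau>) + v t (x - \<tau>) - 2 * v t x\<bar> \<le> \<tau> * (tv_prim m (Z t (x + \<tau>)) - tv_prim m (Z t (x - \<tau>)))"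
proof -
  let ?q = "\<lambda>\<xi>. W (t, \<xi>) / jac W t \<xi>"
  have j: "0 < jac W t \<zeta>" for \<zeta> using m(1) m(2)[of \<zeta>] by linarith
  have mono: "tv_prim m \<xi> \<le> tv_prim m \<eta>" if "\<xi> \<le> \<eta>" for \<xi> \<eta> using slope_variation[OF m that] by linarith
  have lin: "\<bar>V t \<eta> - V t \<xi> - c * (Y t \<eta> - Y t \<xi>)\<bar> \<le> K * (Y t \<eta> - Y t \<xi>)"
    if "\<xi> \<le> \<eta>" "\<And>z. z \<in> {\<xi><..\<eta>} \<Longrightarrow> \<bar>?q z - c\<bar> \<le> K" for \<xi> \<eta> c K
  proof -
    have i: "set_integrable lborel {\<xi><..\<eta>} (\<lambda>z. W (t, z))" by (rule set_integrable_subset[OF W_sint[of \<eta>]]) auto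
    have ij: "set_integrable lborel {\<xi><..\<eta>} (\<lambda>z. c * jac W t z)" using sl.j_ivl_int by (rule set_integrable_mult_right)
    have "V t \<eta> - V t \<xi> - c * (Y t \<eta> - Y t \<xi>) = (LINT z:{\<xi><..\<eta>}|lborel. W (t, z) - c * jac W t z)"
      unfolding V_diff[OF that(1)] Y_def sl.pos_diff[OF that(1)] using set_integral_diff(2)[OF i ij] by simp
    also have "\<bar>\<dots>\<bar> \<le> K * (Y t \<eta> - Y t \<xi>)"
      unfolding Y_def
    proof (rule sl.pos_dominates[OF that(1)])
      fix z assume z: "z \<in> {\<xi><..\<eta>}"
      have "W (t, z) - c * jac W t z = (?q z - c) * jac W t z" using j[of z] by (simp add: field_simps)
      then show "\<bar>W (t, z) - c * jac W t z\<bar> \<le> K * jac W t z"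
        using that(2)[OF z] j[of z] by (simp add: abs_mult mult_right_mono)
    qed measurable
    finally show ?thesis .
  qed
  let ?a = "Z t (x - \<tau>)" and ?b = "Z t x" and ?c = "Z t (x + \<tau>)"
  have ab: "?a \<le> ?b" "?b \<le> ?c" using \<tau> by (auto intro: Z_mono)
  have r: "\<bar>V t ?c - V t ?b - ?q ?b * (Y t ?c - Y t ?b)\<bar> \<le> (tv_prim m ?c - tv_prim m ?b) * (Y t ?c - Y t ?b)"
  proof (rule lin[OF ab(2)])
    fix z assume z: "z \<in> {?b<..?c}"
    then have "?b \<le> z" "z \<le> ?c" by auto
    then show "\<bar>?q z - ?q ?b\<bar> \<le> tv_prim m ?c - tv_prim m ?b"
      using slope_variation[OF m, of ?b z] mono[of z ?c] by (simp add: abs_minus_commute)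
  qed
  have l: "\<bar>V t ?b - V t ?a - ?q ?b * (Y t ?b - Y t ?a)\<bar> \<le> (tv_prim m ?b - tv_prim m ?a) * (Y t ?b - Y t ?a)"
  proof (rule lin[OF ab(1)])
    fix z assume z: "z \<in> {?a<..?b}"
    then have "z \<le> ?b" "?a \<le> z" by auto
    then show "\<bar>?q z - ?q ?b\<bar> \<le> tv_prim m ?b - tv_prim m ?a"
      using slope_variation[OF m, of z ?b] mono[of ?a z] by simp
  qed
  have e: "Y t ?c - Y t ?b = \<tau>" "Y t ?b - Y t ?a = \<tau>" by (simp_all add: Y_Z)
  have "v t (x + \<tau>) + v t (x - \<tau>) - 2 * v t x = (V t ?c - V t ?b - ?q ?b * \<tau>) - (V t ?b - V t ?a - ?q ?b * \<tau>)"
    by (simp add: v_def)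
  also have "\<bar>\<dots>\<bar> \<le> (tv_prim m ?c - tv_prim m ?b) * \<tau> + (tv_prim m ?b - tv_prim m ?a) * \<tau>"
    by (rule order_trans[OF abs_triangle_ineq4 add_mono[OF r[unfolded e] l[unfolded e]]])
  finally show ?thesis by (simp add: algebra_simps)
qed

end

section \<open>The weak formulation\<close>

lemma integrable_compact_pair:
  fixes F :: "real \<times> real \<Rightarrow> real"
  assumes "F \<in> borel_measurable (borel \<Otimes>\<^sub>M borel)" "0 \<le> C"
    and "\<And>x y. \<bar>F (x, y)\<bar> \<le> C" "\<And>x y. x \<notin> {a..b} \<or> y \<notin> {c..d} \<Longrightarrow> F (x, y) = 0"
  shows "integrable (lborel \<Otimes>\<^sub>M lborel) F"
proof (rule integrable_pair_bound[OF _ _ assms(1)])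
  show "integrable lborel (\<lambda>x. C * indicator {a..b} x)"
    by (intro integrable_mult_right) (simp add: integrable_indicator_iff emeasure_lborel_Icc_eq)
  show "integrable lborel (indicat_real {c..d})" by (simp add: integrable_indicator_iff emeasure_lborel_Icc_eq)
  show "norm (F (x, y)) \<le> C * indicator {a..b} x * indicator {c..d} y" for x y
    using assms(3)[of x y] assms(4)[of x y] by (cases "x \<in> {a..b} \<and> y \<in> {c..d}") auto
qed

lemma integrable_compact:
  fixes F :: "real \<Rightarrow> real"
  assumes "F \<in> borel_measurable borel" "\<And>x. \<bar>F x\<bar> \<le> C" "\<And>x. x \<notin> {a..b} \<Longrightarrow> F x = 0"
  shows "integrable lborel F"
proof (rule integrable_bounded_by)
  show "integrable lborel (\<lambda>x. C * indicator {a..b} x)"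
    by (intro integrable_mult_right) (simp add: integrable_indicator_iff emeasure_lborel_Icc_eq)
  show "norm (F x) \<le> C * indicator {a..b} x" for x
    using assms(2)[of x] assms(3)[of x] by (cases "x \<in> {a..b}") auto
qed (use assms(1) in simp)

lemma integral_eq_0_if_deriv:
  fixes F f :: "real \<Rightarrow> real"
  assumes "finite S" "\<And>x. x \<notin> S \<Longrightarrow> (F has_real_derivative f x) (at x)" "continuous_on UNIV F" "integrable lborel f"
    and "(F \<longlongrightarrow> 0) at_bot" "(F \<longlongrightarrow> 0) at_top"
  shows "(LINT x|lborel. f x) = 0"
  using integral_FTC_UNIV_finite_exceptions[where S = S and F = F and f = f and A = 0 and B = 0] assms
  by (simp add: has_real_derivative_iff_has_vector_derivative)

lemma compact_support_tendsto:
  fixes F :: "real \<Rightarrow> real"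
  assumes "\<And>x. x \<notin> {a..b} \<Longrightarrow> F x = 0" shows "(F \<longlongrightarrow> 0) at_bot" "(F \<longlongrightarrow> 0) at_top"
proof -
  have "eventually (\<lambda>x. F x = 0) at_bot" using eventually_le_at_bot[of "a - 1"]
    by eventually_elim (auto intro!: assms)
  then show "(F \<longlongrightarrow> 0) at_bot" by (rule tendsto_eventually)
  have "eventually (\<lambda>x. F x = 0) at_top" using eventually_gt_at_top[of b]
    by eventually_elim (auto intro!: assms)
  then show "(F \<longlongrightarrow> 0) at_top" by (rule tendsto_eventually)
qed

lemma Lipschitz_continuous_on:
  fixes f :: "real \<Rightarrow> real"
  assumes "\<And>x y. \<bar>f x - f y\<bar> \<le> C * \<bar>x - y\<bar>" shows "continuous_on A f"
  by (rule locally_Lipschitz_continuous[where C = "\<lambda>_. C"]) (rule assms)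

text \<open>Collects what the integrations by parts need from a test function: its two partial
  derivatives, a support strictly inside (0,T) and bounded in x, and a common bound.\<close>

definition test_data where
  "test_data T R B \<psi> \<psi>t \<psi>x \<longleftrightarrow> 0 \<le> R \<and> 0 \<le> B \<and>
    (\<forall>z. (\<psi> has_derivative (\<lambda>u. fst u * \<psi>t z + snd u * \<psi>x z)) (at z)) \<and>
    continuous_on UNIV \<psi> \<and> continuous_on UNIV \<psi>t \<and> continuous_on UNIV \<psi>x \<and>
    (\<forall>t x. t \<notin> {0<..<T} \<or> \<bar>x\<bar> > R \<longrightarrow> \<psi> (t, x) = 0 \<and> \<psi>t (t, x) = 0 \<and> \<psi>x (t, x) = 0) \<and>
    (\<forall>z. \<bar>\<psi> z\<bar> \<le> B \<and> \<bar>\<psi>t z\<bar> \<le> B \<and> \<bar>\<psi>x z\<bar> \<le> (B::real))"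

lemma strip_tests_data:
  assumes "\<psi> \<in> strip_tests T"
  obtains R B where "test_data T R B \<psi> (dderiv (1, 0) \<psi>) (dderiv (0, 1) \<psi>)"
proof -
  let ?K = "closure {z. \<psi> z \<noteq> 0}"
  have sm: "smooth \<psi>" and K: "compact ?K" "?K \<subseteq> {0<..<T} \<times> UNIV" using assms by (auto simp: strip_tests_def)
  have df: "foldr dderiv vs \<psi> differentiable (at z)" for vs z using sm unfolding smooth_def by blast
  have d0: "\<psi> differentiable (at z)" for z using df[of "[]"] by simp
  have d1: "dderiv u \<psi> differentiable (at z)" for u z using df[of "[u]"] by simp
  have D: "(\<psi> has_derivative (\<lambda>u. fst u * dderiv (1, 0) \<psi> z + snd u * dderiv (0, 1) \<psi> z)) (at z)" for z
  proof -
    have f: "(\<psi> has_derivative frechet_derivative \<psi> (at z)) (at z)" using d0 by (simp add: frechet_derivative_works)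
    then have l: "linear (frechet_derivative \<psi> (at z))" by (rule has_derivative_linear)
    have "frechet_derivative \<psi> (at z) u = fst u * dderiv (1, 0) \<psi> z + snd u * dderiv (0, 1) \<psi> z" for u
    proof -
      have "u = fst u *\<^sub>R (1, 0) + snd u *\<^sub>R (0, 1)" by (simp add: prod_eq_iff)
      then have "frechet_derivative \<psi> (at z) u = frechet_derivative \<psi> (at z) (fst u *\<^sub>R (1, 0) + snd u *\<^sub>R (0, 1))" by simp
      also have "\<dots> = fst u *\<^sub>R frechet_derivative \<psi> (at z) (1, 0) + snd u *\<^sub>R frechet_derivative \<psi> (at z) (0, 1)"
        by (simp only: linear_add[OF l] linear_scale[OF l])
      finally show ?thesis by (simp add: dderiv_def)
    qed
    then have "frechet_derivative \<psi> (at z) = (\<lambda>u. fst u * dderiv (1, 0) \<psi> z + snd u * dderiv (0, 1) \<psi> z)" by (rule ext)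
    with f show ?thesis by simp
  qed
  have c: "continuous_on UNIV \<psi>" "continuous_on UNIV (dderiv u \<psi>)" for u
    by (intro continuous_at_imp_continuous_on ballI differentiable_imp_continuous_within d0 d1)+
  have out: "\<psi> z = 0" "dderiv u \<psi> z = 0" if "z \<notin> ?K" for z u
  proof -
    have sub: "{z. \<psi> z \<noteq> 0} \<subseteq> ?K" by (rule closure_subset)
    then show "\<psi> z = 0" using that by blast
    have "(\<psi> has_derivative (\<lambda>_. 0)) (at z)"
    proof (rule has_derivative_transform_within_open[of "\<lambda>_. 0" _ _ _ "- ?K"])
      show "0 = \<psi> y" if "y \<in> - ?K" for y using that sub by force
      show "open (- ?K)" by (rule open_Compl) (rule closed_closure)
      show "z \<in> - ?K" using that by simp
    qed (rule has_derivative_const)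
    from frechet_derivative_at[OF this] have "frechet_derivative \<psi> (at z) = (\<lambda>_. 0)" by (rule sym)
    then show "dderiv u \<psi> z = 0" by (simp add: dderiv_def)
  qed
  have b: "\<exists>b. \<forall>z. \<bar>f z\<bar> \<le> b" if f: "continuous_on UNIV f" "\<And>z. z \<notin> ?K \<Longrightarrow> f z = 0" for f :: "real \<times> real \<Rightarrow> real"
  proof -
    have "compact (f ` ?K)" by (intro compact_continuous_image K continuous_on_subset[OF f(1)]) simp
    then obtain b where "\<forall>y\<in>f ` ?K. norm y \<le> b" using compact_imp_bounded bounded_iff by metis
    then have "\<bar>f z\<bar> \<le> max b 0" for z using f(2)[of z] by (cases "z \<in> ?K") (simp_all add: le_max_iff_disj)
    then show ?thesis by blast
  qed
  obtain b0 b1 b2 where b012: "\<And>z. \<bar>\<psi> z\<bar> \<le> b0" "\<And>z. \<bar>dderiv (1, 0) \<psi> z\<bar> \<le> b1" "\<And>z. \<bar>dderiv (0, 1) \<psi> z\<bar> \<le> b2"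
    using b[OF c(1) out(1)] b[OF c(2) out(2)] by metis
  obtain R where R: "\<forall>z\<in>?K. norm z \<le> R" using compact_imp_bounded[OF K(1)] bounded_iff by metis
  have "test_data T (max R 0) (\<bar>b0\<bar> + \<bar>b1\<bar> + \<bar>b2\<bar>) \<psi> (dderiv (1, 0) \<psi>) (dderiv (0, 1) \<psi>)"
    unfolding test_data_def
  proof (intro conjI allI impI D c)
    fix t x :: real assume tx: "t \<notin> {0<..<T} \<or> \<bar>x\<bar> > max R 0"
    have "(t, x) \<notin> ?K"
    proof
      assume z: "(t, x) \<in> ?K"
      then have "norm (t, x) \<le> R" using R by blast
      then have "\<bar>x\<bar> \<le> R" using norm_snd_le[of x t] by simp
      then show False using tx z K(2) by auto
    qed
    then show "\<psi> (t, x) = 0" "dderiv (1, 0) \<psi> (t, x) = 0" "dderiv (0, 1) \<psi> (t, x) = 0" by (rule out)+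
  next
    fix z
    show "\<bar>\<psi> z\<bar> \<le> \<bar>b0\<bar> + \<bar>b1\<bar> + \<bar>b2\<bar>" "\<bar>dderiv (1, 0) \<psi> z\<bar> \<le> \<bar>b0\<bar> + \<bar>b1\<bar> + \<bar>b2\<bar>" "\<bar>dderiv (0, 1) \<psi> z\<bar> \<le> \<bar>b0\<bar> + \<bar>b1\<bar> + \<bar>b2\<bar>"
      using b012[of z] by linarith+
  qed auto
  then show thesis by (rule that)
qed

context rarefaction_solution
begin

lemma jac_bound: "\<bar>jac W t \<xi>\<bar> \<le> 5 / 4"
  using sl.j0[of t \<xi>] sl.j1[of t \<xi>] by simp

text \<open>The estimates for slices are reused with the density V times the Jacobian; the nonlocal
  sum then becomes the convolution of G with v along the flow.\<close>

sublocale sv: slice h "jac W t" "\<lambda>\<eta>. V t \<eta> * jac W t \<eta>" for t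
proof
  fix \<xi>
  have "\<bar>V t \<xi>\<bar> * \<bar>jac W t \<xi>\<bar> \<le> 16 / 5 * h * wt \<xi> * (5 / 4)"
    using h wt_pos[of \<xi>] by (intro mult_mono V_bound_sharp jac_bound) auto
  then show "\<bar>V t \<xi> * jac W t \<xi>\<bar> \<le> 4 * h * wt \<xi>" by (simp add: abs_mult)
  show "0 < h" "h \<le> 1" by (rule h)+
  show "jac W t \<in> borel_measurable borel" by (rule jac_section)
  show "(\<lambda>\<eta>. V t \<eta> * jac W t \<eta>) \<in> borel_measurable borel" by measurable
  show "0 \<le> jac W t \<xi>" by (rule sl.j0)
  show "jac W t \<xi> \<le> 5 / 4" by (rule sl.j1)
  show "\<bar>jac W t \<xi> - 1\<bar> \<le> 3 * wt \<xi>" by (rule sl.j3)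
  show "3 / 4 \<le> jac W t \<xi>" if "\<xi> \<notin> {0<..<1}" using that by (rule sl.j2)
qed

definition "H t \<xi> = nl_sum (jac W t) (\<lambda>\<eta>. V t \<eta> * jac W t \<eta>) \<xi>"

lemma H_continuous: "continuous_on A (H t)"
  unfolding H_def[abs_def] by (rule sv.nl_continuous)

lemma H_bound: "\<bar>H t \<xi>\<bar> \<le> 48"
proof -
  have "48 * h * wt \<xi> \<le> 48 * 1 * 1" using h wt_le_1[of \<xi>] wt_pos[of \<xi>] by (intro mult_mono) auto
  then show ?thesis using sv.nl_sum_bound[of t \<xi>] by (simp add: H_def)
qed

lemma H_measurable[measurable (raw)]:
  "f \<in> borel_measurable M \<Longrightarrow> g \<in> borel_measurable M \<Longrightarrow> (\<lambda>x. H (f x) (g x)) \<in> borel_measurable M"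
proof (rule measurable_curried[of H])
  show "(\<lambda>(t, \<xi>). H t \<xi>) \<in> borel_measurable (borel \<Otimes>\<^sub>M borel)"
    unfolding H_def nonlocal_def Y_def[symmetric] by measurable
qed

text \<open>Integration by parts in the label variable moves the derivative from \<open>V\<close> to the kernel.\<close>

lemma nl_diff_momentum: "nl_diff (jac W t) (\<lambda>\<eta>. V t \<eta> * jac W t \<eta>) \<xi> = - P t \<xi>"
proof -
  let ?e = "\<lambda>\<eta>. exp (- \<bar>Y t \<xi> - Y t \<eta>\<bar>)"
  have i1: "integrable lborel (\<lambda>\<eta>. side \<xi> \<eta> * ?e \<eta> * (V t \<eta> * jac W t \<eta>))"
    unfolding Y_def by (rule sv.nonlocal_integrable) (auto simp: side_def[abs_def])
  have i2: "integrable lborel (\<lambda>\<eta>. 1 * ?e \<eta> * W (t, \<eta>))"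
    unfolding Y_def by (rule sl.nonlocal_integrable) auto
  have "(LINT \<eta>|lborel. side \<xi> \<eta> * ?e \<eta> * (V t \<eta> * jac W t \<eta>) + 1 * ?e \<eta> * W (t, \<eta>)) = 0"
  proof (rule integral_eq_0_if_deriv[where S = "insert \<xi> kinks" and F = "\<lambda>\<eta>. ?e \<eta> * V t \<eta>"])
    fix \<eta> assume \<eta>: "\<eta> \<notin> insert \<xi> kinks"
    then have k: "\<eta> \<notin> kinks" by simp
    note [derivative_intros] = Y_deriv[OF k] V_deriv[OF k]
    show "((\<lambda>\<eta>. ?e \<eta> * V t \<eta>) has_real_derivative side \<xi> \<eta> * ?e \<eta> * (V t \<eta> * jac W t \<eta>) + 1 * ?e \<eta> * W (t, \<eta>)) (at \<eta>)"
    proof (cases "\<eta> < \<xi>")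
      case True
      have "((\<lambda>\<eta>. exp (Y t \<eta> - Y t \<xi>) * V t \<eta>) has_real_derivative exp (Y t \<eta> - Y t \<xi>) * jac W t \<eta> * V t \<eta> + exp (Y t \<eta> - Y t \<xi>) * W (t, \<eta>)) (at \<eta>)"
        by (auto intro!: derivative_eq_intros)
      then have "((\<lambda>\<eta>. ?e \<eta> * V t \<eta>) has_real_derivative exp (Y t \<eta> - Y t \<xi>) * jac W t \<eta> * V t \<eta> + exp (Y t \<eta> - Y t \<xi>) * W (t, \<eta>)) (at \<eta>)"
        by (rule has_field_derivative_transform_within_open[of _ _ _ "{..<\<xi>}"]) (use True Y_mono[of _ \<xi> t] in \<open>auto simp: less_imp_le\<close>)
      then show ?thesis using True Y_mono[of \<eta> \<xi> t] by (simp add: side_def mult_ac)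
    next
      case False
      then have lt: "\<xi> < \<eta>" using \<eta> by auto
      have "((\<lambda>\<eta>. exp (Y t \<xi> - Y t \<eta>) * V t \<eta>) has_real_derivative exp (Y t \<xi> - Y t \<eta>) * (- jac W t \<eta>) * V t \<eta> + exp (Y t \<xi> - Y t \<eta>) * W (t, \<eta>)) (at \<eta>)"
        by (auto intro!: derivative_eq_intros)
      then have "((\<lambda>\<eta>. ?e \<eta> * V t \<eta>) has_real_derivative exp (Y t \<xi> - Y t \<eta>) * (- jac W t \<eta>) * V t \<eta> + exp (Y t \<xi> - Y t \<eta>) * W (t, \<eta>)) (at \<eta>)"
        by (rule has_field_derivative_transform_within_open[of _ _ _ "{\<xi><..}"]) (use lt Y_mono[of \<xi> _ t] in \<open>auto simp: less_imp_le\<close>)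
      then show ?thesis using lt Y_mono[of \<xi> \<eta> t] by (simp add: side_def mult_ac)
    qed
  next
    show "continuous_on UNIV (\<lambda>\<eta>. ?e \<eta> * V t \<eta>)" by (intro continuous_intros Y_continuous V_continuous)
    have "\<bar>?e \<eta> * V t \<eta>\<bar> \<le> 4 * h * wt \<eta>" for \<eta>
    proof -
      have "?e \<eta> * \<bar>V t \<eta>\<bar> \<le> 1 * \<bar>V t \<eta>\<bar>" by (intro mult_right_mono) auto
      then show ?thesis using V_bound[of t \<eta>] by (simp add: abs_mult)
    qed
    then show "((\<lambda>\<eta>. ?e \<eta> * V t \<eta>) \<longlongrightarrow> 0) at_bot" "((\<lambda>\<eta>. ?e \<eta> * V t \<eta>) \<longlongrightarrow> 0) at_top"
      by (rule dominated_by_wt_tendsto)+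
  qed (use i1 i2 in auto)
  then have "(LINT \<eta>|lborel. side \<xi> \<eta> * ?e \<eta> * (V t \<eta> * jac W t \<eta>)) = - (LINT \<eta>|lborel. 1 * ?e \<eta> * W (t, \<eta>))"
    using i1 i2 by simp
  then show ?thesis unfolding P_def nonlocal_def Y_def by simp
qed

text \<open>The identity that the derivative of G * v is G * v', written in labels; it makes the
  linear flux an exact label derivative in \<open>weak_formulation\<close>.\<close>

lemma H_deriv:
  assumes "\<xi> \<notin> kinks" shows "(H t has_real_derivative P t \<xi> * jac W t \<xi>) (at \<xi>)"
proof -
  have "isCont (\<lambda>\<eta>. V t \<eta> * jac W t \<eta>) \<xi>"
    by (intro continuous_intros jac_isCont[OF assms] DERIV_isCont[OF V_deriv[OF assms]])
  from sv.nl_deriv(1)[OF jac_isCont[OF assms] this] show ?thesis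
    unfolding H_def[abs_def] nl_diff_momentum by (simp add: mult.commute)
qed

text \<open>If F is the primitive of f, then F(Y) has derivative f(Y) times the Jacobian off the
  kinks. Its limits at infinity are those of F because Y stays within distance 12 of the
  identity.\<close>

lemma change_of_variables:
  assumes f: "continuous_on UNIV f" and b: "\<And>y. \<bar>f y\<bar> \<le> C * wt y"
  shows "(LINT y|lborel. f y) = (LINT \<xi>|lborel. f (Y t \<xi>) * jac W t \<xi>)"
proof -
  have [measurable]: "f \<in> borel_measurable borel" by (rule borel_measurable_continuous_onI[OF f])
  have C: "0 \<le> C" using b[of 0] by (simp add: wt_def)
  have fi: "integrable lborel f"
    by (rule integrable_bounded_by[OF integrable_mult_right[OF wt_integral(1), of C]]) (use b in auto)
  have fs: "set_integrable lborel {..x} f" for x unfolding set_integrable_def by (intro integrable_mult_indicator fi) simp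
  have ws: "set_integrable lborel {..x} wt" for x unfolding set_integrable_def by (intro integrable_mult_indicator wt_integral) simp
  define F where "F x = (LINT z:{..x}|lborel. f z)" for x
  have wp: "(LINT z:{..x}|lborel. wt z) = wt_prim x" for x
    by (rule set_integral_atMost_FTC[where S = "{0}"]) (auto intro: wt_prim_deriv wt_prim_continuous wt_prim_tendsto ws)
  have Fb: "\<bar>F x\<bar> \<le> C * wt_prim x" for x
  proof -
    have "norm (F x) \<le> (LINT z|lborel. C * (indicator {..x} z *\<^sub>R wt z))"
      unfolding F_def set_lebesgue_integral_def
      by (rule integral_norm_le) (use ws[of x] b in \<open>auto simp: set_integrable_def indicator_def\<close>)
    also have "\<dots> = C * wt_prim x" unfolding wp[symmetric] set_lebesgue_integral_def by simp
    finally show ?thesis by simp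
  qed
  have Ft: "\<bar>F x - (LINT y|lborel. f y)\<bar> \<le> C * (4 - wt_prim x)" for x
  proof -
    have i: "integrable lborel (\<lambda>z. indicator {..x} z *\<^sub>R f z)" "integrable lborel (\<lambda>z. indicator {..x} z *\<^sub>R wt z)"
      using fs[of x] ws[of x] by (auto simp: set_integrable_def)
    have "F x - (LINT y|lborel. f y) = (LINT z|lborel. indicator {..x} z *\<^sub>R f z - f z)"
      unfolding F_def set_lebesgue_integral_def using i fi by simp
    also have "norm \<dots> \<le> (LINT z|lborel. C * (wt z - indicator {..x} z *\<^sub>R wt z))"
      by (rule integral_norm_le) (use i wt_integral b in \<open>auto simp: indicator_def\<close>)
    also have "\<dots> = C * (4 - wt_prim x)"
      unfolding wp[symmetric] set_lebesgue_integral_def using i wt_integral by simp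
    finally show ?thesis by simp
  qed
  have Y_lim: "filterlim (Y t) at_bot at_bot" "filterlim (Y t) at_top at_top"
  proof -
    have "filterlim (\<lambda>x::real. x + 12) at_bot at_bot" by real_asymp
    then show "filterlim (Y t) at_bot at_bot"
      by (rule filterlim_at_bot_mono) (use Y_near[of t] in \<open>auto simp: abs_le_iff intro!: always_eventually\<close>, smt (verit))
    have "filterlim (\<lambda>x::real. x - 12) at_top at_top" by real_asymp
    then show "filterlim (Y t) at_top at_top"
      by (rule filterlim_at_top_mono) (use Y_near[of t] in \<open>auto simp: abs_le_iff intro!: always_eventually\<close>, smt (verit))
  qed
  have F_lim: "(F \<longlongrightarrow> 0) at_bot" "(F \<longlongrightarrow> (LINT y|lborel. f y)) at_top"
  proof -
    have "((\<lambda>x. C * wt_prim x) \<longlongrightarrow> C * 0) at_bot" by (intro tendsto_intros wt_prim_tendsto)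
    then show "(F \<longlongrightarrow> 0) at_bot" using Fb by (intro Lim_null_comparison[of F "\<lambda>x. C * wt_prim x"]) auto
    have "((\<lambda>x. C * (4 - wt_prim x)) \<longlongrightarrow> C * (4 - 4)) at_top" by (intro tendsto_intros wt_prim_tendsto)
    then have "((\<lambda>x. F x - (LINT y|lborel. f y)) \<longlongrightarrow> 0) at_top"
      using Ft by (intro Lim_null_comparison[of "\<lambda>x. F x - (LINT y|lborel. f y)" "\<lambda>x. C * (4 - wt_prim x)"]) auto
    then show "(F \<longlongrightarrow> (LINT y|lborel. f y)) at_top" by (simp add: LIM_zero_iff)
  qed
  have Fd: "(F has_real_derivative f x) (at x)" for x
    unfolding F_def[abs_def] by (rule set_integral_atMost_deriv[OF fs]) (use f in \<open>simp add: continuous_on_eq_continuous_at\<close>)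
  have Fc: "continuous_on UNIV F" using Fd by (auto intro!: continuous_at_imp_continuous_on DERIV_isCont)
  have "(LINT \<xi>|lborel. f (Y t \<xi>) * jac W t \<xi>) = (LINT y|lborel. f y) - 0"
  proof (rule integral_FTC_UNIV_finite_exceptions[where S = kinks and F = "\<lambda>\<xi>. F (Y t \<xi>)"])
    show "((\<lambda>\<xi>. F (Y t \<xi>)) has_vector_derivative f (Y t \<xi>) * jac W t \<xi>) (at \<xi>)" if "\<xi> \<notin> kinks" for \<xi>
      using DERIV_chain2[OF Fd Y_deriv[OF that]] by (simp add: has_real_derivative_iff_has_vector_derivative)
    show "continuous_on UNIV (\<lambda>\<xi>. F (Y t \<xi>))" by (rule continuous_on_compose2[OF Fc Y_continuous]) simp
    show "integrable lborel (\<lambda>\<xi>. f (Y t \<xi>) * jac W t \<xi>)"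
    proof (rule integrable_bounded_by)
      show "integrable lborel (\<lambda>\<xi>. C * exp 6 * (5 / 4) * wt \<xi>)" by (intro integrable_mult_right wt_integral)
      fix \<xi>
      have "wt (Y t \<xi>) \<le> wt \<xi> * exp (\<bar>\<xi> - Y t \<xi>\<bar> / 2)" by (rule wt_shift)
      also have "\<dots> \<le> wt \<xi> * exp 6" using Y_near[of t \<xi>] wt_pos[of \<xi>] by (intro mult_left_mono) (auto simp: abs_minus_commute)
      finally have "C * wt (Y t \<xi>) \<le> C * (wt \<xi> * exp 6)" using C by (intro mult_left_mono)
      then have "\<bar>f (Y t \<xi>)\<bar> * \<bar>jac W t \<xi>\<bar> \<le> (C * (wt \<xi> * exp 6)) * (5 / 4)"
        using b[of "Y t \<xi>"] jac_bound[of t \<xi>] C wt_pos[of \<xi>] by (intro mult_mono) auto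
      then show "norm (f (Y t \<xi>) * jac W t \<xi>) \<le> C * exp 6 * (5 / 4) * wt \<xi>" by (simp add: abs_mult mult_ac)
    qed measurable
    show "((\<lambda>\<xi>. F (Y t \<xi>)) \<longlongrightarrow> 0) at_bot" by (rule filterlim_compose[OF F_lim(1) Y_lim(1)])
    show "((\<lambda>\<xi>. F (Y t \<xi>)) \<longlongrightarrow> (LINT y|lborel. f y)) at_top" by (rule filterlim_compose[OF F_lim(2) Y_lim(2)])
  qed simp
  then show ?thesis by simp
qed

lemma v_continuous: "continuous_on A (v t)"
  by (rule Lipschitz_continuous_on[where C = "48 + 12 / \<epsilon>"]) (use v_Lipschitz[of t _ t] in simp)

lemma v_measurable[measurable (raw)]:
  assumes "f \<in> borel_measurable M" "g \<in> borel_measurable M" shows "(\<lambda>x. v (f x) (g x)) \<in> borel_measurable M"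
proof (rule measurable_curried[OF _ assms])
  let ?L = "48 + 12 / \<epsilon>"
  have "continuous_on UNIV (\<lambda>z. v (fst z) (snd z))"
  proof (rule continuous_at_imp_continuous_on, rule ballI)
    fix z :: "real \<times> real"
    have "((\<lambda>y. ?L * (\<bar>fst y - fst z\<bar> + \<bar>snd y - snd z\<bar>)) \<longlongrightarrow> ?L * (\<bar>fst z - fst z\<bar> + \<bar>snd z - snd z\<bar>)) (at z)"
      by (intro tendsto_intros)
    then have l: "((\<lambda>y. ?L * (\<bar>fst y - fst z\<bar> + \<bar>snd y - snd z\<bar>)) \<longlongrightarrow> 0) (at z)" by simp
    have "((\<lambda>y. v (fst y) (snd y) - v (fst z) (snd z)) \<longlongrightarrow> 0) (at z)"
      by (rule Lim_null_comparison[OF _ l]) (simp add: v_Lipschitz always_eventually)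
    then show "isCont (\<lambda>z. v (fst z) (snd z)) z" unfolding isCont_def by (simp add: LIM_zero_iff)
  qed
  then have "(\<lambda>z. v (fst z) (snd z)) \<in> borel_measurable borel" by (rule borel_measurable_continuous_onI)
  then show "(\<lambda>(t, x). v t x) \<in> borel_measurable (borel \<Otimes>\<^sub>M borel)" by (simp add: borel_prod split_def)
qed

definition "hv t x = (LINT y|lborel. green (x - y) * v t y)"

lemma v_wt: "\<bar>v t y\<bar> \<le> 4 * exp 6 * wt y"
proof -
  have "4 * exp 6 * h * wt y \<le> 4 * exp 6 * 1 * wt y" using h wt_pos[of y] by (intro mult_right_mono mult_left_mono) auto
  with v_bound[of t y] show ?thesis by linarith
qed

lemma green_bound: "\<bar>green x\<bar> \<le> 1" by (simp add: green_def) (smt (verit) exp_le_one_iff)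

lemma green_measurable[measurable]: "green \<in> borel_measurable borel"
  unfolding green_def[abs_def] by measurable

lemma green_v_bound: "\<bar>green (x - y) * v t y\<bar> \<le> 4 * exp 6 * wt y"
  using mult_mono[OF green_bound[of "x - y"] v_wt[of t y]] by (simp add: abs_mult)

lemma hv_Y: "hv t (Y t \<xi>) = H t \<xi>"
proof -
  have "hv t (Y t \<xi>) = (LINT \<eta>|lborel. green (Y t \<xi> - Y t \<eta>) * v t (Y t \<eta>) * jac W t \<eta>)"
    unfolding hv_def
  proof (rule change_of_variables[OF _ green_v_bound])
    show "continuous_on UNIV (\<lambda>y. green (Y t \<xi> - y) * v t y)"
      unfolding green_def by (intro continuous_intros v_continuous) auto
  qed
  also have "\<dots> = (LINT \<eta>|lborel. (1 / 2) * (1 * exp (- \<bar>Y t \<xi> - Y t \<eta>\<bar>) * (V t \<eta> * jac W t \<eta>)))"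
    by (rule Bochner_Integration.integral_cong) (auto simp: green_def v_Y)
  also have "\<dots> = H t \<xi>" unfolding H_def nonlocal_def Y_def by simp
  finally show ?thesis .
qed

lemma hv_measurable[measurable (raw)]:
  assumes "f \<in> borel_measurable M" "g \<in> borel_measurable M" shows "(\<lambda>x. hv (f x) (g x)) \<in> borel_measurable M"
proof (rule measurable_curried[OF _ assms])
  show "(\<lambda>(t, x). hv t x) \<in> borel_measurable (borel \<Otimes>\<^sub>M borel)" unfolding hv_def by measurable
qed

lemma hv_bound: "\<bar>hv t x\<bar> \<le> 48"
  using H_bound[of t "Z t x"] hv_Y[of t "Z t x"] by (simp add: Y_Z)

lemma hv_continuous: "continuous_on UNIV (hv t)"
proof -
  have "continuous_on UNIV (Z t)"
  proof (rule Lipschitz_continuous_on[where C = "1 / \<epsilon>"])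
    fix x y
    have *: "\<epsilon> * (\<eta> - \<xi>) \<le> Y t \<eta> - Y t \<xi>" if "\<xi> \<le> \<eta>" for \<xi> \<eta>
      unfolding Y_def by (rule sl.pos_lower[OF that]) (rule jac_eps)
    have "\<epsilon> * \<bar>Z t x - Z t y\<bar> \<le> \<bar>x - y\<bar>"
      using *[of "Z t x" "Z t y"] *[of "Z t y" "Z t x"] unfolding Y_Z
      by (cases "Z t x \<le> Z t y") (auto simp: abs_if)
    then show "\<bar>Z t x - Z t y\<bar> \<le> 1 / \<epsilon> * \<bar>x - y\<bar>" using \<epsilon> by (simp add: field_simps)
  qed
  moreover have "hv t = (\<lambda>x. H t (Z t x))" using hv_Y[of t "Z t _"] by (auto simp: Y_Z fun_eq_iff)
  ultimately show ?thesis using continuous_on_compose2[OF H_continuous] by auto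
qed

text \<open>Near an interior time the clamp is the identity and the cut-off at 0 is constant, so the
  ordinary fundamental theorem applies.\<close>

lemma time_primitive_deriv:
  assumes f: "continuous_on UNIV f" "\<And>s. \<bar>f s\<bar> \<le> C" and \<tau>: "0 < \<tau>" "\<tau> < T"
  shows "((\<lambda>t. LINT s:{0..cl t}|lborel. f s) has_real_derivative f \<tau>) (at \<tau>)"
proof -
  have [measurable]: "f \<in> borel_measurable borel" by (rule borel_measurable_continuous_onI[OF f(1)])
  let ?g = "\<lambda>s. indicator {0..} s * f s"
  have gi: "set_integrable lborel {..x} ?g" for x
    using set_integrable_bounded[of f C 0 x] f(2)
    by (auto simp: set_integrable_def indicator_inter_arith[symmetric] mult.assoc[symmetric] atLeastAtMost_def Int_commute)
  have "isCont ?g \<tau>"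
  proof -
    have "isCont f \<tau>" using f(1) by (simp add: continuous_on_eq_continuous_at)
    moreover have "eventually (\<lambda>s. ?g s = f s) (nhds \<tau>)"
      using eventually_nhds_in_open[of "{0<..}" \<tau>] \<tau> by (auto elim!: eventually_mono)
    ultimately show ?thesis using isCont_cong[of ?g f \<tau>] by blast
  qed
  from set_integral_atMost_deriv[OF gi this]
  have "((\<lambda>x. LINT z:{..x}|lborel. ?g z) has_real_derivative f \<tau>) (at \<tau>)" using \<tau> by simp
  then show ?thesis
  proof (rule has_field_derivative_transform_within_open[of _ _ _ "{0<..<T}"])
    fix t assume "t \<in> {0<..<T}"
    then have "cl t = t" by (simp add: cl_id)
    then show "(LINT z:{..t}|lborel. ?g z) = (LINT s:{0..cl t}|lborel. f s)"
      unfolding set_lebesgue_integral_def by (intro Bochner_Integration.integral_cong) (auto simp: indicator_def)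
  qed (use \<tau> in auto)
qed

lemma time_continuous:
  "continuous_on A (\<lambda>s. W (s, \<xi>))" "continuous_on A (\<lambda>s. V s \<xi>)" "continuous_on A (\<lambda>s. P s \<xi>)"
  "continuous_on A (\<lambda>s. Y s \<xi>)" "continuous_on A (\<lambda>s. jac W s \<xi>)"
proof -
  show "continuous_on A (\<lambda>s. W (s, \<xi>))"
    by (rule Lipschitz_continuous_on[where C = "60 * h * wt \<xi>"]) (rule W_time)
  show "continuous_on A (\<lambda>s. V s \<xi>)"
    by (rule Lipschitz_continuous_on[where C = "48 * h"]) (rule V_time)
  show "continuous_on A (\<lambda>s. Y s \<xi>)"
    by (rule Lipschitz_continuous_on[where C = "6 * h"]) (rule Y_time)
  show "continuous_on A (\<lambda>s. jac W s \<xi>)"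
    by (rule Lipschitz_continuous_on[where C = "6 * h"]) (rule jac_time)
  show "continuous_on A (\<lambda>s. P s \<xi>)"
  proof (rule Lipschitz_continuous_on[where C = "780 * 60 * wt \<xi>"])
    fix t s
    \<comment> \<open>The comparison of two slices is used here for one profile at two times; 60
      dominates the Lipschitz constants in time of both the Jacobian and W.\<close>
    interpret P: slice_pair h "jac W t" "\<lambda>\<eta>. W (t, \<eta>)" "jac W s" "\<lambda>\<eta>. W (s, \<eta>)" "60 * \<bar>t - s\<bar>"
    proof (rule admissible_slice_pair[OF W W])
      fix \<eta>
      have "6 * h * \<bar>t - s\<bar> \<le> 60 * \<bar>t - s\<bar>" using h by (intro mult_right_mono) auto
      then show "\<bar>jac W t \<eta> - jac W s \<eta>\<bar> \<le> 60 * \<bar>t - s\<bar>" using jac_time[of t \<eta> s] by linarith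
      have "60 * h * wt \<eta> * \<bar>t - s\<bar> \<le> 60 * 1 * wt \<eta> * \<bar>t - s\<bar>"
        using h wt_pos[of \<eta>] by (intro mult_right_mono mult_left_mono) auto
      then show "\<bar>W (t, \<eta>) - W (s, \<eta>)\<bar> \<le> 60 * \<bar>t - s\<bar> * wt \<eta>" using W_time[of t \<eta> s] by (simp add: mult_ac)
    qed simp
    show "\<bar>P t \<xi> - P s \<xi>\<bar> \<le> 780 * 60 * wt \<xi> * \<bar>t - s\<bar>"
      using P.nl_sum_diff[of \<xi>] by (simp add: P_def mult_ac)
  qed
qed

lemma time_derivs:
  assumes "0 < \<tau>" "\<tau> < T"
  shows "((\<lambda>s. V s \<xi>) has_real_derivative - P \<tau> \<xi>) (at \<tau>)"
    "((\<lambda>s. Y s \<xi>) has_real_derivative 3 / 2 * V \<tau> \<xi>) (at \<tau>)"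
    "((\<lambda>s. jac W s \<xi>) has_real_derivative 3 / 2 * W (\<tau>, \<xi>)) (at \<tau>)"
proof -
  note D = time_primitive_deriv[OF _ _ assms]
  have p: "((\<lambda>t. LINT s:{0..cl t}|lborel. P s \<xi>) has_real_derivative P \<tau> \<xi>) (at \<tau>)"
    by (rule D[OF time_continuous(3) P_bound'])
  have vv: "((\<lambda>t. LINT s:{0..cl t}|lborel. V s \<xi>) has_real_derivative V \<tau> \<xi>) (at \<tau>)"
    by (rule D[OF time_continuous(2) V_bound'])
  have w: "((\<lambda>t. LINT s:{0..cl t}|lborel. W (s, \<xi>)) has_real_derivative W (\<tau>, \<xi>)) (at \<tau>)"
    by (rule D[OF time_continuous(1) W_bound'])
  show "((\<lambda>s. V s \<xi>) has_real_derivative - P \<tau> \<xi>) (at \<tau>)"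
    unfolding V_eq[of _ \<xi>] using DERIV_diff[OF DERIV_const p, of "V0 \<xi>"] by simp
  have "((\<lambda>t. Y 0 \<xi> + 3 / 2 * (LINT s:{0..cl t}|lborel. V s \<xi>)) has_real_derivative 3 / 2 * V \<tau> \<xi>) (at \<tau>)"
    using DERIV_add[OF DERIV_const DERIV_cmult[OF vv, of "3 / 2"], of "Y 0 \<xi>"] by simp
  then show "((\<lambda>s. Y s \<xi>) has_real_derivative 3 / 2 * V \<tau> \<xi>) (at \<tau>)" by (simp only: Y_eq[symmetric])
  show "((\<lambda>s. jac W s \<xi>) has_real_derivative 3 / 2 * W (\<tau>, \<xi>)) (at \<tau>)"
    unfolding jac_def using DERIV_add[OF DERIV_const DERIV_cmult[OF w, of "3 / 2"], of "J0 \<xi>"] by simp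
qed

end

lemma test_data_chain:
  assumes "test_data T R B \<psi> \<psi>t \<psi>x" "(p has_real_derivative p') (at s)" "(q has_real_derivative q') (at s)"
  shows "((\<lambda>s. \<psi> (p s, q s)) has_real_derivative p' * \<psi>t (p s, q s) + q' * \<psi>x (p s, q s)) (at s)"
proof -
  have "((\<lambda>s. (p s, q s)) has_derivative (\<lambda>u. (p' * u, q' * u))) (at s)"
    using assms(2,3) unfolding has_field_derivative_def by (rule has_derivative_Pair)
  moreover have "(\<psi> has_derivative (\<lambda>u. fst u * \<psi>t (p s, q s) + snd u * \<psi>x (p s, q s))) (at (p s, q s))"
    using assms(1) unfolding test_data_def by blast
  ultimately have "((\<lambda>s. \<psi> (p s, q s)) has_derivative (\<lambda>u. fst (p' * u, q' * u) * \<psi>t (p s, q s) + snd (p' * u, q' * u) * \<psi>x (p s, q s))) (at s)"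
    by (rule has_derivative_compose)
  moreover have "(\<lambda>u. fst (p' * u, q' * u) * \<psi>t (p s, q s) + snd (p' * u, q' * u) * \<psi>x (p s, q s)) = (*) (p' * \<psi>t (p s, q s) + q' * \<psi>x (p s, q s))"
    by (simp add: fun_eq_iff algebra_simps)
  ultimately show ?thesis unfolding has_field_derivative_def by simp
qed

lemma abs_mult_le: "\<bar>a\<bar> \<le> c \<Longrightarrow> \<bar>b\<bar> \<le> d \<Longrightarrow> \<bar>a * b\<bar> \<le> c * d" for a b c d :: real
  unfolding abs_mult by (rule mult_mono) auto

context rarefaction_solution
begin

text \<open>In labels the integrand becomes E. The difference E - G is an exact label derivative and
  G is an exact time derivative, all boundary terms vanish, and so the double integral is zero. No
  derivative of v in positions appears.\<close>

lemma weak_formulation: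
  assumes td: "test_data T R B \<psi> \<psi>t \<psi>x"
  shows "(LINT \<tau>|lborel. LINT x|lborel. - v \<tau> x * \<psi>t (T - \<tau>, x) + 3 / 4 * (v \<tau> x)\<^sup>2 * \<psi>x (T - \<tau>, x) + hv \<tau> x * \<psi>x (T - \<tau>, x)) = 0"
    (is "(LINT \<tau>|lborel. LINT x|lborel. ?f \<tau> x) = 0")
proof -
  have RB: "0 \<le> R" "0 \<le> B" and c: "continuous_on UNIV \<psi>" "continuous_on UNIV \<psi>t" "continuous_on UNIV \<psi>x"
    and out: "\<And>t x. t \<notin> {0<..<T} \<or> \<bar>x\<bar> > R \<Longrightarrow> \<psi> (t, x) = 0 \<and> \<psi>t (t, x) = 0 \<and> \<psi>x (t, x) = 0"
    and b: "\<And>z. \<bar>\<psi> z\<bar> \<le> B" "\<And>z. \<bar>\<psi>t z\<bar> \<le> B" "\<And>z. \<bar>\<psi>x z\<bar> \<le> B"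
    using td unfolding test_data_def by blast+
  have [measurable]: "\<psi> \<in> borel_measurable (borel \<Otimes>\<^sub>M borel)" "\<psi>t \<in> borel_measurable (borel \<Otimes>\<^sub>M borel)" "\<psi>x \<in> borel_measurable (borel \<Otimes>\<^sub>M borel)"
    using c[THEN borel_measurable_continuous_onI] by (simp_all add: borel_prod)
  note [measurable] = W_meas
  have V4: "\<bar>V t \<xi>\<bar> \<le> 4" and W4: "\<bar>W (t, \<xi>)\<bar> \<le> 4" and P48: "\<bar>P t \<xi>\<bar> \<le> 48" and v4: "\<bar>v t \<xi>\<bar> \<le> 4" for t \<xi>
    using V_bound'[of t \<xi>] W_bound'[of t \<xi>] P_bound'[of t \<xi>] v_bound'[of t \<xi>] h by linarith+
  define a aT ax where "a \<tau> \<xi> = \<psi> (T - \<tau>, Y \<tau> \<xi>)" and "aT \<tau> \<xi> = \<psi>t (T - \<tau>, Y \<tau> \<xi>)" and "ax \<tau> \<xi> = \<psi>x (T - \<tau>, Y \<tau> \<xi>)" for \<tau> \<xi>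
  have ab: "\<bar>a \<tau> \<xi>\<bar> \<le> B" "\<bar>aT \<tau> \<xi>\<bar> \<le> B" "\<bar>ax \<tau> \<xi>\<bar> \<le> B" for \<tau> \<xi> by (simp_all add: a_def aT_def ax_def b)
  \<comment> \<open>The support grows by 12 in the labels, the largest displacement of the
    flow.\<close>
  have a0: "a \<tau> \<xi> = 0 \<and> aT \<tau> \<xi> = 0 \<and> ax \<tau> \<xi> = 0" if "\<tau> \<notin> {0<..<T} \<or> \<xi> \<notin> {- R - 12..R + 12}" for \<tau> \<xi>
    unfolding a_def aT_def ax_def by (rule out) (use that Y_near[of \<tau> \<xi>] in \<open>auto simp: abs_if split: if_splits\<close>)
  have [measurable]: "(\<lambda>(t, \<xi>). a t \<xi>) \<in> borel_measurable (borel \<Otimes>\<^sub>M borel)" "(\<lambda>(t, \<xi>). aT t \<xi>) \<in> borel_measurable (borel \<Otimes>\<^sub>M borel)" "(\<lambda>(t, \<xi>). ax t \<xi>) \<in> borel_measurable (borel \<Otimes>\<^sub>M borel)"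
    unfolding a_def aT_def ax_def by measurable
  define E where "E \<tau> \<xi> = (- V \<tau> \<xi> * aT \<tau> \<xi> + 3 / 4 * (V \<tau> \<xi>)\<^sup>2 * ax \<tau> \<xi> + H \<tau> \<xi> * ax \<tau> \<xi>) * jac W \<tau> \<xi>" for \<tau> \<xi>
  \<comment> \<open>The time derivative of a V jac, computed from the three equations for Y, V and
    the Jacobian; aT has a minus sign because the test function is read at T - \<tau>.\<close>
  define G where "G \<tau> \<xi> = (- aT \<tau> \<xi> + 3 / 2 * V \<tau> \<xi> * ax \<tau> \<xi>) * V \<tau> \<xi> * jac W \<tau> \<xi> + a \<tau> \<xi> * (- P \<tau> \<xi> * jac W \<tau> \<xi> + 3 / 2 * V \<tau> \<xi> * W (\<tau>, \<xi>))" for \<tau> \<xi>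
  have fb: "\<bar>- r * s + 3 / 4 * r\<^sup>2 * q + k * q\<bar> \<le> 64 * B" if "\<bar>r\<bar> \<le> 4" "\<bar>s\<bar> \<le> B" "\<bar>q\<bar> \<le> B" "\<bar>k\<bar> \<le> 48" for r s q k
  proof -
    note abs_mult_le[OF that(1,2)] abs_mult_le[OF abs_mult_le[OF that(1,1)] that(3)] abs_mult_le[OF that(4,3)]
    then show ?thesis unfolding power2_eq_square by linarith
  qed
  have Eb: "\<bar>E \<tau> \<xi>\<bar> \<le> 64 * B * (5 / 4)" for \<tau> \<xi>
    unfolding E_def by (rule abs_mult_le[OF fb[OF V4 ab(2,3) H_bound] jac_bound])
  have Gb: "\<bar>G \<tau> \<xi>\<bar> \<le> 119 * B" for \<tau> \<xi>
  proof -
    have "\<bar>V \<tau> \<xi> * ax \<tau> \<xi>\<bar> \<le> 4 * B" by (rule abs_mult_le[OF V4 ab(3)])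
    then have 1: "\<bar>- aT \<tau> \<xi> + 3 / 2 * V \<tau> \<xi> * ax \<tau> \<xi>\<bar> \<le> 7 * B" using ab(2)[of \<tau> \<xi>] by simp
    have "\<bar>P \<tau> \<xi> * jac W \<tau> \<xi>\<bar> \<le> 48 * (5 / 4)" "\<bar>V \<tau> \<xi> * W (\<tau>, \<xi>)\<bar> \<le> 4 * 4" by (intro abs_mult_le P48 jac_bound V4 W4)+
    then have 2: "\<bar>- P \<tau> \<xi> * jac W \<tau> \<xi> + 3 / 2 * V \<tau> \<xi> * W (\<tau>, \<xi>)\<bar> \<le> 84" by simp
    show ?thesis unfolding G_def
      by (rule order_trans[OF abs_triangle_ineq order_trans[OF add_mono[OF abs_mult_le[OF abs_mult_le[OF 1 V4] jac_bound] abs_mult_le[OF ab(1) 2]]]]) simp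
  qed
  have [measurable]: "(\<lambda>(t, \<xi>). E t \<xi>) \<in> borel_measurable (borel \<Otimes>\<^sub>M borel)" "(\<lambda>(t, \<xi>). G t \<xi>) \<in> borel_measurable (borel \<Otimes>\<^sub>M borel)"
    unfolding E_def G_def by measurable
  have out0: "E \<tau> \<xi> = 0" "G \<tau> \<xi> = 0" if "\<tau> \<notin> {0<..<T} \<or> \<xi> \<notin> {- R - 12..R + 12}" for \<tau> \<xi>
    using a0[OF that] by (simp_all add: E_def G_def)
  have Ei: "integrable lborel (E \<tau>)" and Gi: "integrable lborel (G \<tau>)" for \<tau>
    by (rule integrable_compact[where a = "- R - 12" and b = "R + 12", OF _ Eb], measurable, rule out0, simp)
      (rule integrable_compact[where a = "- R - 12" and b = "R + 12", OF _ Gb], measurable, rule out0, simp)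
  \<comment> \<open>The potential is the test function times the flux H - (3/4) V^2; the excess of
    3/2 over 3/4 in the quadratic terms is the motion of the labels.\<close>
  have EG: "(LINT \<xi>|lborel. E \<tau> \<xi> - G \<tau> \<xi>) = 0" for \<tau>
  proof (rule integral_eq_0_if_deriv[where S = kinks and F = "\<lambda>\<xi>. H \<tau> \<xi> * a \<tau> \<xi> - 3 / 4 * (V \<tau> \<xi>)\<^sup>2 * a \<tau> \<xi>"])
    fix \<xi> assume \<xi>: "\<xi> \<notin> kinks"
    have ad: "(a \<tau> has_real_derivative jac W \<tau> \<xi> * ax \<tau> \<xi>) (at \<xi>)"
      unfolding a_def ax_def using test_data_chain[OF td DERIV_const Y_deriv[OF \<xi>], of "T - \<tau>" \<tau>] by simp
    show "((\<lambda>\<xi>. H \<tau> \<xi> * a \<tau> \<xi> - 3 / 4 * (V \<tau> \<xi>)\<^sup>2 * a \<tau> \<xi>) has_real_derivative E \<tau> \<xi> - G \<tau> \<xi>) (at \<xi>)"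
      unfolding E_def G_def
      by (rule derivative_eq_intros H_deriv[OF \<xi>] V_deriv[OF \<xi>] ad refl)+ (simp add: algebra_simps power2_eq_square)
  next
    have "continuous_on UNIV (a \<tau>)" unfolding a_def
      by (rule continuous_on_compose2[OF c(1)]) (intro continuous_intros Y_continuous, simp)
    then show "continuous_on UNIV (\<lambda>\<xi>. H \<tau> \<xi> * a \<tau> \<xi> - 3 / 4 * (V \<tau> \<xi>)\<^sup>2 * a \<tau> \<xi>)"
      by (intro continuous_intros H_continuous V_continuous)
    have z: "H \<tau> \<xi> * a \<tau> \<xi> - 3 / 4 * (V \<tau> \<xi>)\<^sup>2 * a \<tau> \<xi> = 0" if "\<xi> \<notin> {- R - 12..R + 12}" for \<xi>
      using a0[of \<tau> \<xi>] that by simp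
    show "((\<lambda>\<xi>. H \<tau> \<xi> * a \<tau> \<xi> - 3 / 4 * (V \<tau> \<xi>)\<^sup>2 * a \<tau> \<xi>) \<longlongrightarrow> 0) at_bot" by (rule compact_support_tendsto(1)[OF z])
    show "((\<lambda>\<xi>. H \<tau> \<xi> * a \<tau> \<xi> - 3 / 4 * (V \<tau> \<xi>)\<^sup>2 * a \<tau> \<xi>) \<longlongrightarrow> 0) at_top" by (rule compact_support_tendsto(2)[OF z])
    show "integrable lborel (\<lambda>\<xi>. E \<tau> \<xi> - G \<tau> \<xi>)" by (intro Bochner_Integration.integrable_diff Ei Gi)
  qed simp
  have fE: "(LINT x|lborel. ?f \<tau> x) = (LINT \<xi>|lborel. G \<tau> \<xi>)" for \<tau>
  proof -
    have "(LINT x|lborel. ?f \<tau> x) = (LINT \<xi>|lborel. ?f \<tau> (Y \<tau> \<xi>) * jac W \<tau> \<xi>)"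
    proof (rule change_of_variables)
      have "continuous_on UNIV (\<lambda>x. \<psi>t (T - \<tau>, x))"
        by (rule continuous_on_compose2[OF c(2)]) (intro continuous_intros, simp)
      moreover have "continuous_on UNIV (\<lambda>x. \<psi>x (T - \<tau>, x))"
        by (rule continuous_on_compose2[OF c(3)]) (intro continuous_intros, simp)
      ultimately show "continuous_on UNIV (?f \<tau>)" by (intro continuous_intros v_continuous hv_continuous)
      show "\<bar>?f \<tau> y\<bar> \<le> 64 * B * exp (R / 2) * wt y" for y
      proof (cases "\<bar>y\<bar> > R")
        case True
        then show ?thesis using out[of "T - \<tau>" y] RB wt_pos[of y] by simp
      next
        case False
        then have "1 \<le> exp (R / 2) * wt y" by (simp add: wt_def exp_add[symmetric] flip: exp_minus)
        then have "64 * B * 1 \<le> 64 * B * (exp (R / 2) * wt y)" using RB by (intro mult_left_mono) auto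
        moreover have "\<bar>?f \<tau> y\<bar> \<le> 64 * B" by (rule fb[OF v4 b(2,3) hv_bound])
        ultimately show ?thesis by linarith
      qed
    qed
    also have "\<dots> = (LINT \<xi>|lborel. E \<tau> \<xi>)" by (simp only: E_def aT_def ax_def v_Y hv_Y)
    also have "\<dots> = (LINT \<xi>|lborel. G \<tau> \<xi>)" using EG[of \<tau>] Ei[of \<tau>] Gi[of \<tau>] by simp
    finally show ?thesis .
  qed
  \<comment> \<open>The equations in time hold inside (0,T) only; at 0 and T and beyond, the test
    function vanishes, so the product is continuous with just two exceptional times.\<close>
  have G0: "(LINT \<tau>|lborel. G \<tau> \<xi>) = 0" for \<xi>
  proof (rule integral_eq_0_if_deriv[where S = "{0, T}" and F = "\<lambda>\<tau>. a \<tau> \<xi> * V \<tau> \<xi> * jac W \<tau> \<xi>"])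
    fix \<tau> assume \<tau>: "\<tau> \<notin> {0, T}"
    show "((\<lambda>\<tau>. a \<tau> \<xi> * V \<tau> \<xi> * jac W \<tau> \<xi>) has_real_derivative G \<tau> \<xi>) (at \<tau>)"
    proof (cases "0 < \<tau> \<and> \<tau> < T")
      case True
      then have t: "0 < \<tau>" "\<tau> < T" by auto
      note d = time_derivs[OF t, of \<xi>]
      have ad: "((\<lambda>\<tau>. a \<tau> \<xi>) has_real_derivative - aT \<tau> \<xi> + 3 / 2 * V \<tau> \<xi> * ax \<tau> \<xi>) (at \<tau>)"
      proof -
        have "((\<lambda>\<tau>. T - \<tau>) has_real_derivative - 1) (at \<tau>)" by (auto intro!: derivative_eq_intros)
        from test_data_chain[OF td this d(2)] show ?thesis unfolding a_def aT_def ax_def by simp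
      qed
      show ?thesis unfolding G_def
        by (rule derivative_eq_intros d(1,3) ad refl)+ (simp add: algebra_simps)
    next
      case False
      then have "\<tau> \<in> - {0..T}" using \<tau> by auto
      moreover have "((\<lambda>_. 0) has_real_derivative G \<tau> \<xi>) (at \<tau>)" using out0(2)[of \<tau> \<xi>] False by simp
      ultimately show ?thesis
        by (rule_tac has_field_derivative_transform_within_open[of "\<lambda>_. 0" _ _ "- {0..T}"]) (use a0[of _ \<xi>] in auto)
    qed
  next
    have "continuous_on UNIV (\<lambda>\<tau>. a \<tau> \<xi>)" unfolding a_def
      by (rule continuous_on_compose2[OF c(1)]) (intro continuous_intros time_continuous, simp)
    then show "continuous_on UNIV (\<lambda>\<tau>. a \<tau> \<xi> * V \<tau> \<xi> * jac W \<tau> \<xi>)" by (intro continuous_intros time_continuous)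
    have z: "a \<tau> \<xi> * V \<tau> \<xi> * jac W \<tau> \<xi> = 0" if "\<tau> \<notin> {0..T}" for \<tau>
      using a0[OF disjI1[of "\<tau> \<notin> {0<..<T}"], of \<xi>] that by auto
    show "((\<lambda>\<tau>. a \<tau> \<xi> * V \<tau> \<xi> * jac W \<tau> \<xi>) \<longlongrightarrow> 0) at_bot" by (rule compact_support_tendsto(1)[OF z])
    show "((\<lambda>\<tau>. a \<tau> \<xi> * V \<tau> \<xi> * jac W \<tau> \<xi>) \<longlongrightarrow> 0) at_top" by (rule compact_support_tendsto(2)[OF z])
    show "integrable lborel (\<lambda>\<tau>. G \<tau> \<xi>)"
    proof (rule integrable_compact[OF _ Gb])
      show "G \<tau> \<xi> = 0" if "\<tau> \<notin> {0..T}" for \<tau> using that by (intro out0) auto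
    qed measurable
  qed simp
  have "(LINT \<tau>|lborel. LINT x|lborel. ?f \<tau> x) = (LINT \<tau>|lborel. LINT \<xi>|lborel. G \<tau> \<xi>)" by (simp only: fE)
  also have "\<dots> = (LINT \<xi>|lborel. LINT \<tau>|lborel. G \<tau> \<xi>)"
  proof (rule lborel_pair.Fubini_integral[symmetric])
    have "integrable (lborel \<Otimes>\<^sub>M lborel) (\<lambda>(\<tau>, \<xi>). G \<tau> \<xi>)"
    proof (rule integrable_compact_pair[of _ "119 * B" 0 T "- R - 12" "R + 12"])
      show "(case (\<tau>, \<xi>) of (\<tau>, \<xi>) \<Rightarrow> G \<tau> \<xi>) = 0" if "\<tau> \<notin> {0..T} \<or> \<xi> \<notin> {- R - 12..R + 12}" for \<tau> \<xi>
        using out0(2)[of \<tau> \<xi>] that by auto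
    qed (use Gb RB in auto)
    then show "integrable (lborel \<Otimes>\<^sub>M lborel) (case_prod G)" .
  qed
  also have "\<dots> = 0" by (simp add: G0)
  finally show ?thesis .
qed

end

lemma strip_loc_integrable_bounded:
  assumes [measurable]: "f \<in> borel_measurable borel" and b: "\<And>z. \<bar>f z\<bar> \<le> C"
  shows "strip_loc_integrable T f"
  unfolding strip_loc_integrable_def set_integrable_def
proof (intro allI impI)
  fix K :: "(real \<times> real) set" assume K: "compact K \<and> K \<subseteq> {0<..<T} \<times> UNIV"
  then have [measurable]: "K \<in> sets borel" by (simp add: borel_compact)
  show "integrable lborel (\<lambda>z. indicator K z *\<^sub>R f z)"
  proof (rule Bochner_Integration.integrable_bound)
    show "integrable lborel (\<lambda>z. C * indicator K z :: real)"
      using K by (intro integrable_mult_right integrable_real_indicator) (auto dest!: compact_imp_bounded emeasure_bounded_finite)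
    show "AE z in lborel. norm (indicator K z *\<^sub>R f z) \<le> norm (C * indicator K z)"
      using b by (intro AE_I2) (auto simp: indicator_def intro: order_trans[OF _ abs_ge_self])
  qed simp
qed

context rarefaction_solution
begin

text \<open>Replacing v by -v(T - t) preserves the time derivative and the quadratic term and flips
  the linear nonlocal one. As \<open>weak_formulation\<close> already reads the test function at T -
  \<tau>, one affine substitution in time converts it.\<close>

lemma FW_solution_reversed: "FW_solution T (distr_of (\<lambda>x. - v T x)) (\<lambda>t. distr_of (\<lambda>x. - v (T - t) x))"
proof -
  have v4: "\<bar>v t x\<bar> \<le> 4" for t x using v_bound'[of t x] h by linarith
  define U where "U = (\<lambda>(t, x). - v (T - t) x)"
  have [measurable]: "U \<in> borel_measurable (borel \<Otimes>\<^sub>M borel)" unfolding U_def by measurable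
  then have Um: "U \<in> borel_measurable borel" by (simp add: borel_prod)
  have hel: "helmholtz_inv (\<lambda>y. U (t, y)) x = - hv (T - t) x" for t x
    by (simp add: helmholtz_inv_def U_def hv_def)
  have Hm: "(\<lambda>(t, x). - hv (T - t) x) \<in> borel_measurable (borel \<Otimes>\<^sub>M borel)" by measurable
  show ?thesis unfolding FW_solution_def
  proof (intro conjI bexI[of _ U] ballI allI Um)
    show "distr_of (\<lambda>x. - v (T - 0) x) = distr_of (\<lambda>x. - v T x)" by simp
    show "represents (\<lambda>x. complex_of_real (U (t, x))) (distr_of (\<lambda>x. - v (T - t) x))" for t
      unfolding U_def prod.case by (rule represents_distr_of[where B = 4]) (use v4 in auto)
    show "integrable lborel (\<lambda>y. green (x - y) * U (t, y))" for t x
      by (rule integrable_bounded_by[OF integrable_mult_right[OF wt_integral(1), of "4 * exp 6"]])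
        (use green_v_bound[of x _ "T - t"] in \<open>auto simp: U_def\<close>)
    show "strip_loc_integrable T U"
      by (rule strip_loc_integrable_bounded[OF Um, of 4]) (use v4 in \<open>auto simp: U_def\<close>)
    have "(U z)\<^sup>2 \<le> 4\<^sup>2" for z
      by (rule abs_le_square_iff[THEN iffD1]) (use v4 in \<open>auto simp: U_def split: prod.split\<close>)
    then show "strip_loc_integrable T (\<lambda>z. (U z)\<^sup>2)"
      using Um by (intro strip_loc_integrable_bounded[of _ 16]) auto
    show "strip_loc_integrable T (\<lambda>(t, x). helmholtz_inv (\<lambda>y. U (t, y)) x)"
      unfolding hel using Hm hv_bound by (intro strip_loc_integrable_bounded[of _ 48]) (auto simp: borel_prod)
  next
    fix \<psi> assume "\<psi> \<in> strip_tests T"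
    then obtain R B where td: "test_data T R B \<psi> (dderiv (1, 0) \<psi>) (dderiv (0, 1) \<psi>)" by (rule strip_tests_data)
    let ?t = "dderiv (1, 0) \<psi>" and ?x = "dderiv (0, 1) \<psi>"
    have B: "0 \<le> B" and c: "continuous_on UNIV ?t" "continuous_on UNIV ?x"
      and out: "\<And>t x. t \<notin> {0<..<T} \<or> \<bar>x\<bar> > R \<Longrightarrow> \<psi> (t, x) = 0 \<and> ?t (t, x) = 0 \<and> ?x (t, x) = 0"
      and b: "\<And>z. \<bar>?t z\<bar> \<le> B" "\<And>z. \<bar>?x z\<bar> \<le> B"
      using td unfolding test_data_def by blast+
    have [measurable]: "?t \<in> borel_measurable (borel \<Otimes>\<^sub>M borel)" "?x \<in> borel_measurable (borel \<Otimes>\<^sub>M borel)"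
      using c[THEN borel_measurable_continuous_onI] by (simp_all add: borel_prod)
    have int: "integrable (lborel \<Otimes>\<^sub>M lborel) (\<lambda>(t, x). f t x * k (t, x))"
      if "(\<lambda>(t, x). f t x) \<in> borel_measurable (borel \<Otimes>\<^sub>M borel)" "\<And>t x. \<bar>f t x\<bar> \<le> 48"
        "k \<in> {?t, ?x}" for f k
    proof (rule integrable_compact_pair[of _ "48 * B" 0 T "- R" R])
      have [measurable]: "k \<in> borel_measurable (borel \<Otimes>\<^sub>M borel)" using that(3) by auto
      note that(1)[measurable]
      show "(\<lambda>(t, x). f t x * k (t, x)) \<in> borel_measurable (borel \<Otimes>\<^sub>M borel)" by measurable
      have "\<bar>k z\<bar> \<le> B" for z using that(3) b[of z] by auto
      then show "\<bar>case (t, x) of (t, x) \<Rightarrow> f t x * k (t, x)\<bar> \<le> 48 * B" for t x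
        unfolding prod.case by (rule abs_mult_le[OF that(2)])
      show "(case (t, x) of (t, x) \<Rightarrow> f t x * k (t, x)) = 0" if "t \<notin> {0..T} \<or> x \<notin> {- R..R}" for t x
      proof -
        have "t \<notin> {0<..<T} \<or> \<bar>x\<bar> > R" using that by auto
        from out[OF this] show ?thesis using \<open>k \<in> {?t, ?x}\<close> by auto
      qed
    qed (use B in simp)
    have i1: "integrable (lborel \<Otimes>\<^sub>M lborel) (\<lambda>(t, x). - v (T - t) x * ?t (t, x))"
      by (rule int) (use order_trans[OF v4, of 48] in auto)
    have i2: "integrable (lborel \<Otimes>\<^sub>M lborel) (\<lambda>(t, x). (v (T - t) x)\<^sup>2 * ?x (t, x))"
    proof (rule int)
      show "\<bar>(v (T - t) x)\<^sup>2\<bar> \<le> 48" for t x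
        using abs_le_square_iff[of "v (T - t) x" 4] v4[of "T - t" x] by simp
    qed auto
    have i3: "integrable (lborel \<Otimes>\<^sub>M lborel) (\<lambda>(t, x). - hv (T - t) x * ?x (t, x))"
      by (rule int) (use hv_bound in auto)
    let ?F = "\<lambda>t x. - v (T - t) x * ?t (t, x) + 3 / 4 * (v (T - t) x)\<^sup>2 * ?x (t, x) + hv (T - t) x * ?x (t, x)"
    have "integrable (lborel \<Otimes>\<^sub>M lborel) (\<lambda>z. (case z of (t, x) \<Rightarrow> - v (T - t) x * ?t (t, x))
        + 3 / 4 * (case z of (t, x) \<Rightarrow> (v (T - t) x)\<^sup>2 * ?x (t, x)) - (case z of (t, x) \<Rightarrow> - hv (T - t) x * ?x (t, x)))"
      (is "integrable _ ?G")
      by (intro Bochner_Integration.integrable_diff Bochner_Integration.integrable_add integrable_mult_right i1 i2 i3)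
    moreover have "?G = (\<lambda>(t, x). ?F t x)" by (auto simp: fun_eq_iff)
    moreover have "(LINT z|(lborel \<Otimes>\<^sub>M lborel). ?G z) = (LINT z|(lborel \<Otimes>\<^sub>M lborel). (case z of (t, x) \<Rightarrow> - v (T - t) x * ?t (t, x)))
        + 3 / 4 * (LINT z|(lborel \<Otimes>\<^sub>M lborel). (case z of (t, x) \<Rightarrow> (v (T - t) x)\<^sup>2 * ?x (t, x)))
        - (LINT z|(lborel \<Otimes>\<^sub>M lborel). (case z of (t, x) \<Rightarrow> - hv (T - t) x * ?x (t, x)))"
      using i1 i2 i3 by simp
    moreover have "(LINT z|(lborel \<Otimes>\<^sub>M lborel). (case z of (t, x) \<Rightarrow> ?F t x)) = (LINT t|lborel. LINT x|lborel. ?F t x)"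
      if "integrable (lborel \<Otimes>\<^sub>M lborel) (\<lambda>(t, x). ?F t x)"
      using lborel_pair.integral_fst'[OF that] by simp
    moreover have "(LINT t|lborel. LINT x|lborel. ?F t x) = 0"
      using weak_formulation[OF td]
        lborel_integral_real_affine[of "-1" "\<lambda>\<tau>. LINT x|lborel. - v \<tau> x * ?t (T - \<tau>, x) + 3 / 4 * (v \<tau> x)\<^sup>2 * ?x (T - \<tau>, x) + hv \<tau> x * ?x (T - \<tau>, x)" T]
      by simp
    ultimately have eq: "(LINT z|(lborel \<Otimes>\<^sub>M lborel). (case z of (t, x) \<Rightarrow> - v (T - t) x * ?t (t, x)))
        + 3 / 4 * (LINT z|(lborel \<Otimes>\<^sub>M lborel). (case z of (t, x) \<Rightarrow> (v (T - t) x)\<^sup>2 * ?x (t, x)))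
        - (LINT z|(lborel \<Otimes>\<^sub>M lborel). (case z of (t, x) \<Rightarrow> - hv (T - t) x * ?x (t, x))) = 0"
      by metis
    have e: "U z * ?t z = (case z of (t, x) \<Rightarrow> - v (T - t) x * ?t (t, x))"
      "(U z)\<^sup>2 * ?x z = (case z of (t, x) \<Rightarrow> (v (T - t) x)\<^sup>2 * ?x (t, x))"
      "(case z of (t, x) \<Rightarrow> - hv (T - t) x) * ?x z = (case z of (t, x) \<Rightarrow> - hv (T - t) x * ?x (t, x))" for z
      by (simp_all add: U_def split: prod.split)
    show "distr_deriv (1, 0) (regular_distr U) \<psi> + 3 / 2 * (1 / 2 * distr_deriv (0, 1) (regular_distr (\<lambda>z. (U z)\<^sup>2)) \<psi>)
        = distr_deriv (0, 1) (regular_distr (\<lambda>(t, x). helmholtz_inv (\<lambda>y. U (t, y)) x)) \<psi>"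
      unfolding distr_deriv_def regular_distr_def hel e lborel_prod[symmetric] using eq by linarith
  qed
qed

end

section \<open>Norm inflation\<close>

text \<open>The hypothesis bounds the square, so that it also fits a difference of two solutions,
  where one factor is small by Lipschitz continuity in time and the other decays. With p >= 2 the
  power wt^(p/2) is still below the integrable weight.\<close>

lemma nn_integral_powr_le_wt:
  assumes [measurable]: "u \<in> borel_measurable borel" and p: "2 \<le> p" and K: "0 < K" and u: "\<And>x. (u x)\<^sup>2 \<le> K\<^sup>2 * wt x"
  shows "(\<integral>\<^sup>+ x. ennreal (\<bar>u x\<bar> powr p) \<partial>lborel) \<le> ennreal ((4 * K) powr p)"
proof -
  have sq: "a powr p = (a\<^sup>2) powr (p / 2)" if "0 \<le> a" for a :: real
    using that by (cases "a = 0") (simp_all add: powr_powr flip: powr_numeral)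
  have "\<bar>u x\<bar> powr p \<le> K powr p * wt x" for x
  proof -
    have "\<bar>u x\<bar> powr p \<le> (K\<^sup>2 * wt x) powr (p / 2)"
      using p u[of x] unfolding sq[OF abs_ge_zero] by (intro powr_mono2) auto
    also have "\<dots> = K powr p * wt x powr (p / 2)" using K wt_pos[of x] by (simp add: powr_mult sq[of K] less_imp_le)
    also have "wt x powr (p / 2) \<le> wt x powr 1" using wt_pos[of x] wt_le_1[of x] p by (intro powr_mono') auto
    finally show ?thesis using wt_pos[of x] by (simp add: mult_left_mono)
  qed
  note this[THEN ennreal_leI]
  then have "(\<integral>\<^sup>+ x. ennreal (\<bar>u x\<bar> powr p) \<partial>lborel) \<le> (\<integral>\<^sup>+ x. ennreal (K powr p * wt x) \<partial>lborel)"
    by (rule nn_integral_mono)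
  also have "\<dots> = ennreal (K powr p * 4)"
    using wt_integral less_imp_le[OF wt_pos] by (subst nn_integral_eq_integral) (auto intro!: AE_I2 mult_nonneg_nonneg)
  also have "\<dots> \<le> ennreal ((4 * K) powr p)"
  proof (rule ennreal_leI)
    have "4 powr 1 \<le> (4::real) powr p" using p by (intro powr_mono) auto
    then show "K powr p * 4 \<le> (4 * K) powr p" using K by (simp add: powr_mult mult.commute mult_right_mono)
  qed
  finally show ?thesis .
qed

section \<open>Besov norms of the solution at one time and of differences in time\<close>

context rarefaction_solution
begin

lemma v_integrable: "integrable lborel (v t)"
  by (rule integrable_bounded_by[OF integrable_mult_right[OF wt_integral(1), of "4 * exp 6"]]) (use v_wt in auto)

abbreviation tv_bound where "tv_bound m \<equiv> 4 * (h / m + 3 * h\<^sup>2 * T / m\<^sup>2) + 4 * h / m * 3"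

lemma tv_prim_Z_mono:
  assumes "m > 0" "\<And>\<xi>. m \<le> jac W t \<xi>" shows "mono (\<lambda>x. tv_prim m (Z t x))"
proof (rule monoI)
  fix x y :: real assume "x \<le> y"
  then show "tv_prim m (Z t x) \<le> tv_prim m (Z t y)" using slope_variation[OF assms Z_mono[of x y t]] by linarith
qed

text \<open>The parameter m is free: with m = \<epsilon> the bound holds at all times and shows
  membership in the space, with m = h T it holds at the final time with a variation independent of h
  and \<epsilon>. In 16 exp(6), the exponential is the change of the weight under a displacement of
  12, and 16 = 4 * 4.\<close>

lemma v_norm:
  assumes N: "interpolates N p C \<theta>" and p: "2 \<le> p" and m: "m > 0" "\<And>\<xi>. m \<le> jac W t \<xi>"
    and M: "16 * exp 6 * h \<le> M" "tv_bound m \<le> M"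
  shows "N (distr_of (\<lambda>x. - v t x)) \<le> ennreal (C * ((16 * exp 6 * h) powr \<theta> * M powr (1 - \<theta>)))"
proof (rule N[unfolded interpolates_def, rule_format, where B = 4 and \<Theta> = "\<lambda>x. tv_prim m (Z t x)"])
  show "\<bar>- v t x\<bar> \<le> 4" for x using v_bound'[of t x] h by simp
  show "integrable lborel (\<lambda>x. - v t x)" using v_integrable by simp
  have "(\<integral>\<^sup>+ x. ennreal (\<bar>- v t x\<bar> powr p) \<partial>lborel) \<le> ennreal ((4 * (4 * exp 6 * h)) powr p)"
  proof (rule nn_integral_powr_le_wt[OF _ p])
    fix x
    have "(- v t x)\<^sup>2 \<le> (4 * exp 6 * h * wt x)\<^sup>2"
      using v_bound[of t x] by (intro abs_le_square_iff[THEN iffD1]) simp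
    also have "\<dots> = (4 * exp 6 * h)\<^sup>2 * (wt x * wt x)" by (simp add: power2_eq_square mult_ac)
    also have "\<dots> \<le> (4 * exp 6 * h)\<^sup>2 * (wt x * 1)" using wt_pos[of x] wt_le_1[of x] by (intro mult_left_mono) auto
    finally show "(- v t x)\<^sup>2 \<le> (4 * exp 6 * h)\<^sup>2 * wt x" by simp
  qed (use h in auto)
  then show "(\<integral>\<^sup>+ x. ennreal (\<bar>- v t x\<bar> powr p) \<partial>lborel) \<le> ennreal ((16 * exp 6 * h) powr p)" by (simp add: mult.assoc)
  show "0 \<le> tv_prim m (Z t x) \<and> tv_prim m (Z t x) \<le> M" for x
    using tv_prim_bounds[OF m(1), of "Z t x"] M(2) by linarith
  show "\<bar>- v t (x + \<tau>) + - v t (x - \<tau>) - 2 * - v t x\<bar> \<le> \<tau> * (tv_prim m (Z t (x + \<tau>)) - tv_prim m (Z t (x - \<tau>)))"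
    if "\<tau> > 0" for x \<tau> using second_difference[OF m that, of x] by (simp add: abs_if algebra_simps split: if_splits)
qed (use h M tv_prim_Z_mono[OF m] in auto)

text \<open>The L^p bound A is of order the square root of |s - t|, by one Lipschitz factor and one
  decaying factor in the square. The variations of the two slopes are merely added; the extra A in
  the second factor ensures A <= M, and s \<noteq> t ensures A > 0.\<close>

lemma v_diff_norm:
  assumes N: "interpolates N p C \<theta>" and p: "2 \<le> p" and st: "s \<noteq> t"
  defines "A \<equiv> 4 * sqrt (8 * exp 6 * (48 + 12 / \<epsilon>) * \<bar>s - t\<bar>)"
  shows "N (distr_of (\<lambda>x. v s x - v t x)) \<le> ennreal (C * (A powr \<theta> * (2 * tv_bound \<epsilon> + A) powr (1 - \<theta>)))"
proof (rule N[unfolded interpolates_def, rule_format, where B = 8 and \<Theta> = "\<lambda>x. tv_prim \<epsilon> (Z s x) + tv_prim \<epsilon> (Z t x)"])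
  define K where "K = tv_bound \<epsilon>"
  note tb = tv_prim_bounds[OF \<epsilon>(1), folded K_def]
  let ?L = "48 + 12 / \<epsilon>" and ?K = "sqrt (8 * exp 6 * (48 + 12 / \<epsilon>) * \<bar>s - t\<bar>)"
  have L: "0 < ?L" using \<epsilon> by (simp add: add_pos_pos)
  have K: "0 < ?K" using L st by simp
  then show A: "0 < A" by (simp add: A_def)
  show "\<bar>v s x - v t x\<bar> \<le> 8" for x using v_bound'[of s x] v_bound'[of t x] h by linarith
  show "integrable lborel (\<lambda>x. v s x - v t x)" using v_integrable by simp
  show "(\<integral>\<^sup>+ x. ennreal (\<bar>v s x - v t x\<bar> powr p) \<partial>lborel) \<le> ennreal (A powr p)" unfolding A_def
  proof (rule nn_integral_powr_le_wt[OF _ p K])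
    fix x
    have "\<bar>v s x - v t x\<bar> * \<bar>v s x - v t x\<bar> \<le> (?L * \<bar>s - t\<bar>) * (8 * exp 6 * wt x)"
      using v_Lipschitz[of s x t x] v_wt[of s x] v_wt[of t x] L by (intro mult_mono) auto
    then show "(v s x - v t x)\<^sup>2 \<le> ?K\<^sup>2 * wt x" using L by (simp add: power2_eq_square mult_ac)
  qed simp
  show "mono (\<lambda>x. tv_prim \<epsilon> (Z s x) + tv_prim \<epsilon> (Z t x))"
    using tv_prim_Z_mono[OF \<epsilon>(1) jac_eps] by (simp add: mono_def add_mono)
  show "0 \<le> tv_prim \<epsilon> (Z s x) + tv_prim \<epsilon> (Z t x) \<and> tv_prim \<epsilon> (Z s x) + tv_prim \<epsilon> (Z t x) \<le> 2 * tv_bound \<epsilon> + A" for x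
    unfolding K_def[symmetric] using tb[of "Z s x"] tb[of "Z t x"] A by linarith
  show "A \<le> 2 * tv_bound \<epsilon> + A" unfolding K_def[symmetric] using tb[of 0] by linarith
  show "\<bar>v s (x + \<tau>) - v t (x + \<tau>) + (v s (x - \<tau>) - v t (x - \<tau>)) - 2 * (v s x - v t x)\<bar>
      \<le> \<tau> * (tv_prim \<epsilon> (Z s (x + \<tau>)) + tv_prim \<epsilon> (Z t (x + \<tau>)) - (tv_prim \<epsilon> (Z s (x - \<tau>)) + tv_prim \<epsilon> (Z t (x - \<tau>))))"
    if "\<tau> > 0" for x \<tau>
  proof -
    have "\<bar>a - b\<bar> \<le> \<tau> * c + \<tau> * d" if "\<bar>a\<bar> \<le> \<tau> * c" "\<bar>b\<bar> \<le> \<tau> * d" for a b c d using that by linarith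
    from this[OF second_difference[OF \<epsilon>(1) jac_eps that, of s x] second_difference[OF \<epsilon>(1) jac_eps that, of t x]]
    show ?thesis by (simp add: algebra_simps)
  qed
qed simp

text \<open>For fixed \<epsilon> the norm of a difference is A^\<theta> times a bounded factor, and
  A tends to 0 as the times approach each other; only the punctured limit is asked for.\<close>

lemma reversed_in_besov_continuous:
  assumes N: "interpolates (besov_norm chi phi s (ennreal p) r) p C \<theta>" and p: "2 \<le> p" and \<theta>: "0 < \<theta>" "\<theta> < 1"
  shows "(\<lambda>t. distr_of (\<lambda>x. - v (T - t) x)) \<in> besov_continuous chi phi s (ennreal p) r {0..T}"
proof -
  have v4: "\<bar>- v t x\<bar> \<le> 4" for t x using v_bound'[of t x] h by simp
  have mem: "distr_of (\<lambda>x. - v t x) \<in> besov chi phi s (ennreal p) r" for t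
    unfolding besov_def
    using tempered_distr_of[of "\<lambda>x. - v t x", OF _ v4] v_norm[OF N p \<epsilon>(1) jac_eps, of "max (16 * exp 6 * h) (tv_bound \<epsilon>)" t]
    by (auto intro: le_less_trans[OF _ ennreal_less_top])
  have cont: "((\<lambda>\<tau>. besov_norm chi phi s (ennreal p) r (distr_of (\<lambda>x. - v (T - \<tau>) x) - distr_of (\<lambda>x. - v (T - t) x))) \<longlongrightarrow> 0) (at t within {0..T})" for t
  proof -
    define A where "A \<tau> = 4 * sqrt (8 * exp 6 * (48 + 12 / \<epsilon>) * \<bar>t - \<tau>\<bar>)" for \<tau>
    let ?g = "\<lambda>\<tau>. C * (A \<tau> powr \<theta> * (2 * tv_bound \<epsilon> + A \<tau>) powr (1 - \<theta>))"
    have "besov_norm chi phi s (ennreal p) r (distr_of (\<lambda>x. - v (T - \<tau>) x) - distr_of (\<lambda>x. - v (T - t) x)) \<le> ennreal (?g \<tau>)"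
      if "\<tau> \<noteq> t" for \<tau>
    proof -
      have "distr_of (\<lambda>x. - v (T - \<tau>) x) - distr_of (\<lambda>x. - v (T - t) x) = distr_of (\<lambda>x. v (T - t) x - v (T - \<tau>) x)"
        by (subst distr_of_diff[of _ _ 4]) (use v4 in \<open>auto simp: algebra_simps\<close>)
      then show ?thesis using v_diff_norm[OF N p, of "T - t" "T - \<tau>"] that unfolding A_def
        by (simp add: abs_minus_commute)
    qed
    then have up: "\<forall>\<^sub>F \<tau> in at t within {0..T}. besov_norm chi phi s (ennreal p) r (distr_of (\<lambda>x. - v (T - \<tau>) x) - distr_of (\<lambda>x. - v (T - t) x)) \<le> ennreal (?g \<tau>)"
      by (auto simp: eventually_at_filter)
    have tb: "0 \<le> tv_bound \<epsilon>" using tv_prim_bounds[OF \<epsilon>(1), of 0] by linarith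
    have A0: "0 \<le> A \<tau>" for \<tau> using \<epsilon> by (simp add: A_def)
    have "(A \<longlongrightarrow> 4 * sqrt (8 * exp 6 * (48 + 12 / \<epsilon>) * \<bar>t - t\<bar>)) (at t within {0..T})"
      unfolding A_def by (intro tendsto_intros)
    then have Al: "(A \<longlongrightarrow> 0) (at t within {0..T})" by simp
    have "(?g \<longlongrightarrow> C * (0 powr \<theta> * (2 * tv_bound \<epsilon> + 0) powr (1 - \<theta>))) (at t within {0..T})"
      by (intro tendsto_mult tendsto_const tendsto_powr' tendsto_add Al) (use \<theta> tb A0 in \<open>auto intro!: always_eventually add_nonneg_nonneg\<close>)
    then have "(?g \<longlongrightarrow> 0) (at t within {0..T})" by simp
    then have lim: "((\<lambda>\<tau>. ennreal (?g \<tau>)) \<longlongrightarrow> 0) (at t within {0..T})" using tendsto_ennrealI by fastforce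
    show ?thesis by (rule tendsto_sandwich[OF _ up tendsto_const lim]) simp
  qed
  show ?thesis unfolding besov_continuous_def using mem cont by blast
qed

end

lemma norm_inflation:
  assumes lp: "littlewood_paley_pair chi phi" and s: "1 \<le> s" "s < 1 + 1 / p" and p: "2 \<le> p" and r: "1 \<le> r" and \<delta>: "\<delta> > 0"
  shows "\<exists>u\<^sub>0 \<in> besov chi phi s (ennreal p) r.
           besov_norm chi phi s (ennreal p) r u\<^sub>0 \<le> ennreal \<delta> \<and>
           (\<exists>T\<^sub>0 u. 0 < T\<^sub>0 \<and> T\<^sub>0 < \<delta> \<and>
              u \<in> besov_continuous chi phi s (ennreal p) r {0..T\<^sub>0} \<and>
              FW_solution T\<^sub>0 u\<^sub>0 u \<and>
              besov_norm chi phi s (ennreal p) r (u T\<^sub>0) \<ge> ennreal (1 / \<delta>))"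
proof -
  have p1: "p > 1" using p by simp
  obtain C \<theta> where C: "C > 0" and \<theta>: "0 < \<theta>" "\<theta> < 1" and N: "interpolates (besov_norm chi phi s (ennreal p) r) p C \<theta>"
    using besov_norm_interpolation[OF lp p1 s(2) r] by blast
  obtain c N\<^sub>0 where c: "c > 0" and low: "\<And>j h. j \<ge> N\<^sub>0 \<Longrightarrow> h > 0 \<Longrightarrow>
      ennreal (c * h * 2 powr (real j * (s - 1 / p))) \<le> besov_norm chi phi s (ennreal p) r (distr_of (\<lambda>x. - steep_hat h (1 / 4 ^ j) x))"
    using besov_norm_steep_hat[OF lp p1 r, of s] by blast
  define T where "T = min (\<delta> / 2) (1 / 10000)"
  have T: "0 < T" "T < \<delta>" "T \<le> 1 / 10000" using \<delta> by (auto simp: T_def)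
  \<comment> \<open>T is already fixed and the variation bound 28/T is free of h, so the positive
    exponent \<theta> on h drives the norm to zero.\<close>
  have "((\<lambda>h. C * ((16 * exp 6 * h) powr \<theta> * (28 / T) powr (1 - \<theta>))) \<longlongrightarrow> C * ((16 * exp 6 * 0) powr \<theta> * (28 / T) powr (1 - \<theta>))) (at_right 0)"
    by (intro tendsto_intros tendsto_powr') (use \<theta> in \<open>auto simp: eventually_at_filter\<close>)
  then have "\<forall>\<^sub>F h in at_right 0. C * ((16 * exp 6 * h) powr \<theta> * (28 / T) powr (1 - \<theta>)) < \<delta>"
    by (rule order_tendstoD(2)) (use \<delta> in simp)
  moreover have "\<forall>\<^sub>F h in at_right 0. h < min 1 (28 / T / (16 * exp 6))"
    by (rule order_tendstoD(2)[OF tendsto_ident_at]) (use T in simp)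
  moreover have "\<forall>\<^sub>F h::real in at_right 0. 0 < h" by (rule eventually_at_right_less)
  ultimately have "\<forall>\<^sub>F h in at_right 0. 0 < h \<and> h < min 1 (28 / T / (16 * exp 6)) \<and> C * ((16 * exp 6 * h) powr \<theta> * (28 / T) powr (1 - \<theta>)) < \<delta>"
    by eventually_elim simp
  then obtain h where h: "0 < h" "h < min 1 (28 / T / (16 * exp 6))" "C * ((16 * exp 6 * h) powr \<theta> * (28 / T) powr (1 - \<theta>)) < \<delta>"
    using eventually_happens[of _ "at_right (0::real)"] by auto
  have hM: "16 * exp 6 * h \<le> 28 / T"
  proof -
    have "h < 28 / T / (16 * exp 6)" using h(2) by simp
    then have "h * (16 * exp 6) < 28 / T" by (subst (asm) pos_less_divide_eq) simp_all
    then show ?thesis by (simp only: mult.commute less_imp_le)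
  qed
  define \<sigma> where "\<sigma> = s - 1 / p"
  \<comment> \<open>The growth rate in j of the norm of the hat; here 1/p <= 1/2 < 1 <= s
    enters.\<close>
  have \<sigma>: "\<sigma> > 0"
  proof -
    have "1 / p \<le> 1 / 2" using p by (simp add: field_simps)
    then show ?thesis using s by (simp add: \<sigma>_def)
  qed
  have "c * h > 0" using c h by simp
  then have "filterlim (\<lambda>j. c * h * 2 powr (real j * \<sigma>)) at_top sequentially" using \<sigma> by real_asymp
  then have "\<forall>\<^sub>F j in sequentially. 1 / \<delta> \<le> c * h * 2 powr (real j * \<sigma>)" by (simp add: filterlim_at_top)
  then have "\<forall>\<^sub>F j in sequentially. 1 / \<delta> \<le> c * h * 2 powr (real j * \<sigma>) \<and> N\<^sub>0 \<le> j \<and> 1 \<le> j"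
    by (intro eventually_conj eventually_ge_at_top)
  then obtain j where j: "1 / \<delta> \<le> c * h * 2 powr (real j * \<sigma>)" "N\<^sub>0 \<le> j" "1 \<le> j"
    using eventually_happens[of _ sequentially] by auto
  define \<epsilon> :: real where "\<epsilon> = 1 / 4 ^ j"
  have \<epsilon>: "0 < \<epsilon>" "\<epsilon> \<le> 1 / 2"
  proof -
    have "(4::real) ^ 1 \<le> 4 ^ j" using j(3) by (intro power_increasing) auto
    then show "0 < \<epsilon>" "\<epsilon> \<le> 1 / 2" by (auto simp: \<epsilon>_def field_simps)
  qed
  note T_less = T(2) and h_small = h(3)
  interpret rarefaction h \<epsilon> T using h \<epsilon> T by unfold_locales auto
  obtain W where fix_W: "admissible W" "step W = W" using fixed_point_exists by blast
  interpret rarefaction_profile h \<epsilon> T W by (rule profile[OF fix_W(1)])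
  interpret rarefaction_solution h \<epsilon> T W using fix_W(2) by unfold_locales
  let ?u = "\<lambda>t. distr_of (\<lambda>x. - v (T - t) x)"
  have u: "?u \<in> besov_continuous chi phi s (ennreal p) r {0..T}"
    by (rule reversed_in_besov_continuous[OF N p \<theta>])
  then have "\<forall>t\<in>{0..T}. ?u t \<in> besov chi phi s (ennreal p) r" unfolding besov_continuous_def by blast
  then have "?u 0 \<in> besov chi phi s (ennreal p) r" by (rule bspec) (use T in simp)
  moreover have "besov_norm chi phi s (ennreal p) r (?u 0) \<le> ennreal \<delta>"
  proof -
    \<comment> \<open>The minimum in \<open>jac_lower\<close> is 3/4 or \<epsilon> + h T; both
      exceed h T, which removes \<epsilon> from the estimate at the final time.\<close>
    have "h * T \<le> 1 * (3 / 4)" using h T by (intro mult_mono) auto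
    then have m: "h * T \<le> jac W T \<xi>" for \<xi>
      using jac_lower[of T \<xi>] \<epsilon>(1) T(1) by (simp add: cl_def)
    have hT: "h * T > 0" using h T by simp
    \<comment> \<open>With m = h T the two terms of the variation are 4 (1/T + 3/T) between the
      kinks and 3 * 4/T at the kinks.\<close>
    have "tv_bound (h * T) = 28 / T" using h T by (simp add: field_simps power2_eq_square)
    then have "besov_norm chi phi s (ennreal p) r (distr_of (\<lambda>x. - v T x)) \<le> ennreal (C * ((16 * exp 6 * h) powr \<theta> * (28 / T) powr (1 - \<theta>)))"
      by (intro v_norm[OF N p hT m hM]) simp
    also have "\<dots> \<le> ennreal \<delta>" using h_small by (intro ennreal_leI) simp
    finally show ?thesis by simp
  qed
  moreover have "FW_solution T (?u 0) ?u" using FW_solution_reversed by simp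
  \<comment> \<open>At time T the reversed solution is back at minus the initial hat.\<close>
  moreover have "ennreal (1 / \<delta>) \<le> besov_norm chi phi s (ennreal p) r (?u T)"
  proof -
    have "ennreal (1 / \<delta>) \<le> ennreal (c * h * 2 powr (real j * (s - 1 / p)))" using j(1) by (intro ennreal_leI) (simp add: \<sigma>_def)
    also note low[OF j(2) h(1)]
    finally show ?thesis by (simp only: diff_self v_0 flip: \<epsilon>_def)
  qed
  ultimately show ?thesis using T(1) T_less u by blast
qed

theorem theorem1p1:
  fixes chi phi :: "real \<Rightarrow> real" and s p :: real and r :: ennreal and \<delta> :: real
  assumes "littlewood_paley_pair chi phi"
    and "(1 < s \<and> s < 1 + 1 / p \<and> 2 \<le> p \<and> 1 \<le> r) \<or> (s = 1 \<and> 2 \<le> p \<and> 1 \<le> r \<and> r \<le> 2)"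
    and "\<delta> > 0"
  shows "\<exists>u\<^sub>0 \<in> besov chi phi s (ennreal p) r.
           besov_norm chi phi s (ennreal p) r u\<^sub>0 \<le> ennreal \<delta> \<and>
           (\<exists>T\<^sub>0 u. 0 < T\<^sub>0 \<and> T\<^sub>0 < \<delta> \<and>
              u \<in> besov_continuous chi phi s (ennreal p) r {0..T\<^sub>0} \<and>
              FW_solution T\<^sub>0 u\<^sub>0 u \<and>
              besov_norm chi phi s (ennreal p) r (u T\<^sub>0) \<ge> ennreal (1 / \<delta>))"
proof -
  have "1 \<le> s" "s < 1 + 1 / p" "2 \<le> p" "1 \<le> r" using assms(2) by auto
  then show ?thesis using norm_inflation[OF assms(1) _ _ _ _ assms(3)] by blast
qed

end
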